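(* For every $\varepsilon>0$ and every $A>0$ there exists $\delta>0$ such that the following holds. Let $v_0\in\mathcal{X}^1$ satisfy $d_{A,\mathcal{X}^1}(v_0,\mathfrak{v}_0)\le\delta$, and let $v$ be the global solution of (GP) with initial datum $v_0$. Then for every $t\in\mathbb{R}$ there exist real numbers $a(t)$ and $\theta(t)$ such that $$d_{A,\mathcal{X}^1}\big(v(\cdot+a(t),t),\,e^{i\theta(t)}\mathfrak{v}_0(\cdot)\big)<\varepsilon .$$
   Context: The one-dimensional Gross–Pitaevskii equation (GP) is $i\Psi_t+\Psi_{xx}=\Psi(|\Psi|^2-1)$ on $\mathbb{R}\times\mathbb{R}$. The energy space is $\mathcal{X}^1=\{w\in L^\infty(\mathbb{R}):\ w'\in L^2(\mathbb{R}),\ 1-|w|^2\in L^2(\mathbb{R})\}$ (complex-valued maps). For $v_0\in\mathcal{X}^1$, "the global solution of (GP) with initial datum $v_0$" is the unique solution $v$ with $v(0)=v_0$ and $t\mapsto v(t)-v_0\in\mathcal{C}^0(\mathbb{R},H^1(\mathbb{R}))$ (its existence and uniqueness is known). For $A>0$, $d_{A,\mathcal{X}^1}(v_1,v_2)=\|v_1-v_2\|_{L^\infty([-A,A])}+\|v_1'-v_2'\|_{L^2(\mathbb{R})}+\||v_1|-|v_2|\|_{L^2(\mathbb{R})}$. The kink (black soliton) is $\mathfrak{v}_0(x)=\tanh(x/\sqrt{2})$. *)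

theory Defs
  imports "HOL-Analysis.Analysis"
begin

definition test_fun :: "(real \<Rightarrow> real) \<Rightarrow> bool" where
  "test_fun \<phi> \<longleftrightarrow> (\<forall>n x. ((deriv ^^ n) \<phi>) differentiable (at x))
                  \<and> (\<exists>R. \<forall>x. \<bar>x\<bar> > R \<longrightarrow> \<phi> x = 0)"

definition loc_integrable :: "(real \<Rightarrow> complex) \<Rightarrow> bool" where
  "loc_integrable f \<longleftrightarrow> (\<forall>a b. set_integrable lborel {a..b} f)"

definition weak_deriv :: "(real \<Rightarrow> complex) \<Rightarrow> (real \<Rightarrow> complex) \<Rightarrow> bool" where
  "weak_deriv f g \<longleftrightarrow> loc_integrable f \<and> loc_integrable g \<and>
     (\<forall>\<phi>. test_fun \<phi> \<longrightarrow>
        (LINT x|lborel. f x * of_real (deriv \<phi> x)) = - (LINT x|lborel. g x * of_real (\<phi> x)))"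

definition wderiv :: "(real \<Rightarrow> complex) \<Rightarrow> (real \<Rightarrow> complex)" where
  "wderiv f = (SOME g. weak_deriv f g)"

definition L2 :: "(real \<Rightarrow> 'a::real_normed_vector) \<Rightarrow> bool" where
  "L2 f \<longleftrightarrow> f \<in> borel_measurable lborel \<and> integrable lborel (\<lambda>x. (norm (f x))\<^sup>2)"

definition L2norm :: "(real \<Rightarrow> 'a::real_normed_vector) \<Rightarrow> real" where
  "L2norm f = sqrt (LINT x|lborel. (norm (f x))\<^sup>2)"

definition Linfty :: "(real \<Rightarrow> complex) \<Rightarrow> bool" where
  "Linfty f \<longleftrightarrow> f \<in> borel_measurable lborel \<and> (\<exists>C. AE x in lborel. norm (f x) \<le> C)"

definition Linf_norm_on :: "real \<Rightarrow> (real \<Rightarrow> complex) \<Rightarrow> real" where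
  "Linf_norm_on A f = Inf {C. 0 \<le> C \<and> (AE x in lborel. x \<in> {-A..A} \<longrightarrow> norm (f x) \<le> C)}"

definition X1 :: "(real \<Rightarrow> complex) \<Rightarrow> bool" where
  "X1 w \<longleftrightarrow> Linfty w \<and> (\<exists>g. weak_deriv w g \<and> L2 g) \<and> L2 (\<lambda>x. 1 - (cmod (w x))\<^sup>2)"

definition H1 :: "(real \<Rightarrow> complex) \<Rightarrow> bool" where
  "H1 f \<longleftrightarrow> L2 f \<and> (\<exists>g. weak_deriv f g \<and> L2 g)"

definition H1norm :: "(real \<Rightarrow> complex) \<Rightarrow> real" where
  "H1norm f = sqrt ((L2norm f)\<^sup>2 + (L2norm (wderiv f))\<^sup>2)"

definition dAX1 :: "real \<Rightarrow> (real \<Rightarrow> complex) \<Rightarrow> (real \<Rightarrow> complex) \<Rightarrow> real" where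
  "dAX1 A v1 v2 = Linf_norm_on A (\<lambda>x. v1 x - v2 x)
      + L2norm (\<lambda>x. wderiv v1 x - wderiv v2 x)
      + L2norm (\<lambda>x. cmod (v1 x) - cmod (v2 x))"

definition kink :: "real \<Rightarrow> complex" where
  "kink x = complex_of_real (tanh (x / sqrt 2))"

text \<open>v t x is the value at time t and position x.  v solves (GP)
  i v_t + v_xx = v(|v|^2 - 1) in the weak sense (tested in space against test functions,
  the pairing being differentiable in time), with v(0) = v0 and
  t |-> v(t) - v0 continuous into H^1.\<close>
definition gp_solution :: "(real \<Rightarrow> complex) \<Rightarrow> (real \<Rightarrow> real \<Rightarrow> complex) \<Rightarrow> bool" where
  "gp_solution v0 v \<longleftrightarrow>
     v 0 = v0 \<and>
     (\<forall>t. H1 (\<lambda>x. v t x - v0 x)) \<and>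
     (\<forall>t. ((\<lambda>s. H1norm (\<lambda>x. v s x - v t x)) \<longlongrightarrow> 0) (at t)) \<and>
     (\<forall>\<phi>. test_fun \<phi> \<longrightarrow> (\<forall>t. \<exists>D.
        ((\<lambda>s. LINT x|lborel. v s x * of_real (\<phi> x)) has_vector_derivative D) (at t) \<and>
        \<i> * D + (LINT x|lborel. v t x * of_real (deriv (deriv \<phi>) x))
          = (LINT x|lborel. v t x * of_real ((cmod (v t x))\<^sup>2 - 1) * of_real (\<phi> x))))"

end

theory Submission
  imports Defs
begin

text \<open>
  Energy is conserved, and so is the momentum relative to the initial datum: after mollifying
  the equation in space all densities are smooth, and the commutator of the mollifier with the nonlinearity
  is small enough in \<open>L\<^sup>2\<close> for the error to vanish in the limit.

  Write \<open>u = r exp (i \<phi>)\<close> and \<open>G r = (r - r\<^sup>3/3) / sqrt 2\<close>. The energy density dominates the derivative of \<open>G r\<close>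
  up to nonnegative defects, so a map that almost vanishes somewhere and has energy close to
  \<open>2 G 1 = 2 sqrt 2 / 3\<close> is close to a translated kink, except that its constant phases on the two sides of the core may differ.
  On the other hand, the dark solitons of speed \<open>sqrt 2 m\<close> calibrate the energy: if \<open>\<bar>u\<bar> > m\<close> everywhere and the phase shift of \<open>u\<close>,
  corrected by the momentum, is close to \<open>\<pi>\<close>, then the energy exceeds \<open>2 sqrt 2 / 3\<close> by at least \<open>sqrt 2 m\<^sup>2 / 6\<close>.

  The corrected phase shift is invariant under the flow. For data close to the kink it is close to \<open>\<pi>\<close>, so at every time
  the solution almost vanishes somewhere; and there the same invariant forces the two phases to agree.
\<close>

section \<open>Smooth bump functions\<close>

text \<open>Neither invariant suffices alone. Nonvanishing dark solitons have energy arbitrarily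
  close to that of the kink, so energy does not force a small value; and a phase jump across a zero
  costs no energy, so almost minimal energy leaves one angle free. The corrected phase settles both
  points. A map in the energy space need not have limits at infinity, and its momentum integral need
  not converge. Phase statements are therefore made at \<open>R\<close> and \<open>-R\<close> for
  all large \<open>R\<close>, and the momentum enters only through the exponential of
  \<open>\<i>\<close> times it, which also removes the ambiguity of \<open>2 * pi\<close>. The
  equation holds only against test functions, so the conservation laws cannot be obtained by
  multiplying it by time or space derivatives of the solution. At scale \<open>e\<close> the energy
  error pairs the commutator with a second derivative of size \<open>1/e\<close>; a commutator of
  order \<open>e\<close> would leave an error of order one, whereas cancelling the linear Taylor
  term gives \<open>e * sqrt e\<close>. The energy gained by a nonvanishing map is quadratic in its
  lower bound, so the initial distance is taken small against a square.\<close>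

lemma deriv_funpow_coinduct:
  assumes "P f" and "\<And>f. P f \<Longrightarrow> (\<forall>x. f differentiable (at x)) \<and> P (deriv f)"
  shows "((deriv ^^ n) f) differentiable (at x)"
proof -
  have "P ((deriv ^^ n) f)"
    by (induction n) (use assms in auto)
  then show ?thesis using assms(2) by blast
qed

text \<open>The polynomial and the exponent are parameters so that the family is closed under
  differentiation; \<open>bumpf [:1:] 0\<close> is the usual bump \<open>exp (-1/(x*(1-x)))\<close>
  on the unit interval.\<close>

definition bumpf :: "real poly \<Rightarrow> nat \<Rightarrow> real \<Rightarrow> real" where
  "bumpf p k x = (if 0 < x \<and> x < 1 then poly p x / (x*(1-x))^k * exp (-1/(x*(1-x))) else 0)"

lemma power_div_fact_le_exp:
  assumes "0 \<le> (y::real)" shows "y^n / fact n \<le> exp y"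
proof -
  have "(\<Sum>i\<in>{n}. y^i /\<^sub>R fact i) \<le> (\<Sum>i. y^i /\<^sub>R fact i)"
    by (rule sum_le_suminf[OF summable_exp_generic]) (use assms in auto)
  then show ?thesis by (simp add: exp_def divide_inverse mult.commute)
qed

text \<open>One term of the exponential series gives
  \<open>exp (-1/q) \<le> fact (k+2) * q^(k+2)\<close> for \<open>q = x*(1-x)\<close>, which absorbs
  the pole of order \<open>k\<close> and leaves a factor \<open>q^2\<close>. Quadratic vanishing
  makes the derivative exist and equal 0 at both endpoints.\<close>

lemma bumpf_bound:
  obtains C where "\<And>x. \<bar>bumpf p k x\<bar> \<le> C * x^2" "\<And>x. \<bar>bumpf p k x\<bar> \<le> C * (x - 1)^2"
proof -
  have "compact (poly p ` {0..1})"
    by (intro compact_continuous_image) (auto intro!: continuous_intros)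
  then obtain M where M: "\<And>x. x \<in> {0..1} \<Longrightarrow> \<bar>poly p x\<bar> \<le> M"
    using compact_imp_bounded bounded_iff by (metis imageI real_norm_def)
  have M0: "0 \<le> M" using M[of 0] by auto
  define C where "C = M * fact (k+2)"
  have C0: "0 \<le> C" using M0 by (simp add: C_def)
  have main: "\<bar>bumpf p k x\<bar> \<le> C * (x*(1-x))^2" if x: "0 < x" "x < 1" for x
  proof -
    define q where "q = x*(1-x)"
    have q: "q > 0" using x by (simp add: q_def)
    have "(1/q)^(k+2) / fact (k+2) \<le> exp (1/q)"
      by (rule power_div_fact_le_exp) (use q in auto)
    moreover define a b where "a = q^(k+2)" and "b = (fact (k+2) :: real)"
    moreover have "a > 0" "b > 0" using q by (auto simp: a_def b_def)
    ultimately have "1 / (a * b) \<le> exp (1/q)" by (simp add: power_divide del: fact_Suc)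
    then have "exp (-1/q) \<le> b * a"
      using \<open>a > 0\<close> \<open>b > 0\<close> by (simp add: exp_minus divide_simps mult_ac)
    then have "exp (-1/q) \<le> fact (k+2) * q^(k+2)" by (simp only: a_def b_def)
    then have "\<bar>poly p x\<bar> / q^k * exp (-1/q) \<le> M / q^k * (fact (k+2) * q^(k+2))"
      by (intro mult_mono divide_right_mono) (use M[of x] x q M0 in auto)
    also have "\<dots> = C * q^2"
      using q by (simp add: C_def power_add field_simps power2_eq_square)
    finally show ?thesis using x q by (simp add: bumpf_def abs_mult q_def[symmetric])
  qed
  have "\<bar>bumpf p k x\<bar> \<le> C * x^2 \<and> \<bar>bumpf p k x\<bar> \<le> C * (x - 1)^2" for x
  proof (cases "0 < x \<and> x < 1")
    case True
    have a: "(x*(1-x))^2 \<le> x^2"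
      by (rule power_mono) (use True in \<open>auto simp: mult_left_le\<close>)
    have b: "(x*(1-x))^2 \<le> (1-x)^2"
      by (rule power_mono) (use True in \<open>auto simp: mult_left_le_one_le\<close>)
    have c: "(1-x)^2 = (x-1)^2" by (rule power2_commute)
    show ?thesis using main[of x] True mult_left_mono[OF a C0] mult_left_mono[OF b C0]
      unfolding c by linarith
  next
    case False
    then have "bumpf p k x = 0" by (auto simp: bumpf_def)
    then show ?thesis using C0 by simp
  qed
  then show thesis using that by blast
qed

lemma DERIV_zero_quadratic:
  fixes f :: "real \<Rightarrow> real"
  assumes "\<And>y. \<bar>f y\<bar> \<le> C * (y - a)^2"
  shows "(f has_field_derivative 0) (at a)"
proof -
  have fa: "f a = 0" using assms[of a] by simp
  have "((\<lambda>h. (f (a + h) - f a) / h) \<longlongrightarrow> 0) (at 0)"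
  proof (rule Lim_null_comparison)
    show "\<forall>\<^sub>F h in at 0. norm ((f (a + h) - f a) / h) \<le> C * \<bar>h\<bar>"
    proof (rule eventually_at_filter[THEN iffD2], rule always_eventually, intro allI impI)
      fix h :: real assume "h \<noteq> 0"
      then show "norm ((f (a + h) - f a) / h) \<le> C * \<bar>h\<bar>"
        using assms[of "a+h"] by (simp add: fa abs_divide divide_simps power2_eq_square abs_mult_self_eq mult.assoc)
    qed
    show "((\<lambda>h. C * \<bar>h\<bar>) \<longlongrightarrow> 0) (at 0)"
      by (intro tendsto_eq_intros | simp)+
  qed
  then show ?thesis by (simp add: DERIV_def)
qed

text \<open>With \<open>q = x*(1-x)\<close>, the polynomials \<open>[:0,1,-1:]\<close> and
  \<open>[:1,-2:]\<close> are \<open>q\<close> and its derivative. Differentiating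
  \<open>exp (-1/q)\<close> brings in \<open>q'/q^2\<close>, hence the common denominator
  \<open>q^(k+2)\<close>.\<close>

lemma bumpf_deriv:
  "(bumpf p k has_field_derivative
     bumpf (pderiv p * [:0,1,-1:]^2 - smult (of_nat k) (p * [:1,-2:] * [:0,1,-1:]) + p * [:1,-2:]) (k+2) x) (at x)"
    (is "(_ has_field_derivative bumpf ?P _ x) _")
proof -
  consider "0 < x \<and> x < 1" | "x < 0 \<or> x > 1" | "x = 0" | "x = 1" by linarith
  then show ?thesis
  proof cases
    case 1
    define q where "q = x*(1-x)"
    have q: "q > 0" using 1 by (simp add: q_def)
    have "((\<lambda>x. poly p x / (x*(1-x))^k * exp (-1/(x*(1-x)))) has_field_derivative
        ((poly (pderiv p) x * q^k - poly p x * (of_nat k * q^(k-1) * (1-2*x))) / (q^k*q^k) * exp (-1/q)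
          + poly p x / q^k * (exp (-1/q) * ((1-2*x) / q^2)))) (at x)"
      unfolding q_def
      by (rule derivative_eq_intros refl | use 1 in \<open>simp add: power2_eq_square field_simps\<close>)+
    also have "((poly (pderiv p) x * q^k - poly p x * (of_nat k * q^(k-1) * (1-2*x))) / (q^k*q^k) * exp (-1/q)
          + poly p x / q^k * (exp (-1/q) * ((1-2*x) / q^2))) = 
         (poly (pderiv p) x * q^2 - of_nat k * (poly p x * (1-2*x) * q) + poly p x * (1-2*x)) / q^(k+2) * exp (-1/q)"
    proof -
      have "(of_nat k * q^(k-1)) * q = of_nat k * q^k"
        by (cases k) auto
      then have e: "of_nat k * q^(k-1) = of_nat k * q^k / q" using q by (simp add: field_simps)
      show ?thesis unfolding e using q by (simp add: divide_simps power_add power2_eq_square) (simp add: algebra_simps)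
    qed
    also have "\<dots> = bumpf ?P (k+2) x"
      using 1 by (simp add: bumpf_def q_def algebra_simps power2_eq_square)
    finally show ?thesis
      by (rule has_field_derivative_transform_within_open[where S="{0<..<1}"]) (use 1 in \<open>auto simp: bumpf_def\<close>)
  next
    case 2
    then obtain S where S: "open S" "x \<in> S" "\<And>y. y \<in> S \<Longrightarrow> y < 0 \<or> y > 1"
      by (intro that[of "{..<0} \<union> {1<..}"]) auto
    have "((\<lambda>_. 0) has_field_derivative 0) (at x)" by simp
    then have "(bumpf p k has_field_derivative 0) (at x)"
      by (rule has_field_derivative_transform_within_open[OF _ S(1,2)]) (use S(3) in \<open>fastforce simp: bumpf_def\<close>)
    then show ?thesis using 2 by (auto simp: bumpf_def)
  next
    case 3
    obtain C where "\<And>x. \<bar>bumpf p k x\<bar> \<le> C * x^2" using bumpf_bound by blast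
    then show ?thesis using DERIV_zero_quadratic[of "bumpf p k" C 0] 3 by (simp add: bumpf_def)
  next
    case 4
    obtain C where "\<And>x. \<bar>bumpf p k x\<bar> \<le> C * (x-1)^2" using bumpf_bound by blast
    then show ?thesis using DERIV_zero_quadratic[of "bumpf p k" C 1] 4 by (simp add: bumpf_def)
  qed
qed

lemma test_fun_bumpf: "test_fun (bumpf p k)"
  unfolding test_fun_def
proof (intro conjI allI)
  fix n x
  show "((deriv ^^ n) (bumpf p k)) differentiable (at x)"
  proof (rule deriv_funpow_coinduct[where P="\<lambda>f. \<exists>p k. f = bumpf p k"])
    fix f assume "\<exists>p k. f = bumpf p k"
    then obtain p k where f: "f = bumpf p k" by blast
    have "deriv f = bumpf (pderiv p * [:0,1,-1:]^2 - smult (of_nat k) (p * [:1,-2:] * [:0,1,-1:]) + p * [:1,-2:]) (k+2)"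
      unfolding f by (rule ext) (rule DERIV_imp_deriv[OF bumpf_deriv])
    then show "(\<forall>x. f differentiable at x) \<and> (\<exists>p k. deriv f = bumpf p k)"
      using bumpf_deriv f real_differentiable_def by blast
  qed auto
  show "\<exists>R. \<forall>x. \<bar>x\<bar> > R \<longrightarrow> bumpf p k x = 0"
    by (rule exI[of _ 1]) (auto simp: bumpf_def)
qed

section \<open>Closure properties of test functions\<close>

lemma test_fun_has_deriv: "test_fun \<phi> \<Longrightarrow> (\<phi> has_field_derivative deriv \<phi> x) (at x)"
  unfolding test_fun_def
  by (metis DERIV_deriv_iff_real_differentiable funpow_0)

lemma test_fun_deriv:
  assumes "test_fun \<phi>" shows "test_fun (deriv \<phi>)"
proof -
  obtain R where R: "\<And>x. \<bar>x\<bar> > R \<Longrightarrow> \<phi> x = 0" using assms by (auto simp: test_fun_def)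
  have "deriv \<phi> x = 0" if "\<bar>x\<bar> > R" for x
  proof -
    have "((\<lambda>_. 0) has_field_derivative 0) (at x)" by simp
    then have "(\<phi> has_field_derivative 0) (at x)"
    proof (rule has_field_derivative_transform_within_open)
      show "open {y. \<bar>y\<bar> > R}" by (intro open_Collect_less continuous_intros)
    qed (use R that in auto)
    then show ?thesis by (rule DERIV_imp_deriv)
  qed
  moreover have "(deriv ^^ n) (deriv \<phi>) differentiable (at x)" for n x
    using assms unfolding test_fun_def by (metis funpow_swap1 funpow.simps(2) o_apply)
  ultimately show ?thesis unfolding test_fun_def by blast
qed

lemma test_fun_affine_deriv:
  assumes "test_fun \<phi>"
  shows "((\<lambda>y. c * \<phi> (a*y+b)) has_field_derivative c*a* deriv \<phi> (a*x+b)) (at x)"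
proof -
  have "((\<lambda>y. \<phi> (a*y+b)) has_field_derivative (deriv \<phi> (a*x+b) * a)) (at x)"
    by (rule DERIV_chain'[where f="\<lambda>y. a*y+b" and g=\<phi>])
       (auto intro!: derivative_eq_intros test_fun_has_deriv assms)
  then show ?thesis
    by (auto intro!: derivative_eq_intros simp: algebra_simps)
qed

lemma deriv_test_fun_affine:
  assumes "test_fun \<phi>"
  shows "deriv (\<lambda>y. c * \<phi> (a*y+b)) = (\<lambda>y. (c*a) * deriv \<phi> (a*y+b))"
  by (rule ext) (rule DERIV_imp_deriv[OF test_fun_affine_deriv[OF assms]])

lemma test_fun_affine:
  assumes "test_fun \<phi>" "a \<noteq> 0"
  shows "test_fun (\<lambda>y. c * \<phi> (a*y+b))"
  unfolding test_fun_def
proof (intro conjI allI)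
  fix n x
  show "((deriv ^^ n) (\<lambda>y. c * \<phi> (a*y+b))) differentiable (at x)"
  proof (rule deriv_funpow_coinduct[where P="\<lambda>f. \<exists>\<phi> c. test_fun \<phi> \<and> f = (\<lambda>y. c * \<phi> (a*y+b))"])
    fix f assume "\<exists>\<phi> c. test_fun \<phi> \<and> f = (\<lambda>y. c * \<phi> (a*y+b))"
    then obtain \<phi> c where f: "test_fun \<phi>" "f = (\<lambda>y. c * \<phi> (a*y+b))" by blast
    show "(\<forall>x. f differentiable at x) \<and> (\<exists>\<phi> c. test_fun \<phi> \<and> deriv f = (\<lambda>y. c * \<phi> (a*y+b)))"
      using test_fun_affine_deriv[OF f(1)] deriv_test_fun_affine[OF f(1)] test_fun_deriv[OF f(1)] f(2)
        real_differentiable_def by blast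
  qed (use assms in blast)
  obtain R where R: "\<And>x. \<bar>x\<bar> > R \<Longrightarrow> \<phi> x = 0" using assms by (auto simp: test_fun_def)
  show "\<exists>R. \<forall>x. \<bar>x\<bar> > R \<longrightarrow> c * \<phi> (a*x+b) = 0"
  proof (rule exI[of _ "(\<bar>R\<bar> + \<bar>b\<bar>) / \<bar>a\<bar>"], intro allI impI)
    fix x assume "\<bar>x\<bar> > (\<bar>R\<bar> + \<bar>b\<bar>) / \<bar>a\<bar>"
    then have "\<bar>a*x\<bar> > \<bar>R\<bar> + \<bar>b\<bar>" using assms(2) by (simp add: divide_less_eq abs_mult mult.commute)
    then have "\<bar>a*x+b\<bar> > R" by linarith
    then show "c * \<phi> (a*x+b) = 0" using R by simp
  qed
qed

lemma test_fun_cont: "test_fun \<phi> \<Longrightarrow> continuous_on A \<phi>"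
  by (meson DERIV_isCont continuous_at_imp_continuous_on test_fun_has_deriv)

lemma test_fun_meas[measurable_dest]: "test_fun \<phi> \<Longrightarrow> \<phi> \<in> borel_measurable borel"
  by (intro borel_measurable_continuous_onI test_fun_cont)

lemma test_fun_supp:
  assumes "test_fun \<phi>" obtains R where "R > 0" "\<And>x. \<bar>x\<bar> > R \<Longrightarrow> \<phi> x = 0"
proof -
  obtain R where R: "\<And>x. \<bar>x\<bar> > R \<Longrightarrow> \<phi> x = 0" using assms by (auto simp: test_fun_def)
  show thesis by (rule that[of "\<bar>R\<bar>+1"]) (use R in auto)
qed

lemma test_fun_bounded:
  assumes "test_fun \<phi>" obtains C where "C > 0" "\<And>x. \<bar>\<phi> x\<bar> \<le> C"
proof -
  obtain R where R: "R > 0" "\<And>x. \<bar>x\<bar> > R \<Longrightarrow> \<phi> x = 0" using test_fun_supp[OF assms] by blast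
  have "compact (\<phi> ` {-R..R})"
    by (intro compact_continuous_image test_fun_cont assms) auto
  then obtain M where M: "M > 0" "\<And>x. x \<in> {-R..R} \<Longrightarrow> \<bar>\<phi> x\<bar> \<le> M"
    using compact_imp_bounded bounded_pos by (metis imageI real_norm_def)
  show thesis
  proof (rule that[OF M(1)])
    fix x
    have "x \<in> {-R..R} \<or> \<bar>x\<bar> > R" by (simp add: abs_le_iff) linarith
    then show "\<bar>\<phi> x\<bar> \<le> M" using M(1) M(2)[of x] R(2)[of x] by (metis abs_zero less_imp_le)
  qed
qed

lemma test_fun_integrable:
  assumes "test_fun \<phi>" shows "integrable lborel \<phi>"
proof -
  obtain R where R: "R > 0" "\<And>x. \<bar>x\<bar> > R \<Longrightarrow> \<phi> x = 0" using test_fun_supp[OF assms] by blast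
  have "set_integrable lborel {-R..R} \<phi>"
    by (rule borel_integrable_atLeastAtMost'[OF test_fun_cont[OF assms]])
  moreover have "(\<lambda>x. indicator {-R..R} x *\<^sub>R \<phi> x) = \<phi>"
    using R(2) by (force simp: indicator_def)
  ultimately show ?thesis by (simp add: set_integrable_def)
qed

lemma bump_exists:
  obtains \<beta> where "test_fun \<beta>" "\<And>x. 0 \<le> \<beta> x" "\<And>x. x \<notin> {0<..<1} \<Longrightarrow> \<beta> x = 0" "(LINT x|lborel. \<beta> x) = 1"
proof -
  define f where "f = bumpf [:1:] 0"
  have tf: "test_fun f" by (simp add: f_def test_fun_bumpf)
  have f0: "0 \<le> f x" for x by (simp add: f_def bumpf_def)
  have "(LINT x|lborel. f x) \<noteq> 0"
  proof
    assume "(LINT x|lborel. f x) = 0"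
    then have "AE x in lborel. f x = 0"
      using integral_nonneg_eq_0_iff_AE[OF test_fun_integrable[OF tf]] f0 by auto
    then have "AE x in lborel. x \<notin> {0<..<(1::real)}"
      by eventually_elim (auto simp: f_def bumpf_def)
    then have "{0<..<(1::real)} \<in> null_sets lborel"
      by (subst (asm) AE_iff_null_sets[symmetric]) auto
    then show False by auto
  qed
  moreover have "(LINT x|lborel. f x) \<ge> 0" using f0 by simp
  ultimately have c: "(LINT x|lborel. f x) > 0" by linarith
  define c where "c = 1 / (LINT x|lborel. f x)"
  show thesis
  proof (rule that[of "\<lambda>x. c * f x"])
    show "test_fun (\<lambda>x. c * f x)" using test_fun_affine[OF tf, of 1 c 0] by simp
    show "0 \<le> c * f x" for x using c f0 by (simp add: c_def)
    show "x \<notin> {0<..<1} \<Longrightarrow> c * f x = 0" for x by (auto simp: f_def bumpf_def)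
    show "(LINT x|lborel. c * f x) = 1" using c by (simp add: c_def)
  qed
qed

section \<open>Primitives\<close>

text \<open>Local absolute continuity in integral form: it pins down the increments of
  \<open>f\<close> exactly but \<open>g\<close> only up to null sets, and no pointwise
  differentiability has to be carried along. Continuously differentiable functions enter through
  \<open>prim_C1\<close>.\<close>

definition prim :: "(real \<Rightarrow> 'a::euclidean_space) \<Rightarrow> (real \<Rightarrow> 'a) \<Rightarrow> bool" where
  "prim f g \<longleftrightarrow> (\<forall>a b. set_integrable lborel {a..b} g) \<and>
     (\<forall>a b. a \<le> b \<longrightarrow> f b - f a = (LINT x:{a..b}|lborel. g x))"

lemma primD:
  assumes "prim f g"
  shows "set_integrable lborel {a..b} g" "a \<le> b \<Longrightarrow> f b - f a = (LINT x:{a..b}|lborel. g x)"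
  using assms by (auto simp: prim_def)

lemma set_integral_Icc_combine:
  fixes g :: "real \<Rightarrow> 'a::euclidean_space"
  assumes "set_integrable lborel {a..c} g" "a \<le> b" "b \<le> c"
  shows "(LINT x:{a..c}|lborel. g x) = (LINT x:{a..b}|lborel. g x) + (LINT x:{b..c}|lborel. g x)"
proof -
  have s: "set_integrable lborel {a..b} g" "set_integrable lborel {b..c} g"
    by (rule set_integrable_subset[OF assms(1)]; use assms in auto)+
  show ?thesis
    unfolding set_borel_integral_eq_integral(2)[OF assms(1)]
      set_borel_integral_eq_integral(2)[OF s(1)] set_borel_integral_eq_integral(2)[OF s(2)]
    using Henstock_Kurzweil_Integration.integral_combine[OF assms(2,3) set_borel_integral_eq_integral(1)[OF assms(1)]]
    by simp
qed

lemma loc_int_meas: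
  fixes g :: "real \<Rightarrow> 'a::euclidean_space"
  assumes "\<And>a b. set_integrable lborel {a..b} g"
  shows "g \<in> borel_measurable borel"
proof -
  have "(\<lambda>x. indicator {-real n..real n} x *\<^sub>R g x) \<in> borel_measurable borel" for n
    using assms[of "-real n" "real n"] by (auto simp: set_integrable_def dest: borel_measurable_integrable)
  moreover have "(\<lambda>n. indicator {-real n..real n} x *\<^sub>R g x) \<longlonglongrightarrow> g x" for x
  proof (rule tendsto_eventually)
    obtain N where N: "\<bar>x\<bar> \<le> real N" using real_arch_simple by blast
    show "\<forall>\<^sub>F n in sequentially. indicator {-real n..real n} x *\<^sub>R g x = g x"
      using eventually_ge_at_top[of N] by eventually_elim (use N in \<open>auto simp: indicator_def\<close>)
  qed
  ultimately show ?thesis by (rule borel_measurable_LIMSEQ_metric)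
qed

lemma prim_meas: "prim f g \<Longrightarrow> g \<in> borel_measurable borel"
  by (rule loc_int_meas) (simp add: primD(1))

lemma prim_integral_from:
  fixes g :: "real \<Rightarrow> 'a::euclidean_space"
  assumes "\<And>a b. set_integrable lborel {a..b} g"
  obtains f where "prim f g" "f 0 = 0"
proof -
  define f where "f x = (if x \<ge> 0 then (LINT y:{0..x}|lborel. g y) else - (LINT y:{x..0}|lborel. g y))" for x
  have "f b - f a = (LINT x:{a..b}|lborel. g x)" if "a \<le> b" for a b
  proof -
    consider "0 \<le> a" | "a < 0" "0 \<le> b" | "b < 0" by linarith
    then show ?thesis
    proof cases
      case 1 then show ?thesis using that set_integral_Icc_combine[OF assms, of 0 a b] by (simp add: f_def)
    next
      case 2 then show ?thesis using that set_integral_Icc_combine[OF assms, of a 0 b] by (simp add: f_def)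
    next
      case 3 then show ?thesis using that set_integral_Icc_combine[OF assms, of a b 0] by (simp add: f_def)
    qed
  qed
  then have "prim f g" using assms by (auto simp: prim_def)
  moreover have "f 0 = 0" using set_integral_Icc_combine[OF assms, of 0 0 0] by (simp add: f_def)
  ultimately show thesis using that by blast
qed

lemma prim_norm_le:
  assumes "prim f g" "a \<le> b"
  shows "norm (f b - f a) \<le> (LINT x:{a..b}|lborel. norm (g x))"
  using primD[OF assms(1), of a b] set_integral_norm_bound[of lborel "{a..b}" g] assms(2) by simp

lemma prim_cont:
  assumes "prim f g" shows "continuous_on A f"
proof -
  have "continuous_on {-r..r} f" for r
  proof (cases "-r \<le> r")
    case True
    have eq: "f x = f (-r) + integral {-r..x} g" if "x \<in> {-r..r}" for x
      using primD[OF assms, of "-r" x] that set_borel_integral_eq_integral(2)[of "{-r..x}" g]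
      by (simp add: algebra_simps)
    have "g integrable_on {-r..r}"
      by (rule set_borel_integral_eq_integral(1)[OF primD(1)[OF assms]])
    then have "continuous_on {-r..r} (\<lambda>x. f (-r) + integral {-r..x} g)"
      by (intro continuous_intros indefinite_integral_continuous_1)
    then show ?thesis using eq continuous_on_eq by (smt (verit, best) continuous_on_cong)
  qed auto
  then have c: "continuous_on {-(\<bar>x\<bar>+1)..\<bar>x\<bar>+1} f" for x by blast
  have "isCont f x" for x
  proof (rule continuous_on_interior[OF c])
    have "- (\<bar>x\<bar> + 1) < x \<and> x < \<bar>x\<bar> + 1" by linarith
    then show "x \<in> interior {- (\<bar>x\<bar> + 1)..\<bar>x\<bar> + 1}" by simp
  qed
  then show ?thesis by (simp add: continuous_at_imp_continuous_on)
qed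

lemma prim_meas': "prim f g \<Longrightarrow> f \<in> borel_measurable borel"
  by (intro borel_measurable_continuous_onI prim_cont)

lemma set_integrable_linear:
  fixes g :: "real \<Rightarrow> 'a::euclidean_space" and T :: "'a \<Rightarrow> 'b::euclidean_space"
  assumes "bounded_linear T" "set_integrable lborel S g"
  shows "set_integrable lborel S (\<lambda>x. T (g x))"
    and "(LINT x:S|lborel. T (g x)) = T (LINT x:S|lborel. g x)"
proof -
  interpret T: bounded_linear T by fact
  have e: "(\<lambda>x. indicator S x *\<^sub>R T (g x)) = (\<lambda>x. T (indicator S x *\<^sub>R g x))"
    by (auto simp: T.scaleR)
  show "set_integrable lborel S (\<lambda>x. T (g x))"
    unfolding set_integrable_def e using assms(2) by (intro integrable_bounded_linear[OF assms(1)]) (simp add: set_integrable_def)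
  show "(LINT x:S|lborel. T (g x)) = T (LINT x:S|lborel. g x)"
    unfolding set_lebesgue_integral_def e using assms(2)
    by (intro integral_bounded_linear[OF assms(1)]) (simp add: set_integrable_def)
qed

lemma prim_linear:
  fixes f g :: "real \<Rightarrow> 'a::euclidean_space" and T :: "'a \<Rightarrow> 'b::euclidean_space"
  assumes "bounded_linear T" "prim f g"
  shows "prim (\<lambda>x. T (f x)) (\<lambda>x. T (g x))"
  unfolding prim_def
  using set_integrable_linear[OF assms(1) primD(1)[OF assms(2)]] primD(2)[OF assms(2)]
  by (metis (mono_tags, lifting) assms(1) bounded_linear.linear linear_diff)

lemma prim_add:
  assumes "prim f g" "prim f' g'"
  shows "prim (\<lambda>x. f x + f' x) (\<lambda>x. g x + g' x)"
  unfolding prim_def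
proof (intro conjI allI impI)
  fix a b :: real
  show "set_integrable lborel {a..b} (\<lambda>x. g x + g' x)"
    by (rule set_integral_add(1)[OF primD(1)[OF assms(1)] primD(1)[OF assms(2)]])
  assume "a \<le> b"
  then show "f b + f' b - (f a + f' a) = (LINT x:{a..b}|lborel. g x + g' x)"
    unfolding set_integral_add(2)[OF primD(1)[OF assms(1)] primD(1)[OF assms(2)]]
    by (simp add: primD(2)[OF assms(1), symmetric] primD(2)[OF assms(2), symmetric])
qed

lemma prim_diff:
  assumes "prim f g" "prim f' g'"
  shows "prim (\<lambda>x. f x - f' x) (\<lambda>x. g x - g' x)"
  using prim_add[OF assms(1) prim_linear[OF bounded_linear_minus[OF bounded_linear_ident] assms(2)]] by simp

lemma prim_const: "prim (\<lambda>x. c) (\<lambda>x. 0)"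
  by (simp add: prim_def set_integrable_def set_lebesgue_integral_def)

lemma set_integrable_cont_mult:
  fixes h g :: "real \<Rightarrow> 'a::{real_normed_field,euclidean_space}"
  assumes "continuous_on {a..b} h" "set_integrable lborel {a..b} g"
  shows "set_integrable lborel {a..b} (\<lambda>x. h x * g x)"
proof -
  have "compact (h ` {a..b})" by (intro compact_continuous_image assms) auto
  then obtain K where K: "K > 0" "\<And>x. x \<in> {a..b} \<Longrightarrow> norm (h x) \<le> K"
    using compact_imp_bounded bounded_pos by (metis imageI)
  have m1: "(\<lambda>x. indicator {a..b} x *\<^sub>R h x) \<in> borel_measurable borel"
    by (intro borel_measurable_continuous_on_indicator assms) auto
  have m2: "(\<lambda>x. indicator {a..b} x *\<^sub>R g x) \<in> borel_measurable borel"
    using assms(2) by (auto simp: set_integrable_def dest: borel_measurable_integrable)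
  have e: "(\<lambda>x. indicator {a..b} x *\<^sub>R (h x * g x)) = (\<lambda>x. (indicator {a..b} x *\<^sub>R h x) * (indicator {a..b} x *\<^sub>R g x))"
    by (auto simp: indicator_def)
  show ?thesis unfolding set_integrable_def
  proof (rule Bochner_Integration.integrable_bound)
    show "integrable lborel (\<lambda>x. K * norm (indicator {a..b} x *\<^sub>R g x))"
      using assms(2) by (auto simp: set_integrable_def simp del: norm_scaleR)
    show "(\<lambda>x. indicator {a..b} x *\<^sub>R (h x * g x)) \<in> borel_measurable lborel"
      unfolding e using m1 m2 by measurable
    show "AE x in lborel. norm (indicator {a..b} x *\<^sub>R (h x * g x)) \<le> norm (K * norm (indicator {a..b} x *\<^sub>R g x))"
      using K by (auto simp: indicator_def norm_mult mult_right_mono)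
  qed
qed

text \<open>The error in the chain rule is locally at most \<open>e\<close> times the integral of
  \<open>norm (g x)\<close>. This bound is additive over adjacent intervals, so Bolzano bisection
  makes it global, and then \<open>e\<close> tends to 0. The open set \<open>S\<close> admits
  functions such as \<open>sqrt\<close> that are smooth only away from 0.\<close>

lemma prim_chain_on:
  fixes f g :: "real \<Rightarrow> 'a::{real_normed_field,euclidean_space}"
  assumes p: "prim f g" and ab: "a \<le> b" and S: "open S" "f ` {a..b} \<subseteq> S"
    and F: "\<And>z. z \<in> S \<Longrightarrow> (F has_field_derivative F' z) (at z)" and F'c: "continuous_on S F'"
  shows "set_integrable lborel {a..b} (\<lambda>x. F' (f x) * g x)"
    and "F (f b) - F (f a) = (LINT x:{a..b}|lborel. F' (f x) * g x)"
proof -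
  have cF: "continuous_on {a..b} (\<lambda>x. F' (f x))"
    by (rule continuous_on_compose2[OF F'c prim_cont[OF p] S(2)])
  show I: "set_integrable lborel {a..b} (\<lambda>x. F' (f x) * g x)"
    by (rule set_integrable_cont_mult[OF cF primD(1)[OF p]])
  define I where "I c d = (LINT x:{c..d}|lborel. F' (f x) * g x)" for c d
  define G where "G c d = (LINT x:{c..d}|lborel. norm (g x))" for c d
  have si: "set_integrable lborel {c..d} (\<lambda>x. F' (f x) * g x)" if "a \<le> c" "d \<le> b" for c d
    by (rule set_integrable_subset[OF I]) (use that in auto)
  have sn: "set_integrable lborel {c..d} (\<lambda>x. norm (g x))" for c d
    by (rule set_integrable_norm[OF primD(1)[OF p]])
  have main: "norm (F (f b) - F (f a) - I a b) \<le> e * G a b" if e: "e > 0" for e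
  proof -
    \<comment> \<open>The bisection induction replaces \<open>a\<close> and \<open>b\<close> by
      endpoints of subintervals; these copies keep the outer interval fixed.\<close>
    define a0 b0 where "a0 = a" and "b0 = b"
    have "a0 \<le> a \<and> b \<le> b0 \<longrightarrow> norm (F (f b) - F (f a) - I a b) \<le> e * G a b"
      using ab
    proof (induction rule: Bolzano)
      case (trans c m d)
      show ?case
      proof
        assume "a0 \<le> c \<and> d \<le> b0"
        then have cd: "a \<le> c \<and> d \<le> b" by (simp add: a0_def b0_def)
        have 1: "I c d = I c m + I m d" unfolding I_def
          by (rule set_integral_Icc_combine) (use si cd trans in auto)
        have 2: "G c d = G c m + G m d" unfolding G_def
          by (rule set_integral_Icc_combine) (use sn trans in auto)
        have "F (f d) - F (f c) - I c d = (F (f m) - F (f c) - I c m) + (F (f d) - F (f m) - I m d)"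
          unfolding 1 by simp
        also have "norm \<dots> \<le> e * G c m + e * G m d"
          by (rule norm_triangle_mono) (use trans cd in \<open>auto simp: a0_def b0_def\<close>)
        finally show "norm (F (f d) - F (f c) - I c d) \<le> e * G c d"
          unfolding 2 by (simp add: algebra_simps)
      qed
    next
      case (local x)
      define z where "z = f x"
      have zS: "z \<in> S" using S(2) local by (auto simp: z_def)
      obtain r1 where r1: "r1 > 0" "ball z r1 \<subseteq> S" using S(1) zS open_contains_ball by blast
      obtain r2 where r2: "r2 > 0" "\<And>w. w \<in> S \<Longrightarrow> dist w z < r2 \<Longrightarrow> dist (F' w) (F' z) < e/2"
        using F'c[unfolded continuous_on_iff, rule_format, OF zS, of "e/2"] e by auto
      define r where "r = min r1 r2"
      have r: "r > 0" "ball z r \<subseteq> S" "\<And>w. w \<in> ball z r \<Longrightarrow> norm (F' w - F' z) \<le> e/2"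
      proof -
        show "r > 0" "ball z r \<subseteq> S" using r1 r2(1) by (auto simp: r_def)
        fix w assume "w \<in> ball z r"
        then have "w \<in> S" "dist w z < r2" using r1 by (auto simp: r_def dist_commute)
        then show "norm (F' w - F' z) \<le> e/2" using r2(2)[of w] by (simp add: dist_norm)
      qed
      have "isCont f x" using prim_cont[OF p, of UNIV] continuous_on_eq_continuous_at by blast
      then obtain s where s: "s > 0" "\<And>y. dist y x < s \<Longrightarrow> dist (f y) z < r"
        unfolding continuous_at_eps_delta z_def using r(1) by blast
      show ?case
      proof (intro exI[of _ s] conjI allI impI s(1))
        fix c d assume cxd: "c \<le> x \<and> x \<le> d \<and> d - c < s" and "a0 \<le> c \<and> d \<le> b0"
        then have cd: "a \<le> c \<and> d \<le> b" by (simp add: a0_def b0_def)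
        have fy: "f y \<in> ball z r" if "y \<in> {c..d}" for y
          using s(2)[of y] that cxd by (auto simp: dist_commute dist_real_def)
        have le: "c \<le> d" using cxd by linarith
        \<comment> \<open>Subtracting the linear map with slope \<open>F' z\<close> leaves a
          function whose derivative is at most \<open>e/2\<close> on the ball, so the mean value
          inequality applies there.\<close>
        have "norm ((F (f d) - F' z * f d) - (F (f c) - F' z * f c)) \<le> e/2 * norm (f d - f c)"
        proof (rule field_differentiable_bound[where S="ball z r" and f'="\<lambda>w. F' w - F' z"])
          fix w assume w: "w \<in> ball z r"
          show "((\<lambda>w. F w - F' z * w) has_field_derivative F' w - F' z) (at w within ball z r)"
            by (rule has_field_derivative_at_within[OF DERIV_diff[OF F DERIV_cmult_Id]]) (use w r(2) in blast)
        next
          show "f d \<in> ball z r" "f c \<in> ball z r" using fy[of d] fy[of c] le by simp_all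
        qed (use r(3) in blast)+
        also have "\<dots> \<le> e/2 * G c d"
          using prim_norm_le[OF p le] e by (simp add: G_def)
        finally have A: "norm (F (f d) - F (f c) - F' z * (f d - f c)) \<le> e/2 * G c d"
          by (simp add: algebra_simps)
        have "F' z * (f d - f c) = (LINT y:{c..d}|lborel. F' z * g y)"
          using primD(2)[OF p le] by simp
        then have "F' z * (f d - f c) - I c d = (LINT y:{c..d}|lborel. F' z * g y - F' (f y) * g y)"
          unfolding I_def using si[of c d] cd primD(1)[OF p, of c d] by (subst set_integral_diff) auto
        also have "norm \<dots> \<le> (LINT y:{c..d}|lborel. norm (F' z * g y - F' (f y) * g y))"
          by (rule set_integral_norm_bound) (use si[of c d] cd primD(1)[OF p, of c d] in auto)
        also have "\<dots> \<le> (LINT y:{c..d}|lborel. e/2 * norm (g y))"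
        proof (rule set_integral_mono)
          show "set_integrable lborel {c..d} (\<lambda>y. norm (F' z * g y - F' (f y) * g y))"
            by (rule set_integrable_norm) (use si[of c d] cd primD(1)[OF p, of c d] in auto)
          show "set_integrable lborel {c..d} (\<lambda>y. e/2 * norm (g y))" using sn by auto
          fix y assume "y \<in> {c..d}"
          then have "norm (F' z - F' (f y)) * norm (g y) \<le> e/2 * norm (g y)"
            using r(3)[OF fy] by (intro mult_right_mono) (auto simp: norm_minus_commute)
          then show "norm (F' z * g y - F' (f y) * g y) \<le> e/2 * norm (g y)"
            by (simp add: norm_mult[symmetric] algebra_simps)
        qed
        also have "\<dots> = e/2 * G c d" by (simp add: G_def)
        finally have B: "norm (F' z * (f d - f c) - I c d) \<le> e/2 * G c d" .
        have "F (f d) - F (f c) - I c d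
            = (F (f d) - F (f c) - F' z * (f d - f c)) + (F' z * (f d - f c) - I c d)" by simp
        then have "norm (F (f d) - F (f c) - I c d) \<le> e/2 * G c d + e/2 * G c d"
          using norm_triangle_mono[OF A B] by (simp only:)
        then show "norm (F (f d) - F (f c) - I c d) \<le> e * G c d" by simp
      qed
    qed
    then show ?thesis by (simp add: a0_def b0_def)
  qed
  have G0: "0 \<le> G a b" unfolding G_def set_lebesgue_integral_def by (rule integral_nonneg_AE) auto
  have "norm (F (f b) - F (f a) - I a b) \<le> 0"
  proof (rule field_le_epsilon)
    fix e :: real assume e: "e > 0"
    have "norm (F (f b) - F (f a) - I a b) \<le> e / (G a b + 1) * G a b"
      by (rule main) (use e G0 in simp)
    also have "\<dots> \<le> e" using e G0 by (simp add: divide_simps)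
    finally show "norm (F (f b) - F (f a) - I a b) \<le> 0 + e" by simp
  qed
  then show "F (f b) - F (f a) = (LINT x:{a..b}|lborel. F' (f x) * g x)" by (simp add: I_def)
qed

lemma prim_chain:
  fixes f g :: "real \<Rightarrow> 'a::{real_normed_field,euclidean_space}"
  assumes p: "prim f g" and F: "\<And>z. (F has_field_derivative F' z) (at z)" and F'c: "continuous_on UNIV F'"
  shows "prim (\<lambda>x. F (f x)) (\<lambda>x. F' (f x) * g x)"
proof -
  have "set_integrable lborel {a..b} (\<lambda>x. F' (f x) * g x)" for a b
    by (rule set_integrable_cont_mult[OF continuous_on_compose2[OF F'c prim_cont[OF p]] primD(1)[OF p]]) auto
  then show ?thesis unfolding prim_def using prim_chain_on[OF p _ open_UNIV _ F F'c] by auto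
qed

text \<open>Polarization: \<open>4*f*g = (f+g)^2 - (f-g)^2\<close> reduces the product rule to the
  chain rule for squares.\<close>

lemma prim_mult:
  fixes f g :: "real \<Rightarrow> 'a::{real_normed_field,euclidean_space}"
  assumes f: "prim f f'" and g: "prim g g'"
  shows "prim (\<lambda>x. f x * g x) (\<lambda>x. f' x * g x + f x * g' x)"
proof -
  have sq: "prim (\<lambda>x. (h x)^2) (\<lambda>x. 2 * h x * h' x)" if "prim h h'" for h h' :: "real \<Rightarrow> 'a"
    by (rule prim_chain[OF that, of "\<lambda>z. z^2" "\<lambda>z. 2*z"])
       (auto intro!: derivative_eq_intros continuous_intros)
  have "prim (\<lambda>x. (f x + g x)^2 - (f x - g x)^2) (\<lambda>x. 2 * (f x + g x) * (f' x + g' x) - 2 * (f x - g x) * (f' x - g' x))"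
    by (intro prim_diff sq prim_add f g)
  then have "prim (\<lambda>x. (1/4) * ((f x + g x)^2 - (f x - g x)^2)) (\<lambda>x. (1/4) * (2 * (f x + g x) * (f' x + g' x) - 2 * (f x - g x) * (f' x - g' x)))"
    by (rule prim_linear[OF bounded_linear_mult_right])
  moreover have "(1/4) * ((f x + g x)^2 - (f x - g x)^2) = f x * g x" for x
    by (simp add: power2_eq_square algebra_simps)
  moreover have "(1/4) * (2 * (f x + g x) * (f' x + g' x) - 2 * (f x - g x) * (f' x - g' x)) = f' x * g x + f x * g' x" for x
    by (simp add: algebra_simps)
  ultimately show ?thesis by (simp only:)
qed

lemma prim_C1:
  assumes "\<And>x. (f has_vector_derivative g x) (at x)" "continuous_on UNIV g"
  shows "prim f g"
  unfolding prim_def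
proof (intro conjI allI impI)
  fix a b :: real
  show "set_integrable lborel {a..b} g"
    by (rule borel_integrable_atLeastAtMost'[OF continuous_on_subset[OF assms(2)]]) auto
  assume ab: "a \<le> b"
  have "(g has_integral (f b - f a)) {a..b}"
    by (rule fundamental_theorem_of_calculus[OF ab]) (auto intro: has_vector_derivative_at_within assms)
  moreover have "(LINT x:{a..b}|lborel. g x) = integral {a..b} g"
    by (rule set_borel_integral_eq_integral(2)) fact
  ultimately show "f b - f a = (LINT x:{a..b}|lborel. g x)" by (simp add: integral_unique)
qed

section \<open>Square-integrable functions\<close>

lemma L2_meas: "L2 f \<Longrightarrow> f \<in> borel_measurable borel"
  by (simp add: L2_def)

lemma L2_int: "L2 f \<Longrightarrow> integrable lborel (\<lambda>x. (norm (f x))\<^sup>2)"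
  by (simp add: L2_def)

lemma L2_bound:
  fixes f :: "real \<Rightarrow> 'a::{real_normed_vector,second_countable_topology}" and g :: "real \<Rightarrow> 'b::{real_normed_vector,second_countable_topology}"
  assumes "f \<in> borel_measurable borel" "L2 g" "AE x in lborel. norm (f x) \<le> K * norm (g x)"
  shows "L2 f"
  unfolding L2_def
proof
  show m: "f \<in> borel_measurable lborel" using assms(1) by simp
  show "integrable lborel (\<lambda>x. (norm (f x))\<^sup>2)"
  proof (rule Bochner_Integration.integrable_bound)
    show "integrable lborel (\<lambda>x. K^2 * (norm (g x))\<^sup>2)" using L2_int[OF assms(2)] by simp
    show "(\<lambda>x. (norm (f x))\<^sup>2) \<in> borel_measurable lborel" using m by measurable
    show "AE x in lborel. norm ((norm (f x))\<^sup>2) \<le> norm (K^2 * (norm (g x))\<^sup>2)"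
      using assms(3) by eventually_elim (simp add: power_mult_distrib[symmetric] power_mono abs_mult)
  qed
qed

lemma L2norm_nonneg[simp]: "0 \<le> L2norm f"
  by (simp add: L2norm_def)

lemma L2norm_power2: "(L2norm f)^2 = (LINT x|lborel. (norm (f x))\<^sup>2)"
  by (simp add: L2norm_def)

lemma L2norm_bound:
  fixes f :: "real \<Rightarrow> 'a::{real_normed_vector,second_countable_topology}" and g :: "real \<Rightarrow> 'b::{real_normed_vector,second_countable_topology}"
  assumes "L2 g" "AE x in lborel. norm (f x) \<le> K * norm (g x)" "0 \<le> K"
  shows "L2norm f \<le> K * L2norm g"
proof -
  have "(L2norm f)^2 \<le> (LINT x|lborel. K^2 * (norm (g x))\<^sup>2)"
  proof (cases "integrable lborel (\<lambda>x. (norm (f x))\<^sup>2)")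
    case True
    show ?thesis unfolding L2norm_power2
    proof (rule integral_mono_AE[OF True])
      show "integrable lborel (\<lambda>x. K^2 * (norm (g x))\<^sup>2)" using L2_int[OF assms(1)] by simp
      show "AE x in lborel. (norm (f x))\<^sup>2 \<le> K^2 * (norm (g x))\<^sup>2"
        using assms(2) by eventually_elim (simp add: power_mult_distrib[symmetric] power_mono)
    qed
  next
    \<comment> \<open>The integral of a non-integrable function is 0 by convention, so the left-hand
      side is 0 in this case.\<close>
    case False
    then have "(L2norm f)^2 = 0" unfolding L2norm_power2 by (rule not_integrable_integral_eq)
    then show ?thesis by (simp add: integral_nonneg_AE)
  qed
  also have "\<dots> = (K * L2norm g)^2" by (simp add: L2norm_power2 power_mult_distrib)
  finally show ?thesis by (rule power2_le_imp_le) (use assms(3) in simp)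
qed

lemma L2norm_mono:
  fixes f :: "real \<Rightarrow> 'a::{real_normed_vector,second_countable_topology}" and g :: "real \<Rightarrow> 'b::{real_normed_vector,second_countable_topology}"
  assumes "L2 g" "AE x in lborel. norm (f x) \<le> norm (g x)"
  shows "L2norm f \<le> L2norm g"
  using L2norm_bound[OF assms(1), of f 1] assms(2) by simp

lemma L2_cong_AE:
  fixes f :: "real \<Rightarrow> 'a::{real_normed_vector,second_countable_topology}"
  assumes "L2 f" "g \<in> borel_measurable borel" "AE x in lborel. f x = g x"
  shows "L2 g" "L2norm g = L2norm f"
proof -
  show g: "L2 g" by (rule L2_bound[OF assms(2,1), of 1]) (use assms(3) in \<open>eventually_elim, simp\<close>)
  show "L2norm g = L2norm f"
    by (rule antisym; rule L2norm_mono) (use assms(1) g assms(3) in \<open>auto elim: eventually_mono\<close>)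
qed

lemma L2_prod_integrable:
  fixes f g :: "real \<Rightarrow> 'a::{real_normed_algebra,second_countable_topology,banach}"
  assumes "L2 f" "L2 g"
  shows "integrable lborel (\<lambda>x. f x * g x)"
proof (rule Bochner_Integration.integrable_bound)
  show "integrable lborel (\<lambda>x. (norm (f x))^2 + (norm (g x))^2)" using assms by (simp add: L2_int)
  show "(\<lambda>x. f x * g x) \<in> borel_measurable lborel"
    using assms[THEN L2_meas] by measurable
  have "norm (f x * g x) \<le> (norm (f x))^2 + (norm (g x))^2" for x
  proof -
    have "norm (f x * g x) \<le> norm (f x) * norm (g x)" by (rule norm_mult_ineq)
    also have "\<dots> \<le> (norm (f x))^2 + (norm (g x))^2"
    proof -
      have "2 * norm (f x) * norm (g x) \<le> (norm (f x))^2 + (norm (g x))^2" by (rule sum_squares_bound)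
      moreover have "0 \<le> norm (f x) * norm (g x)" by simp
      ultimately show ?thesis by linarith
    qed
    finally show ?thesis .
  qed
  then show "AE x in lborel. norm (f x * g x) \<le> norm ((norm (f x))^2 + (norm (g x))^2)" by simp
qed

lemma L2_norm: "L2 f \<Longrightarrow> L2 (\<lambda>x. norm (f x))"
  for f :: "real \<Rightarrow> 'a::{real_normed_vector,second_countable_topology}"
  by (auto simp: L2_def)

lemma L2norm_norm: "L2norm (\<lambda>x. norm (f x)) = L2norm f"
  by (simp add: L2norm_def)

lemma L2_Cauchy_Schwarz:
  fixes f :: "real \<Rightarrow> 'a::{real_normed_vector,second_countable_topology}" and g :: "real \<Rightarrow> 'b::{real_normed_vector,second_countable_topology}"
  assumes "L2 f" "L2 g"
  shows "(LINT x|lborel. norm (f x) * norm (g x)) \<le> L2norm f * L2norm g"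
proof -
  define A B C where "A = (LINT x|lborel. (norm (f x))^2)" and "B = (LINT x|lborel. norm (f x) * norm (g x))"
    and "C = (LINT x|lborel. (norm (g x))^2)"
  note I = L2_int[OF assms(1)] L2_int[OF assms(2)] L2_prod_integrable[OF L2_norm[OF assms(1)] L2_norm[OF assms(2)]]
  have q: "0 \<le> s^2 * A - 2 * s * t * B + t^2 * C" for s t
  proof -
    have "0 \<le> (LINT x|lborel. (s * norm (f x) - t * norm (g x))^2)" by simp
    also have "\<dots> = (LINT x|lborel. s^2 * (norm (f x))^2 - 2 * s * t * (norm (f x) * norm (g x)) + t^2 * (norm (g x))^2)"
      by (intro Bochner_Integration.integral_cong refl) (simp add: power2_eq_square algebra_simps)
    also have "\<dots> = s^2 * A - 2 * s * t * B + t^2 * C"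
      using I by (simp add: A_def B_def C_def)
    finally show ?thesis .
  qed
  have A0: "A \<ge> 0" "C \<ge> 0" "B \<ge> 0" by (simp_all add: A_def C_def B_def)
  \<comment> \<open>The nonnegative quadratic form is evaluated at \<open>(B, A)\<close> and
    \<open>(C, B)\<close>, which gives \<open>A\<close> and \<open>C\<close> times the determinant
    \<open>A*C - B^2\<close>; if both coefficients vanish, the point \<open>(1, 1)\<close> forces
    \<open>B = 0\<close>.\<close>
  have "B^2 \<le> A * C"
  proof (cases "A = 0 \<and> C = 0")
    case True
    then have "B \<le> 0" using q[of 1 1] by simp
    then show ?thesis using A0 True by simp
  next
    case False
    have "0 \<le> A * (A*C - B^2)" using q[of B A] by (simp add: power2_eq_square algebra_simps)
    moreover have "0 \<le> C * (A*C - B^2)" using q[of C B] by (simp add: power2_eq_square algebra_simps)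
    ultimately show ?thesis using False A0
      by (metis diff_ge_0_iff_ge less_eq_real_def mult_nonneg_nonneg zero_le_mult_iff not_le)
  qed
  then have "B \<le> sqrt (A * C)" by (rule real_le_rsqrt)
  then show ?thesis by (simp add: L2norm_def A_def B_def C_def real_sqrt_mult)
qed

lemma L2_prod_integral_le:
  fixes f g :: "real \<Rightarrow> complex"
  assumes "L2 f" "L2 g"
  shows "norm (LINT x|lborel. f x * g x) \<le> L2norm f * L2norm g"
proof -
  have "norm (LINT x|lborel. f x * g x) \<le> (LINT x|lborel. norm (f x * g x))" by (rule integral_norm_bound)
  also have "\<dots> \<le> L2norm f * L2norm g" using L2_Cauchy_Schwarz[OF assms] by (simp add: norm_mult)
  finally show ?thesis .
qed

lemma L2_add:
  fixes f g :: "real \<Rightarrow> 'a::{real_normed_vector,second_countable_topology}"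
  assumes "L2 f" "L2 g"
  shows "L2 (\<lambda>x. f x + g x)" and "L2norm (\<lambda>x. f x + g x) \<le> L2norm f + L2norm g"
proof -
  note m = assms[THEN L2_meas]
  have sq: "(norm (f x + g x))^2 \<le> (norm (f x))^2 + 2 * (norm (f x) * norm (g x)) + (norm (g x))^2" for x
  proof -
    have "(norm (f x + g x))^2 \<le> (norm (f x) + norm (g x))^2"
      by (intro power_mono norm_triangle_ineq) auto
    then show ?thesis by (simp add: power2_sum)
  qed
  note I = L2_int[OF assms(1)] L2_int[OF assms(2)] L2_prod_integrable[OF L2_norm[OF assms(1)] L2_norm[OF assms(2)]]
  have J: "integrable lborel (\<lambda>x. (norm (f x))^2 + 2 * (norm (f x) * norm (g x)) + (norm (g x))^2)"
    using I by simp
  have K: "integrable lborel (\<lambda>x. (norm (f x + g x))\<^sup>2)"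
    by (rule Bochner_Integration.integrable_bound[OF J])
       (use m sq in \<open>auto simp: abs_of_nonneg\<close>)
  show "L2 (\<lambda>x. f x + g x)" unfolding L2_def using K m by simp
  have "(L2norm (\<lambda>x. f x + g x))^2 \<le> (LINT x|lborel. (norm (f x))^2 + 2 * (norm (f x) * norm (g x)) + (norm (g x))^2)"
    unfolding L2norm_power2 by (rule integral_mono[OF K J]) (rule sq)
  also have "\<dots> = (L2norm f)^2 + 2 * (LINT x|lborel. norm (f x) * norm (g x)) + (L2norm g)^2"
    using I by (simp add: L2norm_power2)
  also have "\<dots> \<le> (L2norm f + L2norm g)^2"
    using L2_Cauchy_Schwarz[OF assms] by (simp add: power2_sum)
  finally show "L2norm (\<lambda>x. f x + g x) \<le> L2norm f + L2norm g"
    by (rule power2_le_imp_le) simp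
qed

lemma L2_cmult:
  fixes f :: "real \<Rightarrow> 'a::{real_normed_div_algebra,second_countable_topology}"
  assumes "L2 f" shows "L2 (\<lambda>x. c * f x)" and "L2norm (\<lambda>x. c * f x) = norm c * L2norm f"
proof -
  show "L2 (\<lambda>x. c * f x)" 
    by (rule L2_bound[OF _ assms, of _ "norm c"]) (use L2_meas[OF assms] in \<open>auto simp: norm_mult\<close>)
  show "L2norm (\<lambda>x. c * f x) = norm c * L2norm f"
    by (simp add: L2norm_def norm_mult power_mult_distrib real_sqrt_mult)
qed

lemma L2_uminus:
  fixes f :: "real \<Rightarrow> 'a::{real_normed_vector,second_countable_topology}"
  assumes "L2 f" shows "L2 (\<lambda>x. - f x)" "L2norm (\<lambda>x. - f x) = L2norm f"
  using assms by (auto simp: L2_def L2norm_def)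

lemma L2_diff:
  fixes f g :: "real \<Rightarrow> 'a::{real_normed_vector,second_countable_topology}"
  assumes "L2 f" "L2 g"
  shows "L2 (\<lambda>x. f x - g x)" and "L2norm (\<lambda>x. f x - g x) \<le> L2norm f + L2norm g"
  using L2_add[OF assms(1) L2_uminus(1)[OF assms(2)]] L2_uminus(2)[OF assms(2)] by auto

lemma L2_indicator:
  fixes f :: "real \<Rightarrow> 'a::{real_normed_vector,second_countable_topology}"
  assumes "L2 f" "S \<in> sets borel"
  shows "L2 (\<lambda>x. indicator S x *\<^sub>R f x)"
  by (rule L2_bound[OF _ assms(1), of _ 1]) (use assms L2_meas[OF assms(1)] in \<open>auto simp: indicator_def\<close>)

lemma L2_indicator_Icc: "L2 (indicator {a..b} :: real \<Rightarrow> real)"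
  and L2norm_indicator_Icc: "a \<le> b \<Longrightarrow> L2norm (indicator {a..b} :: real \<Rightarrow> real) = sqrt (b - a)"
proof -
  have e: "(\<lambda>x. (norm (indicator {a..b} x :: real))\<^sup>2) = indicator {a..b}" by (auto simp: indicator_def)
  show "L2 (indicator {a..b} :: real \<Rightarrow> real)" unfolding L2_def e
    by (auto intro!: integrable_real_indicator simp: emeasure_lborel_Icc_eq)
  show "a \<le> b \<Longrightarrow> L2norm (indicator {a..b} :: real \<Rightarrow> real) = sqrt (b - a)"
    unfolding L2norm_def e by simp
qed

lemma L2_set_integrable:
  fixes g :: "real \<Rightarrow> 'a::euclidean_space"
  assumes "L2 g"
  shows "set_integrable lborel {a..b} g" "set_integrable lborel {a..b} (\<lambda>x. norm (g x))"
    and "a \<le> b \<Longrightarrow> (LINT x:{a..b}|lborel. norm (g x))^2 \<le> (b - a) * (LINT x:{a..b}|lborel. (norm (g x))^2)"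
proof -
  note m = L2_meas[OF assms]
  have i: "integrable lborel (\<lambda>x. indicator {a..b} x * norm (g x))"
    by (rule L2_prod_integrable[OF L2_indicator_Icc L2_norm[OF assms]])
  show "set_integrable lborel {a..b} (\<lambda>x. norm (g x))" using i by (simp add: set_integrable_def)
  show "set_integrable lborel {a..b} g"
    unfolding set_integrable_def
    by (rule Bochner_Integration.integrable_bound[OF i]) (use m in auto)
  assume ab: "a \<le> b"
  have L: "L2 (\<lambda>x. indicator {a..b} x *\<^sub>R g x)" by (rule L2_indicator[OF assms]) auto
  have "(LINT x:{a..b}|lborel. norm (g x)) = (LINT x|lborel. norm (indicator {a..b} x :: real) * norm (indicator {a..b} x *\<^sub>R g x))"
    unfolding set_lebesgue_integral_def by (intro Bochner_Integration.integral_cong) (auto simp: indicator_def)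
  also have "\<dots> \<le> sqrt (b - a) * L2norm (\<lambda>x. indicator {a..b} x *\<^sub>R g x)"
    using L2_Cauchy_Schwarz[OF L2_indicator_Icc[of a b] L] unfolding L2norm_indicator_Icc[OF ab] .
  finally have "(LINT x:{a..b}|lborel. norm (g x)) \<le> sqrt (b - a) * L2norm (\<lambda>x. indicator {a..b} x *\<^sub>R g x)" .
  moreover have "0 \<le> (LINT x:{a..b}|lborel. norm (g x))" by (simp add: set_lebesgue_integral_def)
  ultimately have "(LINT x:{a..b}|lborel. norm (g x))^2 \<le> (sqrt (b - a) * L2norm (\<lambda>x. indicator {a..b} x *\<^sub>R g x))^2"
    by (rule power_mono)
  also have "\<dots> = (b - a) * (LINT x|lborel. (norm (indicator {a..b} x *\<^sub>R g x))^2)"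
    using ab by (simp add: power_mult_distrib L2norm_power2)
  also have "(LINT x|lborel. (norm (indicator {a..b} x *\<^sub>R g x))^2) = (LINT x:{a..b}|lborel. (norm (g x))^2)"
    unfolding set_lebesgue_integral_def by (intro Bochner_Integration.integral_cong) (auto simp: indicator_def)
  finally show "(LINT x:{a..b}|lborel. norm (g x))^2 \<le> (b - a) * (LINT x:{a..b}|lborel. (norm (g x))^2)" .
qed

lemma set_integral_le_integral:
  fixes f :: "real \<Rightarrow> real"
  assumes "integrable lborel f" "\<And>x. 0 \<le> f x" "S \<in> sets borel"
  shows "(LINT x:S|lborel. f x) \<le> (LINT x|lborel. f x)"
  unfolding set_lebesgue_integral_def
  by (intro integral_mono integrable_mult_indicator assms) (use assms in \<open>auto simp: indicator_def\<close>)

text \<open>The right-hand side keeps only the integral over \<open>{a..b}\<close>: integrated over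
  all windows of length \<open>e\<close>, such local terms gain a further factor
  \<open>e\<close>.\<close>

lemma prim_hoelder_local:
  assumes "prim f g" "L2 g" "a \<le> b"
  shows "(norm (f b - f a))^2 \<le> (b - a) * (LINT x:{a..b}|lborel. (norm (g x))^2)"
proof -
  have "(norm (f b - f a))^2 \<le> (LINT x:{a..b}|lborel. norm (g x))^2"
    by (intro power_mono prim_norm_le[OF assms(1,3)]) auto
  then show ?thesis using L2_set_integrable(3)[OF assms(2,3)] by linarith
qed

lemma prim_hoelder:
  assumes "prim f g" "L2 g"
  shows "norm (f b - f a) \<le> sqrt \<bar>b - a\<bar> * L2norm g"
proof -
  have *: "norm (f b - f a) \<le> sqrt (b - a) * L2norm g" if "a \<le> b" for a b
  proof -
    have "(norm (f b - f a))^2 \<le> (b - a) * (LINT x:{a..b}|lborel. (norm (g x))^2)"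
      by (rule prim_hoelder_local[OF assms that])
    also have "\<dots> \<le> (b - a) * (LINT x|lborel. (norm (g x))^2)"
      by (intro mult_left_mono set_integral_le_integral L2_int assms) (use that in auto)
    also have "\<dots> = (sqrt (b - a) * L2norm g)^2" using that by (simp add: power_mult_distrib L2norm_power2)
    finally show ?thesis by (rule power2_le_imp_le) (use that in simp)
  qed
  show ?thesis
    using *[of a b] *[of b a] by (cases "a \<le> b") (auto simp: norm_minus_commute)
qed

text \<open>An integrable derivative makes \<open>f\<close> converge at infinity, and an integrable
  \<open>f\<close> cannot have a nonzero limit.\<close>

lemma prim_integrable_limits:
  fixes f g :: "real \<Rightarrow> 'a::euclidean_space"
  assumes p: "prim f g" and f: "integrable lborel f" and g: "integrable lborel g"
  shows "(f \<longlongrightarrow> 0) at_top"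
proof -
  define L where "L = f 0 + (LINT x:{0..}|lborel. g x)"
  have "((\<lambda>x. LINT y:{0..x}|lborel. g y) \<longlongrightarrow> (LINT x:{0..}|lborel. g x)) at_top"
  proof (rule tendsto_set_lebesgue_integral_at_top)
    show "set_integrable lborel {0..} g" unfolding set_integrable_def
      by (intro integrable_mult_indicator g) auto
  qed auto
  then have "((\<lambda>x. f 0 + (LINT y:{0..x}|lborel. g y)) \<longlongrightarrow> L) at_top"
    unfolding L_def by (intro tendsto_intros)
  moreover have "\<forall>\<^sub>F x in at_top. f 0 + (LINT y:{0..x}|lborel. g y) = f x"
    using eventually_ge_at_top[of 0] by eventually_elim (simp add: primD(2)[OF p, symmetric])
  ultimately have lim: "(f \<longlongrightarrow> L) at_top" by (rule Lim_transform_eventually)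
  have "L = 0"
  proof (rule ccontr)
    assume "L \<noteq> 0"
    define c where "c = norm L / 2"
    have c: "c > 0" using \<open>L \<noteq> 0\<close> by (simp add: c_def)
    have "\<forall>\<^sub>F x in at_top. dist (f x) L < c" using lim c by (rule tendstoD)
    then obtain X where X: "\<And>x. x \<ge> X \<Longrightarrow> dist (f x) L < c" by (auto simp: eventually_at_top_linorder)
    have big: "norm (f x) \<ge> c" if "x \<ge> X" for x
    proof -
      have "norm L \<le> norm (f x) + dist (f x) L" by (metis dist_norm norm_triangle_sub norm_minus_commute)
      then show ?thesis using X[OF that] c_def by linarith
    qed
    have *: "c * real N \<le> (LINT x|lborel. norm (f x))" for N :: nat
    proof -
      have "c * real N = (LINT x:{X..X+real N}|lborel. c)" by (simp add: set_lebesgue_integral_def)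
      also have "\<dots> \<le> (LINT x:{X..X+real N}|lborel. norm (f x))"
      proof (rule set_integral_mono)
        show "set_integrable lborel {X..X+real N} (\<lambda>x. norm (f x))"
          unfolding set_integrable_def by (intro integrable_mult_indicator integrable_norm f) auto
        show "set_integrable lborel {X..X+real N} (\<lambda>x. c)" 
          by (rule borel_integrable_atLeastAtMost') auto
      qed (use big in auto)
      also have "\<dots> \<le> (LINT x|lborel. norm (f x))"
        by (rule set_integral_le_integral) (use f in auto)
      finally show ?thesis .
    qed
    obtain N :: nat where "real N > (LINT x|lborel. norm (f x)) / c" using reals_Archimedean2 by blast
    then show False using *[of N] c by (simp add: divide_less_eq mult.commute)
  qed
  then show ?thesis using lim by simp
qed

lemma lborel_integrable_reflect:
  fixes f :: "real \<Rightarrow> 'a::{banach,second_countable_topology}"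
  assumes "integrable lborel f" shows "integrable lborel (\<lambda>x. f (-x))"
  using lborel_integrable_real_affine[OF assms, of "-1" 0] by simp

lemma lborel_integral_reflect:
  fixes f :: "real \<Rightarrow> 'a::{banach,second_countable_topology}"
  shows "(LINT x|lborel. f (-x)) = (LINT x|lborel. f x)"
  using lborel_integral_real_affine[of "-1" f 0] by simp

lemma set_integral_reflect_Icc:
  fixes f :: "real \<Rightarrow> 'a::{banach,second_countable_topology}"
  shows "(LINT x:{a..b}|lborel. f (-x)) = (LINT x:{-b..-a}|lborel. f x)"
    and "set_integrable lborel {-b..-a} f \<Longrightarrow> set_integrable lborel {a..b} (\<lambda>x. f (-x))"
proof -
  have i: "indicator {a..b} x = (indicator {-b..-a} (-x) :: real)" for x by (auto simp: indicator_def)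
  show "(LINT x:{a..b}|lborel. f (-x)) = (LINT x:{-b..-a}|lborel. f x)"
    unfolding set_lebesgue_integral_def i by (rule lborel_integral_reflect)
  show "set_integrable lborel {-b..-a} f \<Longrightarrow> set_integrable lborel {a..b} (\<lambda>x. f (-x))"
    unfolding set_integrable_def i by (rule lborel_integrable_reflect)
qed

lemma prim_reflect:
  assumes "prim f g" shows "prim (\<lambda>x. f (-x)) (\<lambda>x. - g (-x))"
  unfolding prim_def
proof (intro conjI allI impI)
  fix a b :: real
  have s: "set_integrable lborel {a..b} (\<lambda>x. g (-x))"
    by (rule set_integral_reflect_Icc(2)[OF primD(1)[OF assms]])
  then show "set_integrable lborel {a..b} (\<lambda>x. - g (-x))" by (simp add: set_integrable_def)
  assume "a \<le> b"
  then show "f (-b) - f (-a) = (LINT x:{a..b}|lborel. - g (-x))"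
    using primD(2)[OF assms, of "-b" "-a"] s
    by (simp add: set_integral_reflect_Icc(1)[of a b g, symmetric] set_integral_uminus algebra_simps)
qed

lemma prim_integrable_limits_bot:
  fixes f g :: "real \<Rightarrow> 'a::euclidean_space"
  assumes p: "prim f g" and f: "integrable lborel f" and g: "integrable lborel g"
  shows "(f \<longlongrightarrow> 0) at_bot"
proof -
  have "((\<lambda>x. f (-x)) \<longlongrightarrow> 0) at_top"
    by (rule prim_integrable_limits[OF prim_reflect[OF p]])
       (use lborel_integrable_reflect[OF f] lborel_integrable_reflect[OF g] in auto)
  then show ?thesis by (simp add: filterlim_at_bot_mirror)
qed

lemma integral_Icc_tendsto:
  fixes g :: "real \<Rightarrow> 'a::euclidean_space"
  assumes "integrable lborel g"
  shows "((\<lambda>R. LINT x:{-R..R}|lborel. g x) \<longlongrightarrow> (LINT x|lborel. g x)) at_top"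
  unfolding set_lebesgue_integral_def
proof (rule integral_dominated_convergence_at_top[where w="\<lambda>x. norm (g x)"])
  show "\<forall>\<^sub>F i in at_top. AE x in lborel. norm (indicator {- i..i} x *\<^sub>R g x) \<le> norm (g x)"
    by (auto simp: indicator_def)
  show "AE x in lborel. ((\<lambda>i. indicator {- i..i} x *\<^sub>R g x) \<longlongrightarrow> g x) at_top"
  proof (intro AE_I2 tendsto_eventually)
    fix x :: real
    show "\<forall>\<^sub>F i in at_top. indicator {- i..i} x *\<^sub>R g x = g x"
      using eventually_ge_at_top[of "\<bar>x\<bar>"] by eventually_elim (auto simp: indicator_def)
  qed
qed (use assms in auto)

text \<open>Applied to a product via \<open>prim_mult\<close>, this is integration by parts on the
  whole line with no boundary terms.\<close>

lemma prim_integral_zero: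
  fixes f g :: "real \<Rightarrow> 'a::euclidean_space"
  assumes p: "prim f g" and f: "integrable lborel f" and g: "integrable lborel g"
  shows "(LINT x|lborel. g x) = 0"
proof -
  have "((\<lambda>R. f R - f (-R)) \<longlongrightarrow> 0 - 0) at_top"
    by (intro tendsto_diff prim_integrable_limits[OF p f g])
       (use prim_integrable_limits_bot[OF p f g] in \<open>simp add: filterlim_at_bot_mirror\<close>)
  moreover have "\<forall>\<^sub>F R in at_top. f R - f (-R) = (LINT x:{-R..R}|lborel. g x)"
    using eventually_ge_at_top[of 0] by eventually_elim (rule primD(2)[OF p], simp)
  ultimately have "((\<lambda>R. LINT x:{-R..R}|lborel. g x) \<longlongrightarrow> 0) at_top"
    by (auto intro: Lim_transform_eventually)
  then show ?thesis using integral_Icc_tendsto[OF g] tendsto_unique trivial_limit_at_top_linorder by blast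
qed

section \<open>Convolution and weak derivatives\<close>

lemma loc_integrableD: "loc_integrable f \<Longrightarrow> set_integrable lborel {a..b} f"
  by (simp add: loc_integrable_def)

lemma loc_integrable_meas: "loc_integrable f \<Longrightarrow> f \<in> borel_measurable borel"
  by (rule loc_int_meas) (rule loc_integrableD)

lemma loc_integrable_cont: "continuous_on UNIV f \<Longrightarrow> loc_integrable f"
  unfolding loc_integrable_def
  by (meson borel_integrable_atLeastAtMost' continuous_on_subset subset_UNIV)

lemma prim_loc_integrable:
  assumes "prim f g" shows "loc_integrable g" "loc_integrable f"
proof -
  show "loc_integrable g" using primD(1)[OF assms] by (simp add: loc_integrable_def)
  show "loc_integrable f" by (rule loc_integrable_cont[OF prim_cont[OF assms]])
qed

lemma loc_integrable_L2: "L2 f \<Longrightarrow> loc_integrable f"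
  by (simp add: loc_integrable_def L2_set_integrable(1))

lemma loc_integrable_diff: "loc_integrable f \<Longrightarrow> loc_integrable g \<Longrightarrow> loc_integrable (\<lambda>x. f x - g x)"
  by (auto simp: loc_integrable_def)

lemma test_fun_shift:
  assumes "test_fun \<phi>"
  shows "test_fun (\<lambda>y. \<phi> (y - x))" "deriv (\<lambda>y. \<phi> (y - x)) = (\<lambda>y. deriv \<phi> (y - x))"
  using test_fun_affine[OF assms, of 1 1 "-x"] deriv_test_fun_affine[OF assms, of 1 1 "-x"] by simp_all

lemma test_mult_integrable:
  assumes "loc_integrable f" "test_fun \<phi>"
  shows "integrable lborel (\<lambda>y. f y * of_real (\<phi> y))"
proof -
  obtain R where R: "R > 0" "\<And>x. \<bar>x\<bar> > R \<Longrightarrow> \<phi> x = 0" using test_fun_supp[OF assms(2)] by blast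
  have "set_integrable lborel {-R..R} (\<lambda>y. of_real (\<phi> y) * f y)"
    by (rule set_integrable_cont_mult[OF _ loc_integrableD[OF assms(1)]])
       (intro continuous_intros test_fun_cont assms)
  moreover have "(\<lambda>x. indicator {-R..R} x *\<^sub>R (of_real (\<phi> x) * f x)) = (\<lambda>y. f y * of_real (\<phi> y))"
    using R(2) by (force simp: indicator_def mult.commute)
  ultimately show ?thesis by (simp add: set_integrable_def)
qed

lemma prim_test_fun: "test_fun \<phi> \<Longrightarrow> prim (\<lambda>x. complex_of_real (\<phi> x)) (\<lambda>x. of_real (deriv \<phi> x))"
  by (intro prim_C1 continuous_intros test_fun_cont test_fun_deriv has_vector_derivative_of_real)
     (simp add: has_real_derivative_iff_has_vector_derivative[symmetric] test_fun_has_deriv)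

lemma prim_weak_deriv:
  assumes "prim f g" shows "weak_deriv f g"
  unfolding weak_deriv_def
proof (intro conjI allI impI prim_loc_integrable[OF assms])
  fix \<phi> assume \<phi>: "test_fun \<phi>"
  note I = test_mult_integrable[OF prim_loc_integrable(2)[OF assms] \<phi>]
    test_mult_integrable[OF prim_loc_integrable(1)[OF assms] \<phi>]
    test_mult_integrable[OF prim_loc_integrable(2)[OF assms] test_fun_deriv[OF \<phi>]]
  have "(LINT x|lborel. g x * of_real (\<phi> x) + f x * of_real (deriv \<phi> x)) = 0"
    by (rule prim_integral_zero[OF prim_mult[OF assms prim_test_fun[OF \<phi>]]]) (use I in auto)
  then show "(LINT x|lborel. f x * of_real (deriv \<phi> x)) = - (LINT x|lborel. g x * of_real (\<phi> x))"
    using I by (simp add: add_eq_0_iff)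
qed

text \<open>The kernel is \<open>\<phi> (y - x)\<close>, not \<open>\<phi> (x - y)\<close>: the
  value at \<open>x\<close> is then the pairing with a translated test function, so weak identities
  apply verbatim, and each derivative in \<open>x\<close> moves onto the kernel with a minus
  sign.\<close>

definition conv :: "(real \<Rightarrow> complex) \<Rightarrow> (real \<Rightarrow> real) \<Rightarrow> real \<Rightarrow> complex" where
  "conv f \<phi> x = (LINT y|lborel. f y * of_real (\<phi> (y - x)))"

lemma conv_integrable:
  "loc_integrable f \<Longrightarrow> test_fun \<phi> \<Longrightarrow> integrable lborel (\<lambda>y. f y * of_real (\<phi> (y - x)))"
  by (rule test_mult_integrable) (simp_all add: test_fun_shift)

lemma weak_deriv_conv:
  assumes "weak_deriv f g" "test_fun \<phi>"
  shows "conv f (deriv \<phi>) x = - conv g \<phi> x"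
  using assms test_fun_shift[OF assms(2), of x] unfolding weak_deriv_def conv_def by metis

lemma conv_diff:
  "loc_integrable f \<Longrightarrow> loc_integrable g \<Longrightarrow> test_fun \<phi> \<Longrightarrow> conv (\<lambda>x. f x - g x) \<phi> x = conv f \<phi> x - conv g \<phi> x"
  unfolding conv_def by (simp add: left_diff_distrib conv_integrable)

lemma prod_integrable:
  fixes f g :: "real \<Rightarrow> real"
  assumes "integrable lborel f" "integrable lborel g"
  shows "integrable (lborel \<Otimes>\<^sub>M lborel) (\<lambda>(x,y). f x * g y)"
proof (rule lborel_pair.Fubini_integrable)
  show "(\<lambda>(x, y). f x * g y) \<in> borel_measurable (lborel \<Otimes>\<^sub>M lborel)"
    using assms by measurable
  show "integrable lborel (\<lambda>x. LINT y|lborel. norm (case (x, y) of (x, y) \<Rightarrow> f x * g y))"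
    using assms by (simp add: abs_mult)
  show "AE x in lborel. integrable lborel (\<lambda>y. case (x, y) of (x, y) \<Rightarrow> f x * g y)"
    using assms by simp
qed

text \<open>As \<open>f\<close> is only locally integrable, nothing is differentiated under the
  integral: the difference of two translated kernels is written as an integral of
  \<open>deriv \<phi>\<close>, and the order of integration is exchanged.\<close>

lemma prim_conv:
  assumes f: "loc_integrable f" and \<phi>: "test_fun \<phi>"
  shows "prim (conv f \<phi>) (\<lambda>x. - conv f (deriv \<phi>) x)"
proof -
  note \<phi>' = test_fun_deriv[OF \<phi>]
  obtain R where R: "R > 0" "\<And>x. \<bar>x\<bar> > R \<Longrightarrow> deriv \<phi> x = 0" using test_fun_supp[OF \<phi>'] by blast
  obtain C where C: "C > 0" "\<And>x. \<bar>deriv \<phi> x\<bar> \<le> C" using test_fun_bounded[OF \<phi>'] by blast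
  have m[measurable]: "f \<in> borel_measurable borel" "deriv \<phi> \<in> borel_measurable borel"
    using loc_integrable_meas[OF f] test_fun_meas[OF \<phi>'] by auto
  have main: "set_integrable lborel {a..b} (\<lambda>x. - conv f (deriv \<phi>) x) \<and>
     conv f \<phi> b - conv f \<phi> a = (LINT x:{a..b}|lborel. - conv f (deriv \<phi>) x)" if ab: "a \<le> b" for a b
  proof -
    define h where "h x y = complex_of_real (indicator {a..b} x) * (f y * of_real (deriv \<phi> (y - x)))" for x y
    have int: "integrable (lborel \<Otimes>\<^sub>M lborel) (\<lambda>(x,y). h x y)"
    proof (rule Bochner_Integration.integrable_bound)
      show "integrable (lborel \<Otimes>\<^sub>M lborel) (\<lambda>(x,y). (C * indicator {a..b} x) * (indicator {a-R..b+R} y * norm (f y)))"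
      proof (rule prod_integrable)
        show "integrable lborel (\<lambda>x. C * indicator {a..b} x)"
          by (auto intro!: integrable_real_indicator simp: emeasure_lborel_Icc_eq)
        show "integrable lborel (\<lambda>y. indicator {a-R..b+R} y * norm (f y))"
          using set_integrable_norm[OF loc_integrableD[OF f]] by (simp add: set_integrable_def)
      qed
      show "(\<lambda>(x,y). h x y) \<in> borel_measurable (lborel \<Otimes>\<^sub>M lborel)"
        unfolding h_def by measurable
      have "norm (h x y) \<le> (C * indicator {a..b} x) * (indicator {a-R..b+R} y * norm (f y))" for x y
      proof (cases "x \<in> {a..b} \<and> y \<in> {a-R..b+R}")
        case True
        then show ?thesis using C(2)[of "y - x"] mult_right_mono[OF C(2)[of "y-x"], of "norm (f y)"]
          by (simp add: h_def norm_mult mult.commute)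
      next
        case False
        then have "x \<notin> {a..b} \<or> \<bar>y - x\<bar> > R" unfolding atLeastAtMost_iff by linarith
        then have "h x y = 0" using R(2)[of "y - x"] by (auto simp: h_def)
        then show ?thesis using C by (simp add: indicator_def)
      qed
      then show "AE z in lborel \<Otimes>\<^sub>M lborel. norm (case z of (x,y) \<Rightarrow> h x y) \<le> norm (case z of (x,y) \<Rightarrow> (C * indicator {a..b} x) * (indicator {a-R..b+R} y * norm (f y)))"
        by (intro AE_I2) (fastforce split: prod.splits intro: order_trans[OF _ abs_ge_self])
    qed
    have X: "(LINT y|lborel. h x y) = indicator {a..b} x *\<^sub>R conv f (deriv \<phi>) x" for x
      unfolding h_def conv_def by (simp add: scaleR_conv_of_real)
    have Y: "(LINT x|lborel. h x y) = f y * of_real (\<phi> (y - a) - \<phi> (y - b))" for y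
    proof -
      have "(LINT x:{a..b}|lborel. - deriv \<phi> (y - x)) = \<phi> (y - b) - \<phi> (y - a)"
      proof -
        have "prim (\<lambda>x. \<phi> (y - x)) (\<lambda>x. - deriv \<phi> (y - x))"
        proof (rule prim_C1)
          show "((\<lambda>x. \<phi> (y - x)) has_vector_derivative - deriv \<phi> (y - x)) (at x)" for x
            unfolding has_real_derivative_iff_has_vector_derivative[symmetric]
            using test_fun_affine_deriv[OF \<phi>, of 1 "-1" y x] by simp
          show "continuous_on UNIV (\<lambda>x. - deriv \<phi> (y - x))"
            by (intro continuous_intros continuous_on_compose2[OF test_fun_cont[OF \<phi>', of UNIV]]) auto
        qed
        then show ?thesis using primD(2)[OF _ ab] by metis
      qed
      then have "(LINT x|lborel. indicator {a..b} x * deriv \<phi> (y - x)) = \<phi> (y - a) - \<phi> (y - b)"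
        by (simp add: set_lebesgue_integral_def)
      moreover have "(LINT x|lborel. h x y) = f y * of_real (LINT x|lborel. indicator {a..b} x * deriv \<phi> (y - x))"
        unfolding h_def
        by (simp add: mult.left_commute flip: integral_complex_of_real)
      ultimately show ?thesis by simp
    qed
    have "(LINT y|lborel. LINT x|lborel. h x y) = (LINT x|lborel. LINT y|lborel. h x y)"
      by (rule lborel_pair.Fubini_integral[OF int])
    then have "(LINT y|lborel. f y * of_real (\<phi> (y - a)) - f y * of_real (\<phi> (y - b)))
       = (LINT x:{a..b}|lborel. conv f (deriv \<phi>) x)"
      unfolding X Y by (simp add: set_lebesgue_integral_def right_diff_distrib)
    moreover have "(LINT y|lborel. f y * of_real (\<phi> (y - a)) - f y * of_real (\<phi> (y - b))) = conv f \<phi> a - conv f \<phi> b"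
      unfolding conv_def by (intro Bochner_Integration.integral_diff conv_integrable f \<phi>)
    moreover have si: "set_integrable lborel {a..b} (conv f (deriv \<phi>))"
      using lborel_pair.integrable_fst[OF int] unfolding X set_integrable_def by simp
    ultimately show ?thesis by (auto simp: set_integral_uminus set_integrable_def algebra_simps)
  qed
  show ?thesis unfolding prim_def
  proof (intro conjI allI impI)
    fix a b :: real
    show "set_integrable lborel {a..b} (\<lambda>x. - conv f (deriv \<phi>) x)"
      using main[of a b] by (cases "a \<le> b") (auto simp: set_integrable_def)
  qed (use main in auto)
qed

lemma conv_cont: "loc_integrable f \<Longrightarrow> test_fun \<phi> \<Longrightarrow> continuous_on A (conv f \<phi>)"
  by (rule prim_cont[OF prim_conv])

lemma prim_conv':
  assumes "prim f g" "test_fun \<phi>" shows "prim (conv f \<phi>) (conv g \<phi>)"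
  using prim_conv[OF prim_loc_integrable(2)[OF assms(1)] assms(2)]
    weak_deriv_conv[OF prim_weak_deriv[OF assms(1)] assms(2)] by simp

lemma conv_Young_aux:
  fixes f :: "real \<Rightarrow> real"
  assumes "integrable lborel f" "integrable lborel \<phi>"
  shows "integrable lborel (\<lambda>x. LINT y|lborel. f y * \<bar>\<phi> (y - x)\<bar>)"
    and "(LINT x|lborel. LINT y|lborel. f y * \<bar>\<phi> (y - x)\<bar>) = (LINT y|lborel. \<bar>\<phi> y\<bar>) * (LINT y|lborel. f y)"
    and "AE x in lborel. integrable lborel (\<lambda>y. f y * \<bar>\<phi> (y - x)\<bar>)"
proof -
  have m[measurable]: "f \<in> borel_measurable borel" "\<phi> \<in> borel_measurable borel"
    using assms borel_measurable_integrable by auto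
  have aff: "(LINT x|lborel. \<bar>\<phi> (y - x)\<bar>) = (LINT y|lborel. \<bar>\<phi> y\<bar>)" for y
    using lborel_integral_real_affine[of "-1" "\<lambda>z. \<bar>\<phi> z\<bar>" y] by simp
  have affi: "integrable lborel (\<lambda>x. \<bar>\<phi> (y - x)\<bar>)" for y
    using lborel_integrable_real_affine[OF integrable_abs[OF assms(2)], of "-1" y] by simp
  have int: "integrable (lborel \<Otimes>\<^sub>M lborel) (\<lambda>(y,x). f y * \<bar>\<phi> (y - x)\<bar>)"
  proof (rule lborel_pair.Fubini_integrable)
    show "(\<lambda>(y, x). f y * \<bar>\<phi> (y - x)\<bar>) \<in> borel_measurable (lborel \<Otimes>\<^sub>M lborel)" by measurable
    show "integrable lborel (\<lambda>y. LINT x|lborel. norm (case (y, x) of (y, x) \<Rightarrow> f y * \<bar>\<phi> (y - x)\<bar>))"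
      using assms(1) by (simp add: abs_mult aff)
    show "AE y in lborel. integrable lborel (\<lambda>x. case (y, x) of (y, x) \<Rightarrow> f y * \<bar>\<phi> (y - x)\<bar>)"
      using affi by simp
  qed
  show "integrable lborel (\<lambda>x. LINT y|lborel. f y * \<bar>\<phi> (y - x)\<bar>)"
    using lborel_pair.integrable_snd[OF int] by simp
  have "(LINT x|lborel. LINT y|lborel. f y * \<bar>\<phi> (y - x)\<bar>) = (LINT y|lborel. LINT x|lborel. f y * \<bar>\<phi> (y - x)\<bar>)"
    by (rule lborel_pair.Fubini_integral[OF int])
  then show "(LINT x|lborel. LINT y|lborel. f y * \<bar>\<phi> (y - x)\<bar>) = (LINT y|lborel. \<bar>\<phi> y\<bar>) * (LINT y|lborel. f y)"
    by (simp add: aff)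
  show "AE x in lborel. integrable lborel (\<lambda>y. f y * \<bar>\<phi> (y - x)\<bar>)"
    using lborel_pair.AE_integrable_snd[OF int] by simp
qed

text \<open>Young's inequality: with the kernel split into two square roots, Cauchy-Schwarz bounds
  the square at \<open>x\<close> by \<open>c * K x\<close>, where \<open>c\<close> is the integral
  of \<open>\<bar>\<phi>\<bar>\<close>, and \<open>K\<close> integrates to \<open>c\<close> times
  the squared norm of \<open>f\<close>.\<close>

lemma conv_L2:
  assumes f: "L2 f" and \<phi>: "test_fun \<phi>"
  shows "L2 (conv f \<phi>)" and "L2norm (conv f \<phi>) \<le> (LINT y|lborel. \<bar>\<phi> y\<bar>) * L2norm f"
proof -
  define c where "c = (LINT y|lborel. \<bar>\<phi> y\<bar>)"
  have c0: "c \<ge> 0" by (simp add: c_def)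
  define K where "K x = (LINT y|lborel. (norm (f y))^2 * \<bar>\<phi> (y - x)\<bar>)" for x
  have m[measurable]: "f \<in> borel_measurable borel" "\<phi> \<in> borel_measurable borel"
    using L2_meas[OF f] test_fun_meas[OF \<phi>] by auto
  have mc: "conv f \<phi> \<in> borel_measurable borel"
    by (intro borel_measurable_continuous_onI conv_cont loc_integrable_L2 f \<phi>)
  note A = conv_Young_aux[OF L2_int[OF f] test_fun_integrable[OF \<phi>]]
  have bd: "AE x in lborel. (norm (conv f \<phi> x))^2 \<le> c * K x"
    using A(3)
  proof eventually_elim
    fix x assume i: "integrable lborel (\<lambda>y. (norm (f y))\<^sup>2 * \<bar>\<phi> (y - x)\<bar>)"
    have i2: "integrable lborel (\<lambda>y. \<bar>\<phi> (y - x)\<bar>)"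
      using lborel_integrable_real_affine[OF integrable_abs[OF test_fun_integrable[OF \<phi>]], of "1" "-x"] by simp
    have a: "L2 (\<lambda>y. sqrt \<bar>\<phi> (y - x)\<bar>)" unfolding L2_def using i2 by simp
    have b: "L2 (\<lambda>y. sqrt \<bar>\<phi> (y - x)\<bar> *\<^sub>R f y)" unfolding L2_def using i
      by (simp add: power_mult_distrib mult.commute)
    have n1: "(L2norm (\<lambda>y. sqrt \<bar>\<phi> (y - x)\<bar>))^2 = c" unfolding L2norm_power2 c_def
      using lborel_integral_real_affine[of "1" "\<lambda>z. \<bar>\<phi> z\<bar>" "-x"] by simp
    have n2: "(L2norm (\<lambda>y. sqrt \<bar>\<phi> (y - x)\<bar> *\<^sub>R f y))^2 = K x" unfolding L2norm_power2 K_def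
      by (simp add: power_mult_distrib mult.commute)
    have "norm (conv f \<phi> x) \<le> (LINT y|lborel. norm (f y * of_real (\<phi> (y - x))))"
      unfolding conv_def by (rule integral_norm_bound)
    also have "\<dots> = (LINT y|lborel. norm (sqrt \<bar>\<phi> (y - x)\<bar>) * norm (sqrt \<bar>\<phi> (y - x)\<bar> *\<^sub>R f y))"
      by (intro Bochner_Integration.integral_cong refl) (simp add: norm_mult)
    also have "\<dots> \<le> L2norm (\<lambda>y. sqrt \<bar>\<phi> (y - x)\<bar>) * L2norm (\<lambda>y. sqrt \<bar>\<phi> (y - x)\<bar> *\<^sub>R f y)"
      by (rule L2_Cauchy_Schwarz[OF a b])
    finally have "(norm (conv f \<phi> x))^2 \<le> (L2norm (\<lambda>y. sqrt \<bar>\<phi> (y - x)\<bar>) * L2norm (\<lambda>y. sqrt \<bar>\<phi> (y - x)\<bar> *\<^sub>R f y))^2"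
      by (rule power_mono) simp
    then show "(norm (conv f \<phi> x))^2 \<le> c * K x" by (simp add: power_mult_distrib n1 n2)
  qed
  have iK: "integrable lborel (\<lambda>x. c * K x)" using A(1) by (simp add: K_def)
  have i: "integrable lborel (\<lambda>x. (norm (conv f \<phi> x))^2)"
    by (rule Bochner_Integration.integrable_bound[OF iK]) (use mc bd in \<open>auto elim!: eventually_mono\<close>)
  show "L2 (conv f \<phi>)" unfolding L2_def using i mc by simp
  have "(L2norm (conv f \<phi>))^2 \<le> (LINT x|lborel. c * K x)"
    unfolding L2norm_power2 by (rule integral_mono_AE[OF i iK bd])
  also have "\<dots> = c * (c * (L2norm f)^2)"
    using A(2) by (simp add: K_def c_def L2norm_power2)
  also have "\<dots> = (c * L2norm f)^2" by (simp add: power2_eq_square)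
  finally show "L2norm (conv f \<phi>) \<le> (LINT y|lborel. \<bar>\<phi> y\<bar>) * L2norm f"
    unfolding c_def[symmetric] by (rule power2_le_imp_le) (simp add: c0)
qed

section \<open>A one-sided mollifier and almost everywhere convergence\<close>

definition bump :: "real \<Rightarrow> real" where
  "bump = (SOME \<beta>. test_fun \<beta> \<and> (\<forall>x. 0 \<le> \<beta> x) \<and> (\<forall>x. x \<notin> {0<..<1} \<longrightarrow> \<beta> x = 0) \<and> (LINT x|lborel. \<beta> x) = 1)"

lemma bump: "test_fun bump" "0 \<le> bump x" "x \<notin> {0<..<1} \<Longrightarrow> bump x = 0" "(LINT x|lborel. bump x) = 1"
proof -
  have "\<exists>\<beta>. test_fun \<beta> \<and> (\<forall>x. 0 \<le> \<beta> x) \<and> (\<forall>x. x \<notin> {0<..<1} \<longrightarrow> \<beta> x = 0) \<and> (LINT x|lborel. \<beta> x) = 1"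
    using bump_exists by metis
  then have "test_fun bump \<and> (\<forall>x. 0 \<le> bump x) \<and> (\<forall>x. x \<notin> {0<..<1} \<longrightarrow> bump x = 0) \<and> (LINT x|lborel. bump x) = 1"
    unfolding bump_def by (rule someI_ex)
  then show "test_fun bump" "0 \<le> bump x" "x \<notin> {0<..<1} \<Longrightarrow> bump x = 0" "(LINT x|lborel. bump x) = 1" by auto
qed

text \<open>The support lies between 0 and \<open>e\<close>, so \<open>conv f (mol e) x\<close>
  averages \<open>f\<close> over \<open>{x..x+e}\<close> only, and right derivatives of primitives
  are enough for convergence. The \<open>+ 0\<close> matches the affine form of
  \<open>test_fun_affine\<close>.\<close>

definition mol :: "real \<Rightarrow> real \<Rightarrow> real" where
  "mol e z = (1/e) * bump ((1/e) * z + 0)"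

lemma mol_test: "e > 0 \<Longrightarrow> test_fun (mol e)"
  using test_fun_affine[OF bump(1), of "1/e" "1/e" 0] by (simp add: mol_def[abs_def])

lemma mol_nonneg: "e > 0 \<Longrightarrow> 0 \<le> mol e z"
  by (simp add: mol_def bump(2))

lemma mol_supp: "e > 0 \<Longrightarrow> z \<notin> {0<..<e} \<Longrightarrow> mol e z = 0"
  by (auto simp: mol_def field_simps intro!: bump(3))

lemma mol_integral: "e > 0 \<Longrightarrow> (LINT y|lborel. mol e (y - x)) = 1"
  using lborel_integral_real_affine[of "1/e" bump "-x/e"] bump(4)
  by (simp add: mol_def diff_divide_distrib)

lemma mol_abs_integral: "e > 0 \<Longrightarrow> (LINT y|lborel. \<bar>mol e y\<bar>) = 1"
  using mol_integral[of e 0] by (simp add: mol_nonneg)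

lemma deriv_test_zero:
  assumes "test_fun \<phi>" "\<And>z. z \<notin> {a<..<b} \<Longrightarrow> \<phi> z = 0" "z \<notin> {a..b}"
  shows "deriv \<phi> z = 0"
proof -
  have "((\<lambda>_. 0) has_field_derivative 0) (at z)" by simp
  then have "(\<phi> has_field_derivative 0) (at z)"
  proof (rule has_field_derivative_transform_within_open)
    show "open (- {a..b})" by (simp add: open_Compl)
  qed (use assms in auto)
  then show ?thesis by (rule DERIV_imp_deriv)
qed

text \<open>Scaling of a fixed bump. The pointwise bound serves the almost everywhere convergence;
  the integral bound is the price \<open>1/e\<close> of one derivative in Young's
  inequality.\<close>

lemma mol_deriv_bound:
  obtains C where "C > 0" "\<And>e z. e > 0 \<Longrightarrow> \<bar>deriv (mol e) z\<bar> \<le> C / e^2 * indicator {0..e} z"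
    "\<And>e. e > 0 \<Longrightarrow> (LINT y|lborel. \<bar>deriv (mol e) y\<bar>) \<le> C / e"
proof -
  obtain C where C: "C > 0" "\<And>x. \<bar>deriv bump x\<bar> \<le> C" using test_fun_bounded[OF test_fun_deriv[OF bump(1)]] by blast
  have b: "\<bar>deriv (mol e) z\<bar> \<le> C / e^2 * indicator {0..e} z" if e: "e > 0" for e z
  proof (cases "z \<in> {0..e}")
    case True
    have "deriv (mol e) z = (1/e) * (1/e) * deriv bump ((1/e)*z+0)"
      using deriv_test_fun_affine[OF bump(1), of "1/e" "1/e" 0] by (simp add: mol_def[abs_def])
    then have "\<bar>deriv (mol e) z\<bar> = (1/e) * (1/e) * \<bar>deriv bump ((1/e)*z+0)\<bar>"
      using e by (simp add: abs_mult)
    also have "\<dots> \<le> (1/e) * (1/e) * C" using C e by (intro mult_left_mono) auto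
    finally show ?thesis using True by (simp add: power2_eq_square)
  next
    case False
    then have "deriv (mol e) z = 0"
      by (intro deriv_test_zero[of _ 0 e] mol_test mol_supp e)
    then show ?thesis using C e by simp
  qed
  have "(LINT y|lborel. \<bar>deriv (mol e) y\<bar>) \<le> C / e" if e: "e > 0" for e
  proof -
    have "(LINT y|lborel. \<bar>deriv (mol e) y\<bar>) \<le> (LINT y|lborel. C / e^2 * indicator {0..e} y)"
    proof (rule integral_mono)
      show "integrable lborel (\<lambda>y. \<bar>deriv (mol e) y\<bar>)"
        by (intro integrable_abs test_fun_integrable test_fun_deriv mol_test e)
      show "integrable lborel (\<lambda>y. C / e^2 * indicator {0..e} y)"
        by (auto intro!: integrable_real_indicator simp: emeasure_lborel_Icc_eq)
    qed (rule b[OF e])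
    also have "\<dots> = C / e" using e by (simp add: power2_eq_square)
    finally show ?thesis .
  qed
  then show thesis using that C(1) b by blast
qed

text \<open>Lebesgue differentiation in terms of cubes with lower corner \<open>x\<close>, which on
  the line are the intervals \<open>{x..x+h}\<close>.\<close>

lemma prim_right_deriv_AE:
  assumes "prim F (f :: real \<Rightarrow> complex)"
  shows "AE x in lborel. \<forall>\<eta>>0. \<exists>d>0. \<forall>h. 0 < h \<and> h < d \<longrightarrow> norm (F (x+h) - F x - of_real h * f x) \<le> \<eta> * h"
proof -
  have si: "f integrable_on {a..b}" for a b
    by (rule set_borel_integral_eq_integral(1)[OF primD(1)[OF assms]])
  obtain N where N: "negligible N" "\<And>x e. \<lbrakk>x \<notin> N; 0 < e\<rbrakk> \<Longrightarrow>
     \<exists>d>0. \<forall>h. 0 < h \<and> h < d \<longrightarrow> norm (integral (cbox x (x + h *\<^sub>R One)) f /\<^sub>R h ^ DIM(real) - f x) < e"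
    by (rule integrable_ccontinuous_explicit[of f]) (use si in auto)
  have "N \<in> null_sets lebesgue" using N(1) by (simp add: negligible_iff_null_sets)
  then have "AE x in lebesgue. x \<notin> N" by (rule AE_not_in)
  then have "AE x in lborel. x \<notin> N" by (simp add: AE_completion_iff)
  then show ?thesis
  proof eventually_elim
    fix x assume x: "x \<notin> N"
    show "\<forall>\<eta>>0. \<exists>d>0. \<forall>h. 0 < h \<and> h < d \<longrightarrow> norm (F (x+h) - F x - of_real h * f x) \<le> \<eta> * h"
    proof (intro allI impI)
      fix \<eta> :: real assume "\<eta> > 0"
      then obtain d where d: "d > 0" and d': "\<forall>h. 0 < h \<and> h < d \<longrightarrow> norm (integral (cbox x (x + h *\<^sub>R One)) f /\<^sub>R h ^ DIM(real) - f x) < \<eta>"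
        using N(2)[OF x \<open>\<eta> > 0\<close>] by (elim exE conjE) (rule that)
      have "norm (F (x+h) - F x - of_real h * f x) \<le> \<eta> * h" if h: "0 < h" "h < d" for h
      proof -
        have "F (x+h) - F x = integral {x..x+h} f"
          using primD(2)[OF assms, of x "x+h"] h set_borel_integral_eq_integral(2)[OF primD(1)[OF assms], of x "x+h"] by simp
        then have "F (x+h) - F x - of_real h * f x = h *\<^sub>R (integral (cbox x (x + h *\<^sub>R One)) f /\<^sub>R h ^ DIM(real) - f x)"
          using h by (simp add: scaleR_conv_of_real right_diff_distrib mult.assoc[symmetric])
        also have "norm \<dots> = h * norm (integral (cbox x (x + h *\<^sub>R One)) f /\<^sub>R h ^ DIM(real) - f x)"
          using h by simp
        also have "\<dots> \<le> \<eta> * h" using d'[rule_format, of h] h by (simp add: mult.commute)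
        finally show ?thesis .
      qed
      then show "\<exists>d>0. \<forall>h. 0 < h \<and> h < d \<longrightarrow> norm (F (x+h) - F x - of_real h * f x) \<le> \<eta> * h"
        using d by blast
    qed
  qed
qed

text \<open>The derivative of the mollifier annihilates constants and returns minus the slope, so
  the tangent line of a primitive can be subtracted exactly.\<close>

lemma conv_of_affine:
  assumes e: "e > 0"
  shows "conv (\<lambda>y. c + of_real (y - x) * d) (deriv (mol e)) x = - d"
proof -
  have "prim (\<lambda>y. c + of_real (y - x) * d) (\<lambda>y. d)"
    by (rule prim_C1) (auto intro!: derivative_eq_intros simp: has_vector_derivative_def scaleR_conv_of_real)
  then have "conv (\<lambda>y. c + of_real (y - x) * d) (deriv (mol e)) x = - conv (\<lambda>y. d) (mol e) x"
    by (intro weak_deriv_conv prim_weak_deriv mol_test e)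
  also have "conv (\<lambda>y. d) (mol e) x = d * of_real (LINT y|lborel. mol e (y - x))"
    unfolding conv_def by simp
  finally show ?thesis using mol_integral[OF e] by simp
qed

text \<open>With \<open>F\<close> a primitive of \<open>f\<close>, \<open>conv f (mol e)\<close> is
  minus the convolution of \<open>F\<close> with \<open>deriv (mol e)\<close>. Where
  \<open>F\<close> has right derivative \<open>f x\<close>, removing the tangent line leaves at most
  \<open>\<eta> * e\<close> on an interval of length \<open>e\<close>, against a kernel of size
  \<open>C / e^2\<close>: in total at most \<open>\<eta> * C\<close>.\<close>

lemma conv_mol_AE_tendsto:
  assumes f: "loc_integrable f" and s: "\<And>n. s n > (0::real)" "s \<longlonglongrightarrow> 0"
  shows "AE x in lborel. (\<lambda>n. conv f (mol (s n)) x) \<longlonglongrightarrow> f x"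
proof -
  obtain F where F: "prim F f" using prim_integral_from[OF loc_integrableD[OF f]] by blast
  obtain C where C: "C > 0" "\<And>e z. e > 0 \<Longrightarrow> \<bar>deriv (mol e) z\<bar> \<le> C / e^2 * indicator {0..e} z"
    using mol_deriv_bound by metis
  show ?thesis using prim_right_deriv_AE[OF F]
  proof eventually_elim
    fix x assume x: "\<forall>\<eta>>0. \<exists>d>0. \<forall>h. 0 < h \<and> h < d \<longrightarrow> norm (F (x+h) - F x - of_real h * f x) \<le> \<eta> * h"
    show "(\<lambda>n. conv f (mol (s n)) x) \<longlonglongrightarrow> f x"
    proof (rule metric_LIMSEQ_I)
      fix r :: real assume r: "r > 0"
      define \<eta> where "\<eta> = r / (2 * C)"
      have \<eta>: "\<eta> > 0" using r C by (simp add: \<eta>_def)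
      obtain d where d: "d > 0" "\<And>h. 0 < h \<Longrightarrow> h < d \<Longrightarrow> norm (F (x+h) - F x - of_real h * f x) \<le> \<eta> * h"
        using x[rule_format, OF \<eta>] by (elim exE conjE) (rule that, auto)
      obtain N where N: "\<And>n. n \<ge> N \<Longrightarrow> s n < d"
        using s(2) d(1) s(1) unfolding LIMSEQ_def dist_real_def by (metis abs_of_pos diff_zero)
      have "dist (conv f (mol (s n)) x) (f x) < r" if n: "n \<ge> N" for n
      proof -
        define e where "e = s n"
        have e: "e > 0" "e < d" using s(1) N[OF n] by (auto simp: e_def)
        define G where "G y = F x + of_real (y - x) * f x" for y
        have lG: "loc_integrable G" unfolding G_def by (intro loc_integrable_cont continuous_intros)
        have lF: "loc_integrable F" by (rule prim_loc_integrable(2)[OF F])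
        note td = test_fun_deriv[OF mol_test[OF e(1)]]
        have "conv f (mol e) x = - conv F (deriv (mol e)) x"
          using weak_deriv_conv[OF prim_weak_deriv[OF F] mol_test[OF e(1)], of x] by simp
        moreover have "conv G (deriv (mol e)) x = - f x"
          unfolding G_def by (rule conv_of_affine[OF e(1)])
        ultimately have "conv f (mol e) x - f x = - conv (\<lambda>y. F y - G y) (deriv (mol e)) x"
          using conv_diff[OF lF lG td, of x] by simp
        then have "norm (conv f (mol e) x - f x) = norm (LINT y|lborel. (F y - G y) * of_real (deriv (mol e) (y - x)))"
          by (simp add: conv_def)
        also have "\<dots> \<le> (LINT y|lborel. \<eta> * C / e * indicator {x..x+e} y)"
        proof (rule Bochner_Integration.integral_norm_bound_integral)
          show "integrable lborel (\<lambda>y. (F y - G y) * of_real (deriv (mol e) (y - x)))"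
            by (rule conv_integrable[OF loc_integrable_diff[OF lF lG] td])
          show "integrable lborel (\<lambda>y. \<eta> * C / e * indicator {x..x+e} y)"
            by (auto intro!: integrable_real_indicator simp: emeasure_lborel_Icc_eq)
          fix y
          show "norm ((F y - G y) * of_real (deriv (mol e) (y - x))) \<le> \<eta> * C / e * indicator {x..x+e} y"
          proof (cases "y \<in> {x..x+e}")
            case True
            have 1: "norm (F y - G y) \<le> \<eta> * e"
            proof (cases "y = x")
              case True then show ?thesis using \<eta> e by (simp add: G_def)
            next
              case False
              then have "norm (F (x+(y-x)) - F x - of_real (y-x) * f x) \<le> \<eta> * (y-x)"
                by (intro d(2)) (use True e in auto)
              also have "\<dots> \<le> \<eta> * e" using True \<eta> by (intro mult_left_mono) auto
              finally show ?thesis by (simp add: G_def algebra_simps)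
            qed
            have 2: "\<bar>deriv (mol e) (y - x)\<bar> \<le> C / e^2" using C(2)[OF e(1), of "y-x"] True by (simp add: indicator_def)
            have "norm ((F y - G y) * of_real (deriv (mol e) (y - x))) \<le> (\<eta> * e) * (C / e^2)"
              unfolding norm_mult by (intro mult_mono 1) (use 2 \<eta> e in auto)
            also have "\<dots> = \<eta> * C / e" using e by (simp add: power2_eq_square)
            finally show ?thesis using True by simp
          next
            case False
            then have "deriv (mol e) (y - x) = 0" using C(2)[OF e(1), of "y-x"] by (auto simp: indicator_def)
            then show ?thesis using \<eta> C e by simp
          qed
        qed
        also have "\<dots> = \<eta> * C" using e by simp
        also have "\<dots> < r" using r C by (simp add: \<eta>_def)
        finally show ?thesis by (simp add: dist_norm e_def)
      qed
      then show "\<exists>N. \<forall>n\<ge>N. dist (conv f (mol (s n)) x) (f x) < r" by blast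
    qed
  qed
qed

lemma inverse_Suc_pos_tendsto: "\<And>n. inverse (real (Suc n)) > 0" "(\<lambda>n. inverse (real (Suc n))) \<longlonglongrightarrow> 0"
proof -
  show "inverse (real (Suc n)) > 0" for n by simp
  show "(\<lambda>n. inverse (real (Suc n))) \<longlonglongrightarrow> 0" by (rule LIMSEQ_inverse_real_of_nat)
qed

section \<open>Weak derivatives and continuous representatives\<close>

lemma AE_lborel_ex: "AE x in lborel. P (x::real) \<Longrightarrow> \<exists>x. P x"
proof (rule ccontr)
  assume "AE x in lborel. P x" "\<nexists>x. P x"
  then have "AE x in lborel. x \<notin> {0<..<(1::real)}" by auto
  then have "{0<..<(1::real)} \<in> null_sets lborel"
    by (subst (asm) AE_iff_null_sets[symmetric]) auto
  then show False by auto
qed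

text \<open>\<open>H\<close>, the difference of \<open>f\<close> and a primitive of
  \<open>g\<close>, has weak derivative zero, so every mollification of it is constant; hence so is
  the almost everywhere limit.\<close>

lemma du_Bois_Reymond:
  assumes "weak_deriv f g"
  obtains F where "prim F g" "AE x in lborel. f x = F x"
proof -
  have li: "loc_integrable f" "loc_integrable g" using assms by (auto simp: weak_deriv_def)
  obtain G where G: "prim G g" using prim_integral_from[OF loc_integrableD[OF li(2)]] by blast
  define H where "H x = f x - G x" for x
  have lG: "loc_integrable G" by (rule prim_loc_integrable(2)[OF G])
  have lH: "loc_integrable H" unfolding H_def by (rule loc_integrable_diff[OF li(1) lG])
  have const: "conv H (mol e) x = conv H (mol e) y" if e: "e > 0" for e x y
  proof -
    have z: "conv H (deriv (mol e)) x = 0" for x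
      unfolding H_def conv_diff[OF li(1) lG test_fun_deriv[OF mol_test[OF e]]]
      using weak_deriv_conv[OF assms mol_test[OF e]] weak_deriv_conv[OF prim_weak_deriv[OF G] mol_test[OF e]] by simp
    have p: "prim (conv H (mol e)) (\<lambda>x. 0)" using prim_conv[OF lH mol_test[OF e]] z by simp
    show ?thesis using primD(2)[OF p, of x y] primD(2)[OF p, of y x]
      by (cases "x \<le> y") (auto simp: set_lebesgue_integral_def)
  qed
  define s where "s n = inverse (real (Suc n))" for n
  have s: "s n > 0" "s \<longlonglongrightarrow> 0" for n using inverse_Suc_pos_tendsto by (auto simp: s_def[abs_def])
  have lim: "AE x in lborel. (\<lambda>n. conv H (mol (s n)) x) \<longlonglongrightarrow> H x"
    by (rule conv_mol_AE_tendsto[OF lH s])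
  then obtain x0 where x0: "(\<lambda>n. conv H (mol (s n)) x0) \<longlonglongrightarrow> H x0" using AE_lborel_ex by blast
  have "AE x in lborel. H x = H x0"
    using lim
  proof eventually_elim
    fix x assume "(\<lambda>n. conv H (mol (s n)) x) \<longlonglongrightarrow> H x"
    then have "(\<lambda>n. conv H (mol (s n)) x0) \<longlonglongrightarrow> H x" using const[OF s(1), of _ x x0] by simp
    then show "H x = H x0" using x0 LIMSEQ_unique by blast
  qed
  moreover have "prim (\<lambda>x. G x + H x0) g" using prim_add[OF G prim_const[of "H x0"]] by simp
  ultimately show thesis using that by (simp add: H_def algebra_simps)
qed

lemma weak_deriv_unique:
  assumes "weak_deriv f g" "weak_deriv f h"
  shows "AE x in lborel. g x = h x"
proof -
  have li: "loc_integrable g" "loc_integrable h" using assms by (auto simp: weak_deriv_def)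
  define s where "s n = inverse (real (Suc n))" for n
  have s: "s n > 0" "s \<longlonglongrightarrow> 0" for n using inverse_Suc_pos_tendsto by (auto simp: s_def[abs_def])
  have "conv g (mol (s n)) x = conv h (mol (s n)) x" for n x
    using weak_deriv_conv[OF assms(1) mol_test[OF s(1)], where x=x] weak_deriv_conv[OF assms(2) mol_test[OF s(1)], where x=x] by simp
  then show ?thesis
    using conv_mol_AE_tendsto[OF li(1) s] conv_mol_AE_tendsto[OF li(2) s]
    by (auto elim!: eventually_elim2 dest: LIMSEQ_unique)
qed

lemma wderiv_eq:
  assumes "weak_deriv f g"
  shows "weak_deriv f (wderiv f)" "AE x in lborel. wderiv f x = g x"
proof -
  show w: "weak_deriv f (wderiv f)" unfolding wderiv_def by (rule someI[of "weak_deriv f" g]) (fact assms)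
  show "AE x in lborel. wderiv f x = g x" by (rule weak_deriv_unique[OF w assms])
qed

lemma loc_integrable_cong_AE:
  assumes "loc_integrable f" "g \<in> borel_measurable borel" "AE x in lborel. f x = g x"
  shows "loc_integrable g"
  unfolding loc_integrable_def
proof (intro allI)
  fix a b
  note [measurable] = assms(2) loc_integrable_meas[OF assms(1)]
  show "set_integrable lborel {a..b} g"
    using loc_integrableD[OF assms(1), of a b] unfolding set_integrable_def
    by (rule integrable_cong_AE_imp) (use assms(3) in \<open>measurable; auto elim: eventually_mono\<close>)+
qed

lemma weak_deriv_cong_AE:
  assumes "weak_deriv f g" "f' \<in> borel_measurable borel" "AE x in lborel. f x = f' x"
    "g' \<in> borel_measurable borel" "AE x in lborel. g x = g' x"
  shows "weak_deriv f' g'"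
  unfolding weak_deriv_def
proof (intro conjI allI impI)
  have li: "loc_integrable f" "loc_integrable g" using assms by (auto simp: weak_deriv_def)
  note [measurable] = assms(2) assms(4) loc_integrable_meas[OF li(1)] loc_integrable_meas[OF li(2)]
  show "loc_integrable f'" "loc_integrable g'"
    by (rule loc_integrable_cong_AE[OF li(1) assms(2,3)], rule loc_integrable_cong_AE[OF li(2) assms(4,5)])
  fix \<phi> assume \<phi>: "test_fun \<phi>"
  note [measurable] = test_fun_meas[OF \<phi>] test_fun_meas[OF test_fun_deriv[OF \<phi>]]
  have "(LINT x|lborel. f' x * of_real (deriv \<phi> x)) = (LINT x|lborel. f x * of_real (deriv \<phi> x))"
    by (rule integral_cong_AE) (use assms(3) in \<open>measurable; auto elim: eventually_mono\<close>)+
  moreover have "(LINT x|lborel. g' x * of_real (\<phi> x)) = (LINT x|lborel. g x * of_real (\<phi> x))"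
    by (rule integral_cong_AE) (use assms(5) in \<open>measurable; auto elim: eventually_mono\<close>)+
  ultimately show "(LINT x|lborel. f' x * of_real (deriv \<phi> x)) = - (LINT x|lborel. g' x * of_real (\<phi> x))"
    using assms(1) \<phi> by (simp add: weak_deriv_def)
qed

text \<open>Fatou's lemma along the mollifications, which converge almost everywhere. The bounds
  \<open>a n\<close> may vary with \<open>n\<close>, the form needed to pass to the limit in the
  energy balance.\<close>

lemma L2norm_lsc:
  assumes f: "L2 f" and s: "\<And>n. s n > (0::real)" "s \<longlonglongrightarrow> 0"
    and b: "\<And>n. (L2norm (conv f (mol (s n))))^2 \<le> a n" "a \<longlonglongrightarrow> A"
  shows "(L2norm f)^2 \<le> A"
proof -
  have m[measurable]: "conv f (mol (s n)) \<in> borel_measurable borel" for n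
    by (intro borel_measurable_continuous_onI conv_cont loc_integrable_L2 f mol_test s(1))
  note [measurable] = L2_meas[OF f]
  have nn: "(\<integral>\<^sup>+x. ennreal ((norm (g x))^2) \<partial>lborel) = ennreal ((L2norm g)^2)" if "L2 g" for g :: "real \<Rightarrow> complex"
    unfolding L2norm_power2 by (rule nn_integral_eq_integral[OF L2_int[OF that]]) simp
  have A0: "A \<ge> 0"
    by (rule LIMSEQ_le_const[OF b(2)]) (use b(1) in \<open>meson order_trans zero_le_power2\<close>)
  have "ennreal ((L2norm f)^2) = (\<integral>\<^sup>+x. ennreal ((norm (f x))^2) \<partial>lborel)" using nn[OF f] by simp
  also have "\<dots> = (\<integral>\<^sup>+x. liminf (\<lambda>n. ennreal ((norm (conv f (mol (s n)) x))^2)) \<partial>lborel)"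
  proof (rule nn_integral_cong_AE)
    show "AE x in lborel. ennreal ((norm (f x))^2) = liminf (\<lambda>n. ennreal ((norm (conv f (mol (s n)) x))^2))"
      using conv_mol_AE_tendsto[OF loc_integrable_L2[OF f] s]
    proof eventually_elim
      fix x assume "(\<lambda>n. conv f (mol (s n)) x) \<longlonglongrightarrow> f x"
      then have "(\<lambda>n. ennreal ((norm (conv f (mol (s n)) x))^2)) \<longlonglongrightarrow> ennreal ((norm (f x))^2)"
        by (intro tendsto_intros) auto
      then show "ennreal ((norm (f x))^2) = liminf (\<lambda>n. ennreal ((norm (conv f (mol (s n)) x))^2))"
        using lim_imp_Liminf by (metis sequentially_bot)
    qed
  qed
  also have "\<dots> \<le> liminf (\<lambda>n. \<integral>\<^sup>+x. ennreal ((norm (conv f (mol (s n)) x))^2) \<partial>lborel)"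
    by (rule nn_integral_liminf) measurable
  also have "\<dots> \<le> liminf (\<lambda>n. ennreal (a n))"
    by (rule Liminf_mono) (simp add: nn[OF conv_L2(1)[OF f mol_test[OF s(1)]]] b(1) ennreal_leI)
  also have "\<dots> = ennreal A"
    using b(2) by (intro lim_imp_Liminf tendsto_ennrealI) auto
  finally show ?thesis using A0 by (simp add: ennreal_le_iff)
qed

section \<open>The nonlinearity\<close>

text \<open>Otherwise \<open>norm (f y)\<close> would exceed \<open>L2norm f\<close> on the whole
  unit interval to the right of \<open>x\<close>, since it drops there by at most \<open>K\<close>,
  and its square would integrate to too much.\<close>

lemma hoelder_L2_sup:
  fixes f :: "real \<Rightarrow> 'a::{real_normed_vector,second_countable_topology}"
  assumes "L2 f" "\<And>x y. norm (f x - f y) \<le> K * sqrt \<bar>x - y\<bar>" "K \<ge> 0"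
  shows "norm (f x) \<le> K + L2norm f"
proof (rule ccontr)
  assume a: "\<not> norm (f x) \<le> K + L2norm f"
  define c where "c = norm (f x) - K"
  have c: "c > L2norm f" using a by (simp add: c_def)
  have c0: "c > 0" using c L2norm_nonneg[of f] by linarith
  have b: "norm (f y) \<ge> c" if "y \<in> {x..x+1}" for y
  proof -
    have "norm (f x) \<le> norm (f y) + norm (f x - f y)" using norm_triangle_sub by blast
    also have "norm (f x - f y) \<le> K * sqrt \<bar>x - y\<bar>" by (rule assms(2))
    also have "\<dots> \<le> K * 1" using that assms(3) by (intro mult_left_mono) auto
    finally show ?thesis by (simp add: c_def)
  qed
  have "c^2 = (LINT y|lborel. c^2 * indicator {x..x+1} y)" by simp
  also have "\<dots> \<le> (LINT y|lborel. (norm (f y))^2)"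
  proof (rule integral_mono[OF _ L2_int[OF assms(1)]])
    show "integrable lborel (\<lambda>y. c\<^sup>2 * indicator {x..x + 1} y)"
      by (auto intro!: integrable_real_indicator simp: emeasure_lborel_Icc_eq)
    show "c\<^sup>2 * indicator {x..x + 1} y \<le> (norm (f y))\<^sup>2" for y
      using b[of y] c0 by (auto simp: indicator_def intro!: power_mono)
  qed
  also have "\<dots> = (L2norm f)^2" by (simp add: L2norm_power2)
  finally have "c \<le> L2norm f" by (rule power2_le_imp_le) simp
  then show False using c by simp
qed

lemma prim_L2_sup:
  assumes "prim f g" "L2 f" "L2 g"
  shows "norm (f x) \<le> L2norm g + L2norm f"
proof (rule hoelder_L2_sup[OF assms(2)])
  show "norm (f x - f y) \<le> L2norm g * sqrt \<bar>x - y\<bar>" for x y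
    using prim_hoelder[OF assms(1,3), where a=y and b=x] by (simp add: mult.commute)
qed simp

text \<open>The sign makes the equation read i v_t + v_xx + NL v = 0; \<open>NL\<close> is minus the
  gradient of the potential \<open>1/4 * (1 - (cmod z)^2)^2\<close> for the real inner product
  \<open>Re (cnj z * w)\<close>.\<close>

definition NL :: "complex \<Rightarrow> complex" where
  "NL z = of_real (1 - (cmod z)^2) * z"

lemma NL_diff:
  assumes "cmod a \<le> M" "cmod b \<le> M"
  shows "cmod (NL a - NL b) \<le> (1 + 3 * M^2) * cmod (a - b)"
proof -
  have M: "M \<ge> 0" using assms(1) norm_ge_zero order_trans by blast
  have e: "NL a - NL b = (a - b) - (of_real ((cmod a)^2) * (a - b) + of_real ((cmod a)^2 - (cmod b)^2) * b)"
    by (simp add: NL_def algebra_simps)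
  have d: "\<bar>(cmod a)^2 - (cmod b)^2\<bar> \<le> 2 * M * cmod (a - b)"
  proof -
    have "(cmod a)^2 - (cmod b)^2 = (cmod a - cmod b) * (cmod a + cmod b)"
      by (simp add: power2_eq_square algebra_simps)
    then have "\<bar>(cmod a)^2 - (cmod b)^2\<bar> = \<bar>cmod a - cmod b\<bar> * (cmod a + cmod b)"
      by (simp add: abs_mult)
    also have "\<dots> \<le> cmod (a - b) * (2 * M)"
      using assms by (intro mult_mono norm_triangle_ineq3) auto
    finally show ?thesis by (simp add: mult.commute)
  qed
  have "cmod (NL a - NL b) \<le> cmod (a - b) + (cmod (of_real ((cmod a)^2) * (a - b)) + cmod (of_real ((cmod a)^2 - (cmod b)^2) * b))"
    unfolding e by (meson add_left_mono norm_triangle_ineq norm_triangle_ineq4 order_trans)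
  also have "cmod (of_real ((cmod a)^2) * (a - b)) \<le> M^2 * cmod (a - b)"
    unfolding norm_mult using assms(1) by (intro mult_right_mono) (auto intro: power_mono simp: norm_power)
  also have "cmod (of_real ((cmod a)^2 - (cmod b)^2) * b) \<le> (2 * M * cmod (a - b)) * M"
    unfolding norm_mult norm_of_real by (intro mult_mono d assms) (use M in auto)
  finally show ?thesis by (simp add: algebra_simps power2_eq_square)
qed

text \<open>The nonlinearity is a cubic polynomial in \<open>z\<close> and \<open>cnj z\<close>, so
  the remainder is explicit. The bound \<open>2 * M\<close> is that for a difference of two values
  of modulus at most \<open>M\<close>; the constant is \<open>3 * M + 2 * M\<close>.\<close>

lemma NL_taylor:
  assumes "cmod a \<le> M" "cmod z \<le> 2 * M"
  shows "cmod (NL (a + z) - NL a - (of_real (1 - 2 * (cmod a)^2) * z - a^2 * cnj z)) \<le> 5 * M * (cmod z)^2"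
proof -
  have M: "M \<ge> 0" using assms(1) norm_ge_zero order_trans by blast
  have n: "of_real ((cmod w)^2) = w * cnj w" for w by (metis complex_norm_square of_real_power)
  have e: "NL (a + z) - NL a - (of_real (1 - 2 * (cmod a)^2) * z - a^2 * cnj z)
      = - (cnj a * z^2 + 2 * a * (z * cnj z) + z * (z * cnj z))"
    unfolding NL_def of_real_diff of_real_mult n by (simp add: algebra_simps power2_eq_square)
  have "cmod \<dots> \<le> cmod (cnj a * z^2) + cmod (2 * a * (z * cnj z)) + cmod (z * (z * cnj z))"
    unfolding norm_minus_cancel by (meson add_right_mono norm_triangle_ineq order_trans)
  also have "\<dots> = 3 * (cmod a * (cmod z)^2) + cmod z * (cmod z)^2"
    by (simp add: norm_mult norm_power power2_eq_square)
  also have "\<dots> \<le> 3 * (M * (cmod z)^2) + (2 * M) * (cmod z)^2"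
    by (intro add_mono mult_left_mono mult_right_mono assms) auto
  finally show ?thesis unfolding e by simp
qed

lemma prim_cnj: "prim f g \<Longrightarrow> prim (\<lambda>x. cnj (f x)) (\<lambda>x. cnj (g x))"
  by (rule prim_linear[OF bounded_linear_cnj])

lemma L2_cnj:
  fixes f :: "real \<Rightarrow> complex" assumes "L2 f"
  shows "L2 (\<lambda>x. cnj (f x))" "L2norm (\<lambda>x. cnj (f x)) = L2norm f"
proof -
  have "(\<lambda>x. cnj (f x)) \<in> borel_measurable borel"
    by (rule measurable_compose[OF L2_meas[OF assms] borel_measurable_continuous_onI]) (intro continuous_intros)
  then show "L2 (\<lambda>x. cnj (f x))" using assms by (simp add: L2_def)
  show "L2norm (\<lambda>x. cnj (f x)) = L2norm f" by (simp add: L2norm_def)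
qed

text \<open>The part of the squared norm seen by the mollifier at \<open>x\<close>. Pointwise it is
  no better than the full squared norm, but its integral over \<open>x\<close> carries a factor
  \<open>e\<close>, the source of the gains below.\<close>

definition locsq :: "(real \<Rightarrow> complex) \<Rightarrow> real \<Rightarrow> real \<Rightarrow> real" where
  "locsq g e x = (LINT y:{x..x+e}|lborel. (cmod (g y))^2)"

lemma locsq:
  assumes "L2 g" "e > 0"
  shows "integrable lborel (locsq g e)" "(LINT x|lborel. locsq g e x) = e * (L2norm g)^2"
    "0 \<le> locsq g e x" "locsq g e x \<le> (L2norm g)^2"
proof -
  have ii: "integrable lborel (indicator {0..e} :: real \<Rightarrow> real)"
    by (auto intro!: integrable_real_indicator simp: emeasure_lborel_Icc_eq)
  have eq: "locsq g e x = (LINT y|lborel. (cmod (g y))^2 * \<bar>indicator {0..e} (y - x)\<bar>)" for x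
    unfolding locsq_def set_lebesgue_integral_def
    by (intro Bochner_Integration.integral_cong) (auto simp: indicator_def)
  show "integrable lborel (locsq g e)" "(LINT x|lborel. locsq g e x) = e * (L2norm g)^2"
    using conv_Young_aux(1,2)[OF L2_int[OF assms(1)] ii] assms(2) by (auto simp: eq[abs_def] L2norm_power2)
  show "0 \<le> locsq g e x" by (simp add: locsq_def set_lebesgue_integral_def)
  show "locsq g e x \<le> (L2norm g)^2" unfolding locsq_def L2norm_power2
    by (rule set_integral_le_integral[OF L2_int[OF assms(1)]]) auto
qed

text \<open>The value \<open>f y\<close> and the values averaged by \<open>conv\<close> all belong
  to the window \<open>{x..x+e}\<close>, where Cauchy-Schwarz bounds every oscillation of
  \<open>f\<close> by \<open>sqrt (e * locsq g e x)\<close>.\<close>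

lemma conv_osc:
  assumes p: "prim f g" and g: "L2 g" and e: "e > 0" and y: "y \<in> {x..x+e}"
  shows "(cmod (f y - conv f (mol e) x))^2 \<le> e * locsq g e x"
proof -
  have d: "cmod (f a - f b) \<le> sqrt (e * locsq g e x)" if "a \<in> {x..x+e}" "b \<in> {x..x+e}" for a b
  proof -
    have *: "(cmod (f b - f a))^2 \<le> e * locsq g e x" if ab: "a \<le> b" "x \<le> a" "b \<le> x + e" for a b
    proof -
      have "(cmod (f b - f a))^2 \<le> (b - a) * (LINT z:{a..b}|lborel. (cmod (g z))^2)"
        by (rule prim_hoelder_local[OF p g ab(1)])
      also have "\<dots> \<le> e * locsq g e x"
      proof (rule mult_mono)
        show "(LINT z:{a..b}|lborel. (cmod (g z))^2) \<le> locsq g e x"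
          unfolding locsq_def set_lebesgue_integral_def
        proof (rule integral_mono)
          show "integrable lborel (\<lambda>z. indicator {a..b} z *\<^sub>R (cmod (g z))\<^sup>2)"
            "integrable lborel (\<lambda>z. indicator {x..x+e} z *\<^sub>R (cmod (g z))\<^sup>2)"
            by (intro integrable_mult_indicator L2_int g; simp)+
        qed (use ab in \<open>auto simp: indicator_def\<close>)
      qed (use ab e in \<open>auto simp: set_lebesgue_integral_def\<close>)
      finally show ?thesis .
    qed
    have "(cmod (f a - f b))^2 \<le> e * locsq g e x"
      using *[of a b] *[of b a] that by (cases "a \<le> b") (auto simp: norm_minus_commute)
    then show ?thesis by (rule real_le_rsqrt)
  qed
  have lf: "loc_integrable f" by (rule prim_loc_integrable(2)[OF p])
  have im: "integrable lborel (\<lambda>z. mol e (z - x))"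
    using test_fun_integrable[OF test_fun_shift(1)[OF mol_test[OF e]]] .
  have i1: "integrable lborel (\<lambda>z. f y * of_real (mol e (z - x)))"
    using im by simp
  note i2 = conv_integrable[OF lf mol_test[OF e], of x]
  have "f y - conv f (mol e) x = (LINT z|lborel. f y * of_real (mol e (z - x))) - conv f (mol e) x"
    using mol_integral[OF e, of x] by simp
  also have "\<dots> = (LINT z|lborel. (f y - f z) * of_real (mol e (z - x)))"
    unfolding conv_def left_diff_distrib by (rule Bochner_Integration.integral_diff[symmetric, OF i1 i2])
  also have "cmod \<dots> \<le> (LINT z|lborel. sqrt (e * locsq g e x) * mol e (z - x))"
  proof (rule Bochner_Integration.integral_norm_bound_integral)
    show "integrable lborel (\<lambda>z. (f y - f z) * of_real (mol e (z - x)))"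
      unfolding left_diff_distrib using i1 i2 by simp
    show "integrable lborel (\<lambda>z. sqrt (e * locsq g e x) * mol e (z - x))" using im by simp
    fix z
    show "cmod ((f y - f z) * of_real (mol e (z - x))) \<le> sqrt (e * locsq g e x) * mol e (z - x)"
    proof (cases "z \<in> {x..x+e}")
      case True
      then show ?thesis using d[OF y True] mol_nonneg[OF e, of "z-x"] by (simp add: norm_mult mult_right_mono)
    next
      case False
      then have "mol e (z - x) = 0" by (intro mol_supp[OF e]) auto
      then show ?thesis by simp
    qed
  qed
  also have "\<dots> = sqrt (e * locsq g e x)" using mol_integral[OF e, of x] by simp
  finally have "(cmod (f y - conv f (mol e) x))^2 \<le> (sqrt (e * locsq g e x))^2" by (intro power_mono) auto
  then show ?thesis using locsq(3)[OF g e, of x] e by simp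
qed

lemma conv_approx:
  assumes p: "prim f g" and g: "L2 g" and e: "e > 0"
  shows "L2 (\<lambda>x. f x - conv f (mol e) x)" "L2norm (\<lambda>x. f x - conv f (mol e) x) \<le> e * L2norm g"
proof -
  have b: "(cmod (f x - conv f (mol e) x))^2 \<le> e * locsq g e x" for x
    by (rule conv_osc[OF p g e]) (use e in auto)
  have m: "(\<lambda>x. f x - conv f (mol e) x) \<in> borel_measurable borel"
    by (intro borel_measurable_continuous_onI continuous_intros prim_cont[OF p] conv_cont mol_test e prim_loc_integrable(2)[OF p])
  have i: "integrable lborel (\<lambda>x. (cmod (f x - conv f (mol e) x))^2)"
  proof (rule Bochner_Integration.integrable_bound)
    show "integrable lborel (\<lambda>x. e * locsq g e x)" using locsq(1)[OF g e] by simp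
  qed (use m b in \<open>auto intro: order_trans[OF _ abs_ge_self]\<close>)
  show "L2 (\<lambda>x. f x - conv f (mol e) x)" using m i by (simp add: L2_def)
  have "(L2norm (\<lambda>x. f x - conv f (mol e) x))^2 \<le> (LINT x|lborel. e * locsq g e x)"
    unfolding L2norm_power2 by (rule integral_mono[OF i]) (use locsq(1)[OF g e] b in auto)
  also have "\<dots> = (e * L2norm g)^2" using locsq(2)[OF g e] by (simp add: power_mult_distrib power2_eq_square)
  finally show "L2norm (\<lambda>x. f x - conv f (mol e) x) \<le> e * L2norm g"
    by (rule power2_le_imp_le) (use e in auto)
qed

lemma conv_sup_bound:
  assumes f: "loc_integrable f" "\<And>x. cmod (f x) \<le> M" and e: "e > 0"
  shows "cmod (conv f (mol e) x) \<le> M"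
proof -
  have im: "integrable lborel (\<lambda>z. mol e (z - x))"
    using test_fun_integrable[OF test_fun_shift(1)[OF mol_test[OF e]]] .
  have "cmod (conv f (mol e) x) \<le> (LINT z|lborel. M * mol e (z - x))"
    unfolding conv_def
    by (rule Bochner_Integration.integral_norm_bound_integral[OF conv_integrable[OF f(1) mol_test[OF e]]])
       (use im f(2) mol_nonneg[OF e] in \<open>auto simp: norm_mult mult_right_mono\<close>)
  then show ?thesis using mol_integral[OF e, of x] by simp
qed

text \<open>The kernel has mean one and \<^term>\<open>f y - conv f (mol e) x\<close> has mean zero against it, so
  only the quadratic Taylor remainder of the nonlinearity survives.\<close>

lemma NL_commutator:
  assumes p: "prim f g" and g: "L2 g" "L2norm g \<le> M" and f: "\<And>x. cmod (f x) \<le> M" and e: "e > 0"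
  defines "R \<equiv> (\<lambda>x. conv (\<lambda>y. NL (f y)) (mol e) x - NL (conv f (mol e) x))"
  shows "L2 R" "L2norm R \<le> 5 * M^3 * (e * sqrt e)"
proof -
  have M: "M \<ge> 0" using f[of 0] norm_ge_zero order_trans by blast
  have cf: "continuous_on UNIV f" by (rule prim_cont[OF p])
  have lf: "loc_integrable f" by (rule prim_loc_integrable(2)[OF p])
  have lN: "loc_integrable (\<lambda>y. NL (f y))"
    unfolding NL_def by (intro loc_integrable_cont continuous_intros cf)
  define u where "u = conv f (mol e)"
  have cu: "continuous_on UNIV u" unfolding u_def by (rule conv_cont[OF lf mol_test[OF e]])
  have um: "cmod (u x) \<le> M" for x unfolding u_def by (rule conv_sup_bound[OF lf f e])
  have m: "R \<in> borel_measurable borel" unfolding R_def NL_def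
    by (intro borel_measurable_continuous_onI continuous_intros conv_cont mol_test e lf lN[unfolded NL_def])
  have b: "cmod (R x) \<le> 5 * M * (e * locsq g e x)" for x
  proof -
    have im: "integrable lborel (\<lambda>z. mol e (z - x))"
      using test_fun_integrable[OF test_fun_shift(1)[OF mol_test[OF e]]] .
    \<comment> \<open>Linearization of \<open>NL\<close> at the local mean; it is only real-linear,
      hence separate coefficients for \<open>z\<close> and \<open>cnj z\<close>.\<close>
    define al be where "al = complex_of_real (1 - 2 * (cmod (u x))^2)" and "be = (u x)^2"
    define h where "h y = NL (f y) - NL (u x) - (al * (f y - u x) - be * cnj (f y - u x))" for y
    have ic: "integrable lborel (\<lambda>y. c * of_real (mol e (y - x)))" for c :: complex using im by simp
    note i1 = conv_integrable[OF lN mol_test[OF e], of x]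
    note i2 = conv_integrable[OF lf mol_test[OF e], of x]
    have i3: "integrable lborel (\<lambda>y. cnj (f y) * of_real (mol e (y - x)))"
      using integrable_bounded_linear[OF bounded_linear_cnj i2] by simp
    have z2: "(LINT y|lborel. f y * of_real (mol e (y - x))) = u x" by (simp add: u_def conv_def)
    have z3: "(LINT y|lborel. cnj (f y) * of_real (mol e (y - x))) = cnj (u x)"
      using integral_bounded_linear[OF bounded_linear_cnj i2] z2 by simp
    have zc: "(LINT y|lborel. c * of_real (mol e (y - x))) = c" for c :: complex
      using mol_integral[OF e, of x] by simp
    have he: "h y * of_real (mol e (y - x)) = NL (f y) * of_real (mol e (y - x)) - al * (f y * of_real (mol e (y - x)))
        + be * (cnj (f y) * of_real (mol e (y - x))) + (al * u x - be * cnj (u x) - NL (u x)) * of_real (mol e (y - x))" for y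
      by (simp add: h_def algebra_simps)
    have ih: "integrable lborel (\<lambda>y. h y * of_real (mol e (y - x)))"
      unfolding he using i1 i2 i3 im by simp
    have "(LINT y|lborel. h y * of_real (mol e (y - x))) = conv (\<lambda>y. NL (f y)) (mol e) x - al * u x + be * cnj (u x) + (al * u x - be * cnj (u x) - NL (u x))"
      unfolding he using i1 i2 i3 ic im by (simp add: z2 z3 zc mol_integral[OF e] conv_def)
    then have "R x = (LINT y|lborel. h y * of_real (mol e (y - x)))"
      by (simp add: R_def u_def)
    also have "cmod \<dots> \<le> (LINT y|lborel. (5 * M * (e * locsq g e x)) * mol e (y - x))"
    proof (rule Bochner_Integration.integral_norm_bound_integral[OF ih])
      show "integrable lborel (\<lambda>y. (5 * M * (e * locsq g e x)) * mol e (y - x))" using im by simp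
      fix y
      show "cmod (h y * of_real (mol e (y - x))) \<le> (5 * M * (e * locsq g e x)) * mol e (y - x)"
      proof (cases "y \<in> {x..x+e}")
        case True
        have "cmod (f y - u x) \<le> cmod (f y) + cmod (u x)" by (rule norm_triangle_ineq4)
        also have "\<dots> \<le> 2 * M" using f[of y] um[of x] by simp
        finally have "cmod (h y) \<le> 5 * M * (cmod (f y - u x))^2"
          using NL_taylor[OF um[of x], of "f y - u x"] by (simp add: h_def al_def be_def)
        also have "\<dots> \<le> 5 * M * (e * locsq g e x)"
          using conv_osc[OF p g(1) e True] M unfolding u_def by (intro mult_left_mono) auto
        finally show ?thesis using mol_nonneg[OF e, of "y-x"] by (simp add: norm_mult mult_right_mono)
      next
        case False
        then have "mol e (y - x) = 0" by (intro mol_supp[OF e]) auto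
        then show ?thesis by simp
      qed
    qed
    also have "\<dots> = 5 * M * (e * locsq g e x)" using mol_integral[OF e, of x] by simp
    finally show ?thesis .
  qed
  \<comment> \<open>Of the two factors \<open>locsq\<close> one is bounded by \<open>M^2\<close> and
    the other kept for integration, which yields one more \<open>e\<close>: the squared norm is of
    order \<open>e^3\<close>.\<close>
  have b2: "(cmod (R x))^2 \<le> 25 * M^4 * e^2 * locsq g e x" for x
  proof -
    have l: "locsq g e x \<le> M^2" using locsq(4)[OF g(1) e, of x] power_mono[OF g(2), of 2] by simp
    have "(cmod (R x))^2 \<le> (5 * M * (e * locsq g e x))^2" by (intro power_mono b) auto
    also have "\<dots> = 25 * M^2 * e^2 * (locsq g e x * locsq g e x)" by (simp add: power2_eq_square)
    also have "\<dots> \<le> 25 * M^2 * e^2 * (M^2 * locsq g e x)"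
      by (intro mult_left_mono mult_right_mono l locsq(3)[OF g(1) e]) auto
    finally show ?thesis by (simp add: power2_eq_square power4_eq_xxxx mult_ac)
  qed
  have iS: "integrable lborel (\<lambda>x. 25 * M^4 * e^2 * locsq g e x)" using locsq(1)[OF g(1) e] by simp
  have i: "integrable lborel (\<lambda>x. (cmod (R x))^2)"
    by (rule Bochner_Integration.integrable_bound[OF iS]) (use m b2 in \<open>auto intro: order_trans[OF _ abs_ge_self]\<close>)
  show "L2 R" using m i by (simp add: L2_def)
  have "(L2norm R)^2 \<le> (LINT x|lborel. 25 * M^4 * e^2 * locsq g e x)"
    unfolding L2norm_power2 by (rule integral_mono[OF i iS b2])
  also have "\<dots> = 25 * M^4 * e^3 * (L2norm g)^2" using locsq(2)[OF g(1) e] by (simp add: power2_eq_square power3_eq_cube)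
  also have "\<dots> \<le> 25 * M^4 * e^3 * M^2"
    using M e g(2) by (intro mult_left_mono power_mono) auto
  also have "\<dots> = (5 * M^3 * (e * sqrt e))^2"
    using e by (simp add: power_mult_distrib power2_eq_square power3_eq_cube power4_eq_xxxx mult_ac)
  finally show "L2norm R \<le> 5 * M^3 * (e * sqrt e)"
    by (rule power2_le_imp_le) (use M e in auto)
qed

lemma conv_L2_sup:
  assumes "L2 f" "test_fun \<phi>"
  shows "cmod (conv f \<phi> x) \<le> L2norm f * L2norm \<phi>"
proof -
  define \<psi> where "\<psi> y = complex_of_real (\<phi> (y - x))" for y
  have i: "integrable lborel (\<lambda>y. (\<phi> y)^2)"
  proof -
    have "integrable lborel (\<lambda>y. complex_of_real (\<phi> y) * of_real (\<phi> y))"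
      by (intro test_mult_integrable assms(2) loc_integrable_cont continuous_intros test_fun_cont)
    then have "integrable lborel (\<lambda>y. Re (complex_of_real (\<phi> y) * of_real (\<phi> y)))"
      by (rule integrable_bounded_linear[OF bounded_linear_Re])
    then show ?thesis by (simp add: power2_eq_square)
  qed
  have i': "integrable lborel (\<lambda>y. (\<phi> (y - x))^2)"
    using lborel_integrable_real_affine[OF i, of 1 "-x"] by simp
  have [measurable]: "\<phi> \<in> borel_measurable borel" by (rule test_fun_meas[OF assms(2)])
  have L: "L2 \<psi>" unfolding L2_def \<psi>_def using i' by simp
  have n: "L2norm \<psi> = L2norm \<phi>" unfolding L2norm_def \<psi>_def
    using lborel_integral_real_affine[of 1 "\<lambda>y. (\<phi> y)^2" "-x"] by simp
  show ?thesis using L2_prod_integral_le[OF assms(1) L] by (simp add: conv_def \<psi>_def[symmetric] n)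
qed

text \<open>Continuity in \<open>x\<close> at each fixed time suffices because the dependence on
  time is continuous uniformly in \<open>x\<close>.\<close>

lemma continuous_on_joint:
  fixes f :: "real \<Rightarrow> real \<Rightarrow> 'a::real_normed_vector"
  assumes "\<And>s. continuous_on UNIV (f s)"
    and "\<And>s t x. norm (f s x - f t x) \<le> b s t" "\<And>t. ((\<lambda>s. b s t) \<longlongrightarrow> 0) (at t)"
  shows "continuous_on UNIV (\<lambda>p. f (fst p) (snd p))"
  unfolding continuous_on_iff
proof (intro ballI allI impI)
  fix p :: "real \<times> real" and r :: real assume r: "0 < r"
  obtain t y where p: "p = (t, y)" by fastforce
  have "\<forall>\<^sub>F s in at t. dist (b s t) 0 < r/2" using assms(3)[of t] r by (intro tendstoD) auto
  then obtain d1 where d1: "d1 > 0" "\<And>s. s \<noteq> t \<Longrightarrow> dist s t < d1 \<Longrightarrow> dist (b s t) 0 < r/2"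
    unfolding eventually_at by blast
  obtain d2 where d2: "d2 > 0" "\<And>x. dist x y < d2 \<Longrightarrow> dist (f t x) (f t y) < r/2"
    using assms(1)[of t, unfolded continuous_on_iff, rule_format, of y "r/2"] r by auto
  show "\<exists>d>0. \<forall>p'\<in>UNIV. dist p' p < d \<longrightarrow> dist (f (fst p') (snd p')) (f (fst p) (snd p)) < r"
  proof (intro exI[of _ "min d1 d2"] conjI ballI impI)
    show "0 < min d1 d2" using d1 d2 by simp
    fix p' :: "real \<times> real" assume a: "dist p' p < min d1 d2"
    obtain s x where p': "p' = (s, x)" by fastforce
    have s: "dist s t < d1" and x: "dist x y < d2"
      using a dist_fst_le[of p' p] dist_snd_le[of p' p] by (auto simp: p p')
    have "dist (f s x) (f t x) < r/2"
    proof (cases "s = t")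
      case True then show ?thesis using r by simp
    next
      case False
      then show ?thesis using d1(2)[OF False s] assms(2)[where s=s and t=t and x=x] by (simp add: dist_norm)
    qed
    then have "dist (f s x) (f t y) < r/2 + r/2"
      using d2(2)[OF x] dist_triangle[of "f s x" "f t y" "f t x"] by linarith
    then show "dist (f (fst p') (snd p')) (f (fst p) (snd p)) < r" by (simp add: p p')
  qed
qed

text \<open>The fundamental theorem is applied in time for each fixed \<open>x\<close> and then
  integrated over \<open>x\<close> by Fubini, so no derivative is taken under the integral.
  \<open>K\<close> provides integrability on the space-time strip; \<open>B\<close> carries the
  estimate, and may be far smaller than \<open>K\<close> thanks to cancellation.\<close>

lemma time_integral_bound:
  fixes q dq :: "real \<Rightarrow> real \<Rightarrow> real"
  assumes t: "t1 \<le> t2"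
    and der: "\<And>s x. ((\<lambda>s. q s x) has_real_derivative dq s x) (at s)"
    and cont: "continuous_on UNIV (\<lambda>p. dq (fst p) (snd p))"
    and int: "\<And>s. s \<in> {t1..t2} \<Longrightarrow> integrable lborel (dq s)"
    and K: "\<And>s. s \<in> {t1..t2} \<Longrightarrow> (LINT x|lborel. \<bar>dq s x\<bar>) \<le> K"
    and B: "\<And>s. s \<in> {t1..t2} \<Longrightarrow> \<bar>LINT x|lborel. dq s x\<bar> \<le> B"
    and q: "integrable lborel (q t1)" "integrable lborel (q t2)"
  shows "\<bar>(LINT x|lborel. q t2 x) - (LINT x|lborel. q t1 x)\<bar> \<le> B * (t2 - t1)"
proof -
  define h where "h s x = indicator {t1..t2} s * dq s x" for s x
  have m0: "(\<lambda>p. dq (fst p) (snd p)) \<in> borel_measurable (borel \<Otimes>\<^sub>M borel)"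
    unfolding borel_prod by (rule borel_measurable_continuous_onI[OF cont])
  have m: "(\<lambda>(s,x). h s x) \<in> borel_measurable (lborel \<Otimes>\<^sub>M lborel)"
  proof -
    have "(\<lambda>p. indicator {t1..t2} (fst p) * dq (fst p) (snd p)) \<in> borel_measurable (borel \<Otimes>\<^sub>M borel)"
      using m0 by measurable
    then show ?thesis by (simp add: h_def split_def cong: measurable_cong_sets)
  qed
  have mabs: "(\<lambda>(s,x). norm (h s x)) \<in> borel_measurable (lborel \<Otimes>\<^sub>M lborel)"
    using m by (simp add: split_def)
  have mI: "(\<lambda>s. LINT x|lborel. norm (h s x)) \<in> borel_measurable lborel"
    by (rule lborel.borel_measurable_lebesgue_integral[OF mabs])
  have ik: "integrable lborel (\<lambda>s. K * indicator {t1..t2} s)"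
    by (auto intro!: integrable_real_indicator simp: emeasure_lborel_Icc_eq)
  have i: "integrable (lborel \<Otimes>\<^sub>M lborel) (\<lambda>(s,x). h s x)"
  proof (rule lborel_pair.Fubini_integrable[OF m])
    show "integrable lborel (\<lambda>s. LINT x|lborel. norm (case (s, x) of (s, x) \<Rightarrow> h s x))"
    proof (rule Bochner_Integration.integrable_bound[OF ik])
      show "(\<lambda>s. LINT x|lborel. norm (case (s, x) of (s, x) \<Rightarrow> h s x)) \<in> borel_measurable lborel"
        using mI by simp
      show "AE s in lborel. norm (LINT x|lborel. norm (case (s, x) of (s, x) \<Rightarrow> h s x)) \<le> norm (K * indicator {t1..t2} s)"
        using K by (auto simp: h_def indicator_def intro: order_trans[OF _ abs_ge_self])
    qed
    show "AE s in lborel. integrable lborel (\<lambda>x. case (s, x) of (s, x) \<Rightarrow> h s x)"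
      using int by (auto simp: h_def indicator_def)
  qed
  have inner: "(LINT s|lborel. h s x) = q t2 x - q t1 x" for x
  proof -
    have "continuous_on UNIV (\<lambda>s. dq s x)"
      using continuous_on_compose2[OF cont, of UNIV "\<lambda>s. (s, x)"]
        continuous_on_Pair[OF continuous_on_id[of UNIV] continuous_on_const[of UNIV x]] by simp
    then have "prim (\<lambda>s. q s x) (\<lambda>s. dq s x)"
      by (intro prim_C1) (use der in \<open>simp add: has_real_derivative_iff_has_vector_derivative\<close>)
    from primD(2)[OF this t] show ?thesis by (simp add: h_def set_lebesgue_integral_def)
  qed
  have o: "(LINT x|lborel. h s x) = indicator {t1..t2} s * (LINT x|lborel. dq s x)" for s
    by (simp add: h_def)
  have fub: "(LINT x|lborel. LINT s|lborel. h s x) = (LINT s|lborel. LINT x|lborel. h s x)"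
    by (rule lborel_pair.Fubini_integral[OF i])
  have io: "integrable lborel (\<lambda>s. LINT x|lborel. h s x)"
    using lborel_pair.integrable_fst[OF i] by simp
  have "(LINT x|lborel. q t2 x) - (LINT x|lborel. q t1 x) = (LINT s|lborel. LINT x|lborel. h s x)"
    using fub q by (simp add: inner)
  also have "\<bar>\<dots>\<bar> \<le> (LINT s|lborel. B * indicator {t1..t2} s)"
    unfolding real_norm_def[symmetric]
  proof (rule Bochner_Integration.integral_norm_bound_integral[OF io])
    show "integrable lborel (\<lambda>s. B * indicator {t1..t2} s)"
      by (auto intro!: integrable_real_indicator simp: emeasure_lborel_Icc_eq)
    show "norm (LINT x|lborel. h s x) \<le> B * indicator {t1..t2} s" for s
      unfolding o using B[of s] by (auto simp: indicator_def)
  qed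
  also have "\<dots> = B * (t2 - t1)" using t by simp
  finally show ?thesis .
qed

section \<open>Conservation of energy and relative momentum\<close>

lemma cmod2_has_deriv:
  assumes "(z has_vector_derivative z') (at t)"
  shows "((\<lambda>s. (cmod (z s))^2) has_real_derivative 2 * Re (cnj (z t) * z')) (at t)"
proof -
  have "((\<lambda>s. cnj (z s)) has_vector_derivative cnj z') (at t)"
    by (rule bounded_linear.has_vector_derivative[OF bounded_linear_cnj assms])
  from has_vector_derivative_mult[OF this assms]
  have "((\<lambda>s. Re (cnj (z s) * z s)) has_vector_derivative Re (cnj (z t) * z' + cnj z' * z t)) (at t)"
    by (rule bounded_linear.has_vector_derivative[OF bounded_linear_Re])
  moreover have "Re (cnj (z s) * z s) = (cmod (z s))^2" for s
    unfolding cmod_power2 by (simp add: power2_eq_square)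
  moreover have "Re (cnj (z t) * z' + cnj z' * z t) = 2 * Re (cnj (z t) * z')" by simp
  ultimately show ?thesis
    unfolding has_real_derivative_iff_has_vector_derivative by (simp only:)
qed

lemma Re_integrable: "integrable lborel f \<Longrightarrow> integrable lborel (\<lambda>x. Re (f x))"
  and Im_integrable: "integrable lborel f \<Longrightarrow> integrable lborel (\<lambda>x. Im (f x))"
  by (rule integrable_bounded_linear[OF bounded_linear_Re], assumption)
     (rule integrable_bounded_linear[OF bounded_linear_Im], assumption)

lemma Re_integral: "integrable lborel f \<Longrightarrow> (LINT x|lborel. Re (f x)) = Re (LINT x|lborel. f x)"
  and Im_integral: "integrable lborel f \<Longrightarrow> (LINT x|lborel. Im (f x)) = Im (LINT x|lborel. f x)"
  by (rule integral_bounded_linear[OF bounded_linear_Re], assumption)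
     (rule integral_bounded_linear[OF bounded_linear_Im], assumption)

text \<open>The solution in terms of continuous representatives \<open>V t\<close> with
  square-integrable derivatives \<open>G t\<close>. The maps \<open>V t\<close> are not in
  \<open>L2\<close>, so continuity in time is imposed on differences; the equation is solved for the
  time derivative.\<close>

locale gp_flow =
  fixes V G :: "real \<Rightarrow> real \<Rightarrow> complex"
  assumes prim_V: "prim (V t) (G t)"
    and L2_G: "L2 (G t)"
    and bdd: "\<exists>M. \<forall>x. cmod (V t x) \<le> M"
    and L2_eta: "L2 (\<lambda>x. 1 - (cmod (V t x))^2)"
    and L2_d: "L2 (\<lambda>x. V s x - V t x)"
    and cV: "((\<lambda>s. L2norm (\<lambda>x. V s x - V t x)) \<longlongrightarrow> 0) (at t)"
    and cG: "((\<lambda>s. L2norm (\<lambda>x. G s x - G t x)) \<longlongrightarrow> 0) (at t)"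
    and eqn: "test_fun \<phi> \<Longrightarrow> ((\<lambda>s. LINT x|lborel. V s x * of_real (\<phi> x)) has_vector_derivative
      (\<i> * ((LINT x|lborel. V t x * of_real (deriv (deriv \<phi>) x)) + (LINT x|lborel. NL (V t x) * of_real (\<phi> x))))) (at t)"
begin

lemma L2_dG: "L2 (\<lambda>x. G s x - G t x)"
  by (rule L2_diff(1)[OF L2_G L2_G])

lemma li_V: "loc_integrable (V t)" and li_G: "loc_integrable (G t)"
  using prim_loc_integrable[OF prim_V] by auto

lemma cont_V: "continuous_on A (V t)"
  by (rule prim_cont[OF prim_V])

lemma L2_NL: "L2 (\<lambda>x. NL (V t x))"
proof -
  obtain M where M: "\<And>x. cmod (V t x) \<le> M" using bdd by blast
  have "continuous_on UNIV (\<lambda>x. NL (V t x))" unfolding NL_def by (intro continuous_intros cont_V)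
  then have m: "(\<lambda>x. NL (V t x)) \<in> borel_measurable borel" by (rule borel_measurable_continuous_onI)
  show ?thesis
    by (rule L2_bound[OF m L2_eta, where K=M])
       (use M in \<open>auto simp: NL_def norm_mult mult.commute[of M] simp del: of_real_diff intro!: mult_left_mono AE_I2\<close>)
qed

lemma L2_dNL: "L2 (\<lambda>x. NL (V s x) - NL (V t x))"
  by (rule L2_diff(1)[OF L2_NL L2_NL])

lemma sup_d: "cmod (V s x - V t x) \<le> L2norm (\<lambda>x. G s x - G t x) + L2norm (\<lambda>x. V s x - V t x)"
  by (rule prim_L2_sup[OF prim_diff[OF prim_V prim_V] L2_d L2_dG])

lemma dNL_bound:
  assumes "\<And>x. cmod (V s x) \<le> M" "\<And>x. cmod (V t x) \<le> M"
  shows "L2norm (\<lambda>x. NL (V s x) - NL (V t x)) \<le> (1 + 3 * M^2) * L2norm (\<lambda>x. V s x - V t x)"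
  by (rule L2norm_bound[OF L2_d]) (use NL_diff assms in \<open>auto intro!: AE_I2\<close>)

text \<open>\<open>NL\<close> is only locally Lipschitz, so the constant depends on the sup bound
  \<open>K s\<close>, which itself converges as \<open>s\<close> tends to \<open>t\<close>.\<close>

lemma cNL: "((\<lambda>s. L2norm (\<lambda>x. NL (V s x) - NL (V t x))) \<longlongrightarrow> 0) (at t)"
proof -
  obtain M where M: "\<And>x. cmod (V t x) \<le> M" using bdd by blast
  define K where "K s = M + (L2norm (\<lambda>x. G s x - G t x) + L2norm (\<lambda>x. V s x - V t x))" for s
  have K: "cmod (V s x) \<le> K s" "cmod (V t x) \<le> K s" for s x
    using norm_triangle_sub[of "V s x" "V t x"] sup_d[of s x t] M[of x]
      L2norm_nonneg[of "\<lambda>x. G s x - G t x"] L2norm_nonneg[of "\<lambda>x. V s x - V t x"]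
    unfolding K_def by linarith+
  have "((\<lambda>s. (1 + 3 * (K s)^2) * L2norm (\<lambda>x. V s x - V t x)) \<longlongrightarrow> (1 + 3 * (M + (0 + 0))^2) * 0) (at t)"
    unfolding K_def by (intro tendsto_intros cV cG)
  then have lim: "((\<lambda>s. (1 + 3 * (K s)^2) * L2norm (\<lambda>x. V s x - V t x)) \<longlongrightarrow> 0) (at t)" by simp
  show ?thesis
    by (rule Lim_null_comparison[OF always_eventually lim]) (use dNL_bound[OF K] in auto)
qed

lemma time_deriv:
  assumes "test_fun \<phi>"
  shows "((\<lambda>s. conv (V s) \<phi> x) has_vector_derivative
    \<i> * (conv (V t) (deriv (deriv \<phi>)) x + conv (\<lambda>y. NL (V t y)) \<phi> x)) (at t)"
  using eqn[OF test_fun_shift(1)[OF assms, of x], of t]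
  unfolding conv_def test_fun_shift(2)[OF assms] test_fun_shift(2)[OF test_fun_deriv[OF assms]] .

lemma joint_aux:
  fixes W :: "real \<Rightarrow> real \<Rightarrow> complex"
  assumes W: "\<And>s. loc_integrable (W s)" "\<And>s t. L2 (\<lambda>x. W s x - W t x)"
    "\<And>t. ((\<lambda>s. L2norm (\<lambda>x. W s x - W t x)) \<longlongrightarrow> 0) (at t)" and \<phi>: "test_fun \<phi>"
  shows "continuous_on UNIV (\<lambda>p. conv (W (fst p)) \<phi> (snd p))"
proof (rule continuous_on_joint[where f="\<lambda>s. conv (W s) \<phi>" and b="\<lambda>s t. L2norm (\<lambda>x. W s x - W t x) * L2norm \<phi>"])
  show "continuous_on UNIV (conv (W s) \<phi>)" for s by (rule conv_cont[OF W(1) \<phi>])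
  show "cmod (conv (W s) \<phi> x - conv (W t) \<phi> x) \<le> L2norm (\<lambda>x. W s x - W t x) * L2norm \<phi>" for s t x
    using conv_L2_sup[OF W(2) \<phi>, of s t x] conv_diff[OF W(1) W(1) \<phi>, of s t x] by simp
  show "((\<lambda>s. L2norm (\<lambda>x. W s x - W t x) * L2norm \<phi>) \<longlongrightarrow> 0) (at t)" for t
    by (rule tendsto_mult_left_zero[OF W(3)])
qed

lemmas joint_V = joint_aux[of V, OF li_V L2_d cV]
lemmas joint_G = joint_aux[of G, OF li_G L2_dG cG]
lemmas joint_N = joint_aux[of "\<lambda>s x. NL (V s x)", OF loc_integrable_L2[OF L2_NL] L2_dNL cNL]

lemma L2_time_bounded:
  fixes W :: "real \<Rightarrow> real \<Rightarrow> complex"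
  assumes W: "\<And>s t. L2 (\<lambda>x. W s x - W t x)"
    "\<And>t. ((\<lambda>s. L2norm (\<lambda>x. W s x - W t x)) \<longlongrightarrow> 0) (at t)"
  shows "\<exists>K. \<forall>s\<in>{t1..t2}. L2norm (\<lambda>x. W s x - W t1 x) \<le> K"
proof -
  define n where "n s = L2norm (\<lambda>x. W s x - W t1 x)" for s
  have tri: "\<bar>n s - n t\<bar> \<le> L2norm (\<lambda>x. W s x - W t x)" for s t
  proof -
    have "n s \<le> L2norm (\<lambda>x. W s x - W t x) + n t"
      using L2_add(2)[OF W(1)[of s t] W(1)[of t t1]] by (simp add: n_def)
    moreover have "n t \<le> L2norm (\<lambda>x. W s x - W t x) + n s"
    proof -
      have "L2norm (\<lambda>x. W t x - W s x) = L2norm (\<lambda>x. W s x - W t x)"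
        by (simp add: L2norm_def norm_minus_commute)
      then show ?thesis using L2_add(2)[OF W(1)[of t s] W(1)[of s t1]] by (simp add: n_def)
    qed
    ultimately show ?thesis by linarith
  qed
  have "isCont n t" for t
    unfolding isCont_def
    by (rule Lim_null[THEN iffD2], rule Lim_null_comparison[OF always_eventually W(2)[of t]])
       (use tri in auto)
  then have "continuous_on {t1..t2} n" by (simp add: continuous_at_imp_continuous_on)
  then have "bounded (n ` {t1..t2})"
    by (intro compact_imp_bounded compact_continuous_image) auto
  then obtain K where "\<And>s. s \<in> {t1..t2} \<Longrightarrow> norm (n s) \<le> K" unfolding bounded_iff by blast
  then show ?thesis unfolding n_def by fastforce
qed

lemma bounds:
  obtains M where "M \<ge> 1" "\<And>s x. s \<in> {t1..t2} \<Longrightarrow> cmod (V s x) \<le> M" "\<And>s. s \<in> {t1..t2} \<Longrightarrow> L2norm (G s) \<le> M"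
    "\<And>s. s \<in> {t1..t2} \<Longrightarrow> L2norm (\<lambda>x. NL (V s x)) \<le> M"
proof -
  obtain K1 where K1: "\<And>s. s \<in> {t1..t2} \<Longrightarrow> L2norm (\<lambda>x. V s x - V t1 x) \<le> K1"
    using L2_time_bounded[of V, OF L2_d cV] by blast
  obtain K2 where K2: "\<And>s. s \<in> {t1..t2} \<Longrightarrow> L2norm (\<lambda>x. G s x - G t1 x) \<le> K2"
    using L2_time_bounded[of G, OF L2_dG cG] by blast
  obtain K3 where K3: "\<And>s. s \<in> {t1..t2} \<Longrightarrow> L2norm (\<lambda>x. NL (V s x) - NL (V t1 x)) \<le> K3"
    using L2_time_bounded[of "\<lambda>s x. NL (V s x)", OF L2_dNL cNL] by blast
  obtain M0 where M0: "\<And>x. cmod (V t1 x) \<le> M0" using bdd by blast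
  define M where "M = Max {1, M0 + (K2 + K1), K2 + L2norm (G t1), K3 + L2norm (\<lambda>x. NL (V t1 x))}"
  have Mge: "1 \<le> M" "M0 + (K2 + K1) \<le> M" "K2 + L2norm (G t1) \<le> M" "K3 + L2norm (\<lambda>x. NL (V t1 x)) \<le> M"
    unfolding M_def by (intro Max_ge; simp)+
  show thesis
  proof (rule that[OF Mge(1)])
    fix s assume s: "s \<in> {t1..t2}"
    show "cmod (V s x) \<le> M" for x
      using norm_triangle_sub[of "V s x" "V t1 x"] sup_d[of s x t1] M0[of x] K1[OF s] K2[OF s] Mge(2) by linarith
    show "L2norm (G s) \<le> M"
      using L2_add(2)[OF L2_dG[of s t1] L2_G[of t1]] K2[OF s] Mge(3) by simp
    show "L2norm (\<lambda>x. NL (V s x)) \<le> M"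
      using L2_add(2)[OF L2_dNL[of s t1] L2_NL[of t1]] K3[OF s] Mge(4) by simp
  qed
qed

definition "moll_phi0 e = mol e"
definition "moll_phi1 e = deriv (mol e)"
definition "moll_phi2 e = deriv (deriv (mol e))"
definition "moll_phi3 e = deriv (deriv (deriv (mol e)))"
definition "moll_u e s = conv (V s) (moll_phi0 e)"
definition "moll_ux e s = conv (G s) (moll_phi0 e)"
definition "moll_uxx e s = conv (V s) (moll_phi2 e)"
definition "moll_JN e s = conv (\<lambda>x. NL (V s x)) (moll_phi0 e)"
text \<open>The time derivative dictated by the mollified equation. In \<open>moll_utx\<close> the
  additional space derivative sits on the kernel, hence the overall minus sign.\<close>

definition "moll_ut e s x = \<i> * (moll_uxx e s x + moll_JN e s x)"
definition "moll_utx e s x = - (\<i> * (conv (V s) (moll_phi3 e) x + conv (\<lambda>x. NL (V s x)) (moll_phi1 e) x))"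
definition "moll_Nu e s x = NL (moll_u e s x)"
text \<open>Commutator of mollification and nonlinearity. The mollified solution satisfies the
  equation up to this source term: \<open>moll_ut\<close> is \<open>\<i>\<close> times the sum of
  \<open>moll_uxx\<close>, \<open>moll_Nu\<close> and \<open>moll_Rm\<close>.\<close>

definition "moll_Rm e s x = moll_JN e s x - moll_Nu e s x"
definition "moll_qE e s x = 1/2 * (cmod (moll_ux e s x))^2 + 1/4 * (1 - (cmod (moll_u e s x))^2)^2"
definition "moll_dE e s x = Re (cnj (moll_ux e s x) * moll_utx e s x) - Re (cnj (moll_Nu e s x) * moll_ut e s x)"
text \<open>The momentum density relative to the state at time \<open>r\<close>: unlike the momentum itself, it is integrable.\<close>

definition "moll_qP e r s x = 1/2 * Im (cnj (moll_u e s x - moll_u e r x) * (moll_ux e r x + moll_ux e s x))"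
definition "moll_dP e r s x = 1/2 * Im (cnj (moll_ut e s x) * (moll_ux e r x + moll_ux e s x) + cnj (moll_u e s x - moll_u e r x) * moll_utx e s x)"

section \<open>Balance laws of the mollified solution\<close>

context
  fixes e M :: real and S :: "real set"
  assumes e: "0 < e" "e \<le> 1" and M: "M \<ge> 1"
    and bV: "\<And>s x. s \<in> S \<Longrightarrow> cmod (V s x) \<le> M"
    and bG: "\<And>s. s \<in> S \<Longrightarrow> L2norm (G s) \<le> M"
    and bN: "\<And>s. s \<in> S \<Longrightarrow> L2norm (\<lambda>x. NL (V s x)) \<le> M"
begin



abbreviation "\<phi>0 \<equiv> moll_phi0 e"
abbreviation "\<phi>1 \<equiv> moll_phi1 e"
abbreviation "\<phi>2 \<equiv> moll_phi2 e"
abbreviation "\<phi>3 \<equiv> moll_phi3 e"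
abbreviation "u \<equiv> moll_u e"
abbreviation "ux \<equiv> moll_ux e"
abbreviation "uxx \<equiv> moll_uxx e"
abbreviation "JN \<equiv> moll_JN e"
abbreviation "ut \<equiv> moll_ut e"
abbreviation "utx \<equiv> moll_utx e"
abbreviation "Nu \<equiv> moll_Nu e"
abbreviation "Rm \<equiv> moll_Rm e"
abbreviation "qE \<equiv> moll_qE e"
abbreviation "dE \<equiv> moll_dE e"
abbreviation "qP \<equiv> moll_qP e"
abbreviation "dP \<equiv> moll_dP e"

lemma tests: "test_fun \<phi>0" "test_fun \<phi>1" "test_fun \<phi>2" "test_fun \<phi>3"
  unfolding moll_phi0_def moll_phi1_def moll_phi2_def moll_phi3_def by (intro test_fun_deriv mol_test e)+

lemma wdV: "weak_deriv (V s) (G s)"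
  by (rule prim_weak_deriv[OF prim_V])

lemma liN: "loc_integrable (\<lambda>x. NL (V s x))"
  by (rule loc_integrable_L2[OF L2_NL])

lemma uxx_eq: "uxx s x = - conv (G s) \<phi>1 x"
  unfolding moll_uxx_def using weak_deriv_conv[OF wdV tests(2), of s x] by (simp add: moll_phi1_def moll_phi2_def)

lemma conv3_eq: "conv (V s) \<phi>3 x = - conv (G s) \<phi>2 x"
  using weak_deriv_conv[OF wdV tests(3), of s x] by (simp add: moll_phi2_def moll_phi3_def)

lemma prims: "prim (u s) (ux s)" "prim (ux s) (uxx s)" "prim (ut s) (utx s)"
proof -
  show "prim (u s) (ux s)" unfolding moll_u_def moll_ux_def by (rule prim_conv'[OF prim_V tests(1)])
  show "prim (ux s) (uxx s)"
    using prim_conv[OF li_G tests(1), of s] unfolding moll_ux_def uxx_eq by (simp add: moll_phi0_def moll_phi1_def uxx_eq[abs_def])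
  have "prim (\<lambda>x. uxx s x + JN s x) (\<lambda>x. - conv (V s) \<phi>3 x + - conv (\<lambda>x. NL (V s x)) \<phi>1 x)"
    using prim_add[OF prim_conv[OF li_V tests(3), of s] prim_conv[OF liN tests(1), of s]]
    unfolding moll_uxx_def moll_JN_def by (simp add: moll_phi0_def moll_phi1_def moll_phi2_def moll_phi3_def)
  from prim_linear[OF bounded_linear_mult_right[of \<i>] this]
  have "prim (\<lambda>x. \<i> * (uxx s x + JN s x)) (\<lambda>x. \<i> * (- conv (V s) \<phi>3 x + - conv (\<lambda>x. NL (V s x)) \<phi>1 x))" .
  moreover have "(\<lambda>x. \<i> * (- conv (V s) \<phi>3 x + - conv (\<lambda>x. NL (V s x)) \<phi>1 x)) = utx s"
    by (rule ext) (simp add: moll_utx_def algebra_simps)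
  moreover have "(\<lambda>x. \<i> * (uxx s x + JN s x)) = ut s" by (rule ext) (simp add: moll_ut_def)
  ultimately show "prim (ut s) (utx s)" by simp
qed

lemma time_u: "((\<lambda>s. u s x) has_vector_derivative ut t x) (at t)"
  using time_deriv[OF tests(1), of x t] by (simp add: moll_u_def moll_ut_def moll_uxx_def moll_JN_def moll_phi0_def moll_phi2_def)

lemma time_ux: "((\<lambda>s. ux s x) has_vector_derivative utx t x) (at t)"
proof -
  have "ux s x = - conv (V s) \<phi>1 x" for s
    using weak_deriv_conv[OF wdV tests(1), of s x] by (simp add: moll_ux_def moll_phi0_def moll_phi1_def)
  then show ?thesis
    using has_vector_derivative_minus[OF time_deriv[OF tests(2), of x t]]
    by (simp add: moll_utx_def moll_phi1_def moll_phi3_def)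
qed

lemma joints:
  "continuous_on UNIV (\<lambda>p. u (fst p) (snd p))" "continuous_on UNIV (\<lambda>p. ux (fst p) (snd p))"
  "continuous_on UNIV (\<lambda>p. ut (fst p) (snd p))" "continuous_on UNIV (\<lambda>p. utx (fst p) (snd p))"
  unfolding moll_u_def moll_ux_def moll_ut_def moll_utx_def moll_uxx_def moll_JN_def
  by (intro continuous_intros joint_V joint_G joint_N tests)+

lemma L2s: "L2 (ux s)" "L2 (uxx s)" "L2 (JN s)" "L2 (ut s)" "L2 (utx s)"
proof -
  show 1: "L2 (ux s)" unfolding moll_ux_def by (rule conv_L2(1)[OF L2_G tests(1)])
  have "L2 (\<lambda>x. - conv (G s) \<phi>1 x)" by (rule L2_uminus(1)[OF conv_L2(1)[OF L2_G tests(2)]])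
  then show 2: "L2 (uxx s)" using uxx_eq by presburger
  show 3: "L2 (JN s)" unfolding moll_JN_def by (rule conv_L2(1)[OF L2_NL tests(1)])
  show "L2 (ut s)" using L2_cmult(1)[OF L2_add(1)[OF 2 3], of \<i>] unfolding moll_ut_def[abs_def] by simp
  have "L2 (\<lambda>x. \<i> * (- conv (G s) \<phi>2 x + conv (\<lambda>x. NL (V s x)) \<phi>1 x))"
    by (intro L2_cmult L2_add L2_uminus conv_L2(1) L2_G L2_NL tests)
  then show "L2 (utx s)" unfolding moll_utx_def[abs_def] conv3_eq by (rule L2_uminus(1))
qed

lemma Rm: 
  assumes "s \<in> S"
  shows "L2 (Rm s)" "L2norm (Rm s) \<le> 5 * M^3 * (e * sqrt e)" 
  using NL_commutator[OF prim_V L2_G bG[OF assms] bV[OF assms] e(1)]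
  unfolding moll_Rm_def[abs_def] moll_JN_def moll_Nu_def moll_u_def moll_phi0_def by auto

lemma sqrt_e: "e * sqrt e \<le> sqrt e" "sqrt e \<le> 1" "e * sqrt e \<le> 1"
proof -
  show a: "e * sqrt e \<le> sqrt e" using e by (simp add: mult_left_le_one_le)
  show b: "sqrt e \<le> 1" using e by simp
  show "e * sqrt e \<le> 1" using a b by linarith
qed

text \<open>\<open>Nu\<close> is the nonlinearity of a mollified map, not a mollification, so its
  norm is estimated by writing it as \<open>JN - Rm\<close>.\<close>

lemma Nu: 
  assumes "s \<in> S"
  shows "L2 (Nu s)" "L2norm (Nu s) \<le> M + 5 * M^3"
proof -
  have eq: "Nu s = (\<lambda>x. JN s x - Rm s x)" by (rule ext) (simp add: moll_Rm_def)
  show "L2 (Nu s)" unfolding eq by (rule L2_diff(1)[OF L2s(3) Rm(1)[OF assms]])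
  have "L2norm (JN s) \<le> 1 * L2norm (\<lambda>x. NL (V s x))"
    using conv_L2(2)[OF L2_NL tests(1), of s] unfolding moll_JN_def using mol_abs_integral[OF e(1)] by (simp add: moll_phi0_def)
  moreover have "L2norm (Rm s) \<le> 5 * M^3 * 1"
    using Rm(2)[OF assms] mult_left_mono[OF sqrt_e(3), of "5 * M^3"] M
    by (meson mult_nonneg_nonneg order_trans zero_le_numeral zero_le_one zero_le_power)
  ultimately show "L2norm (Nu s) \<le> M + 5 * M^3"
    using L2_diff(2)[OF L2s(3)[of s] Rm(1)[OF assms]] bN[OF assms] unfolding eq by linarith
qed

lemma ux_le: "s \<in> S \<Longrightarrow> L2norm (ux s) \<le> M"
  using conv_L2(2)[OF L2_G tests(1), of s] bG[of s] mol_abs_integral[OF e(1)]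
  by (simp add: moll_ux_def moll_phi0_def)

lemma uxx_le: "s \<in> S \<Longrightarrow> L2norm (uxx s) \<le> (LINT y|lborel. \<bar>\<phi>1 y\<bar>) * M"
proof -
  assume s: "s \<in> S"
  have "uxx s = (\<lambda>x. - conv (G s) \<phi>1 x)" by (rule ext) (rule uxx_eq)
  then have "L2norm (uxx s) = L2norm (conv (G s) \<phi>1)" by (simp add: L2norm_def)
  also have "\<dots> \<le> (LINT y|lborel. \<bar>\<phi>1 y\<bar>) * L2norm (G s)" by (rule conv_L2(2)[OF L2_G tests(2)])
  also have "\<dots> \<le> (LINT y|lborel. \<bar>\<phi>1 y\<bar>) * M" using bG[OF s] by (intro mult_left_mono) auto
  finally show ?thesis .
qed

lemma ut_le: "s \<in> S \<Longrightarrow> L2norm (ut s) \<le> (LINT y|lborel. \<bar>\<phi>1 y\<bar>) * M + M"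
proof -
  assume s: "s \<in> S"
  have "L2norm (ut s) = L2norm (\<lambda>x. uxx s x + JN s x)"
    unfolding moll_ut_def[abs_def] using L2_cmult(2)[OF L2_add(1)[OF L2s(2,3)], of \<i>] by simp
  also have "\<dots> \<le> L2norm (uxx s) + L2norm (JN s)" by (rule L2_add(2)[OF L2s(2,3)])
  also have "L2norm (JN s) \<le> 1 * L2norm (\<lambda>x. NL (V s x))"
    using conv_L2(2)[OF L2_NL tests(1), of s] unfolding moll_JN_def using mol_abs_integral[OF e(1)] by (simp add: moll_phi0_def)
  finally show ?thesis using uxx_le[OF s] bN[OF s] by simp
qed

lemma utx_le: "s \<in> S \<Longrightarrow> L2norm (utx s) \<le> (LINT y|lborel. \<bar>\<phi>2 y\<bar>) * M + (LINT y|lborel. \<bar>\<phi>1 y\<bar>) * M"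
proof -
  assume s: "s \<in> S"
  have "L2norm (utx s) = L2norm (\<lambda>x. conv (G s) \<phi>2 x - conv (\<lambda>x. NL (V s x)) \<phi>1 x)"
    unfolding moll_utx_def[abs_def] conv3_eq by (simp add: L2norm_def norm_mult norm_minus_commute)
  also have "\<dots> \<le> L2norm (conv (G s) \<phi>2) + L2norm (conv (\<lambda>x. NL (V s x)) \<phi>1)"
    by (intro L2_diff(2) conv_L2(1) L2_G L2_NL tests)
  also have "\<dots> \<le> (LINT y|lborel. \<bar>\<phi>2 y\<bar>) * L2norm (G s) + (LINT y|lborel. \<bar>\<phi>1 y\<bar>) * L2norm (\<lambda>x. NL (V s x))"
    by (intro add_mono conv_L2(2) L2_G L2_NL tests)
  also have "\<dots> \<le> (LINT y|lborel. \<bar>\<phi>2 y\<bar>) * M + (LINT y|lborel. \<bar>\<phi>1 y\<bar>) * M"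
    by (intro add_mono mult_left_mono bG bN s) auto
  finally show ?thesis .
qed

lemma u_le: "s \<in> S \<Longrightarrow> cmod (u s x) \<le> M"
  unfolding moll_u_def moll_phi0_def by (rule conv_sup_bound[OF li_V bV e(1)])

lemma eta_u:
  assumes "s \<in> S"
  shows "L2 (\<lambda>x. 1 - (cmod (u s x))^2)"
    "\<bar>L2norm (\<lambda>x. 1 - (cmod (u s x))^2) - L2norm (\<lambda>x. 1 - (cmod (V s x))^2)\<bar> \<le> 2 * M^2 * e"
proof -
  note A = conv_approx[OF prim_V L2_G e(1), of s]
  define d where "d x = (cmod (V s x))^2 - (cmod (u s x))^2" for x
  have "continuous_on UNIV d" unfolding d_def moll_u_def moll_phi0_def
    by (intro continuous_intros cont_V conv_cont li_V mol_test e)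
  then have m: "d \<in> borel_measurable borel" by (rule borel_measurable_continuous_onI)
  have b: "norm (d x) \<le> (2 * M) * cmod (V s x - u s x)" for x
  proof -
    have "d x = (cmod (V s x) - cmod (u s x)) * (cmod (V s x) + cmod (u s x))"
      by (simp add: d_def power2_eq_square algebra_simps)
    then have "norm (d x) = \<bar>cmod (V s x) - cmod (u s x)\<bar> * (cmod (V s x) + cmod (u s x))"
      by (simp add: abs_mult)
    also have "\<dots> \<le> cmod (V s x - u s x) * (2 * M)"
      using bV[OF assms, of x] u_le[OF assms, of x] by (intro mult_mono norm_triangle_ineq3) auto
    finally show ?thesis by (simp add: mult.commute)
  qed
  have L: "L2 d" by (rule L2_bound[OF m A(1)]) (use b in \<open>auto simp: moll_u_def moll_phi0_def\<close>)
  have n: "L2norm d \<le> 2 * M^2 * e"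
  proof -
    have "L2norm d \<le> (2 * M) * L2norm (\<lambda>x. V s x - conv (V s) (mol e) x)"
      by (rule L2norm_bound[OF A(1)]) (use b M in \<open>auto simp: moll_u_def moll_phi0_def\<close>)
    also have "\<dots> \<le> (2 * M) * (e * M)"
      using order_trans[OF A(2) mult_left_mono[OF bG[OF assms], of e]] e M by (intro mult_left_mono) auto
    finally show ?thesis by (simp add: power2_eq_square mult_ac)
  qed
  have eq: "(\<lambda>x. 1 - (cmod (u s x))^2) = (\<lambda>x. (1 - (cmod (V s x))^2) + d x)" by (rule ext) (simp add: d_def)
  have eq2: "(\<lambda>x. 1 - (cmod (V s x))^2) = (\<lambda>x. (1 - (cmod (u s x))^2) - d x)" by (rule ext) (simp add: d_def)
  show 1: "L2 (\<lambda>x. 1 - (cmod (u s x))^2)" unfolding eq by (rule L2_add(1)[OF L2_eta L])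
  have "L2norm (\<lambda>x. 1 - (cmod (u s x))^2) \<le> L2norm (\<lambda>x. 1 - (cmod (V s x))^2) + L2norm d"
    unfolding eq by (rule L2_add(2)[OF L2_eta L])
  moreover have "L2norm (\<lambda>x. 1 - (cmod (V s x))^2) \<le> L2norm (\<lambda>x. 1 - (cmod (u s x))^2) + L2norm d"
    unfolding eq2 by (rule L2_diff(2)[OF 1 L])
  ultimately show "\<bar>L2norm (\<lambda>x. 1 - (cmod (u s x))^2) - L2norm (\<lambda>x. 1 - (cmod (V s x))^2)\<bar> \<le> 2 * M^2 * e"
    using n by linarith
qed


lemma qE_deriv: "((\<lambda>s. qE s x) has_real_derivative dE t x) (at t)"
proof -
  note A = cmod2_has_deriv[OF time_ux[of x t]] and B = cmod2_has_deriv[OF time_u[of x t]]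
  have "((\<lambda>s. qE s x) has_real_derivative
      1/2 * (2 * Re (cnj (ux t x) * utx t x)) + 1/4 * (2 * (1 - (cmod (u t x))^2) * (0 - 2 * Re (cnj (u t x) * ut t x)))) (at t)"
    unfolding moll_qE_def
    by (rule derivative_eq_intros refl A B | simp)+
  also have "1/2 * (2 * Re (cnj (ux t x) * utx t x)) + 1/4 * (2 * (1 - (cmod (u t x))^2) * (0 - 2 * Re (cnj (u t x) * ut t x))) = dE t x"
  proof -
    have e: "Re (cnj (Nu t x) * ut t x) = (1 - (cmod (u t x))^2) * Re (cnj (u t x) * ut t x)"
      by (simp add: moll_Nu_def NL_def mult.assoc del: of_real_diff)
    have g: "1/2 * (2 * A) + 1/4 * (2 * c * (0 - 2 * X)) = A - c * X" for A c X :: real by (simp add: field_simps)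
    show ?thesis unfolding moll_dE_def e by (rule g)
  qed
  finally show ?thesis .
qed

lemma prod_int: "L2 f \<Longrightarrow> L2 g \<Longrightarrow> integrable lborel (\<lambda>x. cnj (f x) * g x)"
  for f g :: "real \<Rightarrow> complex"
  by (rule L2_prod_integrable[OF L2_cnj(1)])

lemma prod_le: "L2 f \<Longrightarrow> L2 g \<Longrightarrow> cmod (LINT x|lborel. cnj (f x) * g x) \<le> L2norm f * L2norm g"
  for f g :: "real \<Rightarrow> complex"
  using L2_prod_integral_le[OF L2_cnj(1)] by (simp add: L2_cnj(2))

lemma prod_abs_le: "L2 f \<Longrightarrow> L2 g \<Longrightarrow> (LINT x|lborel. cmod (cnj (f x) * g x)) \<le> L2norm f * L2norm g"
  for f g :: "real \<Rightarrow> complex"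
  using L2_Cauchy_Schwarz[of f g] by (simp add: norm_mult)

text \<open>With \<open>F = uxx + Nu\<close>, one integration by parts turns the integral of
  \<open>dE\<close> into minus the real part of the integral of \<open>cnj F * ut\<close>. Since
  \<open>ut = \<i> * (F + Rm)\<close> and \<open>Re (cnj F * \<i> * F) = 0\<close>, only the
  commutator survives.\<close>

lemma dE_integrable:
  assumes "s \<in> S"
  shows "integrable lborel (dE s)"
    and "(LINT x|lborel. \<bar>dE s x\<bar>) \<le> L2norm (ux s) * L2norm (utx s) + L2norm (Nu s) * L2norm (ut s)"
    and "\<bar>LINT x|lborel. dE s x\<bar> \<le> (L2norm (uxx s) + L2norm (Nu s)) * L2norm (Rm s)"
proof -
  note i1 = prod_int[OF L2s(1) L2s(5), of s s] and i2 = prod_int[OF L2s(2) L2s(4), of s s]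
    and i3 = prod_int[OF Nu(1)[OF assms] L2s(4), of s] and i4 = prod_int[OF L2s(1) L2s(4), of s s]
  show I: "integrable lborel (dE s)" unfolding moll_dE_def[abs_def]
    by (intro Bochner_Integration.integrable_diff Re_integrable i1 i3)
  have "(LINT x|lborel. \<bar>dE s x\<bar>) \<le> (LINT x|lborel. cmod (cnj (ux s x) * utx s x) + cmod (cnj (Nu s x) * ut s x))"
  proof (rule integral_mono)
    show "\<bar>dE s x\<bar> \<le> cmod (cnj (ux s x) * utx s x) + cmod (cnj (Nu s x) * ut s x)" for x
      unfolding moll_dE_def using abs_Re_le_cmod[of "cnj (ux s x) * utx s x"] abs_Re_le_cmod[of "cnj (Nu s x) * ut s x"] by linarith
  qed (use I i1 i3 in \<open>auto simp del: norm_mult\<close>)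
  also have "\<dots> = (LINT x|lborel. cmod (cnj (ux s x) * utx s x)) + (LINT x|lborel. cmod (cnj (Nu s x) * ut s x))"
    using i1 i3 by (intro Bochner_Integration.integral_add integrable_norm)
  also have "\<dots> \<le> L2norm (ux s) * L2norm (utx s) + L2norm (Nu s) * L2norm (ut s)"
    by (intro add_mono prod_abs_le L2s Nu assms)
  finally show "(LINT x|lborel. \<bar>dE s x\<bar>) \<le> L2norm (ux s) * L2norm (utx s) + L2norm (Nu s) * L2norm (ut s)" .
  define F where "F x = uxx s x + Nu s x" for x
  have LF: "L2 F" "L2norm F \<le> L2norm (uxx s) + L2norm (Nu s)"
    unfolding F_def by (intro L2_add L2s Nu assms)+
  have "(LINT x|lborel. cnj (uxx s x) * ut s x + cnj (ux s x) * utx s x) = 0"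
    by (rule prim_integral_zero[OF prim_mult[OF prim_cnj[OF prims(2)] prims(3)]]) (intro i4 Bochner_Integration.integrable_add i1 i2)+
  then have bp: "(LINT x|lborel. cnj (ux s x) * utx s x) = - (LINT x|lborel. cnj (uxx s x) * ut s x)"
    using i1 i2 by (simp add: eq_neg_iff_add_eq_0 add.commute)
  have "(LINT x|lborel. dE s x) = Re (LINT x|lborel. cnj (ux s x) * utx s x) - Re (LINT x|lborel. cnj (Nu s x) * ut s x)"
    unfolding moll_dE_def using i1 i3
    by (simp only: Bochner_Integration.integral_diff[OF Re_integrable[OF i1] Re_integrable[OF i3]] Re_integral)
  also have "\<dots> = - Re ((LINT x|lborel. cnj (uxx s x) * ut s x) + (LINT x|lborel. cnj (Nu s x) * ut s x))"
    unfolding bp by simp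
  also have "(LINT x|lborel. cnj (uxx s x) * ut s x) + (LINT x|lborel. cnj (Nu s x) * ut s x) = (LINT x|lborel. cnj (F x) * ut s x)"
    unfolding Bochner_Integration.integral_add[OF i2 i3, symmetric] by (simp add: F_def algebra_simps)
  also have "Re (LINT x|lborel. cnj (F x) * ut s x) = (LINT x|lborel. Re (cnj (F x) * ut s x))"
    by (rule Re_integral[symmetric, OF prod_int[OF LF(1) L2s(4)]])
  also have "\<dots> = (LINT x|lborel. - Im (cnj (F x) * Rm s x))"
  proof (rule Bochner_Integration.integral_cong[OF refl])
    fix x
    have a: "ut s x = \<i> * (F x + Rm s x)" by (simp add: moll_ut_def F_def moll_Rm_def)
    show "Re (cnj (F x) * ut s x) = - Im (cnj (F x) * Rm s x)" unfolding a by (simp add: algebra_simps)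
  qed
  also have "\<dots> = - Im (LINT x|lborel. cnj (F x) * Rm s x)"
    unfolding Bochner_Integration.integral_minus Im_integral[OF prod_int[OF LF(1) Rm(1)[OF assms]]] ..
  finally have "\<bar>LINT x|lborel. dE s x\<bar> \<le> cmod (LINT x|lborel. cnj (F x) * Rm s x)"
    using abs_Im_le_cmod by simp
  also have "\<dots> \<le> L2norm F * L2norm (Rm s)" by (rule prod_le[OF LF(1) Rm(1)[OF assms]])
  also have "\<dots> \<le> (L2norm (uxx s) + L2norm (Nu s)) * L2norm (Rm s)"
    by (intro mult_right_mono LF) auto
  finally show "\<bar>LINT x|lborel. dE s x\<bar> \<le> (L2norm (uxx s) + L2norm (Nu s)) * L2norm (Rm s)" .
qed

lemma qE_integral:
  assumes "s \<in> S"
  shows "integrable lborel (qE s)"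
    and "(LINT x|lborel. qE s x) = 1/2 * (L2norm (ux s))^2 + 1/4 * (L2norm (\<lambda>x. 1 - (cmod (u s x))^2))^2"
proof -
  note i = L2_int[OF L2s(1), of s] L2_int[OF eta_u(1)[OF assms]]
  show "integrable lborel (qE s)" unfolding moll_qE_def[abs_def] using i by simp
  show "(LINT x|lborel. qE s x) = 1/2 * (L2norm (ux s))^2 + 1/4 * (L2norm (\<lambda>x. 1 - (cmod (u s x))^2))^2"
    unfolding moll_qE_def L2norm_power2 using i by simp
qed

lemma energy_mollified:
  assumes t: "t1 \<le> t2" "{t1..t2} \<subseteq> S"
  shows "\<bar>(LINT x|lborel. qE t2 x) - (LINT x|lborel. qE t1 x)\<bar>
     \<le> ((LINT y|lborel. \<bar>\<phi>1 y\<bar>) * M + (M + 5 * M^3)) * (5 * M^3 * (e * sqrt e)) * (t2 - t1)"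
proof (rule time_integral_bound[where q=qE and dq=dE])
  define c1 c2 where "c1 = (LINT y|lborel. \<bar>\<phi>1 y\<bar>)" and "c2 = (LINT y|lborel. \<bar>\<phi>2 y\<bar>)"
  have c: "c1 \<ge> 0" "c2 \<ge> 0" by (simp_all add: c1_def c2_def)
  show "continuous_on UNIV (\<lambda>p. dE (fst p) (snd p))"
    unfolding moll_dE_def moll_Nu_def NL_def by (intro continuous_intros joints)
  fix s assume "s \<in> {t1..t2}" then have s: "s \<in> S" using t by blast
  show "integrable lborel (dE s)" by (rule dE_integrable(1)[OF s])
  show "(LINT x|lborel. \<bar>dE s x\<bar>) \<le> M * (c2 * M + c1 * M) + (M + 5 * M^3) * (c1 * M + M)"
    by (rule order_trans[OF dE_integrable(2)[OF s]])
       (intro add_mono mult_mono ux_le utx_le[folded c1_def c2_def] Nu(2) ut_le[folded c1_def] s L2norm_nonneg; use M in simp)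
  show "\<bar>LINT x|lborel. dE s x\<bar> \<le> ((LINT y|lborel. \<bar>\<phi>1 y\<bar>) * M + (M + 5 * M^3)) * (5 * M^3 * (e * sqrt e))"
    by (rule order_trans[OF dE_integrable(3)[OF s]])
       (intro mult_mono add_mono uxx_le Nu(2) Rm(2) s L2norm_nonneg add_nonneg_nonneg mult_nonneg_nonneg; use M c c1_def in simp)
qed (use t qE_deriv qE_integral(1) in auto)


lemma qP_deriv: "((\<lambda>s. qP r s x) has_real_derivative dP r t x) (at t)"
proof -
  have a: "((\<lambda>s. cnj (u s x - u r x)) has_vector_derivative cnj (ut t x)) (at t)"
    using has_vector_derivative_diff[OF time_u[of x t] has_vector_derivative_const[of "u r x"]]
    by (intro bounded_linear.has_vector_derivative[OF bounded_linear_cnj]) simp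
  have b: "((\<lambda>s. ux r x + ux s x) has_vector_derivative utx t x) (at t)"
    using has_vector_derivative_add[OF has_vector_derivative_const[of "ux r x"] time_ux[of x t]] by simp
  have "((\<lambda>s. Im (cnj (u s x - u r x) * (ux r x + ux s x))) has_vector_derivative
     Im (cnj (u t x - u r x) * utx t x + cnj (ut t x) * (ux r x + ux t x))) (at t)"
    by (rule bounded_linear.has_vector_derivative[OF bounded_linear_Im has_vector_derivative_mult[OF a b]])
  then have "((\<lambda>s. Im (cnj (u s x - u r x) * (ux r x + ux s x))) has_real_derivative
     Im (cnj (u t x - u r x) * utx t x + cnj (ut t x) * (ux r x + ux t x))) (at t)"
    by (simp only: has_real_derivative_iff_has_vector_derivative)
  from DERIV_cmult[OF this, of "1/2"] show ?thesis
    unfolding moll_qP_def moll_dP_def by (simp add: add.commute)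
qed

lemma w_L2: "L2 (\<lambda>x. u s x - u r x)" "L2norm (\<lambda>x. u s x - u r x) \<le> L2norm (\<lambda>x. V s x - V r x)"
proof -
  have eq: "(\<lambda>x. u s x - u r x) = conv (\<lambda>x. V s x - V r x) \<phi>0"
    by (rule ext) (simp add: moll_u_def conv_diff[OF li_V li_V tests(1)])
  show "L2 (\<lambda>x. u s x - u r x)" unfolding eq by (rule conv_L2(1)[OF L2_d tests(1)])
  show "L2norm (\<lambda>x. u s x - u r x) \<le> L2norm (\<lambda>x. V s x - V r x)" unfolding eq
    using conv_L2(2)[OF L2_d tests(1), of s r] mol_abs_integral[OF e(1)] by (simp add: moll_phi0_def)
qed

lemma qP_integrable: "integrable lborel (qP r s)"
  unfolding moll_qP_def[abs_def]
  by (intro integrable_mult_right Im_integrable prod_int w_L2(1) L2_add(1) L2s)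

text \<open>An integration by parts reduces the integral of \<open>dP\<close> to that of
  \<open>Im (cnj ut * ux)\<close>. After inserting the equation, \<open>uxx\<close> contributes a
  multiple of the derivative of \<open>(cmod ux)^2\<close> and \<open>Nu\<close> a multiple of the
  derivative of \<open>(1 - (cmod u)^2)^2\<close>; both integrate to 0 and the commutator
  remains.\<close>

lemma dP_integrable:
  assumes "s \<in> S" "r \<in> S"
  shows "integrable lborel (dP r s)"
    and "(LINT x|lborel. \<bar>dP r s x\<bar>) \<le> L2norm (ut s) * (L2norm (ux r) + L2norm (ux s)) + L2norm (\<lambda>x. V s x - V r x) * L2norm (utx s)"
    and "\<bar>LINT x|lborel. dP r s x\<bar> \<le> L2norm (Rm s) * L2norm (ux s)"
proof -
  have Ls: "L2 (\<lambda>x. ux r x + ux s x)" "L2norm (\<lambda>x. ux r x + ux s x) \<le> L2norm (ux r) + L2norm (ux s)"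
    by (intro L2_add L2s)+
  have Ld: "L2 (\<lambda>x. ux s x - ux r x)" by (intro L2_diff L2s)
  note i1 = prod_int[OF L2s(4)[of s] Ls(1)] and i2 = prod_int[OF w_L2(1)[of s r] L2s(5)[of s]]
    and i3 = prod_int[OF w_L2(1)[of s r] L2s(4)[of s]] and i4 = prod_int[OF Ld L2s(4)[of s]]
    and i5 = prod_int[OF L2s(4)[of s] Ld] and i6 = prod_int[OF L2s(4)[of s] L2s(1)[of s]]
  show I: "integrable lborel (dP r s)" unfolding moll_dP_def[abs_def]
    by (intro integrable_mult_right Im_integrable Bochner_Integration.integrable_add i1 i2)
  have "(LINT x|lborel. \<bar>dP r s x\<bar>) \<le> (LINT x|lborel. cmod (cnj (ut s x) * (ux r x + ux s x)) + cmod (cnj (u s x - u r x) * utx s x))"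
  proof (rule integral_mono)
    show "\<bar>dP r s x\<bar> \<le> cmod (cnj (ut s x) * (ux r x + ux s x)) + cmod (cnj (u s x - u r x) * utx s x)" for x
    proof -
      have "\<bar>dP r s x\<bar> = 1/2 * \<bar>Im (cnj (ut s x) * (ux r x + ux s x) + cnj (u s x - u r x) * utx s x)\<bar>"
        unfolding moll_dP_def abs_mult by simp
      also have "\<dots> \<le> \<bar>Im (cnj (ut s x) * (ux r x + ux s x) + cnj (u s x - u r x) * utx s x)\<bar>" by simp
      also have "\<dots> \<le> cmod (cnj (ut s x) * (ux r x + ux s x) + cnj (u s x - u r x) * utx s x)" by (rule abs_Im_le_cmod)
      also have "\<dots> \<le> cmod (cnj (ut s x) * (ux r x + ux s x)) + cmod (cnj (u s x - u r x) * utx s x)" by (rule norm_triangle_ineq)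
      finally show ?thesis .
    qed
  qed (use I i1 i2 in \<open>auto simp del: norm_mult\<close>)
  also have "\<dots> = (LINT x|lborel. cmod (cnj (ut s x) * (ux r x + ux s x))) + (LINT x|lborel. cmod (cnj (u s x - u r x) * utx s x))"
    using i1 i2 by (intro Bochner_Integration.integral_add integrable_norm)
  also have "\<dots> \<le> L2norm (ut s) * L2norm (\<lambda>x. ux r x + ux s x) + L2norm (\<lambda>x. u s x - u r x) * L2norm (utx s)"
    by (intro add_mono prod_abs_le L2s Ls w_L2)
  also have "\<dots> \<le> L2norm (ut s) * (L2norm (ux r) + L2norm (ux s)) + L2norm (\<lambda>x. V s x - V r x) * L2norm (utx s)"
    by (intro add_mono mult_left_mono mult_right_mono Ls(2) w_L2(2)) auto
  finally show "(LINT x|lborel. \<bar>dP r s x\<bar>) \<le> L2norm (ut s) * (L2norm (ux r) + L2norm (ux s)) + L2norm (\<lambda>x. V s x - V r x) * L2norm (utx s)" .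
  have "(LINT x|lborel. cnj (ux s x - ux r x) * ut s x + cnj (u s x - u r x) * utx s x) = 0"
    by (rule prim_integral_zero[OF prim_mult[OF prim_cnj[OF prim_diff[OF prims(1) prims(1)]] prims(3)]])
       (intro i3 Bochner_Integration.integrable_add i4 i2)+
  then have bp: "(LINT x|lborel. cnj (u s x - u r x) * utx s x) = - (LINT x|lborel. cnj (ux s x - ux r x) * ut s x)"
    using i4 i2 by (simp add: eq_neg_iff_add_eq_0 add.commute)
  have "(LINT x|lborel. dP r s x) = 1/2 * Im ((LINT x|lborel. cnj (ut s x) * (ux r x + ux s x)) + (LINT x|lborel. cnj (u s x - u r x) * utx s x))"
    unfolding moll_dP_def integral_mult_right_zero Im_integral[OF Bochner_Integration.integrable_add[OF i1 i2]]
      Bochner_Integration.integral_add[OF i1 i2] ..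
  also have "\<dots> = 1/2 * ((LINT x|lborel. Im (cnj (ut s x) * (ux r x + ux s x))) + (LINT x|lborel. Im (cnj (ut s x) * (ux s x - ux r x))))"
  proof -
    have "(LINT x|lborel. Im (cnj (ut s x) * (ux s x - ux r x))) = (LINT x|lborel. - Im (cnj (ux s x - ux r x) * ut s x))"
      by (intro Bochner_Integration.integral_cong refl) (simp add: algebra_simps)
    then have "(LINT x|lborel. Im (cnj (ut s x) * (ux s x - ux r x))) = - Im (LINT x|lborel. cnj (ux s x - ux r x) * ut s x)"
      unfolding Bochner_Integration.integral_minus Im_integral[OF i4] .
    then show ?thesis unfolding bp Im_integral[OF i1] by simp
  qed
  also have "\<dots> = 1/2 * (LINT x|lborel. Im (cnj (ut s x) * (ux r x + ux s x)) + Im (cnj (ut s x) * (ux s x - ux r x)))"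
    unfolding Bochner_Integration.integral_add[OF Im_integrable[OF i1] Im_integrable[OF i5]] ..
  also have "(LINT x|lborel. Im (cnj (ut s x) * (ux r x + ux s x)) + Im (cnj (ut s x) * (ux s x - ux r x))) = (LINT x|lborel. 2 * Im (cnj (ut s x) * ux s x))"
    by (intro Bochner_Integration.integral_cong refl) (simp add: algebra_simps)
  also have "1/2 * \<dots> = (LINT x|lborel. Im (cnj (ut s x) * ux s x))"
    unfolding integral_mult_right_zero by simp
  also have "\<dots> = (LINT x|lborel. - (Re (cnj (uxx s x) * ux s x) + Re (cnj (Nu s x) * ux s x) + Re (cnj (Rm s x) * ux s x)))"
    by (intro Bochner_Integration.integral_cong refl) (simp add: moll_ut_def moll_Rm_def algebra_simps)
  also have "\<dots> = - ((LINT x|lborel. Re (cnj (uxx s x) * ux s x)) + (LINT x|lborel. Re (cnj (Nu s x) * ux s x)) + (LINT x|lborel. Re (cnj (Rm s x) * ux s x)))"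
    unfolding Bochner_Integration.integral_minus
    by (subst Bochner_Integration.integral_add, intro Bochner_Integration.integrable_add Re_integrable prod_int L2s Nu Rm assms,
        intro Re_integrable prod_int L2s Rm assms,
        subst Bochner_Integration.integral_add, (intro Re_integrable prod_int L2s Nu Rm assms)+, rule refl)
  also have "(LINT x|lborel. Re (cnj (uxx s x) * ux s x)) = 0"
  proof -
    note j1 = prod_int[OF L2s(2)[of s] L2s(1)[of s]] and j2 = prod_int[OF L2s(1)[of s] L2s(2)[of s]]
      and j3 = prod_int[OF L2s(1)[of s] L2s(1)[of s]]
    have "(LINT x|lborel. cnj (uxx s x) * ux s x + cnj (ux s x) * uxx s x) = 0"
      by (rule prim_integral_zero[OF prim_mult[OF prim_cnj[OF prims(2)] prims(2)]])
         (intro j3 Bochner_Integration.integrable_add j1 j2)+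
    then have "(LINT x|lborel. Re (cnj (uxx s x) * ux s x + cnj (ux s x) * uxx s x)) = 0"
      using Re_integral[OF Bochner_Integration.integrable_add[OF j1 j2]] by simp
    moreover have "(LINT x|lborel. Re (cnj (uxx s x) * ux s x + cnj (ux s x) * uxx s x)) = (LINT x|lborel. 2 * Re (cnj (uxx s x) * ux s x))"
      by (intro Bochner_Integration.integral_cong refl) (simp add: algebra_simps)
    ultimately have "(LINT x|lborel. 2 * Re (cnj (uxx s x) * ux s x)) = 0" by (simp only:)
    then show ?thesis unfolding integral_mult_right_zero by simp
  qed
  also have "(LINT x|lborel. Re (cnj (Nu s x) * ux s x)) = 0"
  proof -
    \<comment> \<open>The function \<open>1 - (cmod u)^2\<close> is taken complex-valued so that
      \<open>prim_mult\<close> applies to its square, whose derivative is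
      \<open>(-4) * Re (cnj Nu * ux)\<close>.\<close>
    define H where "H x = 1 - u s x * cnj (u s x)" for x
    define H' where "H' x = 0 - (ux s x * cnj (u s x) + u s x * cnj (ux s x))" for x
    have H: "H x = of_real (1 - (cmod (u s x))^2)" for x
      by (simp add: H_def complex_norm_square[symmetric] del: of_real_power)
    have p: "prim H H'" unfolding H_def H'_def
      by (intro prim_diff prim_const prim_mult prims prim_cnj)
    have LH: "L2 H"
      by (rule L2_bound[OF prim_meas'[OF p] eta_u(1)[OF assms(1)], where K=1])
         (simp add: H norm_of_real del: of_real_diff of_real_power)
    have bH: "cmod (H' x) \<le> (2 * M) * cmod (ux s x)" for x
    proof -
      have "cmod (H' x) \<le> cmod (ux s x * cnj (u s x)) + cmod (u s x * cnj (ux s x))"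
        unfolding H'_def by (metis diff_0 norm_minus_cancel norm_triangle_ineq)
      also have "\<dots> = 2 * cmod (u s x) * cmod (ux s x)" by (simp add: norm_mult)
      also have "\<dots> \<le> 2 * M * cmod (ux s x)" using u_le[OF assms(1), of x] by (intro mult_right_mono mult_left_mono) auto
      finally show ?thesis .
    qed
    have LH': "L2 H'" by (rule L2_bound[OF prim_meas[OF p] L2s(1)[of s]]) (use bH in auto)
    note k = L2_prod_integrable[OF LH LH'] L2_prod_integrable[OF LH' LH]
    have "(LINT x|lborel. H' x * H x + H x * H' x) = 0"
      by (rule prim_integral_zero[OF prim_mult[OF p p]])
         (intro L2_prod_integrable[OF LH LH] Bochner_Integration.integrable_add k)+
    then have "(LINT x|lborel. Re (H' x * H x + H x * H' x)) = 0"
      using Re_integral[OF Bochner_Integration.integrable_add[OF k(2) k(1)]] by simp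
    moreover have "(LINT x|lborel. Re (H' x * H x + H x * H' x)) = (LINT x|lborel. (-4) * Re (cnj (Nu s x) * ux s x))"
    proof (intro Bochner_Integration.integral_cong refl)
      fix x
      have "Re (H' x) = - 2 * Re (cnj (u s x) * ux s x)" by (simp add: H'_def algebra_simps)
      moreover have "Re (H' x * H x + H x * H' x) = 2 * (1 - (cmod (u s x))^2) * Re (H' x)"
        unfolding H by simp
      moreover have "Re (cnj (Nu s x) * ux s x) = (1 - (cmod (u s x))^2) * Re (cnj (u s x) * ux s x)"
        by (simp add: moll_Nu_def NL_def mult.assoc del: of_real_diff)
      ultimately show "Re (H' x * H x + H x * H' x) = (-4) * Re (cnj (Nu s x) * ux s x)"
        by (simp only:)
    qed
    ultimately have "(LINT x|lborel. (-4) * Re (cnj (Nu s x) * ux s x)) = 0" by (simp only:)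
    then show ?thesis unfolding integral_mult_right_zero by simp
  qed
  finally have "(LINT x|lborel. dP r s x) = - Re (LINT x|lborel. cnj (Rm s x) * ux s x)"
    using Re_integral[OF prod_int[OF Rm(1)[OF assms(1)] L2s(1)[of s]]] by simp
  then have "\<bar>LINT x|lborel. dP r s x\<bar> \<le> cmod (LINT x|lborel. cnj (Rm s x) * ux s x)"
    using abs_Re_le_cmod by simp
  also have "\<dots> \<le> L2norm (Rm s) * L2norm (ux s)" by (rule prod_le[OF Rm(1)[OF assms(1)] L2s(1)])
  finally show "\<bar>LINT x|lborel. dP r s x\<bar> \<le> L2norm (Rm s) * L2norm (ux s)" .
qed

text \<open>The relative momentum vanishes at the reference time \<open>t1\<close>. Its error pairs
  the commutator with \<open>ux\<close> rather than \<open>uxx\<close>, so no negative power of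
  \<open>e\<close> appears.\<close>

lemma momentum_mollified:
  assumes t: "t1 \<le> t2" "{t1..t2} \<subseteq> S"
  shows "\<bar>LINT x|lborel. qP t1 t2 x\<bar> \<le> (5 * M^3 * (e * sqrt e)) * M * (t2 - t1)"
proof -
  define c1 c2 where "c1 = (LINT y|lborel. \<bar>\<phi>1 y\<bar>)" and "c2 = (LINT y|lborel. \<bar>\<phi>2 y\<bar>)"
  have c: "c1 \<ge> 0" "c2 \<ge> 0" by (simp_all add: c1_def c2_def)
  obtain K where K: "\<And>s. s \<in> {t1..t2} \<Longrightarrow> L2norm (\<lambda>x. V s x - V t1 x) \<le> K"
    using L2_time_bounded[of V, OF L2_d cV] by blast
  have K0: "K \<ge> 0" using K[of t1] t L2norm_nonneg order_trans by (metis atLeastAtMost_iff order_refl)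
  have t1S: "t1 \<in> S" using t by auto
  have "\<bar>(LINT x|lborel. qP t1 t2 x) - (LINT x|lborel. qP t1 t1 x)\<bar> \<le> (5 * M^3 * (e * sqrt e)) * M * (t2 - t1)"
  proof (rule time_integral_bound[where q="qP t1" and dq="dP t1"])
    show "continuous_on UNIV (\<lambda>p. dP t1 (fst p) (snd p))"
      unfolding moll_dP_def
      by (intro continuous_intros joints continuous_on_compose2[OF prim_cont[OF prims(1)[of t1], of UNIV]]
            continuous_on_compose2[OF prim_cont[OF prims(2)[of t1], of UNIV]]) auto
    fix s assume s': "s \<in> {t1..t2}" then have s: "s \<in> S" using t by blast
    show "integrable lborel (dP t1 s)" by (rule dP_integrable(1)[OF s t1S])
    show "(LINT x|lborel. \<bar>dP t1 s x\<bar>) \<le> (c1 * M + M) * (M + M) + K * (c2 * M + c1 * M)"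
      by (rule order_trans[OF dP_integrable(2)[OF s t1S]])
         (intro add_mono mult_mono ux_le utx_le[folded c1_def c2_def] ut_le[folded c1_def] s t1S K[OF s'] L2norm_nonneg add_nonneg_nonneg; use M c K0 in simp)
    show "\<bar>LINT x|lborel. dP t1 s x\<bar> \<le> (5 * M^3 * (e * sqrt e)) * M"
      by (rule order_trans[OF dP_integrable(3)[OF s t1S]])
         (intro mult_mono ux_le Rm(2) s L2norm_nonneg; use M e in simp)
  qed (use t qP_deriv qP_integrable in auto)
  moreover have "qP t1 t1 x = 0" for x by (simp add: moll_qP_def)
  ultimately show ?thesis by simp
qed

end

end

section \<open>Removing the mollification\<close>

definition energy :: "(real \<Rightarrow> complex) \<Rightarrow> (real \<Rightarrow> complex) \<Rightarrow> real" where
  "energy v g = 1/2 * (L2norm g)^2 + 1/4 * (L2norm (\<lambda>x. 1 - (cmod (v x))^2))^2"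

context gp_flow begin

text \<open>\<open>uxx\<close> costs a factor \<open>C / e\<close> and the commutator is of order
  \<open>e * sqrt e\<close>, so the drift is of order \<open>sqrt e\<close>; the terms free of
  \<open>1 / e\<close> are absorbed using \<open>e \<le> 1\<close>.\<close>

lemma energy_mollified':
  obtains K M where "K \<ge> 0" "M \<ge> 0" "\<And>e. 0 < e \<Longrightarrow> e \<le> 1 \<Longrightarrow>
    \<bar>energy (conv (V t2) (mol e)) (conv (G t2) (mol e)) - energy (conv (V t1) (mol e)) (conv (G t1) (mol e))\<bar> \<le> K * sqrt e"
    "\<And>e s. 0 < e \<Longrightarrow> e \<le> 1 \<Longrightarrow> s \<in> {t1, t2} \<Longrightarrow>
       \<bar>L2norm (\<lambda>x. 1 - (cmod (conv (V s) (mol e) x))^2) - L2norm (\<lambda>x. 1 - (cmod (V s x))^2)\<bar> \<le> M * e"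
proof -
  define a b where "a = min t1 t2" and "b = max t1 t2"
  have ab: "a \<le> b" by (simp add: a_def b_def)
  obtain M where M: "M \<ge> 1" "\<And>s x. s \<in> {a..b} \<Longrightarrow> cmod (V s x) \<le> M" "\<And>s. s \<in> {a..b} \<Longrightarrow> L2norm (G s) \<le> M"
    "\<And>s. s \<in> {a..b} \<Longrightarrow> L2norm (\<lambda>x. NL (V s x)) \<le> M" using bounds[of a b] by blast
  obtain C where C: "C > 0" "\<And>e. e > 0 \<Longrightarrow> (LINT y|lborel. \<bar>deriv (mol e) y\<bar>) \<le> C / e"
    using mol_deriv_bound by metis
  define K where "K = (C * M + (M + 5 * M^3)) * (5 * M^3) * (b - a)"
  have K0: "K \<ge> 0" unfolding K_def using C(1) M(1) ab by (intro mult_nonneg_nonneg add_nonneg_nonneg) auto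
  have main: "\<bar>energy (conv (V b) (mol e)) (conv (G b) (mol e)) - energy (conv (V a) (mol e)) (conv (G a) (mol e))\<bar> \<le> K * sqrt e"
    if e: "0 < e" "e \<le> 1" for e
  proof -
    have en: "(LINT x|lborel. moll_qE e s x) = energy (conv (V s) (mol e)) (conv (G s) (mol e))" if "s \<in> {a..b}" for s
    proof -
      have "(LINT x|lborel. moll_qE e s x) = 1/2 * (L2norm (moll_ux e s))^2 + 1/4 * (L2norm (\<lambda>x. 1 - (cmod (moll_u e s x))^2))^2"
        by (rule qE_integral(2)[where S="{a..b}" and M=M]) (use e M that in auto)
      then show ?thesis by (simp add: energy_def moll_u_def moll_ux_def moll_phi0_def)
    qed
    have i: "(LINT y|lborel. \<bar>moll_phi1 e y\<bar>) \<le> C / e" using C(2)[OF e(1)] by (simp add: moll_phi1_def)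
    have "\<bar>(LINT x|lborel. moll_qE e b x) - (LINT x|lborel. moll_qE e a x)\<bar> \<le> ((LINT y|lborel. \<bar>moll_phi1 e y\<bar>) * M + (M + 5 * M^3)) * (5 * M^3 * (e * sqrt e)) * (b - a)"
      by (rule energy_mollified[where S="{a..b}"]) (use e M ab in auto)
    also have "\<dots> \<le> (C / e * M + (M + 5 * M^3) / e) * (5 * M^3 * (e * sqrt e)) * (b - a)"
    proof (intro mult_right_mono add_mono i)
      have "(M + 5 * M^3) * e \<le> M + 5 * M^3" using e M(1) by (intro mult_right_le_one_le) auto
      then show "M + 5 * M^3 \<le> (M + 5 * M^3) / e" using e by (simp add: pos_le_divide_eq)
    qed (use M(1) e ab in auto)
    also have "\<dots> = K * sqrt e" using e by (simp add: K_def field_simps)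
    finally show ?thesis using en ab by simp
  qed
  show thesis
  proof (rule that[OF K0, of "2 * M^2"])
    fix e :: real assume e: "0 < e" "e \<le> 1"
    show "\<bar>energy (conv (V t2) (mol e)) (conv (G t2) (mol e)) - energy (conv (V t1) (mol e)) (conv (G t1) (mol e))\<bar> \<le> K * sqrt e"
      using main[OF e] unfolding a_def b_def by (cases "t1 \<le> t2") (auto simp: abs_minus_commute min_def max_def)
    fix s assume "s \<in> {t1, t2}"
    then have s: "s \<in> {a..b}" by (auto simp: a_def b_def)
    have "\<bar>L2norm (\<lambda>x. 1 - (cmod (moll_u e s x))^2) - L2norm (\<lambda>x. 1 - (cmod (V s x))^2)\<bar> \<le> 2 * M^2 * e"
      by (rule eta_u(2)[where S="{a..b}"]) (use e M s in auto)
    then show "\<bar>L2norm (\<lambda>x. 1 - (cmod (conv (V s) (mol e) x))^2) - L2norm (\<lambda>x. 1 - (cmod (V s x))^2)\<bar> \<le> 2 * M^2 * e"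
      by (simp add: moll_u_def moll_phi0_def)
  qed (use M(1) in simp)
qed

text \<open>At time \<open>b\<close> the gradient term is recovered by lower semicontinuity, at time
  \<open>a\<close> it is bounded because mollification contracts the norm, and the potential terms
  converge. As \<open>a\<close> and \<open>b\<close> are arbitrary, the inequality is
  conservation.\<close>

lemma energy_le: "energy (V b) (G b) \<le> energy (V a) (G a)"
proof -
  obtain K M where KM: "K \<ge> 0" "M \<ge> 0" "\<And>e. 0 < e \<Longrightarrow> e \<le> 1 \<Longrightarrow>
    \<bar>energy (conv (V b) (mol e)) (conv (G b) (mol e)) - energy (conv (V a) (mol e)) (conv (G a) (mol e))\<bar> \<le> K * sqrt e"
    "\<And>e s. 0 < e \<Longrightarrow> e \<le> 1 \<Longrightarrow> s \<in> {a, b} \<Longrightarrow>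
       \<bar>L2norm (\<lambda>x. 1 - (cmod (conv (V s) (mol e) x))^2) - L2norm (\<lambda>x. 1 - (cmod (V s x))^2)\<bar> \<le> M * e"
    using energy_mollified'[of b a] by blast
  define s where "s n = inverse (real (Suc n))" for n
  have s: "s n > 0" "s n \<le> 1" "s \<longlonglongrightarrow> 0" for n
    using inverse_Suc_pos_tendsto by (auto simp: s_def[abs_def] inverse_le_1_iff)
  define h where "h t n = L2norm (\<lambda>x. 1 - (cmod (conv (V t) (mol (s n)) x))^2)" for t n
  have h: "(\<lambda>n. h t n) \<longlonglongrightarrow> L2norm (\<lambda>x. 1 - (cmod (V t x))^2)" if "t \<in> {a,b}" for t
  proof (rule Lim_null[THEN iffD2], rule Lim_null_comparison[OF always_eventually])
    show "\<forall>n. norm (h t n - L2norm (\<lambda>x. 1 - (cmod (V t x))^2)) \<le> M * s n"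
      using KM(4)[OF s(1,2) that] by (simp add: h_def)
    show "(\<lambda>n. M * s n) \<longlonglongrightarrow> 0" using tendsto_mult_left[OF s(3), of M] by simp
  qed
  have "(L2norm (G b))^2 \<le> (L2norm (G a))^2 + 1/2 * (L2norm (\<lambda>x. 1 - (cmod (V a x))^2))^2 + 2 * (K * sqrt 0) - 1/2 * (L2norm (\<lambda>x. 1 - (cmod (V b x))^2))^2"
  proof (rule L2norm_lsc[OF L2_G s(1,3)])
    show "(\<lambda>n. (L2norm (G a))^2 + 1/2 * (h a n)^2 + 2 * (K * sqrt (s n)) - 1/2 * (h b n)^2)
       \<longlonglongrightarrow> (L2norm (G a))^2 + 1/2 * (L2norm (\<lambda>x. 1 - (cmod (V a x))^2))^2 + 2 * (K * sqrt 0) - 1/2 * (L2norm (\<lambda>x. 1 - (cmod (V b x))^2))^2"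
      by (intro tendsto_intros h s) auto
    fix n
    have "L2norm (conv (G a) (mol (s n))) \<le> 1 * L2norm (G a)"
      using conv_L2(2)[OF L2_G mol_test[OF s(1)], of a n] mol_abs_integral[OF s(1)] by simp
    then have "(L2norm (conv (G a) (mol (s n))))^2 \<le> (L2norm (G a))^2" by (intro power_mono) auto
    then show "(L2norm (conv (G b) (mol (s n))))^2 \<le> (L2norm (G a))^2 + 1/2 * (h a n)^2 + 2 * (K * sqrt (s n)) - 1/2 * (h b n)^2"
      using KM(3)[OF s(1,2), of n] unfolding energy_def h_def[symmetric] by linarith
  qed
  then show ?thesis by (simp add: energy_def)
qed

lemma momentum_zero:
  "Im (LINT x|lborel. cnj (V b x - V a x) * (G a x + G b x)) = 0"
proof -
  have main: "Im (LINT x|lborel. cnj (V b x - V a x) * (G a x + G b x)) = 0" if ab: "a \<le> b" for a b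
  proof -
    obtain M where M: "M \<ge> 1" "\<And>s x. s \<in> {a..b} \<Longrightarrow> cmod (V s x) \<le> M" "\<And>s. s \<in> {a..b} \<Longrightarrow> L2norm (G s) \<le> M"
      "\<And>s. s \<in> {a..b} \<Longrightarrow> L2norm (\<lambda>x. NL (V s x)) \<le> M" using bounds[of a b] by blast
    define w where "w x = V b x - V a x" for x
    define w' where "w' x = G b x - G a x" for x
    define f where "f x = V a x + V b x" for x
    define g where "g x = G a x + G b x" for x
    have pw: "prim w w'" unfolding w_def w'_def by (rule prim_diff[OF prim_V prim_V])
    have pf: "prim f g" unfolding f_def g_def by (rule prim_add[OF prim_V prim_V])
    have Lw: "L2 w" unfolding w_def by (rule L2_d)
    have Lw': "L2 w'" unfolding w'_def by (rule L2_dG)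
    have Lg: "L2 g" unfolding g_def by (rule L2_add(1)[OF L2_G L2_G])
    define I where "I = (LINT x|lborel. cnj (w x) * g x)"
    define C where "C = (5 * M^3) * M * (b - a) + L2norm w' * L2norm g"
    have bd: "\<bar>1/2 * Im I\<bar> \<le> C * e" if e: "0 < e" "e \<le> 1" for e
    proof -
      note te = mol_test[OF e(1)]
      define Jw where "Jw = conv w (mol e)"
      define Jf where "Jf = conv f (mol e)"
      define Jg where "Jg = conv g (mol e)"
      have LJg: "L2 Jg" "L2norm Jg \<le> L2norm g"
        using conv_L2[OF Lg te] mol_abs_integral[OF e(1)] by (auto simp: Jg_def)
      have LJw: "L2 Jw" using conv_L2[OF Lw te] by (auto simp: Jw_def)
      note A = conv_approx[OF pw Lw' e(1), folded Jw_def] and B = conv_approx[OF pf Lg e(1), folded Jf_def]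
      have pJf: "prim (\<lambda>x. f x - Jf x) (\<lambda>x. g x - Jg x)"
        unfolding Jf_def Jg_def by (intro prim_diff pf prim_conv' te)
      have q: "(LINT x|lborel. moll_qP e a b x) = 1/2 * Im (LINT x|lborel. cnj (Jw x) * Jg x)"
      proof -
        have eq: "moll_qP e a b x = 1/2 * Im (cnj (Jw x) * Jg x)" for x
        proof -
          have "Jw x = conv (V b) (mol e) x - conv (V a) (mol e) x"
            unfolding Jw_def w_def by (rule conv_diff[OF li_V li_V te])
          moreover have "Jg x = conv (G a) (mol e) x + conv (G b) (mol e) x"
            unfolding Jg_def g_def conv_def distrib_right
            by (rule Bochner_Integration.integral_add[OF conv_integrable[OF li_G te] conv_integrable[OF li_G te]])
          ultimately show ?thesis
            by (simp add: moll_qP_def moll_u_def moll_ux_def moll_phi0_def)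
        qed
        show ?thesis unfolding eq integral_mult_right_zero
            Im_integral[OF L2_prod_integrable[OF L2_cnj(1)[OF LJw] LJg(1)]] ..
      qed
      have m: "\<bar>LINT x|lborel. moll_qP e a b x\<bar> \<le> (5 * M^3 * (e * sqrt e)) * M * (b - a)"
        by (rule momentum_mollified[where S="{a..b}"]) (use e M ab in auto)
      note p = L2_prod_integrable[OF L2_cnj(1)]
      have d0: "L2 (\<lambda>x. w x - Jw x)" "L2 (\<lambda>x. g x - Jg x)" by (intro L2_diff Lw LJw Lg LJg)+
      have "(LINT x|lborel. cnj (w' x) * (f x - Jf x) + cnj (w x) * (g x - Jg x)) = 0"
        by (rule prim_integral_zero[OF prim_mult[OF prim_cnj[OF pw] pJf]])
           (intro p Lw B(1) Bochner_Integration.integrable_add Lw' d0)+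
      \<comment> \<open>\<open>g\<close> is merely square-integrable, so no rate in \<open>e\<close>
        is known for \<open>g - Jg\<close>; integrating by parts replaces it by
        \<open>f - Jf\<close>, which is of order \<open>e\<close>, and puts the derivative on
        \<open>w\<close>.\<close>
      then have bp: "(LINT x|lborel. cnj (w x) * (g x - Jg x)) = - (LINT x|lborel. cnj (w' x) * (f x - Jf x))"
        using p[OF Lw' B(1)] p[OF Lw d0(2)] by (simp add: eq_neg_iff_add_eq_0 add.commute)
      have "I - (LINT x|lborel. cnj (Jw x) * Jg x) = (LINT x|lborel. cnj (w x) * g x - cnj (Jw x) * Jg x)"
        unfolding I_def by (rule Bochner_Integration.integral_diff[symmetric, OF p[OF Lw Lg] p[OF LJw LJg(1)]])
      also have "\<dots> = (LINT x|lborel. cnj (w x) * (g x - Jg x) + cnj (w x - Jw x) * Jg x)"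
        by (intro Bochner_Integration.integral_cong refl) (simp add: algebra_simps)
      also have "\<dots> = (LINT x|lborel. cnj (w x) * (g x - Jg x)) + (LINT x|lborel. cnj (w x - Jw x) * Jg x)"
        by (rule Bochner_Integration.integral_add[OF p[OF Lw d0(2)] p[OF d0(1) LJg(1)]])
      finally have "I - (LINT x|lborel. cnj (Jw x) * Jg x) = - (LINT x|lborel. cnj (w' x) * (f x - Jf x)) + (LINT x|lborel. cnj (w x - Jw x) * Jg x)"
        unfolding bp .
      then have "cmod (I - (LINT x|lborel. cnj (Jw x) * Jg x)) \<le> cmod (LINT x|lborel. cnj (w' x) * (f x - Jf x)) + cmod (LINT x|lborel. cnj (w x - Jw x) * Jg x)"
        by (metis norm_minus_cancel norm_triangle_ineq)
      also have "\<dots> \<le> L2norm w' * L2norm (\<lambda>x. f x - Jf x) + L2norm (\<lambda>x. w x - Jw x) * L2norm Jg"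
        using L2_prod_integral_le[OF L2_cnj(1)[OF Lw'] B(1)] L2_prod_integral_le[OF L2_cnj(1)[OF d0(1)] LJg(1)]
        unfolding L2_cnj(2)[OF Lw'] L2_cnj(2)[OF d0(1)] by (rule add_mono)
      also have "\<dots> \<le> L2norm w' * (e * L2norm g) + (e * L2norm w') * L2norm g"
        by (intro add_mono mult_mono A B LJg) (use e in auto)
      finally have "cmod (I - (LINT x|lborel. cnj (Jw x) * Jg x)) \<le> 2 * (L2norm w' * L2norm g) * e" by (simp add: algebra_simps)
      then have "\<bar>Im I - Im (LINT x|lborel. cnj (Jw x) * Jg x)\<bar> \<le> 2 * (L2norm w' * L2norm g) * e"
        using abs_Im_le_cmod[of "I - (LINT x|lborel. cnj (Jw x) * Jg x)"] by simp
      then have "\<bar>1/2 * Im I\<bar> \<le> \<bar>LINT x|lborel. moll_qP e a b x\<bar> + (L2norm w' * L2norm g) * e"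
        unfolding q by (simp add: abs_if split: if_splits)
      also have "\<bar>LINT x|lborel. moll_qP e a b x\<bar> \<le> (5 * M^3) * M * (b - a) * e"
      proof -
        have le: "e * sqrt e \<le> e * 1" using e by (intro mult_left_mono) auto
        have "((5 * M^3) * M * (b - a)) * (e * sqrt e) \<le> ((5 * M^3) * M * (b - a)) * (e * 1)"
          by (rule mult_left_mono[OF le]) (use M(1) ab in simp)
        then show ?thesis using m by (simp add: mult_ac)
      qed
      finally show ?thesis by (simp add: C_def algebra_simps)
    qed
    have "\<bar>1/2 * Im I\<bar> \<le> 0"
    proof (rule tendsto_lowerbound)
      show "((\<lambda>e. C * e) \<longlongrightarrow> 0) (at_right 0)" by (rule tendsto_eq_intros refl | simp)+
      show "\<forall>\<^sub>F e in at_right 0. \<bar>1/2 * Im I\<bar> \<le> C * e"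
      proof -
        have "\<forall>\<^sub>F e in at_right 0. e \<in> {0<..<(1::real)}" by (rule eventually_at_right_real) simp
        then show ?thesis by eventually_elim (rule bd, auto)
      qed
    qed auto
    then show ?thesis by (simp add: I_def w_def g_def)
  qed
  show ?thesis
  proof (cases "a \<le> b")
    case True then show ?thesis by (rule main)
  next
    case False
    then have "Im (LINT x|lborel. cnj (V a x - V b x) * (G b x + G a x)) = 0" by (intro main) simp
    moreover have "(LINT x|lborel. cnj (V b x - V a x) * (G a x + G b x)) = (LINT x|lborel. - (cnj (V a x - V b x) * (G b x + G a x)))"
      by (intro Bochner_Integration.integral_cong refl) (simp add: algebra_simps)
    ultimately show ?thesis by simp
  qed
qed

text \<open>The momenta on \<open>{-R..R}\<close> need not converge separately. Their difference is
  the imaginary part of the integral of \<open>cnj w * (G a + G b)\<close>, which tends to 0 by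
  \<open>momentum_zero\<close>, plus boundary terms \<open>cnj (V a) * w\<close>, which vanish
  because \<open>w\<close> tends to 0 at both ends.\<close>

lemma momentum_tendsto:
  "((\<lambda>R. Im (LINT x:{-R..R}|lborel. cnj (V b x) * G b x) - Im (LINT x:{-R..R}|lborel. cnj (V a x) * G a x)) \<longlongrightarrow> 0) at_top"
  and diff_tendsto: "((\<lambda>x. V b x - V a x) \<longlongrightarrow> 0) at_top" "((\<lambda>x. V b x - V a x) \<longlongrightarrow> 0) at_bot"
proof -
  define w where "w x = V b x - V a x" for x
  define w' where "w' x = G b x - G a x" for x
  have pw: "prim w w'" unfolding w_def w'_def by (rule prim_diff[OF prim_V prim_V])
  have Lw: "L2 w" unfolding w_def by (rule L2_d)
  have Lw': "L2 w'" unfolding w'_def by (rule L2_dG)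
  have Lg: "L2 (\<lambda>x. G a x + G b x)" by (rule L2_add(1)[OF L2_G L2_G])
  note p = L2_prod_integrable[OF L2_cnj(1)]
  have pp: "prim (\<lambda>x. cnj (w x) * w x) (\<lambda>x. cnj (w' x) * w x + cnj (w x) * w' x)"
    by (rule prim_mult[OF prim_cnj[OF pw] pw])
  have ii: "integrable lborel (\<lambda>x. cnj (w' x) * w x + cnj (w x) * w' x)"
    by (intro Bochner_Integration.integrable_add p Lw Lw')
  have sq: "cnj (w x) * w x = of_real ((cmod (w x))^2)" for x
    by (metis complex_norm_square mult.commute)
  have aux: "(w \<longlongrightarrow> 0) F" if "((\<lambda>x. cnj (w x) * w x) \<longlongrightarrow> 0) F" for F
  proof -
    have "((\<lambda>x. sqrt (cmod (cnj (w x) * w x))) \<longlongrightarrow> sqrt (cmod 0)) F" by (intro tendsto_intros that)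
    then show ?thesis unfolding sq by (simp add: tendsto_norm_zero_iff norm_power)
  qed
  have w1: "(w \<longlongrightarrow> 0) at_top" by (rule aux[OF prim_integrable_limits[OF pp p[OF Lw Lw] ii]])
  have w2: "(w \<longlongrightarrow> 0) at_bot" by (rule aux[OF prim_integrable_limits_bot[OF pp p[OF Lw Lw] ii]])
  show "((\<lambda>x. V b x - V a x) \<longlongrightarrow> 0) at_top" "((\<lambda>x. V b x - V a x) \<longlongrightarrow> 0) at_bot"
    using w1 w2 by (simp_all add: w_def[abs_def])
  obtain M where M: "\<And>x. cmod (V a x) \<le> M" using bdd by blast
  have va: "((\<lambda>x. cnj (V a x) * w x) \<longlongrightarrow> 0) F" if "(w \<longlongrightarrow> 0) F" for F
  proof (rule Lim_null_comparison[OF always_eventually])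
    show "\<forall>x. norm (cnj (V a x) * w x) \<le> M * norm (w x)" using M by (simp add: norm_mult mult_right_mono)
    show "((\<lambda>x. M * norm (w x)) \<longlongrightarrow> 0) F" using tendsto_mult_left[OF tendsto_norm_zero[OF that], of M] by simp
  qed
  have pv: "prim (\<lambda>x. cnj (V a x) * w x) (\<lambda>x. cnj (G a x) * w x + cnj (V a x) * w' x)"
    by (rule prim_mult[OF prim_cnj[OF prim_V] pw])
  have i0: "integrable lborel (\<lambda>x. cnj (w x) * (G a x + G b x))" by (rule p[OF Lw Lg])
  have si: "set_integrable lborel {-R..R} (\<lambda>x. cnj (V t x) * G t x)" for R t
    by (rule set_integrable_cont_mult[OF _ loc_integrableD[OF li_G]]) (intro continuous_intros cont_V)
  have si2: "set_integrable lborel {-R..R} (\<lambda>x. cnj (w x) * (G a x + G b x))" for R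
    unfolding set_integrable_def by (intro integrable_mult_indicator i0) auto
  have e: "Im (LINT x:{-R..R}|lborel. cnj (V b x) * G b x) - Im (LINT x:{-R..R}|lborel. cnj (V a x) * G a x)
     = Im (LINT x:{-R..R}|lborel. cnj (w x) * (G a x + G b x)) + Im (cnj (V a R) * w R - cnj (V a (-R)) * w (-R))" if "R \<ge> 0" for R
  proof -
    have s3: "set_integrable lborel {-R..R} (\<lambda>x. cnj (G a x) * w x + cnj (V a x) * w' x)" by (rule primD(1)[OF pv])
    have "cnj (V a R) * w R - cnj (V a (-R)) * w (-R) = (LINT x:{-R..R}|lborel. cnj (G a x) * w x + cnj (V a x) * w' x)"
      by (rule primD(2)[OF pv]) (use that in simp)
    moreover have "Im (LINT x:{-R..R}|lborel. cnj (V b x) * G b x) - Im (LINT x:{-R..R}|lborel. cnj (V a x) * G a x)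
       - Im (LINT x:{-R..R}|lborel. cnj (w x) * (G a x + G b x)) - Im (LINT x:{-R..R}|lborel. cnj (G a x) * w x + cnj (V a x) * w' x)
      = (LINT x:{-R..R}|lborel. Im (cnj (V b x) * G b x - cnj (V a x) * G a x - cnj (w x) * (G a x + G b x) - (cnj (G a x) * w x + cnj (V a x) * w' x)))"
    proof -
      have "set_integrable lborel {-R..R} (\<lambda>x. cnj (V b x) * G b x - cnj (V a x) * G a x - cnj (w x) * (G a x + G b x) - (cnj (G a x) * w x + cnj (V a x) * w' x))"
        by (intro set_integral_diff si si2 s3)
      from set_integrable_linear(2)[OF bounded_linear_Im this] show ?thesis
        by (simp only: set_integral_diff(2)[OF si si] set_integral_diff(2)[OF set_integral_diff(1)[OF si si] si2]
            set_integral_diff(2)[OF set_integral_diff(1)[OF set_integral_diff(1)[OF si si] si2] s3] minus_complex.sel)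
    qed
    \<comment> \<open>The complex expression equals \<open>- 2 * Re (cnj (w x) * G a x)\<close>, so
      it is real.\<close>
    moreover have "Im (cnj (V b x) * G b x - cnj (V a x) * G a x - cnj (w x) * (G a x + G b x) - (cnj (G a x) * w x + cnj (V a x) * w' x)) = 0" for x
      by (simp add: w_def w'_def algebra_simps)
    ultimately show ?thesis by (simp add: set_lebesgue_integral_def)
  qed
  have "((\<lambda>R. Im (LINT x:{-R..R}|lborel. cnj (w x) * (G a x + G b x)) + Im (cnj (V a R) * w R - cnj (V a (-R)) * w (-R)))
     \<longlongrightarrow> Im (LINT x|lborel. cnj (w x) * (G a x + G b x)) + Im (0 - 0)) at_top"
    by (intro tendsto_intros integral_Icc_tendsto i0 va w1)
       (use va[OF w2] in \<open>simp add: filterlim_at_bot_mirror\<close>)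
  moreover have "Im (LINT x|lborel. cnj (w x) * (G a x + G b x)) = 0" unfolding w_def by (rule momentum_zero)
  ultimately have "((\<lambda>R. Im (LINT x:{-R..R}|lborel. cnj (w x) * (G a x + G b x)) + Im (cnj (V a R) * w R - cnj (V a (-R)) * w (-R))) \<longlongrightarrow> 0) at_top"
    by simp
  then show "((\<lambda>R. Im (LINT x:{-R..R}|lborel. cnj (V b x) * G b x) - Im (LINT x:{-R..R}|lborel. cnj (V a x) * G a x)) \<longlongrightarrow> 0) at_top"
    by (rule Lim_transform_eventually) (use eventually_ge_at_top[of 0] in \<open>eventually_elim, simp add: e\<close>)
qed

end

section \<open>Energy on half-lines and the kink\<close>

text \<open>Its derivative \<open>(1 - r^2) / sqrt 2\<close> is, for \<open>r\<close> between 0 and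
  1, the square root of twice the potential, as in the Modica-Mortola argument;
  \<open>Gf 1 = sqrt 2 / 3\<close> is half the energy of the kink.\<close>

definition Gf :: "real \<Rightarrow> real" where "Gf r = (r - r^3/3) / sqrt 2"

locale finite_energy =
  fixes u du :: "real \<Rightarrow> complex"
  assumes pu: "prim u du" and Ldu: "L2 du" and Leta: "L2 (\<lambda>x. 1 - (cmod (u x))^2)"
begin

text \<open>In polar form \<open>u = r exp (i \<phi>)\<close> one has \<open>al = r'\<close> and \<open>be = r \<phi>'\<close> (both are \<open>0\<close> where \<open>u\<close> vanishes),
  and \<open>df\<close> is the defect in the identity \<open>ed = df + (Gf r)'\<close>.\<close>

definition "ed x = 1/2 * (cmod (du x))^2 + 1/4 * (1 - (cmod (u x))^2)^2"
definition "al x = Re (cnj (u x) * du x) / cmod (u x)"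
definition "be x = Im (cnj (u x) * du x) / cmod (u x)"
definition "df x = 1/2 * (al x - (1 - (cmod (u x))^2) / sqrt 2)^2 + 1/2 * (be x)^2"

lemma ed_nonneg: "0 \<le> ed x" by (simp add: ed_def)
lemma df_nonneg: "0 \<le> df x" by (simp add: df_def)

lemma ed_integrable: "integrable lborel ed"
  unfolding ed_def[abs_def] using L2_int[OF Ldu] L2_int[OF Leta] by simp

lemma ed_set_integrable: "S \<in> sets borel \<Longrightarrow> set_integrable lborel S ed"
  unfolding set_integrable_def by (intro integrable_mult_indicator ed_integrable) simp

lemma ed_integral: "(LINT x|lborel. ed x) = energy u du"
  unfolding ed_def energy_def L2norm_power2 using L2_int[OF Ldu] L2_int[OF Leta] by simp

lemma ed_set_mono:
  assumes "S \<subseteq> T" "S \<in> sets borel" "T \<in> sets borel"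
  shows "(LINT x:S|lborel. ed x) \<le> (LINT x:T|lborel. ed x)"
  unfolding set_lebesgue_integral_def
  by (rule integral_mono)
     (use assms ed_nonneg ed_set_integrable[unfolded set_integrable_def] in \<open>auto simp: indicator_def\<close>)

lemma ed_set_le: "S \<in> sets borel \<Longrightarrow> (LINT x:S|lborel. ed x) \<le> energy u du"
  unfolding ed_integral[symmetric] by (rule set_integral_le_integral[OF ed_integrable ed_nonneg])

lemma cu: "continuous_on A u" by (rule prim_cont[OF pu])

lemma measu[measurable]: "u \<in> borel_measurable borel" "du \<in> borel_measurable borel"
  using prim_meas'[OF pu] prim_meas[OF pu] by auto

lemma cnj_meas[measurable]: "(\<lambda>x. cnj (u x)) \<in> borel_measurable borel"
  by (intro borel_measurable_continuous_onI continuous_intros cu)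

lemma albe_meas[measurable]: "al \<in> borel_measurable borel" "be \<in> borel_measurable borel"
proof -
  have [measurable]: "(\<lambda>x. Re (cnj (u x) * du x)) \<in> borel_measurable borel"
    by (rule measurable_compose[OF _ borel_measurable_continuous_onI[of Re]]) (measurable, intro continuous_intros)
  have [measurable]: "(\<lambda>x. Im (cnj (u x) * du x)) \<in> borel_measurable borel"
    by (rule measurable_compose[OF _ borel_measurable_continuous_onI[of Im]]) (measurable, intro continuous_intros)
  show "al \<in> borel_measurable borel" unfolding al_def[abs_def] by measurable
  show "be \<in> borel_measurable borel" unfolding be_def[abs_def] by measurable
qed

lemma albe_sq: "u x \<noteq> 0 \<Longrightarrow> (al x)^2 + (be x)^2 = (cmod (du x))^2"
proof -
  assume "u x \<noteq> 0"
  have "(Re (cnj (u x) * du x))^2 + (Im (cnj (u x) * du x))^2 = (cmod (u x))^2 * (cmod (du x))^2"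
    unfolding cmod_power2[symmetric] by (simp add: norm_mult power_mult_distrib)
  then show ?thesis using \<open>u x \<noteq> 0\<close> by (simp add: al_def be_def power_divide add_divide_distrib[symmetric])
qed

lemma albe_le: "\<bar>al x\<bar> \<le> cmod (du x)" "\<bar>be x\<bar> \<le> cmod (du x)"
proof -
  have "\<bar>Re (cnj (u x) * du x)\<bar> \<le> cmod (u x) * cmod (du x)" "\<bar>Im (cnj (u x) * du x)\<bar> \<le> cmod (u x) * cmod (du x)"
    using abs_Re_le_cmod[of "cnj (u x) * du x"] abs_Im_le_cmod[of "cnj (u x) * du x"] by (simp_all add: norm_mult)
  then show "\<bar>al x\<bar> \<le> cmod (du x)" "\<bar>be x\<bar> \<le> cmod (du x)"
    by (cases "u x = 0"; simp add: al_def be_def abs_divide divide_le_eq mult.commute)+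
qed

lemma L2_albe: "L2 al" "L2 be"
  by (rule L2_bound[OF _ Ldu, where K=1]; use albe_le in simp)+

lemma ed_df: "u x \<noteq> 0 \<Longrightarrow> ed x = df x + (1 - (cmod (u x))^2) / sqrt 2 * al x"
proof -
  assume a: "u x \<noteq> 0"
  define h where "h = 1 - (cmod (u x))^2"
  have "(al x - h / sqrt 2)^2 = (al x)^2 - 2 * al x * (h / sqrt 2) + h^2 / 2"
    by (simp add: power2_diff power_divide)
  then have "df x = 1/2 * ((al x)^2 + (be x)^2) - al x * (h / sqrt 2) + h^2 / 4"
    by (simp add: df_def h_def[symmetric] algebra_simps)
  then show ?thesis unfolding albe_sq[OF a] ed_def h_def by (simp add: algebra_simps)
qed

lemma modsq: "prim (\<lambda>x. (cmod (u x))^2) (\<lambda>x. 2 * Re (cnj (u x) * du x))"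
proof -
  have "prim (\<lambda>x. Re (cnj (u x) * u x)) (\<lambda>x. Re (cnj (du x) * u x + cnj (u x) * du x))"
    by (rule prim_linear[OF bounded_linear_Re prim_mult[OF prim_cnj[OF pu] pu]])
  moreover have "Re (cnj (u x) * u x) = (cmod (u x))^2" for x unfolding cmod_power2 by (simp add: power2_eq_square)
  moreover have "Re (cnj (du x) * u x + cnj (u x) * du x) = 2 * Re (cnj (u x) * du x)" for x by simp
  ultimately show ?thesis by (simp only:)
qed

lemma eta_prim: "prim (\<lambda>x. 1 - (cmod (u x))^2) (\<lambda>x. - (2 * Re (cnj (u x) * du x)))"
  using prim_diff[OF prim_const[of 1] modsq] by simp

text \<open>The squared modulus obeys the product rule even across zeros of \<open>u\<close>, so
  functions of the modulus are expressed through its square; \<open>S\<close> keeps the values away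
  from singularities of \<open>F\<close>.\<close>

lemma modsq_chain:
  assumes "a \<le> b" "open S" "\<And>x. x \<in> {a..b} \<Longrightarrow> (cmod (u x))^2 \<in> S"
    "\<And>z. z \<in> S \<Longrightarrow> (F has_field_derivative F' z) (at z)" "continuous_on S F'"
  shows "set_integrable lborel {a..b} (\<lambda>x. F' ((cmod (u x))^2) * (2 * cmod (u x)) * al x)"
    "F ((cmod (u b))^2) - F ((cmod (u a))^2) = (LINT x:{a..b}|lborel. F' ((cmod (u x))^2) * (2 * cmod (u x)) * al x)"
proof -
  have e: "F' ((cmod (u x))^2) * (2 * Re (cnj (u x) * du x)) = F' ((cmod (u x))^2) * (2 * cmod (u x)) * al x" for x
    by (cases "u x = 0") (auto simp: al_def)
  have "(\<lambda>x. (cmod (u x))^2) ` {a..b} \<subseteq> S" using assms(3) by auto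
  note A = prim_chain_on[OF modsq assms(1,2) this assms(4,5)]
  show "set_integrable lborel {a..b} (\<lambda>x. F' ((cmod (u x))^2) * (2 * cmod (u x)) * al x)"
    using A(1) unfolding e by simp
  show "F ((cmod (u b))^2) - F ((cmod (u a))^2) = (LINT x:{a..b}|lborel. F' ((cmod (u x))^2) * (2 * cmod (u x)) * al x)"
    using A(2) unfolding e by simp
qed

lemma mod_diff:
  assumes "a \<le> b" "\<And>x. x \<in> {a..b} \<Longrightarrow> u x \<noteq> 0"
  shows "cmod (u b) - cmod (u a) = (LINT x:{a..b}|lborel. al x)"
proof -
  have "sqrt ((cmod (u b))^2) - sqrt ((cmod (u a))^2) = (LINT x:{a..b}|lborel. (inverse (sqrt ((cmod (u x))^2)) / 2) * (2 * cmod (u x)) * al x)"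
    by (rule modsq_chain(2)[where S="{0<..}" and F'="\<lambda>z. inverse (sqrt z) / 2"])
       (use assms in \<open>auto intro!: continuous_intros DERIV_real_sqrt\<close>)
  also have "\<dots> = (LINT x:{a..b}|lborel. al x)"
    by (rule set_lebesgue_integral_cong) (use assms in auto)
  finally show ?thesis by simp
qed

lemma modica:
  assumes "a \<le> b" "\<And>x. x \<in> {a..b} \<Longrightarrow> u x \<noteq> 0"
  shows "set_integrable lborel {a..b} df"
    "(LINT x:{a..b}|lborel. ed x) = (LINT x:{a..b}|lborel. df x) + Gf (cmod (u b)) - Gf (cmod (u a))"
proof -
  define F where "F z = Gf (sqrt z)" for z
  define F' where "F' z = (1 - z) / (2 * sqrt 2 * sqrt z)" for z
  have F: "(F has_field_derivative F' z) (at z)" if "z > 0" for z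
  proof -
    have s: "sqrt z ^ 2 = z" "sqrt z > 0" using that by auto
    have d: "(sqrt has_field_derivative inverse (sqrt z) / 2) (at z)" by (rule DERIV_real_sqrt[OF that])
    have "((\<lambda>z. (sqrt z - sqrt z ^ 3 / 3) / sqrt 2) has_field_derivative
       (inverse (sqrt z) / 2 - (of_nat 3 * (inverse (sqrt z) / 2 * sqrt z ^ (3 - Suc 0))) / 3) / sqrt 2) (at z)"
      by (rule DERIV_cdivide[OF DERIV_diff[OF d DERIV_cdivide[OF DERIV_power[OF d]]]])
    moreover have "(inverse (sqrt z) / 2 - (of_nat 3 * (inverse (sqrt z) / 2 * sqrt z ^ (3 - Suc 0))) / 3) / sqrt 2 = F' z"
      unfolding F'_def using s(2) that by (simp add: field_simps power2_eq_square)
    ultimately show ?thesis by (simp add: F_def[abs_def] Gf_def)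
  qed
  have e: "F' ((cmod (u x))^2) * (2 * cmod (u x)) * al x = (1 - (cmod (u x))^2) / sqrt 2 * al x" if "x \<in> {a..b}" for x
    using assms(2)[OF that] by (simp add: F'_def)
  have c: "continuous_on {0<..} F'" unfolding F'_def by (intro continuous_intros) auto
  have m: "(cmod (u x))^2 \<in> {0<..}" if "x \<in> {a..b}" for x using assms(2)[OF that] by simp
  note A = modsq_chain[OF assms(1) open_greaterThan m F c, simplified]
  have i1: "set_integrable lborel {a..b} (\<lambda>x. (1 - (cmod (u x))^2) / sqrt 2 * al x)"
    using A(1) by (rule set_integrable_cong[THEN iffD1, rotated 3]) (use e in auto)
  have i2: "Gf (cmod (u b)) - Gf (cmod (u a)) = (LINT x:{a..b}|lborel. (1 - (cmod (u x))^2) / sqrt 2 * al x)"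
  proof -
    have "F ((cmod (u b))^2) - F ((cmod (u a))^2) = (LINT x:{a..b}|lborel. (1 - (cmod (u x))^2) / sqrt 2 * al x)"
      unfolding A(2) by (rule set_lebesgue_integral_cong) (use e in auto)
    then show ?thesis by (simp add: F_def)
  qed
  have dfe: "df x = ed x - (1 - (cmod (u x))^2) / sqrt 2 * al x" if "x \<in> {a..b}" for x
    using ed_df[OF assms(2)[OF that]] by simp
  have i3: "set_integrable lborel {a..b} (\<lambda>x. ed x - (1 - (cmod (u x))^2) / sqrt 2 * al x)"
    by (rule set_integral_diff(1)[OF ed_set_integrable i1]) simp
  show "set_integrable lborel {a..b} df"
    using i3 by (rule set_integrable_cong[THEN iffD1, rotated 3]) (use dfe in auto)
  have "(LINT x:{a..b}|lborel. df x) = (LINT x:{a..b}|lborel. ed x - (1 - (cmod (u x))^2) / sqrt 2 * al x)"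
    by (rule set_lebesgue_integral_cong) (use dfe in auto)
  also have "\<dots> = (LINT x:{a..b}|lborel. ed x) - (Gf (cmod (u b)) - Gf (cmod (u a)))"
    unfolding i2 by (rule set_integral_diff(2)[OF ed_set_integrable i1]) simp
  finally show "(LINT x:{a..b}|lborel. ed x) = (LINT x:{a..b}|lborel. df x) + Gf (cmod (u b)) - Gf (cmod (u a))" by simp
qed

text \<open>No branch of the logarithm is chosen: for a primitive \<open>L\<close> of
  \<open>du / u\<close> the function \<open>u * exp (- L)\<close> is constant on the interval, and
  the imaginary part of \<open>L\<close> is the accumulated phase.\<close>

lemma phase:
  assumes "a \<le> b" "\<And>x. x \<in> {a..b} \<Longrightarrow> u x \<noteq> 0"
  shows "set_integrable lborel {a..b} (\<lambda>x. be x / cmod (u x))"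
    "u b / of_real (cmod (u b)) = u a / of_real (cmod (u a)) * exp (\<i> * of_real (LINT x:{a..b}|lborel. be x / cmod (u x)))"
proof -
  have ci: "continuous_on {a..b} (\<lambda>x. inverse (u x))"
    by (intro continuous_intros cu) (use assms in auto)
  have si: "set_integrable lborel {a..b} (\<lambda>x. inverse (u x) * du x)"
    by (rule set_integrable_cont_mult[OF ci primD(1)[OF pu]])
  \<comment> \<open>Cutting off outside \<open>{a..b}\<close> makes the integrand locally integrable
    on the whole line, as \<open>prim_integral_from\<close> requires.\<close>
  define g where "g x = indicator {a..b} x *\<^sub>R (inverse (u x) * du x)" for x
  have ig: "integrable lborel g" using si by (simp add: set_integrable_def g_def[abs_def])
  have "set_integrable lborel {c..d} g" for c d
    unfolding set_integrable_def by (intro integrable_mult_indicator ig) auto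
  then obtain L where L: "prim L g" using prim_integral_from by blast
  have Ld: "L b - L a = (LINT x:{a..b}|lborel. inverse (u x) * du x)"
    unfolding primD(2)[OF L assms(1)] by (rule set_lebesgue_integral_cong) (auto simp: g_def)
  have pE: "prim (\<lambda>x. exp (- L x)) (\<lambda>x. - exp (- L x) * g x)"
    by (rule prim_chain[OF L, of "\<lambda>z. exp (- z)" "\<lambda>z. - exp (- z)"]) (auto intro!: derivative_eq_intros continuous_intros)
  have "u b * exp (- L b) - u a * exp (- L a) = (LINT x:{a..b}|lborel. du x * exp (- L x) + u x * (- exp (- L x) * g x))"
    by (rule primD(2)[OF prim_mult[OF pu pE] assms(1)])
  also have "\<dots> = (LINT x:{a..b}|lborel. 0)"
    by (rule set_lebesgue_integral_cong) (use assms in \<open>auto simp: g_def\<close>)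
  finally have "u b * exp (- L b) = u a * exp (- L a)" by simp
  then have ub: "u b = u a * exp (L b - L a)"
    by (simp add: exp_minus exp_diff field_simps)
  have Imx: "Im (inverse (u x) * du x) = be x / cmod (u x)" if "x \<in> {a..b}" for x
  proof -
    have "inverse (u x) = cnj (u x) / of_real ((cmod (u x))^2)"
    proof -
      have "of_real ((cmod (u x))^2) = u x * cnj (u x)" by (metis complex_norm_square of_real_power)
      then show ?thesis using assms(2)[OF that] by (simp add: inverse_eq_divide)
    qed
    then have "inverse (u x) * du x = (cnj (u x) * du x) / of_real ((cmod (u x))^2)" by simp
    then show ?thesis by (simp add: be_def power2_eq_square)
  qed
  have sI: "set_integrable lborel {a..b} (\<lambda>x. Im (inverse (u x) * du x))"
    by (rule set_integrable_linear(1)[OF bounded_linear_Im si])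
  show "set_integrable lborel {a..b} (\<lambda>x. be x / cmod (u x))"
    using sI by (rule set_integrable_cong[THEN iffD1, rotated 3]) (use Imx in auto)
  have ImL: "Im (L b - L a) = (LINT x:{a..b}|lborel. be x / cmod (u x))"
  proof -
    have "Im (L b - L a) = (LINT x:{a..b}|lborel. Im (inverse (u x) * du x))"
      unfolding Ld by (rule set_integrable_linear(2)[symmetric, OF bounded_linear_Im si])
    also have "\<dots> = (LINT x:{a..b}|lborel. be x / cmod (u x))"
      by (rule set_lebesgue_integral_cong) (use Imx in auto)
    finally show ?thesis .
  qed
  define z where "z = L b - L a"
  have ez: "exp z = of_real (exp (Re z)) * exp (\<i> * of_real (Im z))"
    by (metis exp_eq_polar cis_conv_exp)
  have n: "cmod (u b) = cmod (u a) * exp (Re z)" unfolding ub z_def[symmetric] norm_mult by simp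
  have "u b / of_real (cmod (u b)) = u a / of_real (cmod (u a)) * exp (\<i> * of_real (Im z))"
    unfolding n unfolding ub z_def[symmetric] ez by simp
  then show "u b / of_real (cmod (u b)) = u a / of_real (cmod (u a)) * exp (\<i> * of_real (LINT x:{a..b}|lborel. be x / cmod (u x)))"
    unfolding ImL[symmetric] z_def .
qed

lemma local_variation:
  assumes "y \<in> {x..x+1}" shows "(cmod (u y - u x))^2 \<le> 2 * (LINT z:{x..x+1}|lborel. ed z)"
proof -
  have "(cmod (u y - u x))^2 \<le> (y - x) * (LINT z:{x..y}|lborel. (cmod (du z))^2)"
    by (rule prim_hoelder_local[OF pu Ldu]) (use assms in auto)
  also have "\<dots> \<le> 1 * (LINT z:{x..x+1}|lborel. 2 * ed z)"
  proof (rule mult_mono)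
    show "(LINT z:{x..y}|lborel. (cmod (du z))^2) \<le> (LINT z:{x..x+1}|lborel. 2 * ed z)"
      unfolding set_lebesgue_integral_def
    proof (rule integral_mono)
      show "integrable lborel (\<lambda>z. indicator {x..y} z *\<^sub>R (cmod (du z))\<^sup>2)"
        by (intro integrable_mult_indicator L2_int Ldu) simp
      show "integrable lborel (\<lambda>z. indicator {x..x+1} z *\<^sub>R (2 * ed z))"
        by (intro integrable_mult_indicator integrable_mult_right ed_integrable) simp
      show "indicator {x..y} z *\<^sub>R (cmod (du z))\<^sup>2 \<le> indicator {x..x+1} z *\<^sub>R (2 * ed z)" for z
        using assms by (auto simp: indicator_def ed_def)
    qed
  qed (use assms in \<open>auto simp: set_lebesgue_integral_def\<close>)
  finally show ?thesis by simp
qed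

lemma ed_unit_lower:
  assumes "\<And>y. y \<in> {x..x+1} \<Longrightarrow> c \<le> ed y"
  shows "c \<le> (LINT z:{x..x+1}|lborel. ed z)"
proof -
  have "c = (LINT z:{x..x+1}|lborel. c)" by (simp add: set_lebesgue_integral_def)
  also have "\<dots> \<le> (LINT z:{x..x+1}|lborel. ed z)"
    by (rule set_integral_mono[OF borel_integrable_atLeastAtMost' ed_set_integrable]) (use assms in auto)
  finally show ?thesis .
qed

text \<open>If \<open>cmod (u x) < 1/2\<close>, a variation of at most \<open>1/4\<close> on the
  unit interval keeps the modulus below \<open>3/4\<close> there, and the potential alone
  contributes \<open>1/4 * (7/16)^2 = 49/1024\<close>, more than \<open>1/32\<close>.\<close>

lemma lower_half:
  assumes "(LINT z:{x..x+1}|lborel. ed z) \<le> 1/32" shows "1/2 \<le> cmod (u x)"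
proof (rule ccontr)
  assume a: "\<not> 1/2 \<le> cmod (u x)"
  have "49/1024 \<le> (LINT z:{x..x+1}|lborel. ed z)"
  proof (rule ed_unit_lower)
    fix y assume y: "y \<in> {x..x+1}"
    have "(cmod (u y - u x))^2 \<le> (1/4)^2" using local_variation[OF y] assms by (simp add: power2_eq_square)
    then have "cmod (u y - u x) \<le> 1/4" by (rule power2_le_imp_le) simp
    then have "cmod (u y) \<le> 3/4" using norm_triangle_sub[of "u y" "u x"] a by linarith
    then have "(cmod (u y))^2 \<le> (3/4)^2" by (intro power_mono) auto
    then have "7/16 \<le> 1 - (cmod (u y))^2" by (simp add: power2_eq_square)
    then have "(7/16)^2 \<le> (1 - (cmod (u y))^2)^2" by (intro power_mono) auto
    then show "49/1024 \<le> ed y" unfolding ed_def power2_eq_square[of "7/16"] by (simp add: add_increasing)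
  qed
  then show False using assms by simp
qed

lemma upper_five:
  assumes "(LINT z:{x..x+1}|lborel. ed z) \<le> 1" shows "cmod (u x) \<le> 5"
proof (rule ccontr)
  assume a: "\<not> cmod (u x) \<le> 5"
  have "9/4 \<le> (LINT z:{x..x+1}|lborel. ed z)"
  proof (rule ed_unit_lower)
    fix y assume y: "y \<in> {x..x+1}"
    have "(cmod (u y - u x))^2 \<le> 2^2" using local_variation[OF y] assms by simp
    then have "cmod (u y - u x) \<le> 2" by (rule power2_le_imp_le) simp
    then have "3 \<le> cmod (u y)" using norm_triangle_sub[of "u x" "u y"] a by (simp add: norm_minus_commute)
    then have "3^2 \<le> (cmod (u y))^2" by (intro power_mono) auto
    then have "3 \<le> (cmod (u y))^2 - 1" by simp
    then have "3^2 \<le> ((cmod (u y))^2 - 1)^2" by (intro power_mono) auto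
    then show "9/4 \<le> ed y" unfolding ed_def power2_commute[of 1 "(cmod (u y))^2"] by (simp add: add_increasing)
  qed
  then show False using assms by simp
qed

text \<open>The threshold 1 leaves room above the kink energy \<open>2 * sqrt 2 / 3\<close>, about
  0.943; the value 5 is crude.\<close>

lemma bounded_five: "energy u du \<le> 1 \<Longrightarrow> cmod (u x) \<le> 5"
  by (rule upper_five) (use ed_set_le[of "{x..x+1}"] in simp)

text \<open>\<open>h = 1 - (cmod u)^2\<close> and its derivative are both square-integrable, so
  \<open>h * h\<close> is integrable with integrable derivative and tends to 0.\<close>

lemma mod_tendsto_one:
  assumes M: "\<And>x. cmod (u x) \<le> M"
  shows "((\<lambda>x. cmod (u x)) \<longlongrightarrow> 1) at_top" "((\<lambda>x. cmod (u x)) \<longlongrightarrow> 1) at_bot"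
proof -
  define h where "h x = 1 - (cmod (u x))^2" for x
  define h' where "h' x = - (2 * Re (cnj (u x) * du x))" for x
  have ph: "prim h h'" unfolding h_def h'_def by (rule eta_prim)
  have Lh: "L2 h" unfolding h_def by (rule Leta)
  have b: "norm (h' x) \<le> (2 * M) * cmod (du x)" for x
  proof -
    have "norm (h' x) \<le> 2 * cmod (cnj (u x) * du x)"
      unfolding h'_def using abs_Re_le_cmod[of "cnj (u x) * du x"] by simp
    also have "\<dots> \<le> (2 * M) * cmod (du x)" using M[of x] by (simp add: norm_mult mult_right_mono)
    finally show ?thesis .
  qed
  have Lh': "L2 h'" by (rule L2_bound[OF prim_meas[OF ph] Ldu, where K="2*M"]) (use b in auto)
  have pp: "prim (\<lambda>x. h x * h x) (\<lambda>x. h' x * h x + h x * h' x)" by (rule prim_mult[OF ph ph])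
  note i = L2_prod_integrable[OF Lh Lh] Bochner_Integration.integrable_add[OF L2_prod_integrable[OF Lh' Lh] L2_prod_integrable[OF Lh Lh']]
  have aux: "((\<lambda>x. cmod (u x)) \<longlongrightarrow> 1) F" if "((\<lambda>x. h x * h x) \<longlongrightarrow> 0) F" for F
  proof -
    have "((\<lambda>x. sqrt (h x * h x)) \<longlongrightarrow> sqrt 0) F" by (intro tendsto_intros that)
    then have "(h \<longlongrightarrow> 0) F" by (simp add: tendsto_rabs_zero_iff)
    then have "((\<lambda>x. sqrt (1 - h x)) \<longlongrightarrow> sqrt (1 - 0)) F" by (intro tendsto_intros)
    then show ?thesis by (simp add: h_def)
  qed
  show "((\<lambda>x. cmod (u x)) \<longlongrightarrow> 1) at_top" by (rule aux[OF prim_integrable_limits[OF pp i]])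
  show "((\<lambda>x. cmod (u x)) \<longlongrightarrow> 1) at_bot" by (rule aux[OF prim_integrable_limits_bot[OF pp i]])
qed

lemma Gf_tendsto:
  assumes "\<And>x. cmod (u x) \<le> M"
  shows "((\<lambda>x. Gf (cmod (u x))) \<longlongrightarrow> sqrt 2 / 3) at_top"
proof -
  have "((\<lambda>x. (cmod (u x) - (cmod (u x))^3/3) / sqrt 2) \<longlongrightarrow> (1 - 1^3/3) / sqrt 2) at_top"
    by (intro tendsto_intros mod_tendsto_one(1)[OF assms]) auto
  moreover have "(1 - 1^3/3) / sqrt 2 = sqrt 2 / (3::real)" by (simp add: field_simps)
  ultimately show ?thesis unfolding Gf_def by (simp only:)
qed

lemma energy_half_line:
  assumes M: "\<And>x. cmod (u x) \<le> M" and nz: "\<And>x. x \<ge> b \<Longrightarrow> u x \<noteq> 0"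
  shows "R \<ge> b \<Longrightarrow> (LINT x:{b..R}|lborel. df x) \<le> (LINT x:{b..}|lborel. ed x) - sqrt 2 / 3 + Gf (cmod (u b))"
proof -
  have df_mono: "(LINT x:{b..R}|lborel. df x) \<le> (LINT x:{b..R'}|lborel. df x)" if "b \<le> R" "R \<le> R'" for R R'
    unfolding set_lebesgue_integral_def
    by (rule integral_mono)
       (use modica(1)[of b R] modica(1)[of b R'] nz that df_nonneg in \<open>auto simp: set_integrable_def indicator_def\<close>)
  have le: "(LINT x:{b..R}|lborel. df x) + Gf (cmod (u R')) - Gf (cmod (u b)) \<le> (LINT x:{b..}|lborel. ed x)"
    if "b \<le> R" "R \<le> R'" for R R'
    using modica(2)[of b R'] nz that df_mono[OF that] ed_set_mono[of "{b..R'}" "{b..}"] by auto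
  have lim: "(LINT x:{b..R}|lborel. df x) + sqrt 2 / 3 - Gf (cmod (u b)) \<le> (LINT x:{b..}|lborel. ed x)" if "b \<le> R" for R
  proof (rule tendsto_upperbound)
    show "((\<lambda>R'. (LINT x:{b..R}|lborel. df x) + Gf (cmod (u R')) - Gf (cmod (u b))) \<longlongrightarrow> (LINT x:{b..R}|lborel. df x) + sqrt 2 / 3 - Gf (cmod (u b))) at_top"
      by (intro tendsto_intros Gf_tendsto[OF M])
    show "\<forall>\<^sub>F R' in at_top. (LINT x:{b..R}|lborel. df x) + Gf (cmod (u R')) - Gf (cmod (u b)) \<le> (LINT x:{b..}|lborel. ed x)"
      using eventually_ge_at_top[of R] by eventually_elim (rule le[OF that])
  qed simp
  show "R \<ge> b \<Longrightarrow> (LINT x:{b..R}|lborel. df x) \<le> (LINT x:{b..}|lborel. ed x) - sqrt 2 / 3 + Gf (cmod (u b))"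
    using lim[of R] by simp
qed

end

section \<open>The kink profile\<close>

definition kT :: "real \<Rightarrow> real" where "kT x = tanh (x / sqrt 2)"
definition kd :: "real \<Rightarrow> real" where "kd x = (1 - (kT x)^2) / sqrt 2"

lemma kT_deriv: "(kT has_field_derivative kd x) (at x)"
proof -
  have "((\<lambda>x. tanh (x / sqrt 2)) has_field_derivative ((1 - tanh (x / sqrt 2)^2) * (1 / sqrt 2))) (at x)"
    by (rule has_field_derivative_tanh[OF _ DERIV_cdivide[OF DERIV_ident]]) simp
  then show ?thesis by (simp add: kT_def[abs_def] kd_def)
qed

lemma kT_bounds: "\<bar>kT x\<bar> < 1" "(kT x)^2 < 1"
proof -
  show "\<bar>kT x\<bar> < 1" unfolding kT_def by (metis abs_less_iff tanh_real_lt_1 tanh_real_gt_neg1 minus_less_iff)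
  then show "(kT x)^2 < 1" by (metis abs_square_less_1)
qed

lemma kd_bounds: "0 < kd x" "kd x \<le> 1" "\<bar>kd x\<bar> \<le> 1"
proof -
  show a: "0 < kd x" using kT_bounds[of x] by (simp add: kd_def)
  have "1 - (kT x)^2 \<le> sqrt 2" by (rule order_trans[of _ 1]) auto
  then show "kd x \<le> 1" by (simp add: kd_def)
  then show "\<bar>kd x\<bar> \<le> 1" using a by simp
qed

lemma kT_0[simp]: "kT 0 = 0" by (simp add: kT_def)
lemma kT_minus: "kT (-x) = - kT x" by (simp add: kT_def)
lemma kd_minus: "kd (-x) = kd x" by (simp add: kd_def kT_minus)

lemma kT_mono: "x \<le> y \<Longrightarrow> kT x \<le> kT y"
  by (rule DERIV_nonneg_imp_nondecreasing[of x y]) (use kT_deriv kd_bounds(1) less_imp_le in blast)+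

lemma kT_nonneg: "0 \<le> x \<Longrightarrow> 0 \<le> kT x" using kT_mono[of 0 x] by simp

lemma kT_pos: "0 < x \<Longrightarrow> 0 < kT x"
  by (simp add: kT_def)

lemma kT_Lipschitz: "\<bar>kT x - kT y\<bar> \<le> \<bar>x - y\<bar>"
  using field_differentiable_bound[of UNIV kT kd 1 x y] kT_deriv kd_bounds(3) by auto

lemma kd_deriv: "(kd has_field_derivative (- (sqrt 2) * kT x * kd x)) (at x)"
proof -
  have "((\<lambda>x. (1 - (kT x)^2) / sqrt 2) has_field_derivative (0 - of_nat 2 * (kd x * kT x ^ (2 - Suc 0))) / sqrt 2) (at x)"
    by (rule DERIV_cdivide[OF DERIV_diff[OF DERIV_const DERIV_power[OF kT_deriv]]])
  moreover have "(0 - of_nat 2 * (kd x * kT x ^ (2 - Suc 0))) / sqrt 2 = - (sqrt 2) * kT x * kd x"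
    by (simp add: field_simps)
  moreover have "(\<lambda>x. (1 - (kT x)^2) / sqrt 2) = kd" by (rule ext) (simp add: kd_def)
  ultimately show ?thesis by (simp only:)
qed

lemma kd_Lipschitz: "\<bar>kd x - kd y\<bar> \<le> \<bar>x - y\<bar>"
proof -
  have "\<bar>- (sqrt 2) * kT x * kd x\<bar> \<le> 1" for x
  proof -
    have "\<bar>- (sqrt 2) * kT x * kd x\<bar> = \<bar>kT x\<bar> * \<bar>1 - (kT x)^2\<bar>"
      by (simp add: kd_def abs_mult)
    also have "\<dots> \<le> 1 * 1" using kT_bounds[of x] by (intro mult_mono) auto
    finally show ?thesis by simp
  qed
  then show ?thesis using field_differentiable_bound[of UNIV kd "\<lambda>x. - (sqrt 2) * kT x * kd x" 1 x y] kd_deriv by auto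
qed

lemma kd_cont: "continuous_on A kd" and kT_cont: "continuous_on A kT"
  using kd_deriv kT_deriv by (meson DERIV_isCont continuous_at_imp_continuous_on)+

lemma kT_tendsto: "(kT \<longlongrightarrow> 1) at_top"
  unfolding kT_def[abs_def]
  by (rule filterlim_compose[OF tanh_real_at_top])
     (rule filterlim_tendsto_pos_mult_at_top[where f="\<lambda>_. 1 / sqrt 2" and g="\<lambda>x. x" and c="1 / sqrt 2", simplified];
      simp add: filterlim_ident)

lemma prim_kT: "prim kT kd"
  by (rule prim_C1) (use kT_deriv in \<open>auto simp: has_real_derivative_iff_has_vector_derivative intro: kd_cont\<close>)

lemma prim_shift:
  fixes f g :: "real \<Rightarrow> 'a::euclidean_space"
  assumes "prim f g" shows "prim (\<lambda>x. f (x + c)) (\<lambda>x. g (x + c))"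
proof -
  have i: "indicator {a..b} x = (indicator {a+c..b+c} (x + c) :: real)" for a b x :: real by (auto simp: indicator_def)
  have s: "set_integrable lborel {a..b} (\<lambda>x. g (x + c))" for a b
    using lborel_integrable_real_affine[OF primD(1)[OF assms, of "a+c" "b+c", unfolded set_integrable_def], of 1 c]
    unfolding set_integrable_def i[of a b] by (simp add: add.commute)
  show ?thesis unfolding prim_def
  proof (intro conjI allI impI s)
    fix a b :: real assume "a \<le> b"
    then have "f (b + c) - f (a + c) = (LINT x:{a+c..b+c}|lborel. g x)" by (intro primD(2)[OF assms]) simp
    also have "\<dots> = (LINT x:{a..b}|lborel. g (x + c))"
      unfolding set_lebesgue_integral_def i[of a b]
      using lborel_integral_real_affine[of 1 "\<lambda>x. indicator {a+c..b+c} x *\<^sub>R g x" c] by (simp add: add.commute)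
    finally show "f (b + c) - f (a + c) = (LINT x:{a..b}|lborel. g (x + c))" .
  qed
qed

section \<open>Localized norms and elementary inequalities\<close>

definition nrm :: "real set \<Rightarrow> (real \<Rightarrow> 'a::{real_normed_vector,second_countable_topology}) \<Rightarrow> real" where
  "nrm S f = L2norm (\<lambda>x. indicator S x *\<^sub>R f x)"

lemma L2_const_indicator:
  assumes "0 \<le> K" "a \<le> b"
  shows "L2 (\<lambda>x. K * indicator {a..b} x :: real)" "L2norm (\<lambda>x. K * indicator {a..b} x :: real) = K * sqrt (b - a)"
  using L2_cmult[OF L2_indicator_Icc[of a b], of K] L2norm_indicator_Icc[OF assms(2)] assms(1) by auto

lemma nrm_sq_le:
  assumes "L2 f" "S \<in> sets borel" "(LINT x:S|lborel. (norm (f x))^2) \<le> c"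
  shows "nrm S f \<le> sqrt c"
proof -
  have "(nrm S f)^2 = (LINT x:S|lborel. (norm (f x))^2)"
    unfolding nrm_def L2norm_power2 set_lebesgue_integral_def
    by (intro Bochner_Integration.integral_cong refl) (simp add: indicator_def)
  then show ?thesis using assms(3) by (metis real_le_rsqrt)
qed

lemma max_bound_aux:
  assumes "0 \<le> (M::real)" "M^2 \<le> m^2 + 2 * M * r" "0 \<le> m" "0 \<le> r"
  shows "M \<le> m + 2 * r"
proof (rule ccontr)
  assume a: "\<not> M \<le> m + 2 * r"
  then have M: "M > m + 2 * r" "M > 0" using assms by linarith+
  have "M * (m + 2 * r) < M * M" using M by (intro mult_strict_left_mono)
  moreover have "m * m \<le> M * m" using M assms by (intro mult_right_mono) auto
  ultimately show False using assms(2) by (simp add: power2_eq_square algebra_simps)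
qed

lemma exp_i_dist: "cmod (exp (\<i> * of_real x) - exp (\<i> * of_real y)) \<le> \<bar>x - y\<bar>"
proof -
  have d: "((\<lambda>t. cis t) has_vector_derivative (\<i> * cis t)) (at t within UNIV)" for t
    using has_derivative_cis[OF has_derivative_ident, of t UNIV]
    by (simp add: has_vector_derivative_def)
  have o: "onorm (\<lambda>h. h *\<^sub>R (\<i> * cis t)) \<le> 1" for t
    by (rule onorm_le) (simp add: norm_mult)
  have "norm (cis x - cis y) \<le> 1 * norm (x - y)"
    by (rule differentiable_bound[of UNIV cis "\<lambda>t h. h *\<^sub>R (\<i> * cis t)"])
       (use d o in \<open>auto simp: has_vector_derivative_def\<close>)
  then show ?thesis by (simp add: cis_conv_exp)
qed

context finite_energy begin

text \<open>A small defect says that the modulus solves the kink equation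
  \<open>\<rho>' = (1 - \<rho>^2) / sqrt 2\<close> up to an error \<open>r\<close> that is small in
  \<open>L2\<close>. In the equation for \<open>f = \<rho> - T\<close> the term
  \<open>- (T + \<rho>) * f / sqrt 2\<close> is a damping, so no exponential factor in
  \<open>B\<close> appears. Within distance \<open>c\<close> of \<open>b\<close> the phase is out of
  control, its density being \<open>be / cmod u\<close>; there directions are compared trivially,
  which costs \<open>2 * sqrt c\<close>.\<close>

lemma half_line_profile:
  assumes bm: "cmod (u b) \<le> \<delta>" and nz: "\<And>x. x \<ge> b \<Longrightarrow> u x \<noteq> 0"
    and D: "\<And>R. R \<ge> b \<Longrightarrow> (LINT x:{b..R}|lborel. df x) \<le> \<delta>" and B: "0 < B"
  defines "M \<equiv> \<delta> + 2 * sqrt (2 * B * \<delta>)"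
  shows half_line_mod: "x \<in> {b..b+B} \<Longrightarrow> \<bar>cmod (u x) - kT (x - b)\<bar> \<le> M"
    and half_line_be: "R \<ge> b \<Longrightarrow> (LINT x:{b..R}|lborel. (be x)^2) \<le> 2 * \<delta>"
    and half_line_deriv: "0 < c \<Longrightarrow> c \<le> B \<Longrightarrow> M < kT c \<Longrightarrow>
      nrm {b..b+B} (\<lambda>x. du x - u (b+B) / of_real (cmod (u (b+B))) * of_real (kd (x - b)))
       \<le> 2 * sqrt (2 * \<delta>) + (M * (2 + M) + sqrt (2 * B * \<delta>) / (kT c - M)) * sqrt B + 2 * sqrt c"
proof -
  have \<delta>: "\<delta> \<ge> 0" using bm norm_ge_zero order_trans by blast
  define r where "r x = al x - (1 - (cmod (u x))^2) / sqrt 2" for x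
  have Lr: "L2 r" unfolding r_def
    using L2_diff(1)[OF L2_albe(1) L2_cmult(1)[OF Leta, of "1 / sqrt 2"]] by simp
  have parts: "(LINT x:{b..R}|lborel. (r x)^2) \<le> 2 * \<delta>" "(LINT x:{b..R}|lborel. (be x)^2) \<le> 2 * \<delta>" if R: "R \<ge> b" for R
  proof -
    have dfi: "set_integrable lborel {b..R} df" using modica(1)[OF R] nz by auto
    have "(LINT x:{b..R}|lborel. 2 * df x) \<le> 2 * \<delta>" using D[OF R] by simp
    moreover have "(LINT x:{b..R}|lborel. (f x)^2) \<le> (LINT x:{b..R}|lborel. 2 * df x)"
      if "L2 f" "\<And>x. (f x)^2 \<le> 2 * df x" for f :: "real \<Rightarrow> real"
    proof (rule set_integral_mono)
      show "set_integrable lborel {b..R} (\<lambda>x. (f x)^2)"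
        using L2_int[OF that(1)] unfolding set_integrable_def by (intro integrable_mult_indicator) auto
      show "set_integrable lborel {b..R} (\<lambda>x. 2 * df x)" using dfi by simp
    qed (use that in auto)
    ultimately show "(LINT x:{b..R}|lborel. (r x)^2) \<le> 2 * \<delta>" "(LINT x:{b..R}|lborel. (be x)^2) \<le> 2 * \<delta>"
      using Lr L2_albe(2) by (fastforce simp: df_def r_def)+
  qed
  then show "R \<ge> b \<Longrightarrow> (LINT x:{b..R}|lborel. (be x)^2) \<le> 2 * \<delta>" for R by blast
  have abs1: "(LINT x:{b..b+B}|lborel. \<bar>f x\<bar>) \<le> sqrt (2 * B * \<delta>)"
    if "L2 f" "(LINT x:{b..b+B}|lborel. (f x)^2) \<le> 2 * \<delta>" for f :: "real \<Rightarrow> real"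
  proof -
    have "(LINT x:{b..b+B}|lborel. norm (f x))^2 \<le> (b + B - b) * (LINT x:{b..b+B}|lborel. (norm (f x))^2)"
      by (rule L2_set_integrable(3)[OF that(1)]) (use B in simp)
    also have "\<dots> \<le> B * (2 * \<delta>)" using that(2) B by simp
    finally show ?thesis by (intro real_le_rsqrt) (simp add: mult_ac)
  qed
  have bB: "b \<le> b + B" using B by simp
  note ir = abs1[OF Lr parts(1)[OF bB]] and ibe = abs1[OF L2_albe(2) parts(2)[OF bB]]
  define g where "g x = indicator {b..b+B} x *\<^sub>R al x" for x
  have Lg: "L2 g" unfolding g_def by (rule L2_indicator[OF L2_albe(1)]) simp
  obtain P where P: "prim P g" using prim_integral_from[OF L2_set_integrable(1)[OF Lg]] by blast
  have Pu: "cmod (u x) = cmod (u b) + (P x - P b)" if "x \<in> {b..b+B}" for x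
  proof -
    have "cmod (u x) - cmod (u b) = (LINT y:{b..x}|lborel. al y)" by (rule mod_diff) (use that nz in auto)
    also have "\<dots> = (LINT y:{b..x}|lborel. g y)" by (rule set_lebesgue_integral_cong) (use that in \<open>auto simp: g_def\<close>)
    also have "\<dots> = P x - P b" using primD(2)[OF P, of b x] that by simp
    finally show ?thesis by simp
  qed
  define f where "f x = (cmod (u b) + (P x - P b)) - kT (x - b)" for x
  have pf: "prim f (\<lambda>x. g x - kd (x - b))"
    using prim_diff[OF prim_add[OF prim_const[of "cmod (u b) - P b"] P] prim_shift[OF prim_kT, of "-b"]]
    by (simp add: f_def[abs_def] algebra_simps)
  have f_eq: "f x = cmod (u x) - kT (x - b)" if "x \<in> {b..b+B}" for x using Pu[OF that] by (simp add: f_def)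
  obtain xm where xm: "xm \<in> {b..b+B}" "\<And>x. x \<in> {b..b+B} \<Longrightarrow> \<bar>f x\<bar> \<le> \<bar>f xm\<bar>"
  proof -
    have "\<exists>x\<in>{b..b+B}. \<forall>y\<in>{b..b+B}. \<bar>f y\<bar> \<le> \<bar>f x\<bar>"
      by (rule continuous_attains_sup) (use B in \<open>auto intro!: continuous_intros prim_cont[OF pf]\<close>)
    then show thesis using that by blast
  qed
  define N where "N = \<bar>f xm\<bar>"
  have N0: "N \<ge> 0" by (simp add: N_def)
  have pt: "(g x - kd (x - b)) * f x + f x * (g x - kd (x - b)) \<le> 2 * N * \<bar>r x\<bar>" if x: "x \<in> {b..b+B}" for x
  proof -
    define T \<rho> where "T = kT (x - b)" and "\<rho> = cmod (u x)"
    have T0: "T \<ge> 0" "\<rho> \<ge> 0" using x by (auto simp: T_def \<rho>_def intro!: kT_nonneg)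
    have e1: "g x - kd (x - b) = r x - (T + \<rho>) * f x / sqrt 2"
    proof -
      have fx: "f x = \<rho> - T" using f_eq[OF x] by (simp add: T_def \<rho>_def)
      have "(T + \<rho>) * f x = \<rho>^2 - T^2" unfolding fx by (simp add: power2_eq_square algebra_simps)
      then show ?thesis
        using x by (simp add: g_def r_def kd_def T_def[symmetric] \<rho>_def[symmetric] diff_divide_distrib)
    qed
    have "f x * (g x - kd (x - b)) = f x * r x - (T + \<rho>) * (f x * f x) / sqrt 2"
      unfolding e1 by (simp add: algebra_simps)
    also have "\<dots> \<le> f x * r x" using T0 by simp
    also have "\<dots> \<le> \<bar>f x\<bar> * \<bar>r x\<bar>" by (simp add: abs_mult[symmetric])
    also have "\<dots> \<le> N * \<bar>r x\<bar>" using xm(2)[OF x] by (intro mult_right_mono) (auto simp: N_def)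
    finally show ?thesis by (simp add: mult.commute)
  qed
  \<comment> \<open>\<open>pt\<close> is integrated from \<open>b\<close>, where the kink vanishes,
    to the maximum point. The maximum \<open>N\<close> also bounds the factor \<open>f\<close> in
    the integrand, which leads to a quadratic inequality for \<open>N\<close>.\<close>
  have "N^2 \<le> (cmod (u b))^2 + 2 * N * sqrt (2 * B * \<delta>)"
  proof -
    have pff: "prim (\<lambda>x. f x * f x) (\<lambda>x. (g x - kd (x - b)) * f x + f x * (g x - kd (x - b)))"
      by (rule prim_mult[OF pf pf])
    have si: "set_integrable lborel {b..xm} (\<lambda>x. \<bar>r x\<bar>)" using L2_set_integrable(2)[OF Lr] by simp
    have "f xm * f xm - f b * f b = (LINT x:{b..xm}|lborel. (g x - kd (x - b)) * f x + f x * (g x - kd (x - b)))"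
      by (rule primD(2)[OF pff]) (use xm in simp)
    also have "\<dots> \<le> (LINT x:{b..xm}|lborel. 2 * N * \<bar>r x\<bar>)"
      by (rule set_integral_mono[OF primD(1)[OF pff]]) (use si pt xm in auto)
    also have "\<dots> = 2 * N * (LINT x:{b..xm}|lborel. \<bar>r x\<bar>)" by simp
    also have "\<dots> \<le> 2 * N * (LINT x:{b..b+B}|lborel. \<bar>r x\<bar>)"
    proof (intro mult_left_mono)
      show "(LINT x:{b..xm}|lborel. \<bar>r x\<bar>) \<le> (LINT x:{b..b+B}|lborel. \<bar>r x\<bar>)"
        unfolding set_lebesgue_integral_def
        by (rule integral_mono)
           (use si L2_set_integrable(2)[OF Lr] xm in \<open>auto simp: set_integrable_def indicator_def\<close>)
    qed (use N0 in simp)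
    also have "\<dots> \<le> 2 * N * sqrt (2 * B * \<delta>)" using ir N0 by (intro mult_left_mono) auto
    finally have "f xm * f xm \<le> f b * f b + 2 * N * sqrt (2 * B * \<delta>)" by simp
    moreover have "f b = cmod (u b)" using f_eq[of b] B by simp
    moreover have "N^2 = f xm * f xm" by (simp add: N_def power2_eq_square)
    ultimately show ?thesis by (simp add: power2_eq_square)
  qed
  then have "N \<le> cmod (u b) + 2 * sqrt (2 * B * \<delta>)"
    by (intro max_bound_aux N0) (use \<delta> B in auto)
  then have NM: "N \<le> M" using bm by (simp add: M_def)
  show mod: "\<bar>cmod (u x) - kT (x - b)\<bar> \<le> M" if "x \<in> {b..b+B}" for x
    using xm(2)[OF that] NM f_eq[OF that] by (simp add: N_def)
  have M0: "M \<ge> 0" using NM N0 by simp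
  assume c: "0 < c" "c \<le> B" "M < kT c"
  define \<sigma> where "\<sigma> = u (b+B) / of_real (cmod (u (b+B)))"
  define m where "m = kT c - M"
  have m0: "m > 0" using c by (simp add: m_def)
  have s1: "cmod (u x / of_real (cmod (u x))) = 1" if "x \<ge> b" for x using nz[OF that] by (simp add: norm_divide)
  \<comment> \<open>Past \<open>b + c\<close> the modulus is at least \<open>m\<close>, so the phase
    varies by at most the integral of \<open>\<bar>be\<bar> / m\<close>.\<close>
  have ph: "cmod (u x / of_real (cmod (u x)) - \<sigma>) \<le> sqrt (2 * B * \<delta>) / m" if x: "x \<in> {b+c..b+B}" for x
  proof -
    define Y where "Y = (LINT y:{x..b+B}|lborel. be y / cmod (u y))"
    have p: "\<sigma> = u x / of_real (cmod (u x)) * exp (\<i> * of_real Y)"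
      unfolding \<sigma>_def Y_def by (rule phase(2)) (use x nz c in auto)
    have "cmod (u x / of_real (cmod (u x)) - \<sigma>) = cmod (u x / of_real (cmod (u x)) * (exp (\<i> * of_real 0) - exp (\<i> * of_real Y)))"
      unfolding p right_diff_distrib by simp
    also have "\<dots> = cmod (exp (\<i> * of_real 0) - exp (\<i> * of_real Y))"
      unfolding norm_mult using s1[of x] x c by simp
    also have "\<dots> \<le> \<bar>Y\<bar>" using exp_i_dist[of 0 Y] by simp
    also have "\<bar>Y\<bar> \<le> (LINT y:{x..b+B}|lborel. \<bar>be y\<bar> / m)"
    proof -
      have si: "set_integrable lborel {x..b+B} (\<lambda>y. be y / cmod (u y))" by (rule phase(1)) (use x nz c in auto)
      have "\<bar>Y\<bar> \<le> (LINT y:{x..b+B}|lborel. norm (be y / cmod (u y)))"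
        unfolding Y_def using set_integral_norm_bound[OF si] by simp
      also have "\<dots> \<le> (LINT y:{x..b+B}|lborel. \<bar>be y\<bar> / m)"
      proof (rule set_integral_mono)
        show "set_integrable lborel {x..b+B} (\<lambda>y. norm (be y / cmod (u y)))" using si by (rule set_integrable_norm)
        show "set_integrable lborel {x..b+B} (\<lambda>y. \<bar>be y\<bar> / m)" using L2_set_integrable(2)[OF L2_albe(2)] by simp
        fix y assume y: "y \<in> {x..b+B}"
        have "kT c \<le> kT (y - b)" using x y by (intro kT_mono) auto
        moreover have "\<bar>cmod (u y) - kT (y - b)\<bar> \<le> M" by (rule mod) (use x y c in auto)
        ultimately have "m \<le> cmod (u y)" unfolding m_def by linarith
        then show "norm (be y / cmod (u y)) \<le> \<bar>be y\<bar> / m" using m0 by (simp add: abs_divide frac_le)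
      qed
      finally show ?thesis .
    qed
    also have "\<dots> = (LINT y:{x..b+B}|lborel. \<bar>be y\<bar>) / m" by simp
    also have "\<dots> \<le> (LINT y:{b..b+B}|lborel. \<bar>be y\<bar>) / m"
    proof (intro divide_right_mono)
      show "(LINT y:{x..b+B}|lborel. \<bar>be y\<bar>) \<le> (LINT y:{b..b+B}|lborel. \<bar>be y\<bar>)"
        unfolding set_lebesgue_integral_def
        by (rule integral_mono)
           (use L2_set_integrable(2)[OF L2_albe(2)] x c in \<open>auto simp: set_integrable_def indicator_def\<close>)
    qed (use m0 in simp)
    also have "\<dots> \<le> sqrt (2 * B * \<delta>) / m" using ibe m0 by (intro divide_right_mono) auto
    finally show ?thesis .
  qed
  define K where "K = M * (2 + M) + sqrt (2 * B * \<delta>) / m"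
  have K0: "K \<ge> 0" using M0 m0 \<delta> B by (simp add: K_def)
  have pw: "norm (indicator {b..b+B} x *\<^sub>R (du x - \<sigma> * of_real (kd (x - b))))
     \<le> norm (norm (indicator {b..b+B} x *\<^sub>R r x) + norm (indicator {b..b+B} x *\<^sub>R be x) + K * indicator {b..b+B} x + 2 * indicator {b..b+c} x)" for x
  proof (cases "x \<in> {b..b+B}")
    case x: True
    define T \<rho> s where "T = kT (x - b)" and "\<rho> = cmod (u x)" and "s = u x / of_real (cmod (u x))"
    have ux: "u x \<noteq> 0" using nz x by auto
    have cs: "cmod s = 1" using s1[of x] x by (simp add: s_def)
    have "cnj (u x) * du x = of_real \<rho> * (of_real (al x) + \<i> * of_real (be x))"
      using ux by (simp add: complex_eq_iff al_def be_def \<rho>_def)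
    then have "u x * (cnj (u x) * du x) = u x * (of_real \<rho> * (of_real (al x) + \<i> * of_real (be x)))" by simp
    moreover have "u x * (cnj (u x) * du x) = of_real \<rho> * (of_real \<rho> * du x)"
    proof -
      have "u x * cnj (u x) = of_real \<rho> * of_real \<rho>" unfolding \<rho>_def
        by (metis complex_norm_square of_real_mult of_real_power power2_eq_square)
      then show ?thesis by (metis mult.assoc)
    qed
    ultimately have "of_real \<rho> * (of_real \<rho> * du x) = of_real \<rho> * (u x * (of_real (al x) + \<i> * of_real (be x)))"
      by (metis mult.left_commute)
    then have "of_real \<rho> * du x = u x * (of_real (al x) + \<i> * of_real (be x))"
      using ux by (simp add: \<rho>_def)
    then have "du x = u x * (of_real (al x) + \<i> * of_real (be x)) / of_real \<rho>"
      using ux by (simp add: \<rho>_def eq_divide_eq mult.commute)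
    then have du: "du x = s * (of_real (al x) + \<i> * of_real (be x))"
      unfolding s_def \<rho>_def by simp
    \<comment> \<open>Three errors: the radial derivative against that of the kink, the angular
      derivative, and the direction \<open>s\<close> against its value \<open>\<sigma>\<close> at
      the far end.\<close>
    have "du x - \<sigma> * of_real (kd (x - b)) = s * of_real (al x - kd (x - b)) + s * (\<i> * of_real (be x)) + (s - \<sigma>) * of_real (kd (x - b))"
      unfolding du by (simp add: algebra_simps)
    also have "cmod \<dots> \<le> cmod (s * of_real (al x - kd (x - b))) + cmod (s * (\<i> * of_real (be x))) + cmod ((s - \<sigma>) * of_real (kd (x - b)))"
      by (meson add_right_mono norm_triangle_ineq order_trans)
    also have "\<dots> = \<bar>al x - kd (x - b)\<bar> + \<bar>be x\<bar> + cmod (s - \<sigma>) * \<bar>kd (x - b)\<bar>"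
      by (simp only: norm_mult cs norm_of_real norm_ii) simp
    also have "\<dots> \<le> (\<bar>r x\<bar> + M * (2 + M)) + \<bar>be x\<bar> + (sqrt (2 * B * \<delta>) / m + 2 * indicator {b..b+c} x)"
    proof (intro add_mono order_refl)
      have "al x - kd (x - b) = r x + (T^2 - \<rho>^2) / sqrt 2"
        by (simp add: r_def kd_def T_def \<rho>_def diff_divide_distrib)
      moreover have "\<bar>(T^2 - \<rho>^2) / sqrt 2\<bar> \<le> M * (2 + M)"
      proof -
        have h: "\<bar>\<rho> - T\<bar> \<le> M" using mod[OF x] by (simp add: T_def \<rho>_def)
        have T: "\<bar>T\<bar> \<le> 1" using kT_bounds(1)[of "x - b"] by (simp add: T_def)
        have "\<bar>T^2 - \<rho>^2\<bar> = \<bar>\<rho> - T\<bar> * \<bar>T + \<rho>\<bar>"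
          unfolding abs_mult[symmetric] by (simp add: power2_eq_square algebra_simps abs_minus_commute)
        also have "\<dots> \<le> M * (2 + M)" by (intro mult_mono h) (use h T M0 in linarith)+
        finally have "\<bar>T^2 - \<rho>^2\<bar> \<le> M * (2 + M)" .
        moreover have "\<bar>(T^2 - \<rho>^2) / sqrt 2\<bar> \<le> \<bar>T^2 - \<rho>^2\<bar>"
          by (simp add: abs_divide divide_le_eq mult_le_cancel_left1)
        ultimately show ?thesis by linarith
      qed
      ultimately show "\<bar>al x - kd (x - b)\<bar> \<le> \<bar>r x\<bar> + M * (2 + M)" by linarith
      have kdb: "\<bar>kd (x - b)\<bar> \<le> 1" by (rule kd_bounds(3))
      have "cmod (s - \<sigma>) * \<bar>kd (x - b)\<bar> \<le> cmod (s - \<sigma>) * 1" by (intro mult_left_mono kdb) simp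
      moreover have "cmod (s - \<sigma>) \<le> sqrt (2 * B * \<delta>) / m + 2 * indicator {b..b+c} x"
      proof (cases "x \<in> {b+c..b+B}")
        case True
        then show ?thesis using ph[OF True] unfolding s_def by (smt (verit) indicator_pos_le)
      next
        case False
        then have "indicator {b..b+c} x = (1::real)" using x by auto
        moreover have "cmod (s - \<sigma>) \<le> 1 + 1"
          using norm_triangle_ineq4[of s \<sigma>] cs s1[of "b+B"] B by (simp add: \<sigma>_def)
        moreover have "0 \<le> sqrt (2 * B * \<delta>) / m" using m0 \<delta> B by simp
        ultimately show ?thesis by linarith
      qed
      ultimately show "cmod (s - \<sigma>) * \<bar>kd (x - b)\<bar> \<le> sqrt (2 * B * \<delta>) / m + 2 * indicator {b..b+c} x" by linarith
    qed
    finally show ?thesis using x K0 unfolding K_def by simp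
  next
    case False then show ?thesis by simp
  qed
  have Lri: "L2 (\<lambda>x. norm (indicator {b..b+B} x *\<^sub>R r x))" "L2 (\<lambda>x. norm (indicator {b..b+B} x *\<^sub>R be x))"
    by (intro L2_norm L2_indicator Lr L2_albe; simp)+
  note Lk = L2_const_indicator[OF K0 bB] and Lc = L2_const_indicator[of 2 b "b+c"]
  have bc: "b \<le> b + c" using c by simp
  note A1 = L2_add[OF Lri] note A2 = L2_add[OF A1(1) Lk(1)] note A3 = L2_add[OF A2(1) Lc(1)[OF _ bc], simplified]
  have "nrm {b..b+B} (\<lambda>x. du x - \<sigma> * of_real (kd (x - b)))
     \<le> L2norm (\<lambda>x. norm (indicator {b..b+B} x *\<^sub>R r x) + norm (indicator {b..b+B} x *\<^sub>R be x) + K * indicator {b..b+B} x + 2 * indicator {b..b+c} x)"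
    unfolding nrm_def by (rule L2norm_mono) (use A3(1) pw in auto)
  also have "\<dots> \<le> nrm {b..b+B} r + nrm {b..b+B} be + K * sqrt B + 2 * sqrt c"
    using L2_add(2)[OF A2(1) Lc(1)[OF _ bc]] A2(2) A1(2) Lk(2) Lc(2)[OF _ bc] unfolding L2norm_norm nrm_def by simp
  also have "nrm {b..b+B} r \<le> sqrt (2 * \<delta>)"
    by (rule nrm_sq_le[OF Lr]) (use parts(1)[OF bB] in auto)
  also have "nrm {b..b+B} be \<le> sqrt (2 * \<delta>)"
    by (rule nrm_sq_le[OF L2_albe(2)]) (use parts(2)[OF bB] in auto)
  finally show "nrm {b..b+B} (\<lambda>x. du x - u (b+B) / of_real (cmod (u (b+B))) * of_real (kd (x - b)))
       \<le> 2 * sqrt (2 * \<delta>) + (M * (2 + M) + sqrt (2 * B * \<delta>) / (kT c - M)) * sqrt B + 2 * sqrt c"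
    unfolding \<sigma>_def K_def m_def by simp
qed

end

section \<open>Tails of the energy and the phase along a half-line\<close>

lemma Gf_le: "0 \<le> r \<Longrightarrow> Gf r \<le> sqrt 2 / 3"
proof -
  assume r: "0 \<le> r"
  have "0 \<le> (r - 1)^2 * (r + 2)" using r by simp
  then have "r - r^3/3 \<le> 2/3" by (simp add: power2_eq_square power3_eq_cube algebra_simps)
  then have "Gf r \<le> (2/3) / sqrt 2" unfolding Gf_def by (intro divide_right_mono) auto
  also have "(2/3) / sqrt 2 = sqrt 2 / (3::real)" by (simp add: field_simps)
  finally show ?thesis .
qed

lemma Gf_le_self: "0 \<le> r \<Longrightarrow> Gf r \<le> r"
proof -
  assume r: "0 \<le> r"
  have "Gf r \<le> r / sqrt 2" unfolding Gf_def using r by (intro divide_right_mono) auto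
  also have "\<dots> \<le> r" using r by (simp add: divide_le_eq mult_le_cancel_left1)
  finally show ?thesis .
qed

lemma div_sqrt2_le: "0 \<le> x \<Longrightarrow> x / sqrt 2 \<le> (x::real)"
  by (simp add: divide_le_eq mult_le_cancel_left1)

lemma Gf_Lipschitz:
  assumes "0 \<le> r" "r \<le> 2" "0 \<le> T" "T \<le> 1"
  shows "\<bar>Gf r - Gf T\<bar> \<le> 4 * \<bar>r - T\<bar>"
proof -
  define k where "k = 1 - (r*r + r*T + T*T) / 3"
  have "r * r \<le> 2 * 2" "r * T \<le> 2 * 1" "T * T \<le> 1 * 1" using assms by (intro mult_mono; simp)+
  then have "(r*r + r*T + T*T) / 3 \<le> 4" by simp
  moreover have "0 \<le> (r*r + r*T + T*T) / 3" using assms by simp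
  ultimately have k: "\<bar>k\<bar> \<le> 4" unfolding k_def by linarith
  have e: "(r - r^3/3) - (T - T^3/3) = (r - T) * k"
    by (simp add: k_def power3_eq_cube field_simps)
  have "Gf r - Gf T = (r - T) * k / sqrt 2"
    unfolding Gf_def diff_divide_distrib[symmetric] e ..
  then have "\<bar>Gf r - Gf T\<bar> = \<bar>r - T\<bar> * \<bar>k\<bar> / sqrt 2" by (simp add: abs_mult)
  also have "\<dots> \<le> \<bar>r - T\<bar> * \<bar>k\<bar>" by (rule div_sqrt2_le) simp
  also have "\<dots> \<le> \<bar>r - T\<bar> * 4" using k by (intro mult_left_mono) auto
  finally show ?thesis by simp
qed

text \<open>Energy of the kink beyond \<open>B\<close>: its energy density is
  \<open>(kd x)^2\<close>, the derivative of \<open>Gf (kT x)\<close>.\<close>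

definition gap :: "real \<Rightarrow> real" where "gap B = sqrt 2 / 3 - Gf (kT B)"

lemma gap_nonneg: "0 \<le> B \<Longrightarrow> 0 \<le> gap B"
  using Gf_le[OF kT_nonneg] by (simp add: gap_def)

lemma gap_tendsto: "(gap \<longlongrightarrow> 0) at_top"
proof -
  have "((\<lambda>B. sqrt 2 / 3 - (kT B - (kT B)^3/3) / sqrt 2) \<longlongrightarrow> sqrt 2 / 3 - (1 - 1^3/3) / sqrt 2) at_top"
    by (intro tendsto_intros kT_tendsto) auto
  moreover have "sqrt 2 / 3 - (1 - 1^3/3) / sqrt 2 = (0::real)" by (simp add: field_simps)
  ultimately show ?thesis unfolding gap_def[abs_def] Gf_def by (simp only:)
qed

lemma nonneg_half_line_le:
  fixes f :: "real \<Rightarrow> real"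
  assumes "integrable lborel f" "\<And>R. R \<ge> b \<Longrightarrow> (LINT x:{b..R}|lborel. f x) \<le> c"
  shows "(LINT x:{b..}|lborel. f x) \<le> c"
proof (rule tendsto_upperbound)
  show "((\<lambda>R. LINT x:{b..R}|lborel. f x) \<longlongrightarrow> (LINT x:{b..}|lborel. f x)) at_top"
  proof (rule tendsto_set_lebesgue_integral_at_top)
    show "set_integrable lborel {b..} f"
      unfolding set_integrable_def by (intro integrable_mult_indicator assms(1)) simp
  qed simp
  show "\<forall>\<^sub>F R in at_top. (LINT x:{b..R}|lborel. f x) \<le> c"
    using eventually_ge_at_top[of b] by eventually_elim (rule assms(2))
qed simp

context finite_energy begin

text \<open>By \<open>modica\<close> the energy beyond \<open>b + B\<close> is the defect plus an
  increment of \<open>Gf\<close>. The increment is at most \<open>sqrt 2 / 3 - Gf (kT B)\<close>, up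
  to the Lipschitz error \<open>4 * M\<close> made by replacing the modulus at \<open>b + B\<close>
  with that of the kink.\<close>

lemma half_line_tail:
  assumes bm: "cmod (u b) \<le> \<delta>" and nz: "\<And>x. x \<ge> b \<Longrightarrow> u x \<noteq> 0"
    and D: "\<And>R. R \<ge> b \<Longrightarrow> (LINT x:{b..R}|lborel. df x) \<le> \<delta>" and B: "0 < B"
    and M: "M = \<delta> + 2 * sqrt (2 * B * \<delta>)" "M \<le> 1" and R: "R \<ge> b + B"
  shows "(LINT x:{b+B..R}|lborel. ed x) \<le> \<delta> + gap B + 4 * M"
proof -
  have "(LINT x:{b+B..R}|lborel. df x) \<le> (LINT x:{b..R}|lborel. df x)"
    unfolding set_lebesgue_integral_def
    by (rule integral_mono)
       (use modica(1)[of "b+B" R] modica(1)[of b R] nz R B df_nonneg in \<open>auto simp: set_integrable_def indicator_def\<close>)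
  also have "\<dots> \<le> \<delta>" using D[of R] R B by simp
  finally have 1: "(LINT x:{b+B..R}|lborel. df x) \<le> \<delta>" .
  have 2: "(LINT x:{b+B..R}|lborel. ed x) = (LINT x:{b+B..R}|lborel. df x) + Gf (cmod (u R)) - Gf (cmod (u (b+B)))"
    by (rule modica(2)) (use nz R B in auto)
  have 3: "Gf (cmod (u R)) \<le> sqrt 2 / 3" by (rule Gf_le) simp
  have m: "\<bar>cmod (u (b+B)) - kT B\<bar> \<le> M"
    using half_line_mod[OF bm nz D B, of "b+B"] B M by simp
  have k: "0 \<le> kT B" "kT B \<le> 1" using kT_nonneg[of B] kT_bounds(1)[of B] B by auto
  have "\<bar>Gf (cmod (u (b+B))) - Gf (kT B)\<bar> \<le> 4 * \<bar>cmod (u (b+B)) - kT B\<bar>"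
    by (rule Gf_Lipschitz) (use m k M in auto)
  from abs_le_D2[OF order_trans[OF this mult_left_mono[OF m, of 4]]]
  have 4: "Gf (kT B) - 4 * M \<le> Gf (cmod (u (b+B)))" by simp
  show ?thesis using 1 2 3 4 unfolding gap_def by linarith
qed

lemma Im_cnj_be: "Im (cnj (u x) * du x) = cmod (u x) * be x"
  by (cases "u x = 0") (auto simp: be_def)

lemma mom_integrable: "set_integrable lborel {a..b} (\<lambda>x. Im (cnj (u x) * du x))"
proof -
  have "set_integrable lborel {a..b} (\<lambda>x. cnj (u x) * du x)"
    by (rule set_integrable_cont_mult[OF _ primD(1)[OF pu]]) (intro continuous_intros cu)
  from set_integrable_linear(1)[OF bounded_linear_Im this] show ?thesis .
qed

text \<open>The phase density \<open>be / cmod u\<close> exceeds the momentum density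
  \<open>cmod u * be\<close> by \<open>(1 - (cmod u)^2) * be / cmod u\<close>, a product of two
  square-integrable factors once the modulus is at least \<open>1/2\<close>. The error is thus
  uniform in \<open>R\<close>, and the momentum on the half-line measures the phase shift beyond the
  core. The 5 bounds \<open>cmod u\<close> up to \<open>b + B\<close>, the 4 is the bound on
  \<open>L2norm h\<close> past it.\<close>

lemma half_line_phase:
  assumes E: "energy u du \<le> 1" and bm: "cmod (u b) \<le> \<delta>" and nz: "\<And>x. x \<ge> b \<Longrightarrow> u x \<noteq> 0"
    and D: "\<And>R. R \<ge> b \<Longrightarrow> (LINT x:{b..R}|lborel. df x) \<le> \<delta>" and B: "0 < B"
    and M: "M = \<delta> + 2 * sqrt (2 * B * \<delta>)" "M \<le> 1" "\<delta> + gap B + 4 * M \<le> 1/32" and R: "R \<ge> b + B"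
  shows "cmod (exp (\<i> * of_real (LINT x:{b..R}|lborel. Im (cnj (u x) * du x))) * (u (b+B) / of_real (cmod (u (b+B))))
     - u R / of_real (cmod (u R))) \<le> sqrt (2 * \<delta>) * (5 * sqrt B + 4)"
proof -
  have \<delta>: "\<delta> \<ge> 0" using bm norm_ge_zero order_trans by blast
  define J where "J = (LINT x:{b..R}|lborel. Im (cnj (u x) * du x))"
  define Y where "Y = (LINT x:{b+B..R}|lborel. be x / cmod (u x))"
  have half: "1/2 \<le> cmod (u x)" if x: "x \<ge> b + B" for x
  proof (rule lower_half)
    have "(LINT z:{x..x+1}|lborel. ed z) \<le> (LINT z:{b+B..x+1}|lborel. ed z)"
      by (rule ed_set_mono) (use x in auto)
    also have "\<dots> \<le> 1/32"
      using half_line_tail[OF bm nz D B M(1,2), of "x+1"] M(3) x by simp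
    finally show "(LINT z:{x..x+1}|lborel. ed z) \<le> 1/32" .
  qed
  have bb: "nrm {b..R} be \<le> sqrt (2 * \<delta>)"
    by (rule nrm_sq_le[OF L2_albe(2)]) (use half_line_be[OF bm nz D B, of R] R B in auto)
  have bi: "(LINT x:{c..d}|lborel. \<bar>h x * be x\<bar>) \<le> K * sqrt (2 * \<delta>)"
    if "{c..d} \<subseteq> {b..R}" "L2 h" "L2norm h \<le> K" for c d K and h :: "real \<Rightarrow> real"
  proof -
    have "(LINT x:{c..d}|lborel. \<bar>h x * be x\<bar>) = (LINT x|lborel. norm (indicator {c..d} x *\<^sub>R h x) * norm (indicator {b..R} x *\<^sub>R be x))"
      unfolding set_lebesgue_integral_def
      by (intro Bochner_Integration.integral_cong refl) (use that(1) in \<open>auto simp: indicator_def abs_mult\<close>)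
    also have "\<dots> \<le> L2norm (\<lambda>x. indicator {c..d} x *\<^sub>R h x) * L2norm (\<lambda>x. indicator {b..R} x *\<^sub>R be x)"
      by (intro L2_Cauchy_Schwarz L2_indicator that L2_albe) auto
    also have "\<dots> \<le> K * sqrt (2 * \<delta>)"
    proof (intro mult_mono)
      have "L2norm (\<lambda>x. indicator {c..d} x *\<^sub>R h x) \<le> L2norm h"
        by (rule L2norm_mono[OF that(2)]) (auto simp: indicator_def)
      then show "L2norm (\<lambda>x. indicator {c..d} x *\<^sub>R h x) \<le> K" using that(3) by linarith
      show "0 \<le> K" using that(3) L2norm_nonneg order_trans by blast
    qed (use bb in \<open>auto simp: nrm_def\<close>)
    finally show ?thesis .
  qed
  have J: "J = (LINT x:{b..b+B}|lborel. Im (cnj (u x) * du x)) + (LINT x:{b+B..R}|lborel. Im (cnj (u x) * du x))"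
    unfolding J_def by (rule set_integral_Icc_combine[OF mom_integrable]) (use B R in auto)
  have p1: "\<bar>LINT x:{b..b+B}|lborel. Im (cnj (u x) * du x)\<bar> \<le> (5 * sqrt B) * sqrt (2 * \<delta>)"
  proof -
    have "\<bar>LINT x:{b..b+B}|lborel. Im (cnj (u x) * du x)\<bar> \<le> (LINT x:{b..b+B}|lborel. \<bar>Im (cnj (u x) * du x)\<bar>)"
      using set_integral_norm_bound[OF mom_integrable[of b "b+B"]] by simp
    also have "\<dots> \<le> (LINT x:{b..b+B}|lborel. \<bar>(5 * indicator {b..b+B} x) * be x\<bar>)"
    proof (rule set_integral_mono)
      show "set_integrable lborel {b..b+B} (\<lambda>x. \<bar>Im (cnj (u x) * du x)\<bar>)"
        using set_integrable_norm[OF mom_integrable[of b "b+B"]] by simp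
      show "set_integrable lborel {b..b+B} (\<lambda>x. \<bar>5 * indicator {b..b+B} x * be x\<bar>)"
        unfolding set_integrable_def
        by (intro integrable_mult_indicator integrable_abs L2_prod_integrable L2_albe L2_const_indicator(1)) (use B in auto)
      show "\<bar>Im (cnj (u x) * du x)\<bar> \<le> \<bar>5 * indicator {b..b+B} x * be x\<bar>" if "x \<in> {b..b+B}" for x
        using that bounded_five[OF E, of x] unfolding Im_cnj_be by (simp add: abs_mult mult_right_mono)
    qed
    also have "\<dots> \<le> (5 * sqrt B) * sqrt (2 * \<delta>)"
      by (rule bi) (use B R L2_const_indicator[of 5 b "b+B"] in auto)
    finally show ?thesis .
  qed
  have p2: "\<bar>(LINT x:{b+B..R}|lborel. Im (cnj (u x) * du x)) - Y\<bar> \<le> 4 * sqrt (2 * \<delta>)"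
  proof -
    define h where "h x = 2 * (1 - (cmod (u x))^2)" for x
    have Lh: "L2 h" "L2norm h \<le> 4"
    proof -
      show "L2 h" unfolding h_def by (rule L2_cmult(1)[OF Leta])
      have "1/4 * (L2norm (\<lambda>x. 1 - (cmod (u x))^2))^2 \<le> 1"
        using E unfolding energy_def using zero_le_power2[of "L2norm du"] by linarith
      then have "(L2norm (\<lambda>x. 1 - (cmod (u x))^2))^2 \<le> 2^2" by simp
      then have "L2norm (\<lambda>x. 1 - (cmod (u x))^2) \<le> 2" by (rule power2_le_imp_le) simp
      then show "L2norm h \<le> 4" unfolding h_def L2_cmult(2)[OF Leta] by simp
    qed
    have si: "set_integrable lborel {b+B..R} (\<lambda>x. be x / cmod (u x))"
      by (rule phase(1)) (use R B nz in auto)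
    have sd: "set_integrable lborel {b+B..R} (\<lambda>x. Im (cnj (u x) * du x) - be x / cmod (u x))"
      by (rule set_integral_diff(1)[OF mom_integrable si])
    have "(LINT x:{b+B..R}|lborel. Im (cnj (u x) * du x)) - Y = (LINT x:{b+B..R}|lborel. Im (cnj (u x) * du x) - be x / cmod (u x))"
      unfolding Y_def by (rule set_integral_diff(2)[symmetric, OF mom_integrable si])
    then have "\<bar>(LINT x:{b+B..R}|lborel. Im (cnj (u x) * du x)) - Y\<bar> \<le> (LINT x:{b+B..R}|lborel. \<bar>Im (cnj (u x) * du x) - be x / cmod (u x)\<bar>)"
      using set_integral_norm_bound[OF sd] by simp
    also have "\<dots> \<le> (LINT x:{b+B..R}|lborel. \<bar>h x * be x\<bar>)"
    proof (rule set_integral_mono)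
      show "set_integrable lborel {b+B..R} (\<lambda>x. \<bar>Im (cnj (u x) * du x) - be x / cmod (u x)\<bar>)"
        using set_integrable_norm[OF sd] by simp
      show "set_integrable lborel {b+B..R} (\<lambda>x. \<bar>h x * be x\<bar>)"
        unfolding set_integrable_def by (intro integrable_mult_indicator integrable_abs L2_prod_integrable L2_albe Lh) auto
      fix x assume x: "x \<in> {b+B..R}"
      then have r: "1/2 \<le> cmod (u x)" using half by auto
      then have pos: "cmod (u x) > 0" by linarith
      have "Im (cnj (u x) * du x) - be x / cmod (u x) = - ((1 - (cmod (u x))^2) * be x / cmod (u x))"
        using pos unfolding Im_cnj_be by (simp add: field_simps power2_eq_square)
      then have "\<bar>Im (cnj (u x) * du x) - be x / cmod (u x)\<bar> = \<bar>(1 - (cmod (u x))^2) * be x\<bar> / cmod (u x)"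
        by (simp add: abs_divide)
      also have "\<dots> \<le> \<bar>(1 - (cmod (u x))^2) * be x\<bar> / (1/2)"
        by (rule divide_left_mono) (use r pos in auto)
      also have "\<dots> = \<bar>h x * be x\<bar>" unfolding h_def abs_mult by simp
      finally show "\<bar>Im (cnj (u x) * du x) - be x / cmod (u x)\<bar> \<le> \<bar>h x * be x\<bar>" .
    qed
    also have "\<dots> \<le> 4 * sqrt (2 * \<delta>)" by (rule bi) (use B Lh in auto)
    finally show ?thesis .
  qed
  have p: "u R / of_real (cmod (u R)) = u (b+B) / of_real (cmod (u (b+B))) * exp (\<i> * of_real Y)"
    unfolding Y_def by (rule phase(2)) (use R B nz in auto)
  have "exp (\<i> * of_real J) * (u (b+B) / of_real (cmod (u (b+B)))) - u R / of_real (cmod (u R))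
     = (u (b+B) / of_real (cmod (u (b+B)))) * (exp (\<i> * of_real J) - exp (\<i> * of_real Y))"
    unfolding p right_diff_distrib by (simp add: mult.commute)
  then have "cmod (exp (\<i> * of_real J) * (u (b+B) / of_real (cmod (u (b+B)))) - u R / of_real (cmod (u R)))
     = cmod (exp (\<i> * of_real J) - exp (\<i> * of_real Y))"
    using nz[of "b+B"] B by (simp only: norm_mult) (simp add: norm_divide)
  also have "\<dots> \<le> \<bar>J - Y\<bar>" by (rule exp_i_dist)
  also have "\<dots> \<le> (5 * sqrt B) * sqrt (2 * \<delta>) + 4 * sqrt (2 * \<delta>)" using p1 p2 unfolding J by linarith
  also have "\<dots> = sqrt (2 * \<delta>) * (5 * sqrt B + 4)" by (simp add: algebra_simps)
  finally show ?thesis unfolding J_def .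
qed

end

section \<open>Splitting norms over pieces of the line\<close>

lemma nrm_Un:
  fixes f :: "real \<Rightarrow> 'a::{real_normed_vector,second_countable_topology}"
  assumes "L2 f" "S \<in> sets borel" "T \<in> sets borel"
  shows "nrm (S \<union> T) f \<le> nrm S f + nrm T f"
proof -
  note L = L2_norm[OF L2_indicator[OF assms(1,2)]] L2_norm[OF L2_indicator[OF assms(1,3)]]
  have "nrm (S \<union> T) f \<le> L2norm (\<lambda>x. norm (indicator S x *\<^sub>R f x) + norm (indicator T x *\<^sub>R f x))"
    unfolding nrm_def by (rule L2norm_mono[OF L2_add(1)[OF L]]) (auto simp: indicator_def)
  also have "\<dots> \<le> nrm S f + nrm T f"
    using L2_add(2)[OF L] unfolding L2norm_norm nrm_def .
  finally show ?thesis .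
qed

lemma nrm_add_le:
  fixes f :: "real \<Rightarrow> 'a::{real_normed_vector,second_countable_topology}"
    and g :: "real \<Rightarrow> 'b::{real_normed_vector,second_countable_topology}"
    and h :: "real \<Rightarrow> 'c::{real_normed_vector,second_countable_topology}"
  assumes "S \<in> sets borel" "L2 g" "L2 h" "\<And>x. x \<in> S \<Longrightarrow> norm (f x) \<le> norm (g x) + norm (h x)"
  shows "nrm S f \<le> nrm S g + nrm S h"
proof -
  note L = L2_norm[OF L2_indicator[OF assms(2,1)]] L2_norm[OF L2_indicator[OF assms(3,1)]]
  have "nrm S f \<le> L2norm (\<lambda>x. norm (indicator S x *\<^sub>R g x) + norm (indicator S x *\<^sub>R h x))"
    unfolding nrm_def by (rule L2norm_mono[OF L2_add(1)[OF L]]) (use assms(4) in \<open>auto simp: indicator_def\<close>)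
  also have "\<dots> \<le> nrm S g + nrm S h"
    using L2_add(2)[OF L] unfolding L2norm_norm nrm_def .
  finally show ?thesis .
qed

lemma nrm_Icc_bound:
  fixes f :: "real \<Rightarrow> 'a::{real_normed_vector,second_countable_topology}"
  assumes "a \<le> b" "0 \<le> K" "\<And>x. x \<in> {a..b} \<Longrightarrow> norm (f x) \<le> K"
  shows "nrm {a..b} f \<le> K * sqrt (b - a)"
proof -
  note L = L2_const_indicator[OF assms(2,1)]
  have "nrm {a..b} f \<le> L2norm (\<lambda>x. K * indicator {a..b} x :: real)"
    unfolding nrm_def by (rule L2norm_mono[OF L(1)]) (use assms in \<open>auto simp: indicator_def\<close>)
  then show ?thesis using L(2) by simp
qed

lemma L2norm_reflect: 
  fixes f :: "real \<Rightarrow> 'a::{real_normed_vector,second_countable_topology}"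
  shows "L2norm (\<lambda>x. f (-x)) = L2norm f"
  unfolding L2norm_def using lborel_integral_reflect[of "\<lambda>x. (norm (f x))^2"] by simp

lemma L2_reflect:
  fixes f :: "real \<Rightarrow> 'a::{real_normed_vector,second_countable_topology}"
  assumes "L2 f" shows "L2 (\<lambda>x. f (-x))"
proof -
  have "(\<lambda>x. f (-x)) \<in> borel_measurable borel"
    by (rule measurable_compose[OF _ L2_meas[OF assms]]) simp
  then show ?thesis using lborel_integrable_reflect[OF L2_int[OF assms]] by (simp add: L2_def)
qed

lemma L2norm_shift:
  fixes f :: "real \<Rightarrow> 'a::{real_normed_vector,second_countable_topology}"
  shows "L2norm (\<lambda>x. f (x + c)) = L2norm f"
  unfolding L2norm_def using lborel_integral_real_affine[of 1 "\<lambda>x. (norm (f x))^2" c] by (simp add: add.commute)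

lemma L2_shift:
  fixes f :: "real \<Rightarrow> 'a::{real_normed_vector,second_countable_topology}"
  assumes "L2 f" shows "L2 (\<lambda>x. f (x + c))"
proof -
  have "(\<lambda>x. f (x + c)) \<in> borel_measurable borel"
    by (rule measurable_compose[OF _ L2_meas[OF assms]]) simp
  then show ?thesis using lborel_integrable_real_affine[OF L2_int[OF assms], of 1 c] by (simp add: L2_def add.commute)
qed

lemma kd_sq_Icc: "a \<le> b \<Longrightarrow> (LINT x:{a..b}|lborel. (kd x)^2) = Gf (kT b) - Gf (kT a)"
proof -
  assume ab: "a \<le> b"
  have "prim (\<lambda>x. Gf (kT x)) (\<lambda>x. (kd x)^2)"
  proof (rule prim_C1)
    fix x
    have "((\<lambda>x. (kT x - (kT x)^3 / 3) / sqrt 2) has_field_derivative (kd x - (of_nat 3 * (kd x * kT x ^ (3 - Suc 0))) / 3) / sqrt 2) (at x)"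
      by (rule DERIV_cdivide[OF DERIV_diff[OF kT_deriv DERIV_cdivide[OF DERIV_power[OF kT_deriv]]]])
    moreover have "(kd x - (of_nat 3 * (kd x * kT x ^ (3 - Suc 0))) / 3) / sqrt 2 = (kd x)^2"
    proof -
      have "(kd x - (of_nat 3 * (kd x * kT x ^ (3 - Suc 0))) / 3) / sqrt 2 = kd x * ((1 - (kT x)^2) / sqrt 2)"
        by (simp add: algebra_simps diff_divide_distrib)
      also have "(1 - (kT x)^2) / sqrt 2 = kd x" by (simp add: kd_def)
      finally show ?thesis by (simp only: power2_eq_square)
    qed
    ultimately show "((\<lambda>x. Gf (kT x)) has_vector_derivative (kd x)^2) (at x)"
      unfolding Gf_def has_real_derivative_iff_has_vector_derivative[symmetric] by simp
  qed (intro continuous_intros kd_cont)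
  from primD(2)[OF this ab] show ?thesis by simp
qed

text \<open>Monotone convergence along \<open>{-n..n}\<close>, where \<open>kd_sq_Icc\<close> gives
  the value \<open>2 * Gf (kT n)\<close>. Since \<open>(kd x)^2\<close> is the energy density of the
  kink, the limit is its energy.\<close>

lemma kd_L2: "L2 kd" and kd_norm: "(L2norm kd)^2 = 2 * sqrt 2 / 3"
proof -
  define f where "f n x = indicator {-real n..real n} x *\<^sub>R (kd x)^2" for n x
  have m: "kd \<in> borel_measurable borel" by (intro borel_measurable_continuous_onI kd_cont)
  have A: "integrable lborel (f n)" for n
    using borel_integrable_atLeastAtMost'[of "-real n" "real n" "\<lambda>x. (kd x)^2"]
    by (simp add: f_def[abs_def] set_integrable_def continuous_on_power kd_cont)
  have B: "AE x in lborel. mono (\<lambda>n. f n x)"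
    by (intro AE_I2 monoI) (auto simp: f_def indicator_def)
  have C: "AE x in lborel. (\<lambda>n. f n x) \<longlonglongrightarrow> (kd x)^2"
  proof (intro AE_I2 tendsto_eventually)
    fix x :: real
    obtain N where N: "\<bar>x\<bar> \<le> real N" using real_arch_simple by blast
    show "\<forall>\<^sub>F n in sequentially. f n x = (kd x)^2"
      using eventually_ge_at_top[of N] by eventually_elim (use N in \<open>auto simp: f_def indicator_def\<close>)
  qed
  have I: "(LINT x|lborel. f n x) = 2 * Gf (kT (real n))" for n
  proof -
    have "(LINT x|lborel. f n x) = (LINT x:{-real n..real n}|lborel. (kd x)^2)"
      by (simp add: f_def set_lebesgue_integral_def)
    also have "\<dots> = Gf (kT (real n)) - Gf (kT (- real n))" by (rule kd_sq_Icc) simp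
    also have "\<dots> = 2 * Gf (kT (real n))" by (simp add: kT_minus Gf_def diff_divide_distrib[symmetric])
    finally show ?thesis .
  qed
  have D: "(\<lambda>n. LINT x|lborel. f n x) \<longlonglongrightarrow> 2 * sqrt 2 / 3"
  proof -
    have "(\<lambda>n. gap (real n)) \<longlonglongrightarrow> 0"
      by (rule filterlim_compose[OF gap_tendsto filterlim_real_sequentially])
    then have "(\<lambda>n. 2 * (sqrt 2 / 3 - gap (real n))) \<longlonglongrightarrow> 2 * (sqrt 2 / 3 - 0)" by (intro tendsto_intros)
    then show ?thesis unfolding I by (simp add: gap_def)
  qed
  have E: "(\<lambda>x. (kd x)^2) \<in> borel_measurable lborel" using m by simp
  show "L2 kd" unfolding L2_def
    using integrable_monotone_convergence[OF A B C D E] m by simp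
  show "(L2norm kd)^2 = 2 * sqrt 2 / 3" unfolding L2norm_power2
    using integral_monotone_convergence[OF A B C D E] by simp
qed

lemma nrm_kd:
  assumes "0 \<le> B" shows "nrm {c+B..} (\<lambda>x. kd (x - c)) \<le> sqrt (gap B)"
proof -
  have L: "L2 (\<lambda>x. kd (x - c))" using L2_shift[OF kd_L2, of "-c"] by simp
  show ?thesis
  proof (rule nrm_sq_le[OF L])
    have i: "indicator {B+c..} (x + c) = (indicator {B..} x :: real)" for x by (auto simp: indicator_def)
    have "(LINT x:{c+B..}|lborel. (norm (kd (x - c)))^2) = (LINT x:{B..}|lborel. (kd x)^2)"
      unfolding set_lebesgue_integral_def
      using lborel_integral_real_affine[of 1 "\<lambda>x. indicator {c+B..} x *\<^sub>R (norm (kd (x - c)))^2" c]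
      by (simp add: i add.commute[of c])
    also have "\<dots> \<le> gap B"
    proof (rule nonneg_half_line_le)
      show "integrable lborel (\<lambda>x. (kd x)^2)" using L2_int[OF kd_L2] by simp
      show "(LINT x:{B..R}|lborel. (kd x)^2) \<le> gap B" if "R \<ge> B" for R
        unfolding kd_sq_Icc[OF that] gap_def using Gf_le[OF kT_nonneg, of R] assms that by simp
    qed
    finally show "(LINT x:{c+B..}|lborel. (norm (kd (x - c)))^2) \<le> gap B" .
  qed simp
qed

section \<open>Maps of almost minimal energy that almost vanish\<close>

lemma nrm_cong: "(\<And>x. x \<in> S \<Longrightarrow> f x = g x) \<Longrightarrow> nrm S f = nrm S g"
  unfolding nrm_def by (intro arg_cong[where f=L2norm] ext) (auto simp: indicator_def)

lemma nrm_mono_set: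
  fixes f :: "real \<Rightarrow> 'a::{real_normed_vector,second_countable_topology}"
  assumes "L2 f" "S \<subseteq> T" "T \<in> sets borel"
  shows "nrm S f \<le> nrm T f"
  unfolding nrm_def by (rule L2norm_mono[OF L2_indicator[OF assms(1,3)]]) (use assms in \<open>auto simp: indicator_def\<close>)

lemma nrm_reflect:
  fixes f :: "real \<Rightarrow> 'a::{real_normed_vector,second_countable_topology}"
  assumes "\<And>x. x \<in> S \<longleftrightarrow> -x \<in> T"
  shows "nrm S f = nrm T (\<lambda>x. f (-x))"
proof -
  have "nrm T (\<lambda>x. f (-x)) = L2norm (\<lambda>x. (\<lambda>y. indicator S y *\<^sub>R f y) (-x))"
    unfolding nrm_def using assms by (intro arg_cong[where f=L2norm] ext) (auto simp: indicator_def)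
  also have "\<dots> = nrm S f" unfolding nrm_def by (rule L2norm_reflect)
  finally show ?thesis by simp
qed

lemma nrm_uminus:
  fixes f :: "real \<Rightarrow> 'a::{real_normed_vector,second_countable_topology}"
  shows "nrm S (\<lambda>x. - f x) = nrm S f"
  unfolding nrm_def L2norm_def by simp

lemma kd_meas[measurable]: "kd \<in> borel_measurable borel"
  and kT_meas[measurable]: "kT \<in> borel_measurable borel"
  by (intro borel_measurable_continuous_onI kd_cont kT_cont)+

lemma kd_shift_L2: "L2 (\<lambda>x. kd (x - c))"
  using L2_shift[OF kd_L2, of "-c"] by simp

lemma nrm_kd_left:
  assumes "0 \<le> B" shows "nrm {..c-B} (\<lambda>x. kd (x - c)) \<le> sqrt (gap B)"
proof -
  have "nrm {..c-B} (\<lambda>x. kd (x - c)) = nrm {-c+B..} (\<lambda>x. kd (- x - c))"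
    by (rule nrm_reflect) auto
  also have "\<dots> = nrm {-c+B..} (\<lambda>x. kd (x - (-c)))"
    by (rule nrm_cong) (metis kd_minus minus_diff_eq minus_minus diff_minus_eq_add minus_add_distrib uminus_add_conv_diff)
  also have "\<dots> \<le> sqrt (gap B)" by (rule nrm_kd[OF assms])
  finally show ?thesis .
qed

lemma unit_prod_dist:
  fixes A A' C C' :: complex
  assumes "cmod C = 1" "cmod A' = 1"
  shows "cmod (A * cnj C - A' * cnj C') \<le> cmod (A - A') + cmod (C - C')"
proof -
  have "A * cnj C - A' * cnj C' = (A - A') * cnj C + A' * cnj (C - C')" by (simp add: algebra_simps)
  also have "cmod \<dots> \<le> cmod ((A - A') * cnj C) + cmod (A' * cnj (C - C'))" by (rule norm_triangle_ineq)
  also have "\<dots> = cmod (A - A') + cmod (C - C')" by (simp only: norm_mult complex_mod_cnj assms mult_1_right mult_1_left)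
  finally show ?thesis .
qed

context finite_energy begin

lemma nrm_du: "S \<in> sets borel \<Longrightarrow> (LINT x:S|lborel. ed x) \<le> t \<Longrightarrow> nrm S du \<le> sqrt (2 * t)"
proof (rule nrm_sq_le[OF Ldu])
  assume S: "S \<in> sets borel" "(LINT x:S|lborel. ed x) \<le> t"
  have "(LINT x:S|lborel. (cmod (du x))^2) \<le> (LINT x:S|lborel. 2 * ed x)"
  proof (rule set_integral_mono)
    show "set_integrable lborel S (\<lambda>x. (cmod (du x))^2)"
      unfolding set_integrable_def by (intro integrable_mult_indicator L2_int Ldu) (use S in simp)
    show "set_integrable lborel S (\<lambda>x. 2 * ed x)" using ed_set_integrable[OF S(1)] by simp
  qed (simp add: ed_def)
  then show "(LINT x:S|lborel. (cmod (du x))^2) \<le> 2 * t" using S by simp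
qed

lemma nrm_eta: "S \<in> sets borel \<Longrightarrow> (LINT x:S|lborel. ed x) \<le> t \<Longrightarrow> nrm S (\<lambda>x. 1 - (cmod (u x))^2) \<le> sqrt (4 * t)"
proof (rule nrm_sq_le[OF Leta])
  assume S: "S \<in> sets borel" "(LINT x:S|lborel. ed x) \<le> t"
  have "(LINT x:S|lborel. (norm (1 - (cmod (u x))^2))^2) \<le> (LINT x:S|lborel. 4 * ed x)"
  proof (rule set_integral_mono)
    show "set_integrable lborel S (\<lambda>x. (norm (1 - (cmod (u x))^2))^2)"
      unfolding set_integrable_def by (intro integrable_mult_indicator L2_int Leta) (use S in simp)
    show "set_integrable lborel S (\<lambda>x. 4 * ed x)" using ed_set_integrable[OF S(1)] by simp
  qed (simp add: ed_def)
  then show "(LINT x:S|lborel. (norm (1 - (cmod (u x))^2))^2) \<le> 4 * t" using S by simp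
qed

lemma reflect: "finite_energy (\<lambda>x. u (-x)) (\<lambda>x. - du (-x))"
proof
  show "prim (\<lambda>x. u (-x)) (\<lambda>x. - du (-x))" by (rule prim_reflect[OF pu])
  show "L2 (\<lambda>x. - du (-x))" by (rule L2_uminus(1)[OF L2_reflect[OF Ldu]])
  show "L2 (\<lambda>x. 1 - (cmod (u (-x)))^2)" by (rule L2_reflect[OF Leta])
qed

text \<open>\<open>xp\<close> is the supremum of the closed set where the modulus is at most
  \<open>\<delta>\<close>, bounded above because the modulus tends to 1. By continuity the modulus
  is at least \<open>\<delta>\<close> from \<open>xp\<close> on, \<open>xp\<close> included, so the
  polar form is available on the closed half-line.\<close>

lemma last_small:
  assumes "0 < \<delta>" "\<delta> < 1/2" "cmod (u x0) \<le> \<delta>" "\<And>x. cmod (u x) \<le> K"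
  obtains xp where "x0 \<le> xp" "cmod (u xp) \<le> \<delta>" "\<And>x. x \<ge> xp \<Longrightarrow> u x \<noteq> 0"
proof -
  define S where "S = {x. cmod (u x) \<le> \<delta>}"
  have "\<forall>\<^sub>F x in at_top. cmod (u x) > 1/2"
    by (rule order_tendstoD(1)[OF mod_tendsto_one(1)[OF assms(4)]]) simp
  then obtain X where X: "\<And>x. x \<ge> X \<Longrightarrow> cmod (u x) > 1/2" by (auto simp: eventually_at_top_linorder)
  have bdd: "bdd_above S"
  proof (rule bdd_aboveI)
    fix x assume "x \<in> S"
    then show "x \<le> X" using X[of x] assms(2) unfolding S_def by (cases "x \<ge> X") auto
  qed
  have cl: "closed S" unfolding S_def by (intro closed_Collect_le continuous_intros cu)
  have x0: "x0 \<in> S" using assms(3) by (simp add: S_def)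
  define xp where "xp = Sup S"
  have xpS: "xp \<in> S" unfolding xp_def by (rule closed_contains_Sup[OF _ bdd cl]) (use x0 in auto)
  have up: "x \<le> xp" if "x \<in> S" for x unfolding xp_def by (rule cSup_upper[OF that bdd])
  have gt: "cmod (u x) > \<delta>" if "x > xp" for x using up[of x] that by (force simp: S_def)
  have "closure {xp<..} \<subseteq> {x. \<delta> \<le> cmod (u x)}"
  proof (rule closure_minimal)
    show "closed {x. \<delta> \<le> cmod (u x)}" by (intro closed_Collect_le continuous_intros cu)
    show "{xp<..} \<subseteq> {x. \<delta> \<le> cmod (u x)}"
    proof
      fix x assume "x \<in> {xp<..}"
      then show "x \<in> {x. \<delta> \<le> cmod (u x)}" using gt[of x] by simp
    qed
  qed
  then have ge: "\<delta> \<le> cmod (u x)" if "x \<ge> xp" for x using that by auto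
  show thesis
  proof (rule that)
    show "x0 \<le> xp" by (rule up[OF x0])
    show "cmod (u xp) \<le> \<delta>" using xpS by (simp add: S_def)
    show "u x \<noteq> 0" if "x \<ge> xp" for x using ge[OF that] assms(1) by auto
  qed
qed

text \<open>The Modica identity on both half-lines saturates the minimal energy \<^term>\<open>2 * sqrt 2 / 3\<close>,
  so the energy excess controls both defects and the energy between the two half-lines.\<close>

lemma two_sided_defect:
  assumes bd: "\<And>x. cmod (u x) \<le> K" and x: "xm \<le> xp"
    and nzp: "\<And>x. x \<ge> xp \<Longrightarrow> u x \<noteq> 0" and nzm: "\<And>x. x \<le> xm \<Longrightarrow> u x \<noteq> 0"
    and E: "energy u du + Gf (cmod (u xp)) + Gf (cmod (u xm)) - 2 * sqrt 2 / 3 \<le> c"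
  shows "(LINT x:{xm..xp}|lborel. ed x) \<le> c"
    and "R \<ge> xp \<Longrightarrow> (LINT x:{xp..R}|lborel. df x) \<le> c"
    and "R \<ge> -xm \<Longrightarrow> (LINT x:{-xm..R}|lborel. finite_energy.df (\<lambda>x. u (-x)) (\<lambda>x. - du (-x)) x) \<le> c"
proof -
  interpret L: finite_energy "\<lambda>x. u (-x)" "\<lambda>x. - du (-x)" by (rule reflect)
  have Led: "L.ed x = ed (-x)" for x by (simp add: L.ed_def ed_def)
  define mid where "mid = (LINT x:{xm..xp}|lborel. ed x)"
  \<comment> \<open>The energy on \<open>{-R..R}\<close> is cut at \<open>xm\<close> and
    \<open>xp\<close>, and the two outer pieces are expanded by \<open>modica\<close>, the left one
    after reflection.\<close>
  have id: "(LINT x:{xp..R}|lborel. df x) + (LINT x:{-xm..R}|lborel. L.df x) + mid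
     \<le> energy u du + Gf (cmod (u xp)) + Gf (cmod (u xm)) - Gf (cmod (u R)) - Gf (cmod (u (-R)))"
    if R: "R \<ge> xp" "R \<ge> -xm" for R
  proof -
    have a: "(LINT x:{xp..R}|lborel. ed x) = (LINT x:{xp..R}|lborel. df x) + Gf (cmod (u R)) - Gf (cmod (u xp))"
      by (rule modica(2)) (use R nzp in auto)
    have b: "(LINT x:{-xm..R}|lborel. L.ed x) = (LINT x:{-xm..R}|lborel. L.df x) + Gf (cmod (u (-R))) - Gf (cmod (u (-(-xm))))"
      by (rule L.modica(2)) (use R nzm in auto)
    have c: "(LINT x:{-xm..R}|lborel. L.ed x) = (LINT x:{-R..xm}|lborel. ed x)"
      using set_integral_reflect_Icc(1)[of "-xm" R ed] by (simp add: Led)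
    have d: "(LINT x:{-R..R}|lborel. ed x) = (LINT x:{-R..xm}|lborel. ed x) + (LINT x:{xm..R}|lborel. ed x)"
      by (rule set_integral_Icc_combine[OF ed_set_integrable]) (use R x in auto)
    have e: "(LINT x:{xm..R}|lborel. ed x) = mid + (LINT x:{xp..R}|lborel. ed x)"
      unfolding mid_def by (rule set_integral_Icc_combine[OF ed_set_integrable]) (use R x in auto)
    have "(LINT x:{-R..R}|lborel. ed x) \<le> energy u du" by (rule ed_set_le) simp
    then show ?thesis using a b c d e by simp
  qed
  have mono1: "(LINT x:{xp..R}|lborel. df x) \<le> (LINT x:{xp..R'}|lborel. df x)" if "xp \<le> R" "R \<le> R'" for R R'
    unfolding set_lebesgue_integral_def
    by (rule integral_mono)
       (use modica(1)[of xp R] modica(1)[of xp R'] nzp that df_nonneg in \<open>auto simp: set_integrable_def indicator_def\<close>)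
  have mono2: "(LINT x:{-xm..R}|lborel. L.df x) \<le> (LINT x:{-xm..R'}|lborel. L.df x)" if "-xm \<le> R" "R \<le> R'" for R R'
    unfolding set_lebesgue_integral_def
    by (rule integral_mono)
       (use L.modica(1)[of "-xm" R] L.modica(1)[of "-xm" R'] nzm that L.df_nonneg in \<open>auto simp: set_integrable_def indicator_def\<close>)
  have main: "(LINT x:{xp..R}|lborel. df x) + (LINT x:{-xm..R}|lborel. L.df x) + mid \<le> c"
    if R: "R \<ge> xp" "R \<ge> -xm" for R
  proof -
    have "(LINT x:{xp..R}|lborel. df x) + (LINT x:{-xm..R}|lborel. L.df x) + mid
       \<le> energy u du + Gf (cmod (u xp)) + Gf (cmod (u xm)) - sqrt 2 / 3 - sqrt 2 / 3"
    proof (rule tendsto_lowerbound)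
      show "((\<lambda>R. energy u du + Gf (cmod (u xp)) + Gf (cmod (u xm)) - Gf (cmod (u R)) - Gf (cmod (u (-R))))
        \<longlongrightarrow> energy u du + Gf (cmod (u xp)) + Gf (cmod (u xm)) - sqrt 2 / 3 - sqrt 2 / 3) at_top"
        by (intro tendsto_intros Gf_tendsto[OF bd] L.Gf_tendsto[OF bd])
      show "\<forall>\<^sub>F R' in at_top. (LINT x:{xp..R}|lborel. df x) + (LINT x:{-xm..R}|lborel. L.df x) + mid
         \<le> energy u du + Gf (cmod (u xp)) + Gf (cmod (u xm)) - Gf (cmod (u R')) - Gf (cmod (u (-R')))"
        using eventually_ge_at_top[of R]
      proof eventually_elim
        fix R' assume R': "R \<le> R'"
        show "(LINT x:{xp..R}|lborel. df x) + (LINT x:{-xm..R}|lborel. L.df x) + mid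
         \<le> energy u du + Gf (cmod (u xp)) + Gf (cmod (u xm)) - Gf (cmod (u R')) - Gf (cmod (u (-R')))"
          using id[of R'] mono1[OF R(1) R'] mono2[OF R(2) R'] R R' by linarith
      qed
    qed simp
    then show ?thesis using E by linarith
  qed
  have n1: "0 \<le> (LINT x:{xp..R}|lborel. df x)" and n2: "0 \<le> (LINT x:{-xm..R}|lborel. L.df x)" for R
    unfolding set_lebesgue_integral_def by (simp_all add: df_nonneg L.df_nonneg)
  have n3: "0 \<le> mid" unfolding mid_def set_lebesgue_integral_def by (simp add: ed_nonneg)
  define R0 where "R0 = max xp (-xm)"
  have R0: "R0 \<ge> xp" "R0 \<ge> -xm" by (simp_all add: R0_def)
  show "(LINT x:{xm..xp}|lborel. ed x) \<le> c"
    using main[OF R0] n1[of R0] n2[of R0] by (simp add: mid_def)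
  define R1 where "R1 = max R R0"
  have R1: "R1 \<ge> xp" "R1 \<ge> -xm" "R1 \<ge> R" using R0 by (auto simp: R1_def le_max_iff_disj)
  show "R \<ge> xp \<Longrightarrow> (LINT x:{xp..R}|lborel. df x) \<le> c"
    using main[OF R1(1,2)] mono1[of R R1] R1(3) n2[of R1] n3 by linarith
  show "R \<ge> -xm \<Longrightarrow> (LINT x:{-xm..R}|lborel. L.df x) \<le> c"
    using main[OF R1(1,2)] mono2[of R R1] R1(3) n1[of R1] n3 by linarith
qed

text \<open>With energy at most \<open>3 * \<delta>\<close>, a map that is almost zero at
  \<open>xm\<close> stays below \<open>1/2\<close> for unit length, and the energy density is at
  least \<open>9/64\<close> there. The length is then at most \<open>64/3 * \<delta>\<close>,
  rounded to \<open>22 * \<delta>\<close>; the cut-off at \<open>xm + 1\<close> is not reached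
  because \<open>9/64\<close> exceeds \<open>3/96\<close>.\<close>

lemma short_core:
  assumes x: "xm \<le> xp" and um: "cmod (u xm) \<le> \<delta>" and mid: "(LINT x:{xm..xp}|lborel. ed x) \<le> 3 * \<delta>"
    and \<delta>: "0 < \<delta>" "\<delta> \<le> 1/96"
  shows "xp - xm \<le> 22 * \<delta>"
proof -
  define y1 where "y1 = min xp (xm + 1)"
  have y1: "xm \<le> y1" "y1 \<le> xp" "y1 \<le> xm + 1" using x by (auto simp: y1_def)
  have lb: "9/64 \<le> ed y" if y: "y \<in> {xm..y1}" for y
  proof -
    have "(cmod (u y - u xm))^2 \<le> (y - xm) * (LINT z:{xm..y}|lborel. (cmod (du z))^2)"
      by (rule prim_hoelder_local[OF pu Ldu]) (use y in auto)
    also have "\<dots> \<le> 1 * (LINT z:{xm..xp}|lborel. 2 * ed z)"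
    proof (rule mult_mono)
      show "(LINT z:{xm..y}|lborel. (cmod (du z))^2) \<le> (LINT z:{xm..xp}|lborel. 2 * ed z)"
        unfolding set_lebesgue_integral_def
      proof (rule integral_mono)
        show "integrable lborel (\<lambda>z. indicator {xm..y} z *\<^sub>R (cmod (du z))\<^sup>2)"
          by (intro integrable_mult_indicator L2_int Ldu) simp
        show "integrable lborel (\<lambda>z. indicator {xm..xp} z *\<^sub>R (2 * ed z))"
          by (intro integrable_mult_indicator integrable_mult_right ed_integrable) simp
        show "indicator {xm..y} z *\<^sub>R (cmod (du z))\<^sup>2 \<le> indicator {xm..xp} z *\<^sub>R (2 * ed z)" for z
          using y y1 by (auto simp: indicator_def ed_def)
      qed
    qed (use y y1 in \<open>auto simp: set_lebesgue_integral_def\<close>)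
    also have "\<dots> \<le> (1/4)^2" using mid \<delta> by (simp add: power2_eq_square)
    finally have "cmod (u y - u xm) \<le> 1/4" by (rule power2_le_imp_le) simp
    then have "cmod (u y) \<le> 1/2" using norm_triangle_sub[of "u y" "u xm"] um \<delta> by linarith
    then have "(cmod (u y))^2 \<le> (1/2)^2" by (intro power_mono) auto
    then have "3/4 \<le> 1 - (cmod (u y))^2" by (simp add: power2_eq_square)
    then have "(3/4)^2 \<le> (1 - (cmod (u y))^2)^2" by (intro power_mono) auto
    then show "9/64 \<le> ed y" unfolding ed_def power2_eq_square[of "3/4"] by (simp add: add_increasing)
  qed
  have "(y1 - xm) * (9/64) = (LINT z:{xm..y1}|lborel. 9/64)" using y1 by (simp add: set_lebesgue_integral_def)
  also have "\<dots> \<le> (LINT z:{xm..y1}|lborel. ed z)"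
    by (rule set_integral_mono[OF borel_integrable_atLeastAtMost' ed_set_integrable]) (use lb in auto)
  also have "\<dots> \<le> (LINT z:{xm..xp}|lborel. ed z)" by (rule ed_set_mono) (use y1 in auto)
  finally have l: "(y1 - xm) * (9/64) \<le> 3 * \<delta>" using mid by linarith
  then have "y1 \<noteq> xm + 1" using \<delta> by auto
  then have "y1 = xp" by (auto simp: y1_def min_def split: if_splits)
  then show ?thesis using l \<delta> by simp
qed

end

text \<open>At 0 the convention for division gives \<open>dir 0 = 0\<close>, so
  \<open>dir_norm_le\<close> and \<open>dir_prod_dist\<close> hold for all arguments.\<close>

definition dir :: "complex \<Rightarrow> complex" where "dir z = z / of_real (cmod z)"

lemma dir_norm: "z \<noteq> 0 \<Longrightarrow> cmod (dir z) = 1"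
  by (simp add: dir_def norm_divide)

text \<open>From left to right the pieces are tail, profile, core, profile and tail.\<close>

lemma UNIV_five: "(a::real) \<le> b \<Longrightarrow> 0 \<le> B \<Longrightarrow> UNIV = {..a-B} \<union> {a-B..<a} \<union> {a..b} \<union> {b..b+B} \<union> {b+B..}"
  by auto

lemma L2norm_five:
  fixes f :: "real \<Rightarrow> 'a::{real_normed_vector,second_countable_topology}"
  assumes "L2 f" "a \<le> b" "0 \<le> B" "nrm {..a-B} f \<le> n1" "nrm {a-B..<a} f \<le> n2" "nrm {a..b} f \<le> n3" "nrm {b..b+B} f \<le> n4" "nrm {b+B..} f \<le> n5"
  shows "L2norm f \<le> n1 + n2 + n3 + n4 + n5"
proof -
  have "L2norm f = nrm UNIV f" by (simp add: nrm_def)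
  also have "\<dots> \<le> nrm {..a-B} f + nrm {a-B..<a} f + nrm {a..b} f + nrm {b..b+B} f + nrm {b+B..} f"
    unfolding UNIV_five[OF assms(2,3)]
    by (intro order_trans[OF nrm_Un[OF assms(1)]] add_mono order_refl) auto
  finally show ?thesis using assms(4-8) by linarith
qed

context finite_energy begin

text \<open>The points \<open>xm\<close> and \<open>xp\<close> supplied by \<open>last_small\<close>
  bound a short core, and \<open>half_line_profile\<close> applies outside it, on the left after
  reflection. The kink is centred at \<open>xp\<close> throughout; on the left this moves it from
  \<open>xm\<close> by at most \<open>22 * \<delta>\<close>, which the Lipschitz bounds for
  \<open>kT\<close> and \<open>kd\<close> absorb. The last clause combines
  \<open>half_line_phase\<close> on both sides.\<close>

lemma corner:
  assumes E: "energy u du \<le> 2 * sqrt 2 / 3 + \<delta>" and \<delta>: "0 < \<delta>" "\<delta> \<le> 1/96" and x0: "cmod (u x0) \<le> \<delta>"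
    and B: "0 < B" and M: "M = 3*\<delta> + 2 * sqrt (2 * B * (3*\<delta>))" "M \<le> 1" "3*\<delta> + gap B + 4 * M \<le> \<tau>" "\<tau> \<le> 1/32"
    and c: "0 < c" "c \<le> B" "M < kT c"
    and lam: "lam = 2 * sqrt (2 * (3*\<delta>)) + (M * (2 + M) + sqrt (2 * B * (3*\<delta>)) / (kT c - M)) * sqrt B + 2 * sqrt c"
  obtains a \<sigma>p \<sigma>m where "cmod \<sigma>p = 1" "cmod \<sigma>m = 1" "\<bar>a - x0\<bar> \<le> 22 * \<delta>" "cmod (u a) \<le> \<delta>"
    "L2 (\<lambda>x. du x - (if x \<ge> a then \<sigma>p else \<sigma>m) * of_real (kd (x - a)))"
    "L2norm (\<lambda>x. du x - (if x \<ge> a then \<sigma>p else \<sigma>m) * of_real (kd (x - a)))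
      \<le> 2 * (sqrt (2 * \<tau>) + sqrt (gap B)) + 2 * lam + 22 * \<delta> * sqrt B + sqrt (6 * \<delta>) + sqrt (22 * \<delta>)"
    "L2 (\<lambda>x. cmod (u x) - \<bar>kT (x - a)\<bar>)"
    "L2norm (\<lambda>x. cmod (u x) - \<bar>kT (x - a)\<bar>)
      \<le> 2 * (sqrt (4 * \<tau>) + sqrt 2 * sqrt (gap B)) + (2 * M + 22 * \<delta>) * sqrt B + 6 * sqrt (22 * \<delta>)"
    "\<forall>\<^sub>F R in at_top. cmod (exp (\<i> * of_real (LINT x:{-R..R}|lborel. Im (cnj (u x) * du x))) * \<sigma>p * cnj \<sigma>m
        + dir (u R) * cnj (dir (u (-R)))) \<le> 2 * (sqrt (2 * (3*\<delta>)) * (5 * sqrt B + 4)) + 60 * \<delta>"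
proof -
  interpret L: finite_energy "\<lambda>x. u (-x)" "\<lambda>x. - du (-x)" by (rule reflect)
  have Led: "L.ed x = ed (-x)" for x by (simp add: L.ed_def ed_def)
  have s2: "sqrt 2 \<le> (143/100::real)" by (rule real_le_lsqrt) (auto simp: power2_eq_square)
  have E1: "energy u du \<le> 1" using E \<delta> s2 by linarith
  have LE1: "energy (\<lambda>x. u (-x)) (\<lambda>x. - du (-x)) \<le> 1"
    using E1 lborel_integral_reflect[of ed] unfolding L.ed_integral[symmetric] ed_integral[symmetric] Led by simp
  have five: "cmod (u x) \<le> 5" for x by (rule bounded_five[OF E1])
  have d2: "\<delta> < 1/2" using \<delta> by simp
  obtain xp where xp: "x0 \<le> xp" "cmod (u xp) \<le> \<delta>" "\<And>x. x \<ge> xp \<Longrightarrow> u x \<noteq> 0"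
    using last_small[OF \<delta>(1) d2 x0 five] by blast
  have x0': "cmod (u (- (- x0))) \<le> \<delta>" using x0 by simp
  obtain xn where xn: "-x0 \<le> xn" "cmod (u (-xn)) \<le> \<delta>" "\<And>x. x \<ge> xn \<Longrightarrow> u (-x) \<noteq> 0"
    using L.last_small[OF \<delta>(1) d2 x0' five] by blast
  define xm where "xm = -xn"
  have xm: "xm \<le> x0" "cmod (u xm) \<le> \<delta>" "\<And>x. x \<le> xm \<Longrightarrow> u x \<noteq> 0"
    using xn(1,2) xn(3)[of "-x" for x] by (auto simp: xm_def)
  have mp: "xm \<le> xp" using xm(1) xp(1) by linarith
  have Gd: "Gf (cmod (u xp)) \<le> \<delta>" "Gf (cmod (u xm)) \<le> \<delta>"
    using Gf_le_self[of "cmod (u xp)"] Gf_le_self[of "cmod (u xm)"] xp(2) xm(2) by simp_all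
  \<comment> \<open>One \<open>\<delta>\<close> from the energy excess and one from each value of
    \<open>Gf\<close>; this is the origin of the \<open>3*\<delta>\<close> in the
    hypotheses.\<close>
  have ex: "energy u du + Gf (cmod (u xp)) + Gf (cmod (u xm)) - 2 * sqrt 2 / 3 \<le> 3*\<delta>" using E Gd by linarith
  note DD = two_sided_defect[OF five mp xp(3) xm(3) ex]
  have mid: "(LINT x:{xm..xp}|lborel. ed x) \<le> 3*\<delta>" by (rule DD(1)) auto
  have Dp: "(LINT x:{xp..R}|lborel. df x) \<le> 3*\<delta>" if "R \<ge> xp" for R by (rule DD(2)) (use that in auto)
  have Dm: "(LINT x:{-xm..R}|lborel. L.df x) \<le> 3*\<delta>" if "R \<ge> -xm" for R by (rule DD(3)) (use that in auto)
  define l where "l = xp - xm"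
  have l: "0 \<le> l" "l \<le> 22 * \<delta>" using short_core[OF mp xm(2) mid \<delta>] mp by (auto simp: l_def)
  have bp: "cmod (u xp) \<le> 3*\<delta>" and bmm: "cmod (u (-(-xm))) \<le> 3*\<delta>" using xp(2) xm(2) \<delta> by auto
  have nzL: "x \<ge> -xm \<Longrightarrow> u (-x) \<noteq> 0" for x using xm(3)[of "-x"] by simp
  have g0: "0 \<le> gap B" using gap_nonneg B by simp
  have M0: "0 \<le> M" using M(1) \<delta> B by simp
  have \<tau>0: "0 \<le> \<tau>" using M(3) g0 M0 \<delta> by linarith
  have tau32: "3*\<delta> + gap B + 4 * M \<le> 1/32" using M(3,4) by linarith
  define \<sigma>p where "\<sigma>p = dir (u (xp + B))"
  \<comment> \<open>The kink is negative on the left, so the phase there is minus the direction of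
    \<open>u\<close>.\<close>
  define \<sigma>m where "\<sigma>m = - dir (u (xm - B))"
  have sp: "cmod \<sigma>p = 1" unfolding \<sigma>p_def by (rule dir_norm) (use xp(3) B in simp)
  have sm: "cmod \<sigma>m = 1" unfolding \<sigma>m_def norm_minus_cancel by (rule dir_norm) (use xm(3) B in simp)
  note P1 = half_line_mod[OF bp xp(3) Dp B, folded M(1)] and P2 = half_line_deriv[OF bp xp(3) Dp B, folded M(1), OF _ _ c, folded lam]
  note Q1 = L.half_line_mod[OF bmm nzL Dm B, folded M(1)] and Q2 = L.half_line_deriv[OF bmm nzL Dm B, folded M(1), OF _ _ c, folded lam]
  have tailp: "(LINT x:{xp+B..}|lborel. ed x) \<le> \<tau>"
    by (rule nonneg_half_line_le[OF ed_integrable])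
       (use half_line_tail[OF bp xp(3) Dp B M(1,2)] M(3) in fastforce)
  have tailm: "(LINT x:{-xm+B..}|lborel. L.ed x) \<le> \<tau>"
    by (rule nonneg_half_line_le[OF L.ed_integrable])
       (use L.half_line_tail[OF bmm nzL Dm B M(1,2)] M(3) in fastforce)
  define f where "f x = du x - (if x \<ge> xp then \<sigma>p else \<sigma>m) * of_real (kd (x - xp))" for x
  have Lk: "L2 (\<lambda>x. (if x \<ge> xp then \<sigma>p else \<sigma>m) * complex_of_real (kd (x - xp)))"
  proof (rule L2_bound[OF _ kd_shift_L2[of xp], where K=1])
    show "(\<lambda>x. (if x \<ge> xp then \<sigma>p else \<sigma>m) * complex_of_real (kd (x - xp))) \<in> borel_measurable borel" by measurable
  qed (use sp sm in \<open>auto simp: norm_mult\<close>)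
  have Lf: "L2 f" unfolding f_def by (rule L2_diff(1)[OF Ldu Lk])
  have fle: "norm (f x) \<le> norm (du x) + norm (kd (x - xp))" for x
  proof -
    have "norm (f x) \<le> norm (du x) + norm ((if x \<ge> xp then \<sigma>p else \<sigma>m) * complex_of_real (kd (x - xp)))"
      unfolding f_def by (rule norm_triangle_ineq4)
    then show ?thesis using sp sm by (simp add: norm_mult split: if_splits)
  qed
  have F5: "nrm {xp+B..} f \<le> sqrt (2 * \<tau>) + sqrt (gap B)"
  proof -
    have "nrm {xp+B..} f \<le> nrm {xp+B..} du + nrm {xp+B..} (\<lambda>x. kd (x - xp))"
      by (rule nrm_add_le[OF _ Ldu kd_shift_L2]) (use fle in auto)
    also have "nrm {xp+B..} du \<le> sqrt (2 * \<tau>)" by (rule nrm_du[OF _ tailp]) simp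
    also have "nrm {xp+B..} (\<lambda>x. kd (x - xp)) \<le> sqrt (gap B)" by (rule nrm_kd) (use B in simp)
    finally show ?thesis by simp
  qed
  have F4: "nrm {xp..xp+B} f \<le> lam"
  proof -
    have "nrm {xp..xp+B} f = nrm {xp..xp+B} (\<lambda>x. du x - u (xp+B) / of_real (cmod (u (xp+B))) * of_real (kd (x - xp)))"
      by (rule nrm_cong) (simp add: f_def \<sigma>p_def dir_def)
    also have "\<dots> \<le> lam" by (rule P2) auto
    finally show ?thesis .
  qed
  have F3: "nrm {xm..xp} f \<le> sqrt (6 * \<delta>) + sqrt (22 * \<delta>)"
  proof -
    have "nrm {xm..xp} f \<le> nrm {xm..xp} du + nrm {xm..xp} (\<lambda>x. kd (x - xp))"
      by (rule nrm_add_le[OF _ Ldu kd_shift_L2]) (use fle in auto)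
    also have "nrm {xm..xp} du \<le> sqrt (2 * (3*\<delta>))" by (rule nrm_du[OF _ mid]) simp
    also have "nrm {xm..xp} (\<lambda>x. kd (x - xp)) \<le> 1 * sqrt (xp - xm)"
      by (rule nrm_Icc_bound[OF mp]) (use kd_bounds in auto)
    also have "sqrt (xp - xm) \<le> sqrt (22 * \<delta>)" using l by (simp add: l_def)
    finally show ?thesis by simp
  qed
  have F1: "nrm {..xm-B} f \<le> sqrt (2 * \<tau>) + sqrt (gap B)"
  proof -
    have "nrm {..xm-B} f \<le> nrm {..xm-B} du + nrm {..xm-B} (\<lambda>x. kd (x - xp))"
      by (rule nrm_add_le[OF _ Ldu kd_shift_L2]) (use fle in auto)
    also have "nrm {..xm-B} du = nrm {-xm+B..} (\<lambda>x. du (-x))" by (rule nrm_reflect) auto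
    also have "\<dots> = nrm {-xm+B..} (\<lambda>x. - du (-x))" by (rule nrm_uminus[symmetric])
    also have "\<dots> \<le> sqrt (2 * \<tau>)" by (rule L.nrm_du[OF _ tailm]) simp
    also have "nrm {..xm-B} (\<lambda>x. kd (x - xp)) \<le> nrm {..xp-B} (\<lambda>x. kd (x - xp))"
      by (rule nrm_mono_set[OF kd_shift_L2]) (use mp in auto)
    also have "\<dots> \<le> sqrt (gap B)" by (rule nrm_kd_left) (use B in simp)
    finally show ?thesis by simp
  qed
  have F2: "nrm {xm-B..<xm} f \<le> lam + 22 * \<delta> * sqrt B"
  proof -
    define g where "g x = du x - \<sigma>m * of_real (kd (x - xm))" for x
    have Lg: "L2 g"
    proof -
      have "L2 (\<lambda>x. complex_of_real (kd (x - xm)))"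
        using kd_shift_L2[of xm] by (auto simp: L2_def)
      then show ?thesis unfolding g_def by (intro L2_diff(1) Ldu L2_cmult(1))
    qed
    have Lh: "L2 (\<lambda>x. kd (x - xm) - kd (x - xp))" by (rule L2_diff(1)[OF kd_shift_L2 kd_shift_L2])
    have "nrm {xm-B..<xm} f \<le> nrm {xm-B..<xm} g + nrm {xm-B..<xm} (\<lambda>x. kd (x - xm) - kd (x - xp))"
    proof (rule nrm_add_le[OF _ Lg Lh])
      fix x assume "x \<in> {xm-B..<xm}"
      then have "f x = g x + \<sigma>m * of_real (kd (x - xm) - kd (x - xp))"
        using mp by (simp add: f_def g_def algebra_simps)
      then have "norm (f x) \<le> norm (g x) + norm (\<sigma>m * of_real (kd (x - xm) - kd (x - xp)))"
        by (metis norm_triangle_ineq)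
      then show "norm (f x) \<le> norm (g x) + norm (kd (x - xm) - kd (x - xp))"
        unfolding norm_mult sm norm_of_real by simp
    qed simp
    also have "nrm {xm-B..<xm} g \<le> nrm {xm-B..xm} g" by (rule nrm_mono_set[OF Lg]) auto
    also have "nrm {xm-B..xm} g = nrm {-xm..-xm+B} (\<lambda>x. g (-x))" by (rule nrm_reflect) auto
    also have "\<dots> = nrm {-xm..-xm+B} (\<lambda>x. - g (-x))" by (rule nrm_uminus[symmetric])
    also have "\<dots> = nrm {-xm..-xm+B} (\<lambda>x. - du (-x) - u (-(-xm+B)) / of_real (cmod (u (-(-xm+B)))) * of_real (kd (x - -xm)))"
    proof (rule nrm_cong)
      fix x
      have k: "kd (- x - xm) = kd (x - -xm)" using kd_minus[of "x + xm"] by (simp add: algebra_simps)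
      have a: "-(-xm+B) = xm - B" by simp
      show "- g (-x) = - du (-x) - u (-(-xm+B)) / of_real (cmod (u (-(-xm+B)))) * of_real (kd (x - -xm))"
        unfolding g_def k a \<sigma>m_def dir_def by simp
    qed
    also have "\<dots> \<le> lam" by (rule Q2) auto
    also have "nrm {xm-B..<xm} (\<lambda>x. kd (x - xm) - kd (x - xp)) \<le> nrm {xm-B..xm} (\<lambda>x. kd (x - xm) - kd (x - xp))"
      by (rule nrm_mono_set[OF Lh]) auto
    also have "\<dots> \<le> (22 * \<delta>) * sqrt (xm - (xm - B))"
    proof (rule nrm_Icc_bound)
      fix x
      have "\<bar>kd (x - xm) - kd (x - xp)\<bar> \<le> \<bar>(x - xm) - (x - xp)\<bar>" by (rule kd_Lipschitz)
      then show "norm (kd (x - xm) - kd (x - xp)) \<le> 22 * \<delta>" using l by (simp add: l_def)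
    qed (use B \<delta> in auto)
    finally show ?thesis by simp
  qed
  have FF: "L2norm f \<le> 2 * (sqrt (2 * \<tau>) + sqrt (gap B)) + 2 * lam + 22 * \<delta> * sqrt B + sqrt (6 * \<delta>) + sqrt (22 * \<delta>)"
    using L2norm_five[OF Lf mp _ F1 F2 F3 F4 F5] B by simp
  define h where "h x = cmod (u x) - \<bar>kT (x - xp)\<bar>" for x
  define et where "et x = 1 - (cmod (u x))^2" for x
  have Let: "L2 et" unfolding et_def by (rule Leta)
  have Lsk: "L2 (\<lambda>x. sqrt 2 * kd (x - xp))" by (rule L2_cmult(1)[OF kd_shift_L2])
  have hle: "norm (h x) \<le> norm (et x) + norm (sqrt 2 * kd (x - xp))" for x
  proof -
    have "\<bar>1 - r\<bar> \<le> \<bar>1 - r^2\<bar>" if "r \<ge> 0" for r :: real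
    proof -
      have "\<bar>1 - r\<bar> * 1 \<le> \<bar>1 - r\<bar> * \<bar>1 + r\<bar>" using that by (intro mult_left_mono) auto
      also have "\<dots> = \<bar>1 - r^2\<bar>" unfolding abs_mult[symmetric] by (simp add: power2_eq_square algebra_simps)
      finally show ?thesis by simp
    qed
    from this[of "cmod (u x)"] this[of "\<bar>kT (x - xp)\<bar>"]
    have "\<bar>1 - cmod (u x)\<bar> \<le> \<bar>et x\<bar>" "\<bar>1 - \<bar>kT (x - xp)\<bar>\<bar> \<le> \<bar>1 - (kT (x - xp))^2\<bar>" by (auto simp: et_def)
    moreover have "1 - (kT (x - xp))^2 = sqrt 2 * kd (x - xp)" by (simp add: kd_def)
    ultimately show ?thesis by (simp add: h_def)
  qed
  have Lh: "L2 h"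
  proof (rule L2_bound[where K=1])
    show "h \<in> borel_measurable borel" unfolding h_def[abs_def] by measurable
    show "L2 (\<lambda>x. norm (et x) + norm (sqrt 2 * kd (x - xp)))" by (intro L2_add(1) L2_norm Let Lsk)
    show "AE x in lborel. norm (h x) \<le> 1 * norm (norm (et x) + norm (sqrt 2 * kd (x - xp)))" using hle by auto
  qed
  have nsk: "nrm S (\<lambda>x. sqrt 2 * kd (x - xp)) = sqrt 2 * nrm S (\<lambda>x. kd (x - xp))" if "S \<in> sets borel" for S
    unfolding nrm_def using L2_cmult(2)[OF L2_indicator[OF kd_shift_L2 that], of "sqrt 2" xp] by (simp add: mult.left_commute)
  have H5: "nrm {xp+B..} h \<le> sqrt (4 * \<tau>) + sqrt 2 * sqrt (gap B)"
  proof -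
    have "nrm {xp+B..} h \<le> nrm {xp+B..} et + nrm {xp+B..} (\<lambda>x. sqrt 2 * kd (x - xp))"
      by (rule nrm_add_le[OF _ Let Lsk]) (use hle in auto)
    also have "nrm {xp+B..} et \<le> sqrt (4 * \<tau>)" unfolding et_def by (rule nrm_eta[OF _ tailp]) simp
    also have "nrm {xp+B..} (\<lambda>x. sqrt 2 * kd (x - xp)) \<le> sqrt 2 * sqrt (gap B)"
      using nsk[of "{xp+B..}"] nrm_kd[of B xp] B by simp
    finally show ?thesis by simp
  qed
  have H1: "nrm {..xm-B} h \<le> sqrt (4 * \<tau>) + sqrt 2 * sqrt (gap B)"
  proof -
    have "nrm {..xm-B} h \<le> nrm {..xm-B} et + nrm {..xm-B} (\<lambda>x. sqrt 2 * kd (x - xp))"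
      by (rule nrm_add_le[OF _ Let Lsk]) (use hle in auto)
    also have "nrm {..xm-B} et = nrm {-xm+B..} (\<lambda>x. et (-x))" by (rule nrm_reflect) auto
    also have "\<dots> \<le> sqrt (4 * \<tau>)" unfolding et_def by (rule L.nrm_eta[OF _ tailm]) simp
    also have "nrm {..xm-B} (\<lambda>x. sqrt 2 * kd (x - xp)) = sqrt 2 * nrm {..xm-B} (\<lambda>x. kd (x - xp))" by (rule nsk) simp
    also have "nrm {..xm-B} (\<lambda>x. kd (x - xp)) \<le> nrm {..xp-B} (\<lambda>x. kd (x - xp))"
      by (rule nrm_mono_set[OF kd_shift_L2]) (use mp in auto)
    also have "\<dots> \<le> sqrt (gap B)" by (rule nrm_kd_left) (use B in simp)
    finally show ?thesis by simp
  qed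
  have H4: "nrm {xp..xp+B} h \<le> M * sqrt (xp + B - xp)"
  proof (rule nrm_Icc_bound)
    fix x assume x: "x \<in> {xp..xp+B}"
    then have "\<bar>kT (x - xp)\<bar> = kT (x - xp)" using kT_nonneg[of "x - xp"] by simp
    then show "norm (h x) \<le> M" using P1[of x] x by (simp add: h_def)
  qed (use B M0 in auto)
  have H3: "nrm {xm..xp} h \<le> 6 * sqrt (22 * \<delta>)"
  proof -
    have "nrm {xm..xp} h \<le> 6 * sqrt (xp - xm)"
    proof (rule nrm_Icc_bound[OF mp])
      fix x show "norm (h x) \<le> 6" using five[of x] kT_bounds(1)[of "x - xp"] norm_ge_zero[of "u x"] abs_ge_zero[of "kT (x - xp)"]
        unfolding h_def real_norm_def by linarith
    qed simp
    also have "\<dots> \<le> 6 * sqrt (22 * \<delta>)" using l by (simp add: l_def)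
    finally show ?thesis .
  qed
  have H2: "nrm {xm-B..<xm} h \<le> (M + 22 * \<delta>) * sqrt B"
  proof -
    have "nrm {xm-B..<xm} h \<le> nrm {xm-B..xm} h" by (rule nrm_mono_set[OF Lh]) auto
    also have "\<dots> \<le> (M + 22 * \<delta>) * sqrt (xm - (xm - B))"
    proof (rule nrm_Icc_bound)
      fix x assume x: "x \<in> {xm-B..xm}"
      have "\<bar>cmod (u (-(-x))) - kT (-x - -xm)\<bar> \<le> M" by (rule Q1) (use x in auto)
      then have 1: "\<bar>cmod (u x) - kT (xm - x)\<bar> \<le> M" by (simp add: algebra_simps)
      have 2: "\<bar>kT (xm - x) - kT (xp - x)\<bar> \<le> 22 * \<delta>" using kT_Lipschitz[of "xm - x" "xp - x"] l by (simp add: l_def)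
      have 3: "\<bar>kT (x - xp)\<bar> = kT (xp - x)" using kT_minus[of "xp - x"] kT_nonneg[of "xp - x"] x mp by simp
      show "norm (h x) \<le> M + 22 * \<delta>" using 1 2 unfolding h_def 3 real_norm_def by linarith
    qed (use B M0 \<delta> in auto)
    finally show ?thesis by simp
  qed
  have HH: "L2norm h \<le> 2 * (sqrt (4 * \<tau>) + sqrt 2 * sqrt (gap B)) + (2 * M + 22 * \<delta>) * sqrt B + 6 * sqrt (22 * \<delta>)"
    using L2norm_five[OF Lh mp _ H1 H2 H3 H4 H5] B by (simp add: algebra_simps)
  have mom: "\<forall>\<^sub>F R in at_top. cmod (exp (\<i> * of_real (LINT x:{-R..R}|lborel. Im (cnj (u x) * du x))) * \<sigma>p * cnj \<sigma>m
        + dir (u R) * cnj (dir (u (-R)))) \<le> 2 * (sqrt (2 * (3*\<delta>)) * (5 * sqrt B + 4)) + 60 * \<delta>"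
    using eventually_ge_at_top[of "xp + B"] eventually_ge_at_top[of "-xm + B"]
  proof eventually_elim
    fix R assume R: "xp + B \<le> R" "-xm + B \<le> R"
    define e1 where "e1 = sqrt (2 * (3*\<delta>)) * (5 * sqrt B + 4)"
    define Jp Jm J0 where "Jp = (LINT x:{xp..R}|lborel. Im (cnj (u x) * du x))"
      and "Jm = (LINT x:{-R..xm}|lborel. Im (cnj (u x) * du x))"
      and "J0 = (LINT x:{xm..xp}|lborel. Im (cnj (u x) * du x))"
    have A: "cmod (exp (\<i> * of_real Jp) * \<sigma>p - dir (u R)) \<le> e1"
      using half_line_phase[OF E1 bp xp(3) Dp B M(1,2) tau32 R(1)]
      unfolding Jp_def \<sigma>p_def dir_def e1_def by simp
    have JL: "(LINT x:{-xm..R}|lborel. Im (cnj (u (-x)) * (- du (-x)))) = - Jm"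
    proof -
      have "(LINT x:{-xm..R}|lborel. Im (cnj (u (-x)) * (- du (-x)))) = (LINT x:{-xm..R}|lborel. (\<lambda>y. - Im (cnj (u y) * du y)) (-x))"
        by simp
      also have "\<dots> = (LINT x:{-R..-(-xm)}|lborel. - Im (cnj (u x) * du x))"
        by (rule set_integral_reflect_Icc(1))
      also have "\<dots> = - Jm"
        unfolding Jm_def minus_minus by (rule set_integral_uminus[OF mom_integrable])
      finally show ?thesis .
    qed
    have C: "cmod (exp (\<i> * of_real (- Jm)) * (- \<sigma>m) - dir (u (-R))) \<le> e1"
      using L.half_line_phase[OF LE1 bmm nzL Dm B M(1,2) tau32 R(2)]
      unfolding JL \<sigma>m_def dir_def e1_def by simp
    have J: "(LINT x:{-R..R}|lborel. Im (cnj (u x) * du x)) = Jm + J0 + Jp"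
    proof -
      have "(LINT x:{-R..R}|lborel. Im (cnj (u x) * du x)) = Jm + (LINT x:{xm..R}|lborel. Im (cnj (u x) * du x))"
        unfolding Jm_def by (rule set_integral_Icc_combine[OF mom_integrable]) (use R mp B in auto)
      moreover have "(LINT x:{xm..R}|lborel. Im (cnj (u x) * du x)) = J0 + Jp"
        unfolding J0_def Jp_def by (rule set_integral_Icc_combine[OF mom_integrable]) (use R mp B in auto)
      ultimately show ?thesis by simp
    qed
    \<comment> \<open>Length at most \<open>22 * \<delta>\<close> and energy at most
      \<open>3*\<delta>\<close> bound the integral of \<open>cmod (du x)\<close> over the core by
      \<open>sqrt 132 * \<delta>\<close>, rounded to \<open>12 * \<delta>\<close>; the remaining
      factor 5 bounds \<open>cmod u\<close>.\<close>
    have J0: "\<bar>J0\<bar> \<le> 60 * \<delta>"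
    proof -
      have "\<bar>J0\<bar> \<le> (LINT x:{xm..xp}|lborel. norm (Im (cnj (u x) * du x)))"
        unfolding J0_def using set_integral_norm_bound[OF mom_integrable[of xm xp]] by simp
      also have "\<dots> \<le> (LINT x:{xm..xp}|lborel. 5 * cmod (du x))"
      proof (rule set_integral_mono)
        show "set_integrable lborel {xm..xp} (\<lambda>x. norm (Im (cnj (u x) * du x)))" by (rule set_integrable_norm[OF mom_integrable])
        show "set_integrable lborel {xm..xp} (\<lambda>x. 5 * cmod (du x))" using L2_set_integrable(2)[OF Ldu] by simp
        fix x
        have "\<bar>Im (cnj (u x) * du x)\<bar> \<le> cmod (cnj (u x) * du x)" by (rule abs_Im_le_cmod)
        also have "\<dots> \<le> 5 * cmod (du x)" using five[of x] by (simp add: norm_mult mult_right_mono)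
        finally show "norm (Im (cnj (u x) * du x)) \<le> 5 * cmod (du x)" by simp
      qed
      also have "\<dots> = 5 * (LINT x:{xm..xp}|lborel. cmod (du x))" by simp
      also have "(LINT x:{xm..xp}|lborel. cmod (du x)) \<le> 12 * \<delta>"
      proof (rule power2_le_imp_le)
        have "(LINT x:{xm..xp}|lborel. cmod (du x))^2 \<le> (xp - xm) * (LINT x:{xm..xp}|lborel. (cmod (du x))^2)"
          by (rule L2_set_integrable(3)[OF Ldu mp])
        also have "\<dots> \<le> (22 * \<delta>) * (2 * (3*\<delta>))"
        proof (rule mult_mono)
          show "xp - xm \<le> 22 * \<delta>" using l by (simp add: l_def)
          have "(LINT x:{xm..xp}|lborel. (cmod (du x))^2) \<le> (LINT x:{xm..xp}|lborel. 2 * ed x)"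
          proof (rule set_integral_mono)
            show "set_integrable lborel {xm..xp} (\<lambda>x. (cmod (du x))^2)"
              unfolding set_integrable_def by (intro integrable_mult_indicator L2_int Ldu) simp
            show "set_integrable lborel {xm..xp} (\<lambda>x. 2 * ed x)" using ed_set_integrable[of "{xm..xp}"] by simp
          qed (simp add: ed_def)
          then show "(LINT x:{xm..xp}|lborel. (cmod (du x))^2) \<le> 2 * (3*\<delta>)" using mid by simp
        qed (use \<delta> in \<open>auto simp: set_lebesgue_integral_def\<close>)
        also have "\<dots> \<le> (12 * \<delta>)^2" by (simp add: power2_eq_square)
        finally show "(LINT x:{xm..xp}|lborel. cmod (du x))^2 \<le> (12 * \<delta>)^2" .
      qed (use \<delta> in simp)
      finally show ?thesis by simp
    qed
    define W where "W = exp (\<i> * of_real (Jp + Jm)) * \<sigma>p * cnj \<sigma>m"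
    have nR: "cmod (dir (u R)) = 1" by (rule dir_norm) (use xp(3) R B in auto)
    have uC: "cmod (exp (\<i> * of_real (- Jm)) * (- \<sigma>m)) = 1" by (simp only: norm_mult norm_minus_cancel sm norm_exp_i_times)
    have "cmod ((exp (\<i> * of_real Jp) * \<sigma>p) * cnj (exp (\<i> * of_real (- Jm)) * (- \<sigma>m)) - dir (u R) * cnj (dir (u (-R)))) \<le> e1 + e1"
      using unit_prod_dist[OF uC nR, of "exp (\<i> * of_real Jp) * \<sigma>p" "dir (u (-R))"] A C by linarith
    moreover have "(exp (\<i> * of_real Jp) * \<sigma>p) * cnj (exp (\<i> * of_real (- Jm)) * (- \<sigma>m)) = - W"
    proof -
      have "cnj (exp (\<i> * of_real (- Jm))) = exp (\<i> * of_real Jm)" by (simp add: exp_cnj)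
      then show ?thesis unfolding W_def by (simp add: exp_add distrib_left mult_ac)
    qed
    ultimately have 1: "cmod (W + dir (u R) * cnj (dir (u (-R)))) \<le> 2 * e1"
      using norm_minus_cancel[of "W + dir (u R) * cnj (dir (u (-R)))"] by simp
    have "exp (\<i> * of_real (Jm + J0 + Jp)) * \<sigma>p * cnj \<sigma>m - W = (exp (\<i> * of_real (Jm + J0 + Jp)) - exp (\<i> * of_real (Jp + Jm))) * \<sigma>p * cnj \<sigma>m"
      by (simp add: W_def algebra_simps)
    then have "cmod (exp (\<i> * of_real (Jm + J0 + Jp)) * \<sigma>p * cnj \<sigma>m - W) = cmod (exp (\<i> * of_real (Jm + J0 + Jp)) - exp (\<i> * of_real (Jp + Jm)))"
      by (simp only: norm_mult complex_mod_cnj sp sm mult_1_right)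
    also have "\<dots> \<le> \<bar>(Jm + J0 + Jp) - (Jp + Jm)\<bar>" by (rule exp_i_dist)
    also have "\<dots> = \<bar>J0\<bar>" by simp
    finally have 2: "cmod (exp (\<i> * of_real (Jm + J0 + Jp)) * \<sigma>p * cnj \<sigma>m - W) \<le> 60 * \<delta>" using J0 by linarith
    have "exp (\<i> * of_real (Jm + J0 + Jp)) * \<sigma>p * cnj \<sigma>m + dir (u R) * cnj (dir (u (-R)))
       = (exp (\<i> * of_real (Jm + J0 + Jp)) * \<sigma>p * cnj \<sigma>m - W) + (W + dir (u R) * cnj (dir (u (-R))))" by simp
    then have "cmod (exp (\<i> * of_real (Jm + J0 + Jp)) * \<sigma>p * cnj \<sigma>m + dir (u R) * cnj (dir (u (-R)))) \<le> 60 * \<delta> + 2 * e1"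
      using norm_triangle_mono[OF 2 1] by (simp only:)
    then show "cmod (exp (\<i> * of_real (LINT x:{-R..R}|lborel. Im (cnj (u x) * du x))) * \<sigma>p * cnj \<sigma>m
        + dir (u R) * cnj (dir (u (-R)))) \<le> 2 * (sqrt (2 * (3*\<delta>)) * (5 * sqrt B + 4)) + 60 * \<delta>"
      unfolding J e1_def by simp
  qed
  show thesis
  proof (rule that[OF sp sm _ xp(2) Lf[unfolded f_def[abs_def]] FF[unfolded f_def[abs_def]] Lh[unfolded h_def[abs_def]] HH[unfolded h_def[abs_def]] mom])
    show "\<bar>xp - x0\<bar> \<le> 22 * \<delta>" using xp(1) xm(1) l by (simp add: l_def)
  qed
qed

end

section \<open>Calibration by dark solitons\<close>

text \<open>Primitive of \<open>(1 - r\<^sup>2) sqrt (r\<^sup>2 - m\<^sup>2) / (sqrt 2 r)\<close>, written in terms of \<open>s = r\<^sup>2\<close>.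
  It calibrates the dark soliton of speed \<open>sqrt 2 m\<close>.\<close>

definition Fm :: "real \<Rightarrow> real \<Rightarrow> real" where
  "Fm m s = (sqrt (s - m^2) - m * arctan (sqrt (s - m^2) / m) - (sqrt (s - m^2))^3 / 3) / sqrt 2"

lemma Fm_deriv:
  assumes m: "0 < m" and s: "m^2 < s"
  shows "(Fm m has_field_derivative (sqrt (s - m^2) * (1 - s) / (2 * sqrt 2 * s))) (at s)"
proof -
  define w where "w = sqrt (s - m^2)"
  have w: "w > 0" "w^2 = s - m^2" using s by (simp_all add: w_def)
  have s0: "s > 0" using s m by (meson less_trans zero_less_power)
  have dw: "((\<lambda>s. sqrt (s - m^2)) has_field_derivative inverse w / 2) (at s)"
    using DERIV_chain2[OF DERIV_real_sqrt[of "s - m^2"] DERIV_diff[OF DERIV_ident DERIV_const[of "m^2"]]] s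
    by (simp add: w_def)
  have da: "((\<lambda>s. arctan (sqrt (s - m^2) / m)) has_field_derivative inverse (1 + (w/m)^2) * (inverse w / 2 / m)) (at s)"
    using DERIV_chain2[OF DERIV_arctan DERIV_cdivide[OF dw, of m]] by (simp add: w_def)
  have "(Fm m has_field_derivative (inverse w / 2 - m * (inverse (1 + (w/m)^2) * (inverse w / 2 / m)) - (of_nat 3 * (inverse w / 2 * w ^ (3 - Suc 0))) / 3) / sqrt 2) (at s)"
    unfolding Fm_def[abs_def]
    using DERIV_cdivide[OF DERIV_diff[OF DERIV_diff[OF dw DERIV_cmult[OF da, of m]] DERIV_cdivide[OF DERIV_power[OF dw, of 3], of 3]], of "sqrt 2"]
    by (simp add: w_def)
  also have "(inverse w / 2 - m * (inverse (1 + (w/m)^2) * (inverse w / 2 / m)) - (of_nat 3 * (inverse w / 2 * w ^ (3 - Suc 0))) / 3) / sqrt 2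
      = w * (1 - s) / (2 * sqrt 2 * s)"
  proof -
    have 1: "1 + (w/m)^2 = s / m^2" using m w(2) by (simp add: power_divide field_simps)
    have "inverse w / 2 - m * (inverse (1 + (w/m)^2) * (inverse w / 2 / m)) - (of_nat 3 * (inverse w / 2 * w ^ (3 - Suc 0))) / 3
      = inverse w / 2 * (1 - m^2 / s - w^2)"
      unfolding 1 using m s0 w(1) by (simp add: field_simps power2_eq_square)
    also have "1 - m^2 / s - w^2 = w^2 * (1 - s) / s"
    proof -
      have e: "1 - m^2 / s = w^2 / s" unfolding w(2) using s0 by (simp add: field_simps)
      show ?thesis unfolding e using s0 by (simp add: right_diff_distrib diff_divide_distrib)
    qed
    also have "inverse w / 2 * (w^2 * (1 - s) / s) = w * (1 - s) / (2 * s)"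
      using w s0 by (simp add: field_simps power2_eq_square)
    finally show ?thesis by simp
  qed
  finally show ?thesis by (simp add: w_def)
qed

lemma sqrt2_mult: "sqrt 2 * Z = 2 * (Z / sqrt 2)" for Z :: real
proof -
  have e: "2 / sqrt 2 = sqrt (2::real)" by (rule real_div_sqrt) simp
  have "sqrt 2 * Z = (2 / sqrt 2) * Z" by (simp only: e)
  also have "\<dots> = 2 * (Z / sqrt 2)" by simp
  finally show ?thesis .
qed

text \<open>\<open>w = sqrt (1 - m^2)\<close> is at least \<open>1 - m^2\<close>, and
  \<open>arctan (w / m)\<close> is \<open>arccos m\<close>, at most \<open>pi / 2 - m\<close>. The
  term \<open>- m * pi / 2\<close> will be compensated by a corrected phase shift near
  \<open>pi\<close>; what then remains above the kink value is \<open>m^2 / 3\<close>, up to the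
  factor \<open>sqrt 2\<close>.\<close>

lemma Fm_one:
  assumes "0 < m" "m < 1"
  shows "sqrt 2 * (2/3 + m^2/3 - m * pi / 2) \<le> 2 * Fm m 1"
proof -
  define w where "w = sqrt (1 - m^2)"
  have m2: "m^2 < 1" using assms by (simp add: power2_less_1_iff abs_less_iff)
  have w: "w > 0" "w^2 = 1 - m^2" "w \<le> 1" using m2 by (simp_all add: w_def)
  have wge: "1 - m^2 \<le> w"
  proof -
    have "w * w \<le> 1 * w" using w by (intro mult_right_mono) auto
    then show ?thesis using w(2) by (simp add: power2_eq_square)
  qed
  have at: "arctan (w / m) \<le> pi / 2 - m"
  proof -
    have m_pi: "m < pi / 2" using assms pi_gt3 by linarith
    have sin: "0 < sin m" "sin m \<le> m" using assms m_pi sin_gt_zero[of m] sin_x_le_x[of m] pi_gt3 by auto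
    have "w \<le> cos m"
    proof (rule power2_le_imp_le)
      have "(sin m)^2 \<le> m^2" using sin by (intro power_mono) auto
      then show "w^2 \<le> (cos m)^2" using w(2) by (simp add: cos_squared_eq)
      show "0 \<le> cos m" using cos_gt_zero[of m] assms m_pi by auto
    qed
    then have "w * sin m \<le> cos m * m" using sin w assms by (intro mult_mono) auto
    then have "w / m \<le> cos m / sin m" using sin assms by (simp add: field_simps)
    also have "\<dots> = tan (pi / 2 - m)" by (simp add: tan_def sin_diff cos_diff)
    finally have "arctan (w / m) \<le> arctan (tan (pi / 2 - m))" by (simp add: arctan_le_iff)
    also have "\<dots> = pi / 2 - m" by (rule arctan_tan) (use assms m_pi in auto)
    finally show ?thesis .
  qed
  have "w^3 = w * (1 - m^2)" unfolding w(2)[symmetric] by (simp add: power3_eq_cube power2_eq_square)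
  then have "w - w^3/3 = w * (2 + m^2) / 3" by (simp add: field_simps)
  also have "\<dots> \<ge> (1 - m^2) * (2 + m^2) / 3" using wge by (intro divide_right_mono mult_right_mono) auto
  finally have 1: "(1 - m^2) * (2 + m^2) / 3 \<le> w - w^3/3" .
  have 2: "m * arctan (w / m) \<le> m * (pi / 2 - m)" using at assms by (intro mult_left_mono) auto
  have 3: "m^2 * m^2 \<le> 1 * m^2" using m2 by (intro mult_right_mono) auto
  have 4: "(1 - m^2) * (2 + m^2) / 3 = (2 - m^2 - m^2 * m^2) / 3" by (simp add: algebra_simps)
  have 5: "m * (pi / 2 - m) = m * pi / 2 - m^2" by (simp add: algebra_simps power2_eq_square)
  have "2/3 + m^2/3 - m * pi / 2 \<le> (1 - m^2) * (2 + m^2) / 3 - m * (pi / 2 - m)"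
    using 3 unfolding 4 5 by (simp add: field_simps)
  then have "2/3 + m^2/3 - m * pi / 2 \<le> w - m * arctan (w / m) - w^3/3" using 1 2 by linarith
  then have "sqrt 2 * (2/3 + m^2/3 - m * pi / 2) \<le> sqrt 2 * (w - m * arctan (w / m) - w^3/3)"
    by (intro mult_left_mono) auto
  also have "\<dots> = 2 * Fm m 1" unfolding sqrt2_mult by (simp add: Fm_def w_def)
  finally show ?thesis .
qed

text \<open>Crude, but the right-hand side vanishes as \<open>m^2\<close> approaches
  \<open>s\<close>, the situation at the minimum of the modulus.\<close>

lemma Fm_le:
  assumes "0 < m" "m^2 \<le> s"
  shows "2 * Fm m s \<le> sqrt 2 * sqrt (s - m^2)"
proof -
  define w where "w = sqrt (s - m^2)"
  have w: "w \<ge> 0" using assms by (simp add: w_def)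
  have "0 \<le> m * arctan (w / m)" using assms w by simp
  moreover have "0 \<le> w^3 / 3" using w by simp
  ultimately have "w - m * arctan (w / m) - w^3 / 3 \<le> w" by linarith
  then have "sqrt 2 * (w - m * arctan (w / m) - w^3 / 3) \<le> sqrt 2 * w" by (intro mult_left_mono) auto
  moreover have "2 * Fm m s = sqrt 2 * (w - m * arctan (w / m) - w^3 / 3)"
    unfolding sqrt2_mult by (simp add: Fm_def w_def)
  ultimately show ?thesis by (simp add: w_def)
qed

context finite_energy begin

text \<open>Half the difference between the phase density \<open>be / cmod u\<close> and the
  momentum density \<open>cmod u * be\<close>. It is the renormalized momentum: unlike either
  density, it is integrable on the line as soon as the modulus is bounded below.\<close>

definition mo where "mo x = (1 - (cmod (u x))^2) * be x / (2 * cmod (u x))"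

text \<open>The squares of \<open>al x - s2 * lh\<close> and \<open>be x - s1 * kh\<close> are
  nonnegative; \<open>(k, l)\<close> is a unit vector, so \<open>kh^2 + lh^2 = h^2 / 2\<close> is
  twice the potential. The signs \<open>s1\<close> and \<open>s2\<close> stay free, to treat both
  orientations of the phase and both sides of a minimum.\<close>

lemma calibration:
  assumes m: "0 \<le> m" "m^2 \<le> (cmod (u x))^2" and u: "u x \<noteq> 0" and s: "s1^2 = 1" "s2^2 = (1::real)"
  shows "s1 * (sqrt 2 * m * mo x) + s2 * (sqrt ((cmod (u x))^2 - m^2) * (1 - (cmod (u x))^2) / (2 * sqrt 2 * (cmod (u x))^2) * (2 * cmod (u x)) * al x) \<le> ed x"
proof -
  define \<rho> h w where "\<rho> = cmod (u x)" and "h = 1 - (cmod (u x))^2" and "w = sqrt ((cmod (u x))^2 - m^2)"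
  define k l where "k = m / \<rho>" and "l = w / \<rho>"
  have \<rho>: "\<rho> > 0" using u by (simp add: \<rho>_def)
  have w2: "w^2 = \<rho>^2 - m^2" using m by (simp add: w_def \<rho>_def)
  have kl: "k^2 + l^2 = 1" using \<rho> by (simp add: k_def l_def power_divide w2 add_divide_distrib[symmetric])
  have a: "sqrt 2 * m * mo x = k * h * be x / sqrt 2"
  proof -
    have "sqrt 2 * m * mo x = 2 * (m * mo x / sqrt 2)" using sqrt2_mult[of "m * mo x"] by simp
    then show ?thesis by (simp add: mo_def k_def h_def \<rho>_def)
  qed
  have b: "sqrt ((cmod (u x))^2 - m^2) * (1 - (cmod (u x))^2) / (2 * sqrt 2 * (cmod (u x))^2) * (2 * cmod (u x)) * al x = l * h * al x / sqrt 2"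
    unfolding w_def[symmetric] h_def[symmetric] unfolding \<rho>_def[symmetric] l_def using \<rho> by (simp add: field_simps power2_eq_square)
  define kh lh where "kh = k * h / sqrt 2" and "lh = l * h / sqrt 2"
  have sq: "kh^2 + lh^2 = h^2 / 2"
  proof -
    have "kh^2 + lh^2 = (k^2 + l^2) * h^2 / 2" by (simp add: kh_def lh_def power_divide power_mult_distrib algebra_simps add_divide_distrib)
    then show ?thesis unfolding kl by simp
  qed
  have "0 \<le> (al x - s2 * lh)^2 + (be x - s1 * kh)^2" by simp
  also have "\<dots> = ((al x)^2 + (be x)^2) + (s2^2 * lh^2 + s1^2 * kh^2) - 2 * (s2 * (lh * al x)) - 2 * (s1 * (kh * be x))"
    by (simp add: power2_eq_square algebra_simps)
  also have "\<dots> = (cmod (du x))^2 + h^2 / 2 - 2 * (s2 * (lh * al x)) - 2 * (s1 * (kh * be x))"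
    unfolding albe_sq[OF u] s using sq by simp
  finally have "s1 * (kh * be x) + s2 * (lh * al x) \<le> ed x" by (simp add: ed_def h_def)
  moreover have "k * h * be x / sqrt 2 = kh * be x" "l * h * al x / sqrt 2 = lh * al x" by (simp_all add: kh_def lh_def)
  ultimately show ?thesis unfolding a b by simp
qed

lemma mo_integrable:
  assumes "\<And>x. u x \<noteq> 0" shows "set_integrable lborel {a..b} mo"
proof (cases "a \<le> b")
  case True
  have c: "continuous_on {a..b} (\<lambda>x. (1 - (cmod (u x))^2) / 2)" by (intro continuous_intros cu) auto
  have "set_integrable lborel {a..b} (\<lambda>x. (1 - (cmod (u x))^2) / 2 * (be x / cmod (u x)))"
    by (rule set_integrable_cont_mult[OF c phase(1)[OF True]]) (use assms in auto)
  then show ?thesis unfolding mo_def[abs_def] by simp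
qed (simp add: set_integrable_def)

text \<open>The calibration is integrated with \<open>s2 = -1\<close> to the left and
  \<open>s2 = 1\<close> to the right of \<open>x0\<close>, so that both sides contribute the
  increment of \<open>Fm\<close> from \<open>x0\<close> outwards; \<open>s1\<close> is the sign of
  the integral of \<open>mo\<close>.\<close>

lemma calibrated_energy:
  assumes m: "0 < m" "\<And>x. m < cmod (u x)" and R: "-R \<le> x0" "x0 \<le> R"
  shows "sqrt 2 * m * \<bar>LINT x:{-R..R}|lborel. mo x\<bar> + Fm m ((cmod (u R))^2) + Fm m ((cmod (u (-R)))^2) - 2 * Fm m ((cmod (u x0))^2) \<le> energy u du"
proof -
  have nz: "u x \<noteq> 0" for x using m(1) m(2)[of x] by auto
  have sq: "m^2 < (cmod (u x))^2" for x using m(1) m(2)[of x] by (intro power_strict_mono) auto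
  define F' where "F' s = sqrt (s - m^2) * (1 - s) / (2 * sqrt 2 * s)" for s
  have cF: "continuous_on {m^2<..} F'" unfolding F'_def
  proof (intro continuous_intros)
    show "\<forall>x\<in>{m\<^sup>2<..}. 2 * sqrt 2 * x \<noteq> 0" using m(1) by auto
  qed
  note ch = modsq_chain[OF _ open_greaterThan[of "m^2"] _ _ cF, where F="Fm m"]
  define q where "q x = F' ((cmod (u x))^2) * (2 * cmod (u x)) * al x" for x
  have qi: "set_integrable lborel {a..b} q" if "a \<le> b" for a b
    unfolding q_def[abs_def] by (rule ch(1)[OF that]) (use sq Fm_deriv[OF m(1)] in \<open>auto simp: F'_def\<close>)
  have qv: "Fm m ((cmod (u b))^2) - Fm m ((cmod (u a))^2) = (LINT x:{a..b}|lborel. q x)" if "a \<le> b" for a b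
    unfolding q_def by (rule ch(2)[OF that]) (use sq Fm_deriv[OF m(1)] in \<open>auto simp: F'_def\<close>)
  have bd: "s1 * (sqrt 2 * m) * (LINT x:{a..b}|lborel. mo x) + s2 * (Fm m ((cmod (u b))^2) - Fm m ((cmod (u a))^2)) \<le> (LINT x:{a..b}|lborel. ed x)"
    if "a \<le> b" "s1^2 = 1" "s2^2 = 1" for a b s1 s2 :: real
  proof -
    note i1 = mo_integrable[OF nz, of a b]
    have i: "set_integrable lborel {a..b} (\<lambda>x. s1 * (sqrt 2 * m * mo x) + s2 * q x)"
      using i1 qi[OF that(1)] by (intro set_integral_add(1) set_integrable_mult_right) auto
    have "s1 * (sqrt 2 * m) * (LINT x:{a..b}|lborel. mo x) + s2 * (Fm m ((cmod (u b))^2) - Fm m ((cmod (u a))^2))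
      = (LINT x:{a..b}|lborel. s1 * (sqrt 2 * m * mo x) + s2 * q x)"
      unfolding qv[OF that(1)] using i1 qi[OF that(1)] by (subst set_integral_add(2)) auto
    also have "\<dots> \<le> (LINT x:{a..b}|lborel. ed x)"
    proof (rule set_integral_mono[OF i ed_set_integrable])
      show "s1 * (sqrt 2 * m * mo x) + s2 * q x \<le> ed x" for x
        unfolding q_def F'_def by (rule calibration[OF _ _ nz that(2,3)]) (use m(1) less_imp_le[OF m(2)[of x]] in auto)
    qed simp
    finally show ?thesis .
  qed
  have main: "s1 * (sqrt 2 * m) * (LINT x:{-R..R}|lborel. mo x) + Fm m ((cmod (u R))^2) + Fm m ((cmod (u (-R)))^2) - 2 * Fm m ((cmod (u x0))^2) \<le> energy u du"
    if "s1^2 = 1" for s1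
  proof -
    have A: "(LINT x:{-R..R}|lborel. ed x) = (LINT x:{-R..x0}|lborel. ed x) + (LINT x:{x0..R}|lborel. ed x)"
      by (rule set_integral_Icc_combine[OF ed_set_integrable]) (use R in auto)
    have Bc: "(LINT x:{-R..R}|lborel. mo x) = (LINT x:{-R..x0}|lborel. mo x) + (LINT x:{x0..R}|lborel. mo x)"
      by (rule set_integral_Icc_combine[OF mo_integrable[OF nz]]) (use R in auto)
    have C: "(LINT x:{-R..R}|lborel. ed x) \<le> energy u du" by (rule ed_set_le) simp
    show ?thesis
      using bd[of x0 R s1 1] bd[of "-R" x0 s1 "-1"] R that A C unfolding Bc by (simp add: distrib_left)
  qed
  show ?thesis using main[of 1] main[of "-1"] m(1)
    by (cases "0 \<le> (LINT x:{-R..R}|lborel. mo x)") (auto simp: abs_if)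
qed

lemma phase_mo:
  assumes nz: "\<And>x. u x \<noteq> 0" and R: "0 \<le> R"
  shows "dir (u R) * cnj (dir (u (-R))) = exp (\<i> * of_real ((LINT x:{-R..R}|lborel. Im (cnj (u x) * du x)) + 2 * (LINT x:{-R..R}|lborel. mo x)))"
proof -
  have le: "-R \<le> R" using R by simp
  have "dir (u R) = dir (u (-R)) * exp (\<i> * of_real (LINT x:{-R..R}|lborel. be x / cmod (u x)))"
    unfolding dir_def by (rule phase(2)[OF le nz])
  also have "(LINT x:{-R..R}|lborel. be x / cmod (u x)) = (LINT x:{-R..R}|lborel. Im (cnj (u x) * du x) + 2 * mo x)"
  proof (rule set_lebesgue_integral_cong)
    show "\<forall>x. x \<in> {-R..R} \<longrightarrow> be x / cmod (u x) = Im (cnj (u x) * du x) + 2 * mo x"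
      using nz unfolding Im_cnj_be mo_def by (simp add: field_simps power2_eq_square)
  qed simp
  also have "\<dots> = (LINT x:{-R..R}|lborel. Im (cnj (u x) * du x)) + 2 * (LINT x:{-R..R}|lborel. mo x)"
    using mo_integrable[OF nz, of "-R" R] by (subst set_integral_add(2)[OF mom_integrable]) auto
  finally have d: "dir (u R) = dir (u (-R)) * exp (\<i> * of_real ((LINT x:{-R..R}|lborel. Im (cnj (u x) * du x)) + 2 * (LINT x:{-R..R}|lborel. mo x)))" .
  have "dir (u (-R)) * cnj (dir (u (-R))) = 1"
    using dir_norm[OF nz[of "-R"]] by (simp add: complex_norm_square[symmetric])
  then show ?thesis unfolding d by (simp add: mult.assoc mult.left_commute)
qed

text \<open>The modulus tends to 1 at both ends, so a value below 1 confines the minimization to a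
  compact interval.\<close>

lemma minimum_attained:
  assumes bd: "\<And>x. cmod (u x) \<le> K" and x1: "cmod (u x1) < 1"
  obtains x0 where "\<And>x. cmod (u x0) \<le> cmod (u x)" "cmod (u x0) < 1"
proof -
  have "\<forall>\<^sub>F x in at_top. cmod (u x1) < cmod (u x)" "\<forall>\<^sub>F x in at_bot. cmod (u x1) < cmod (u x)"
    by (rule order_tendstoD(1)[OF mod_tendsto_one(1)[OF bd] x1], rule order_tendstoD(1)[OF mod_tendsto_one(2)[OF bd] x1])
  then obtain X Y where X: "\<And>x. x \<ge> X \<Longrightarrow> cmod (u x1) < cmod (u x)" and Y: "\<And>x. x \<le> Y \<Longrightarrow> cmod (u x1) < cmod (u x)"
    by (auto simp: eventually_at_top_linorder eventually_at_bot_linorder)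
  define A B where "A = min Y x1" and "B = max X x1"
  have "\<exists>x\<in>{A..B}. \<forall>y\<in>{A..B}. cmod (u x) \<le> cmod (u y)"
    by (rule continuous_attains_inf) (auto intro!: continuous_intros cu simp: A_def B_def)
  then obtain x0 where x0: "x0 \<in> {A..B}" "\<And>y. y \<in> {A..B} \<Longrightarrow> cmod (u x0) \<le> cmod (u y)" by blast
  have x1AB: "x1 \<in> {A..B}" by (auto simp: A_def B_def)
  show thesis
  proof (rule that[of x0])
    show "cmod (u x0) < 1" using x0(2)[OF x1AB] x1 by linarith
    fix x
    consider "x \<in> {A..B}" | "x \<ge> X" | "x \<le> Y" by (force simp: A_def B_def)
    then show "cmod (u x0) \<le> cmod (u x)"
      by cases (use x0(2) X[of x] Y[of x] x0(2)[OF x1AB] in \<open>auto intro: order_trans less_imp_le\<close>)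
  qed
qed

text \<open>With \<open>P\<close> the integral of \<open>mo\<close>, the hypothesis says
  \<open>\<bar>cos P\<bar> \<le> sin t\<close>, whence
  \<open>\<bar>P\<bar> \<ge> pi / 2 - t\<close>. If the modulus has a minimum \<open>r\<close> below
  1, calibrating with \<open>m\<close> tending to \<open>r\<close> gives energy at least
  \<open>sqrt 2 * (2/3 + r * (r/3 - t))\<close>, and \<open>t \<le> \<mu> / 6\<close> turns this
  into the stated excess.\<close>

lemma nonvanishing_energy:
  assumes E: "energy u du \<le> 1" and \<mu>: "0 < \<mu>" "\<And>x. \<mu> < cmod (u x)" and t: "0 < t" "t \<le> \<mu> / 6" "t \<le> 1/2"
    and ph: "\<forall>\<^sub>F R in at_top. cmod (exp (\<i> * of_real (LINT x:{-R..R}|lborel. Im (cnj (u x) * du x))) + dir (u R) * cnj (dir (u (-R)))) \<le> 2 * sin t"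
  shows "2 * sqrt 2 / 3 + sqrt 2 / 6 * \<mu>^2 \<le> energy u du"
proof -
  have nz: "u x \<noteq> 0" for x using \<mu>(1) \<mu>(2)[of x] by auto
  have bd: "cmod (u x) \<le> 5" for x by (rule bounded_five[OF E])
  define P where "P R = (LINT x:{-R..R}|lborel. mo x)" for R
  have P: "\<forall>\<^sub>F R in at_top. pi / 2 - t \<le> \<bar>P R\<bar>"
    using ph eventually_ge_at_top[of 0]
  proof eventually_elim
    fix R :: real
    define J where "J = (LINT x:{-R..R}|lborel. Im (cnj (u x) * du x))"
    assume a: "cmod (exp (\<i> * of_real (LINT x:{-R..R}|lborel. Im (cnj (u x) * du x))) + dir (u R) * cnj (dir (u (-R)))) \<le> 2 * sin t" and R: "0 \<le> R"
    \<comment> \<open>Factoring out the mean phase \<open>J + P R\<close> leaves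
      \<open>2 * cos (P R)\<close>.\<close>
    have "exp (\<i> * of_real J) + exp (\<i> * of_real (J + 2 * P R)) = exp (\<i> * of_real (J + P R)) * (exp (\<i> * of_real (- P R)) + exp (\<i> * of_real (P R)))"
      by (simp add: distrib_left exp_add[symmetric] algebra_simps)
    also have "exp (\<i> * of_real (- P R)) + exp (\<i> * of_real (P R)) = of_real (2 * cos (P R))"
      unfolding cis_conv_exp[symmetric] by (simp add: complex_eq_iff)
    finally have "cmod (exp (\<i> * of_real J) + exp (\<i> * of_real (J + 2 * P R))) = 2 * \<bar>cos (P R)\<bar>"
      by (simp add: norm_mult)
    then have c: "\<bar>cos (P R)\<bar> \<le> sin t" using a unfolding phase_mo[OF nz R] J_def P_def by simp
    show "pi / 2 - t \<le> \<bar>P R\<bar>"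
    proof (rule ccontr)
      assume "\<not> pi / 2 - t \<le> \<bar>P R\<bar>"
      then have "cos (pi / 2 - t) < cos \<bar>P R\<bar>"
        using t pi_gt3 by (intro cos_monotone_0_pi) auto
      then show False using c by (simp add: cos_diff cos_abs_real)
    qed
  qed
  show ?thesis
  proof (cases "\<exists>x1. cmod (u x1) < 1")
    case True
    then obtain x1 where "cmod (u x1) < 1" by blast
    from minimum_attained[OF bd this] obtain x0 where x0: "\<And>x. cmod (u x0) \<le> cmod (u x)" "cmod (u x0) < 1" by blast
    define r where "r = cmod (u x0)"
    have r: "\<mu> < r" "r < 1" using \<mu>(2)[of x0] x0(2) by (auto simp: r_def)
    have step: "sqrt 2 * m * (pi / 2 - t) + sqrt 2 * (2/3 + m^2/3 - m * pi / 2) - sqrt 2 * sqrt (r^2 - m^2) \<le> energy u du"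
      if m: "0 < m" "m < r" for m
    proof -
      have mu: "m < cmod (u x)" for x using x0(1)[of x] m by (simp add: r_def)
      have m1: "m < 1" "m^2 < 1" using m r by (auto simp: power2_less_1_iff abs_less_iff)
      have mr: "m^2 \<le> r^2" using m by (intro power_mono) auto
      have iso: "isCont (Fm m) 1" using Fm_deriv[OF m(1) m1(2)] by (rule DERIV_isCont)
      have lim: "((\<lambda>R. Fm m ((cmod (u R))^2)) \<longlongrightarrow> Fm m 1) at_top" "((\<lambda>R. Fm m ((cmod (u (-R)))^2)) \<longlongrightarrow> Fm m 1) at_top"
      proof -
        have "((\<lambda>R. (cmod (u R))^2) \<longlongrightarrow> 1^2) at_top" by (intro tendsto_intros mod_tendsto_one(1)[OF bd])
        then show "((\<lambda>R. Fm m ((cmod (u R))^2)) \<longlongrightarrow> Fm m 1) at_top" by (intro isCont_tendsto_compose[OF iso]) simp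
        have "((\<lambda>R. cmod (u (-R))) \<longlongrightarrow> 1) at_top"
          using mod_tendsto_one(2)[OF bd] by (simp add: filterlim_at_bot_mirror)
        then have "((\<lambda>R. (cmod (u (-R)))^2) \<longlongrightarrow> 1^2) at_top" by (intro tendsto_intros)
        then show "((\<lambda>R. Fm m ((cmod (u (-R)))^2)) \<longlongrightarrow> Fm m 1) at_top" by (intro isCont_tendsto_compose[OF iso]) simp
      qed
      have "sqrt 2 * m * (pi / 2 - t) + Fm m 1 + Fm m 1 - 2 * Fm m (r^2) \<le> energy u du"
      proof (rule tendsto_upperbound)
        show "((\<lambda>R. sqrt 2 * m * (pi / 2 - t) + Fm m ((cmod (u R))^2) + Fm m ((cmod (u (-R)))^2) - 2 * Fm m (r^2))
           \<longlongrightarrow> sqrt 2 * m * (pi / 2 - t) + Fm m 1 + Fm m 1 - 2 * Fm m (r^2)) at_top"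
          by (intro tendsto_intros lim)
        show "\<forall>\<^sub>F R in at_top. sqrt 2 * m * (pi / 2 - t) + Fm m ((cmod (u R))^2) + Fm m ((cmod (u (-R)))^2) - 2 * Fm m (r^2) \<le> energy u du"
          using P eventually_ge_at_top[of "\<bar>x0\<bar>"]
        proof eventually_elim
          fix R assume p: "pi / 2 - t \<le> \<bar>P R\<bar>" and R: "\<bar>x0\<bar> \<le> R"
          have "sqrt 2 * m * \<bar>P R\<bar> + Fm m ((cmod (u R))^2) + Fm m ((cmod (u (-R)))^2) - 2 * Fm m (r^2) \<le> energy u du"
            unfolding P_def r_def by (rule calibrated_energy[OF m(1) mu]) (use R in auto)
          moreover have "sqrt 2 * m * (pi / 2 - t) \<le> sqrt 2 * m * \<bar>P R\<bar>" using p m by (intro mult_left_mono) auto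
          ultimately show "sqrt 2 * m * (pi / 2 - t) + Fm m ((cmod (u R))^2) + Fm m ((cmod (u (-R)))^2) - 2 * Fm m (r^2) \<le> energy u du" by linarith
        qed
      qed simp
      then show ?thesis using Fm_one[OF m(1) m1(1)] Fm_le[OF m(1) mr] by linarith
    qed
    \<comment> \<open>The derivative formula for \<open>Fm m\<close> holds strictly above
      \<open>m^2\<close>, so \<open>m = r\<close> is reached as a limit from the left, where the
      contribution of the minimum disappears.\<close>
    have "sqrt 2 * r * (pi / 2 - t) + sqrt 2 * (2/3 + r^2/3 - r * pi / 2) - sqrt 2 * sqrt (r^2 - r^2) \<le> energy u du"
    proof (rule tendsto_upperbound)
      show "((\<lambda>m. sqrt 2 * m * (pi / 2 - t) + sqrt 2 * (2/3 + m^2/3 - m * pi / 2) - sqrt 2 * sqrt (r^2 - m^2))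
         \<longlongrightarrow> sqrt 2 * r * (pi / 2 - t) + sqrt 2 * (2/3 + r^2/3 - r * pi / 2) - sqrt 2 * sqrt (r^2 - r^2)) (at_left r)"
        by (intro tendsto_intros) auto
      have "\<forall>\<^sub>F m in at_left r. m \<in> {0<..<r}" by (rule eventually_at_left_real) (use r \<mu> in simp)
      then show "\<forall>\<^sub>F m in at_left r. sqrt 2 * m * (pi / 2 - t) + sqrt 2 * (2/3 + m^2/3 - m * pi / 2) - sqrt 2 * sqrt (r^2 - m^2) \<le> energy u du"
        by eventually_elim (rule step, auto)
    qed simp
    then have e: "sqrt 2 * (2/3 + r * (r/3 - t)) \<le> energy u du" by (simp add: algebra_simps power2_eq_square)
    have "\<mu> * (\<mu> / 6) \<le> r * (r/3 - t)" using r t \<mu> by (intro mult_mono) auto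
    then have "sqrt 2 * (2/3 + \<mu> * (\<mu> / 6)) \<le> sqrt 2 * (2/3 + r * (r/3 - t))" by (intro mult_left_mono) auto
    then show ?thesis using e by (simp add: algebra_simps power2_eq_square)
  next
    case False
    \<comment> \<open>With modulus at least 1 everywhere, the calibration for \<open>m = 1\<close>
      gives \<open>\<bar>mo x\<bar> \<le> ed x\<close>; then \<open>pi / 2 - t\<close> would be at
      most the energy, hence at most 1. The contradiction is phrased as \<open>1 < 1\<close> holding
      eventually.\<close>
    then have ge: "1 \<le> cmod (u x)" for x by (meson not_le)
    have "\<forall>\<^sub>F R::real in at_top. (1::real) < 1"
      using P eventually_ge_at_top[of 0]
    proof eventually_elim
      fix R assume p: "pi / 2 - t \<le> \<bar>P R\<bar>" and R: "(0::real) \<le> R"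
      have "\<bar>P R\<bar> \<le> (LINT x:{-R..R}|lborel. norm (mo x))"
        unfolding P_def using set_integral_norm_bound[OF mo_integrable[OF nz, of "-R" R]] by simp
      also have "\<dots> \<le> (LINT x:{-R..R}|lborel. ed x)"
      proof (rule set_integral_mono[OF set_integrable_norm[OF mo_integrable[OF nz]] ed_set_integrable])
        fix x
        have m: "\<bar>mo x\<bar> \<le> \<bar>sqrt 2 * 1 * mo x\<bar>" by (simp add: abs_mult mult_le_cancel_right1)
        define sg where "sg = (if sqrt 2 * 1 * mo x \<ge> 0 then 1 else -1::real)"
        have sg: "sg^2 = 1" "\<bar>sqrt 2 * 1 * mo x\<bar> = sg * (sqrt 2 * 1 * mo x)" by (auto simp: sg_def)
        define Z where "Z = sqrt ((cmod (u x))^2 - 1^2) * (1 - (cmod (u x))^2) / (2 * sqrt 2 * (cmod (u x))^2) * (2 * cmod (u x)) * al x"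
        have g2: "1^2 \<le> (cmod (u x))^2" using ge[of x] by (intro power_mono) auto
        have "sg * (sqrt 2 * 1 * mo x) + 1 * Z \<le> ed x" "sg * (sqrt 2 * 1 * mo x) + (-1) * Z \<le> ed x"
          unfolding Z_def by (rule calibration[OF _ g2 nz sg(1)]; simp)+
        then show "norm (mo x) \<le> ed x" using m sg(2) by simp
      qed simp
      also have "\<dots> \<le> energy u du" by (rule ed_set_le) simp
      finally have "pi / 2 - t \<le> 1" using p E by linarith
      then show "(1::real) < 1" using t pi_gt3 by linarith
    qed
    then show ?thesis by simp
  qed
qed

end

text \<open>The order of choice matters: \<open>B\<close> and \<open>c\<close> come first and make
  the terms \<open>gap B\<close> and \<open>sqrt c\<close> small, which do not involve
  \<open>\<delta>\<close>; with these fixed, everything else tends to 0 with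
  \<open>\<delta>\<close>. The fractions \<open>\<omega>/20\<close> keep the limits of the bounds
  below \<open>\<omega>\<close>, and \<open>1/64\<close> keeps the limit of \<open>\<tau>\<close>
  below \<open>1/32\<close>.\<close>

lemma small_parameters:
  assumes w: "0 < \<omega>"
  obtains \<delta> B M \<tau> c lam where "0 < \<delta>" "\<delta> \<le> 1/96" "\<delta> \<le> \<omega>" "22 * \<delta> \<le> \<omega>" "0 < B"
    "M = 3*\<delta> + 2 * sqrt (2 * B * (3*\<delta>))" "M \<le> 1" "3*\<delta> + gap B + 4 * M \<le> \<tau>" "\<tau> \<le> 1/32"
    "0 < c" "c \<le> B" "M < kT c"
    "lam = 2 * sqrt (2 * (3*\<delta>)) + (M * (2 + M) + sqrt (2 * B * (3*\<delta>)) / (kT c - M)) * sqrt B + 2 * sqrt c"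
    "2 * (sqrt (2 * \<tau>) + sqrt (gap B)) + 2 * lam + 22 * \<delta> * sqrt B + sqrt (6 * \<delta>) + sqrt (22 * \<delta>) \<le> \<omega>"
    "2 * (sqrt (4 * \<tau>) + sqrt 2 * sqrt (gap B)) + (2 * M + 22 * \<delta>) * sqrt B + 6 * sqrt (22 * \<delta>) \<le> \<omega>"
    "2 * (sqrt (2 * (3*\<delta>)) * (5 * sqrt B + 4)) + 60 * \<delta> \<le> \<omega>"
proof -
  define \<eta> where "\<eta> = min (1/64) ((\<omega>/20)^2)"
  have \<eta>: "0 < \<eta>" using w by (simp add: \<eta>_def)
  have "\<forall>\<^sub>F B in at_top. gap B < \<eta>" by (rule order_tendstoD(2)[OF gap_tendsto \<eta>])
  then have "\<forall>\<^sub>F B in at_top. gap B < \<eta> \<and> 0 < B" using eventually_gt_at_top[of 0] by eventually_elim simp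
  then obtain B where B: "gap B < \<eta>" "0 < B" using eventually_happens' trivial_limit_at_top_linorder by blast
  have g0: "0 \<le> gap B" using gap_nonneg B by simp
  define g where "g = sqrt (gap B)"
  have g: "0 \<le> g" "g \<le> \<omega>/20"
  proof -
    show "0 \<le> g" using g0 by (simp add: g_def)
    have "gap B \<le> (\<omega>/20)^2" using B(1) by (simp add: \<eta>_def)
    then show "g \<le> \<omega>/20" unfolding g_def using w real_sqrt_le_mono[of "gap B" "(\<omega>/20)^2"] by simp
  qed
  define c where "c = min B ((\<omega>/20)^2)"
  have c: "0 < c" "c \<le> B" using B w by (auto simp: c_def)
  have sc: "sqrt c \<le> \<omega>/20"
  proof -
    have "c \<le> (\<omega>/20)^2" by (simp add: c_def)
    then show ?thesis using w real_sqrt_le_mono[of c "(\<omega>/20)^2"] by simp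
  qed
  have kc: "0 < kT c" by (rule kT_pos[OF c(1)])
  define Mf where "Mf \<delta> = 3*\<delta> + 2 * sqrt (2 * B * (3*\<delta>))" for \<delta>
  define tf where "tf \<delta> = 3*\<delta> + gap B + 4 * Mf \<delta>" for \<delta>
  define lf where "lf \<delta> = 2 * sqrt (2 * (3*\<delta>)) + (Mf \<delta> * (2 + Mf \<delta>) + sqrt (2 * B * (3*\<delta>)) / (kT c - Mf \<delta>)) * sqrt B + 2 * sqrt c" for \<delta>
  have id: "((\<lambda>\<delta>::real. \<delta>) \<longlongrightarrow> 0) (at_right 0)" by (rule tendsto_ident_at)
  have "(Mf \<longlongrightarrow> 3*0 + 2 * sqrt (2 * B * (3*0))) (at_right 0)"
    unfolding Mf_def[abs_def] by (intro tendsto_intros id)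
  then have M: "(Mf \<longlongrightarrow> 0) (at_right 0)" by simp
  have "(tf \<longlongrightarrow> 3*0 + gap B + 4*0) (at_right 0)"
    unfolding tf_def[abs_def] by (intro tendsto_intros id M)
  then have T: "(tf \<longlongrightarrow> gap B) (at_right 0)" by simp
  have "(lf \<longlongrightarrow> 2 * sqrt (2 * (3*0)) + (0 * (2 + 0) + sqrt (2 * B * (3*0)) / (kT c - 0)) * sqrt B + 2 * sqrt c) (at_right 0)"
    unfolding lf_def[abs_def] by (intro tendsto_intros id M) (use kc in simp)
  then have L: "(lf \<longlongrightarrow> 2 * sqrt c) (at_right 0)" by simp
  have "((\<lambda>\<delta>. 2 * (sqrt (2 * tf \<delta>) + sqrt (gap B)) + 2 * lf \<delta> + 22 * \<delta> * sqrt B + sqrt (6 * \<delta>) + sqrt (22 * \<delta>))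
     \<longlongrightarrow> 2 * (sqrt (2 * gap B) + sqrt (gap B)) + 2 * (2 * sqrt c) + 22 * 0 * sqrt B + sqrt (6 * 0) + sqrt (22 * 0)) (at_right 0)"
    by (intro tendsto_intros id T L)
  moreover have "2 * (sqrt (2 * gap B) + sqrt (gap B)) + 2 * (2 * sqrt c) + 22 * 0 * sqrt B + sqrt (6 * 0) + sqrt (22 * 0) < \<omega>"
  proof -
    have "sqrt (2 * gap B) \<le> 2 * g"
    proof -
      have "sqrt 2 \<le> (2::real)" by (rule real_le_lsqrt) auto
      then show ?thesis unfolding g_def real_sqrt_mult using g0 by (intro mult_right_mono) auto
    qed
    then show ?thesis using g sc w unfolding g_def[symmetric] by simp
  qed
  ultimately have e1: "\<forall>\<^sub>F \<delta> in at_right 0. 2 * (sqrt (2 * tf \<delta>) + sqrt (gap B)) + 2 * lf \<delta> + 22 * \<delta> * sqrt B + sqrt (6 * \<delta>) + sqrt (22 * \<delta>) < \<omega>"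
    by (rule order_tendstoD(2))
  have "((\<lambda>\<delta>. 2 * (sqrt (4 * tf \<delta>) + sqrt 2 * sqrt (gap B)) + (2 * Mf \<delta> + 22 * \<delta>) * sqrt B + 6 * sqrt (22 * \<delta>))
     \<longlongrightarrow> 2 * (sqrt (4 * gap B) + sqrt 2 * sqrt (gap B)) + (2 * 0 + 22 * 0) * sqrt B + 6 * sqrt (22 * 0)) (at_right 0)"
    by (intro tendsto_intros id T M)
  moreover have "2 * (sqrt (4 * gap B) + sqrt 2 * sqrt (gap B)) + (2 * 0 + 22 * 0) * sqrt B + 6 * sqrt (22 * 0) < \<omega>"
  proof -
    have "sqrt 2 \<le> (2::real)" by (rule real_le_lsqrt) auto
    then have "sqrt 2 * g \<le> 2 * g" using g by (intro mult_right_mono) auto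
    moreover have "sqrt (4 * gap B) = 2 * g" by (simp add: g_def real_sqrt_mult)
    ultimately show ?thesis using g w unfolding g_def[symmetric] by simp
  qed
  ultimately have e2: "\<forall>\<^sub>F \<delta> in at_right 0. 2 * (sqrt (4 * tf \<delta>) + sqrt 2 * sqrt (gap B)) + (2 * Mf \<delta> + 22 * \<delta>) * sqrt B + 6 * sqrt (22 * \<delta>) < \<omega>"
    by (rule order_tendstoD(2))
  have "((\<lambda>\<delta>. 2 * (sqrt (2 * (3*\<delta>)) * (5 * sqrt B + 4)) + 60 * \<delta>) \<longlongrightarrow> 2 * (sqrt (2 * (3*0)) * (5 * sqrt B + 4)) + 60 * 0) (at_right 0)"
    by (intro tendsto_intros id)
  then have e3: "\<forall>\<^sub>F \<delta> in at_right 0. 2 * (sqrt (2 * (3*\<delta>)) * (5 * sqrt B + 4)) + 60 * \<delta> < \<omega>"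
    by (rule order_tendstoD(2)) (use w in simp)
  have e4: "\<forall>\<^sub>F \<delta> in at_right 0. Mf \<delta> < min 1 (kT c)" by (rule order_tendstoD(2)[OF M]) (use kc in simp)
  have e5: "\<forall>\<^sub>F \<delta> in at_right 0. tf \<delta> < 1/32" by (rule order_tendstoD(2)[OF T]) (use B in \<open>simp add: \<eta>_def\<close>)
  have e6: "\<forall>\<^sub>F \<delta> in at_right 0. \<delta> \<in> {0<..<min (1/96) (\<omega>/22)}" by (rule eventually_at_right_real) (use w in simp)
  note ev = eventually_conj[OF e1 eventually_conj[OF e2 eventually_conj[OF e3 eventually_conj[OF e4 eventually_conj[OF e5 e6]]]]]
  obtain \<delta> where elim: "2 * (sqrt (2 * tf \<delta>) + sqrt (gap B)) + 2 * lf \<delta> + 22 * \<delta> * sqrt B + sqrt (6 * \<delta>) + sqrt (22 * \<delta>) < \<omega>"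
    "2 * (sqrt (4 * tf \<delta>) + sqrt 2 * sqrt (gap B)) + (2 * Mf \<delta> + 22 * \<delta>) * sqrt B + 6 * sqrt (22 * \<delta>) < \<omega>"
    "2 * (sqrt (2 * (3*\<delta>)) * (5 * sqrt B + 4)) + 60 * \<delta> < \<omega>" "Mf \<delta> < min 1 (kT c)" "tf \<delta> < 1/32" "\<delta> \<in> {0<..<min (1/96) (\<omega>/22)}"
    using eventually_happens'[OF trivial_limit_at_right_real ev] by blast
  show thesis
    by (rule that[OF _ _ _ _ B(2) Mf_def[of \<delta>] _ eq_refl[OF tf_def[of \<delta>, symmetric]] _ c _ lf_def[of \<delta>]])
       (use elim in simp_all)
qed

text \<open>The phase may jump across the core; that it does not is recovered from the momentum later.\<close>

definition corner_close :: "(real \<Rightarrow> complex) \<Rightarrow> (real \<Rightarrow> complex) \<Rightarrow> real \<Rightarrow> real \<Rightarrow> bool" where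
  "corner_close u du x0 \<omega> \<longleftrightarrow>
    (\<exists>a \<sigma>p \<sigma>m. cmod \<sigma>p = 1 \<and> cmod \<sigma>m = 1 \<and> \<bar>a - x0\<bar> \<le> \<omega> \<and> cmod (u a) \<le> \<omega> \<and>
      L2 (\<lambda>x. du x - (if x \<ge> a then \<sigma>p else \<sigma>m) * of_real (kd (x - a))) \<and>
      L2norm (\<lambda>x. du x - (if x \<ge> a then \<sigma>p else \<sigma>m) * of_real (kd (x - a))) \<le> \<omega> \<and>
      L2 (\<lambda>x. cmod (u x) - \<bar>kT (x - a)\<bar>) \<and> L2norm (\<lambda>x. cmod (u x) - \<bar>kT (x - a)\<bar>) \<le> \<omega> \<and>
      (\<forall>\<^sub>F R in at_top. cmod (exp (\<i> * of_real (LINT x:{-R..R}|lborel. Im (cnj (u x) * du x))) * \<sigma>p * cnj \<sigma>m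
        + dir (u R) * cnj (dir (u (-R)))) \<le> \<omega>))"

lemma corner_uniform:
  assumes "0 < \<omega>"
  obtains \<delta> where "0 < \<delta>" "\<delta> \<le> \<omega>" "\<delta> \<le> 1/96"
    "\<And>u du x0. finite_energy u du \<Longrightarrow> energy u du \<le> 2 * sqrt 2 / 3 + \<delta> \<Longrightarrow> cmod (u x0) \<le> \<delta> \<Longrightarrow>
      corner_close u du x0 \<omega>"
proof -
  obtain \<delta> B M \<tau> c lam where p: "0 < \<delta>" "\<delta> \<le> 1/96" "\<delta> \<le> \<omega>" "22 * \<delta> \<le> \<omega>" "0 < B"
    "M = 3*\<delta> + 2 * sqrt (2 * B * (3*\<delta>))" "M \<le> 1" "3*\<delta> + gap B + 4 * M \<le> \<tau>" "\<tau> \<le> 1/32"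
    "0 < c" "c \<le> B" "M < kT c"
    "lam = 2 * sqrt (2 * (3*\<delta>)) + (M * (2 + M) + sqrt (2 * B * (3*\<delta>)) / (kT c - M)) * sqrt B + 2 * sqrt c"
    "2 * (sqrt (2 * \<tau>) + sqrt (gap B)) + 2 * lam + 22 * \<delta> * sqrt B + sqrt (6 * \<delta>) + sqrt (22 * \<delta>) \<le> \<omega>"
    "2 * (sqrt (4 * \<tau>) + sqrt 2 * sqrt (gap B)) + (2 * M + 22 * \<delta>) * sqrt B + 6 * sqrt (22 * \<delta>) \<le> \<omega>"
    "2 * (sqrt (2 * (3*\<delta>)) * (5 * sqrt B + 4)) + 60 * \<delta> \<le> \<omega>"
    by (rule small_parameters[OF assms])
  show thesis
  proof (rule that[OF p(1,3,2)])
    fix u du x0 assume fe: "finite_energy u du" and E: "energy u du \<le> 2 * sqrt 2 / 3 + \<delta>" and x0: "cmod (u x0) \<le> \<delta>"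
    interpret finite_energy u du by fact
    obtain a \<sigma>p \<sigma>m where q: "cmod \<sigma>p = 1" "cmod \<sigma>m = 1" "\<bar>a - x0\<bar> \<le> 22 * \<delta>" "cmod (u a) \<le> \<delta>"
      "L2 (\<lambda>x. du x - (if x \<ge> a then \<sigma>p else \<sigma>m) * of_real (kd (x - a)))"
      "L2norm (\<lambda>x. du x - (if x \<ge> a then \<sigma>p else \<sigma>m) * of_real (kd (x - a)))
        \<le> 2 * (sqrt (2 * \<tau>) + sqrt (gap B)) + 2 * lam + 22 * \<delta> * sqrt B + sqrt (6 * \<delta>) + sqrt (22 * \<delta>)"
      "L2 (\<lambda>x. cmod (u x) - \<bar>kT (x - a)\<bar>)"
      "L2norm (\<lambda>x. cmod (u x) - \<bar>kT (x - a)\<bar>)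
        \<le> 2 * (sqrt (4 * \<tau>) + sqrt 2 * sqrt (gap B)) + (2 * M + 22 * \<delta>) * sqrt B + 6 * sqrt (22 * \<delta>)"
      "\<forall>\<^sub>F R in at_top. cmod (exp (\<i> * of_real (LINT x:{-R..R}|lborel. Im (cnj (u x) * du x))) * \<sigma>p * cnj \<sigma>m
          + dir (u R) * cnj (dir (u (-R)))) \<le> 2 * (sqrt (2 * (3*\<delta>)) * (5 * sqrt B + 4)) + 60 * \<delta>"
      by (rule corner[OF E p(1,2) x0 p(5-13)])
    have ev: "\<forall>\<^sub>F R in at_top. cmod (exp (\<i> * of_real (LINT x:{-R..R}|lborel. Im (cnj (u x) * du x))) * \<sigma>p * cnj \<sigma>m
          + dir (u R) * cnj (dir (u (-R)))) \<le> \<omega>"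
      using q(9) by eventually_elim (use p(16) in linarith)
    show "corner_close u du x0 \<omega>"
      unfolding corner_close_def
      by (intro exI[of _ a] exI[of _ \<sigma>p] exI[of _ \<sigma>m] conjI q(1,2,5,7) ev;
          use q(3,4,6,8) p(3,4,14,15) in linarith)
  qed
qed

lemma dir_dist:
  assumes "w \<noteq> 0" shows "cmod (dir z - dir w) \<le> 2 * cmod (z - w) / cmod w"
proof (cases "z = 0")
  case True
  then show ?thesis using assms dir_norm[OF assms] by (simp add: dir_def)
next
  case False
  have "dir z - dir w = (z - w) / of_real (cmod w) + z * of_real ((cmod w - cmod z) / (cmod z * cmod w))"
    using assms False by (simp add: dir_def field_simps)
  also have "cmod \<dots> \<le> cmod ((z - w) / of_real (cmod w)) + cmod (z * of_real ((cmod w - cmod z) / (cmod z * cmod w)))"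
    by (rule norm_triangle_ineq)
  also have "cmod (z * of_real ((cmod w - cmod z) / (cmod z * cmod w))) = \<bar>cmod w - cmod z\<bar> / cmod w"
    unfolding norm_mult norm_of_real using False by (simp add: abs_mult)
  also have "\<dots> \<le> cmod (z - w) / cmod w"
    using norm_triangle_ineq3[of w z] by (intro divide_right_mono) (auto simp: norm_minus_commute)
  also have "cmod ((z - w) / of_real (cmod w)) = cmod (z - w) / cmod w" by (simp add: norm_divide)
  finally show ?thesis by simp
qed

lemma dir_norm_le: "cmod (dir z) \<le> 1"
  by (cases "z = 0") (auto simp: dir_norm, simp add: dir_def)

lemma dir_prod_dist: "cmod (dir a * cnj (dir b) - dir c * cnj (dir d)) \<le> cmod (dir a - dir c) + cmod (dir b - dir d)"
proof -
  have "dir a * cnj (dir b) - dir c * cnj (dir d) = (dir a - dir c) * cnj (dir b) + dir c * cnj (dir b - dir d)" by (simp add: algebra_simps)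
  also have "cmod \<dots> \<le> cmod ((dir a - dir c) * cnj (dir b)) + cmod (dir c * cnj (dir b - dir d))" by (rule norm_triangle_ineq)
  also have "\<dots> \<le> cmod (dir a - dir c) * 1 + 1 * cmod (dir b - dir d)"
    unfolding norm_mult complex_mod_cnj by (intro add_mono mult_mono dir_norm_le) auto
  finally show ?thesis by simp
qed

text \<open>Where \<open>kd\<close> is bounded below, an \<open>L2\<close> bound on a multiple of
  \<open>kd\<close> controls the multiple itself; this is how phases are read off from
  derivatives.\<close>

lemma kd_unit_lower:
  obtains c where "0 < c" "\<And>x. 1 \<le> \<bar>x\<bar> \<Longrightarrow> \<bar>x\<bar> \<le> 2 \<Longrightarrow> c \<le> kd x"
proof -
  have "\<exists>x\<in>{1..2}. \<forall>y\<in>{1..2}. kd x \<le> kd y"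
    by (rule continuous_attains_inf) (auto intro: kd_cont)
  then obtain z where z: "\<And>y. y \<in> {1..2} \<Longrightarrow> kd z \<le> kd y" by blast
  show thesis
  proof (rule that[OF kd_bounds(1)[of z]])
    fix x :: real assume x: "1 \<le> \<bar>x\<bar>" "\<bar>x\<bar> \<le> 2"
    have "kd x = kd \<bar>x\<bar>" by (cases "x \<ge> 0") (auto simp: kd_minus)
    then show "kd z \<le> kd x" using z[of "\<bar>x\<bar>"] x by simp
  qed
qed

text \<open>On the interval \<open>(\<sigma> - 1) * kd x\<close> is \<open>K x\<close> plus an error
  of at most \<open>\<bar>s\<bar>\<close> from the shift; unit length makes the norm of a constant
  the constant itself.\<close>

lemma unit_phase_close:
  assumes c: "0 < c" "\<And>x. 1 \<le> \<bar>x\<bar> \<Longrightarrow> \<bar>x\<bar> \<le> 2 \<Longrightarrow> c \<le> kd x"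
    and \<sigma>: "cmod \<sigma> = 1" and I: "b = a + 1" "\<And>x. x \<in> {a..b} \<Longrightarrow> 1 \<le> \<bar>x\<bar> \<and> \<bar>x\<bar> \<le> 2"
    and K: "L2 K" "\<And>x. x \<in> {a..b} \<Longrightarrow> K x = \<sigma> * of_real (kd (x - s)) - of_real (kd x)"
  shows "cmod (\<sigma> - 1) * c \<le> L2norm K + \<bar>s\<bar>"
proof -
  define m where "m = cmod (\<sigma> - 1) * c"
  have m0: "0 \<le> m" using c by (simp add: m_def)
  have ab: "a \<le> b" using I by simp
  note Lm = L2_const_indicator[OF m0 ab] and Ls = L2_const_indicator[OF abs_ge_zero[of s] ab]
  have "L2norm (\<lambda>x. m * indicator {a..b} x :: real) \<le> L2norm (\<lambda>x. norm (K x) + \<bar>s\<bar> * indicator {a..b} x)"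
  proof (rule L2norm_mono[OF L2_add(1)[OF L2_norm[OF K(1)] Ls(1)]], intro AE_I2)
    fix x
    show "norm (m * indicator {a..b} x) \<le> norm (norm (K x) + \<bar>s\<bar> * indicator {a..b} x)"
    proof (cases "x \<in> {a..b}")
      case True
      have "(\<sigma> - 1) * of_real (kd x) = K x + \<sigma> * of_real (kd x - kd (x - s))"
        unfolding K(2)[OF True] by (simp add: algebra_simps)
      then have "cmod (\<sigma> - 1) * kd x \<le> cmod (K x) + \<bar>kd x - kd (x - s)\<bar>"
        using norm_triangle_ineq[of "K x" "\<sigma> * of_real (kd x - kd (x - s))"] kd_bounds(1)[of x]
        by (metis \<sigma> abs_of_pos mult_1 norm_mult norm_of_real)
      moreover have "\<bar>kd x - kd (x - s)\<bar> \<le> \<bar>s\<bar>" using kd_Lipschitz[of x "x - s"] by simp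
      moreover have "m \<le> cmod (\<sigma> - 1) * kd x" unfolding m_def using c(2)[of x] I(2)[OF True] by (intro mult_left_mono) auto
      ultimately show ?thesis using True m0 by simp
    qed simp
  qed
  also have "\<dots> \<le> L2norm K + \<bar>s\<bar>"
    using L2_add(2)[OF L2_norm[OF K(1)] Ls(1)] Ls(2) I(1) unfolding L2norm_norm by simp
  finally show ?thesis using Lm(2) I(1) by (simp add: m_def)
qed

text \<open>For the kink the momentum vanishes and the directions at the two ends are opposite, so the
  quantity below measures the deviation of the momentum-corrected phase shift from \<open>\<pi>\<close>.\<close>

lemma (in gp_flow) phase_transport:
  assumes ph: "\<forall>\<^sub>F R in at_top. cmod (exp (\<i> * of_real (LINT x:{-R..R}|lborel. Im (cnj (V a x) * G a x))) + dir (V a R) * cnj (dir (V a (-R)))) \<le> S"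
    and s: "0 < s"
  shows "\<forall>\<^sub>F R in at_top. cmod (exp (\<i> * of_real (LINT x:{-R..R}|lborel. Im (cnj (V b x) * G b x))) + dir (V b R) * cnj (dir (V b (-R)))) \<le> S + s"
proof -
  interpret A: finite_energy "V a" "G a" by standard (rule prim_V L2_G L2_eta)+
  obtain M where M: "\<And>x. cmod (V a x) \<le> M" using bdd by blast
  define J where "J t R = (LINT x:{-R..R}|lborel. Im (cnj (V t x) * G t x))" for t R
  have JIm: "J t R = Im (LINT x:{-R..R}|lborel. cnj (V t x) * G t x)" for t R
    unfolding J_def
    by (rule set_integrable_linear(2)[OF bounded_linear_Im set_integrable_cont_mult[OF _ loc_integrableD[OF li_G]]])
       (intro continuous_intros cont_V)
  have Jlim: "((\<lambda>R. \<bar>J b R - J a R\<bar>) \<longlongrightarrow> 0) at_top"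
    using tendsto_rabs[OF momentum_tendsto[of b a]] unfolding JIm by simp
  have dlim: "((\<lambda>x. cmod (dir (V b x) - dir (V a x))) \<longlongrightarrow> 0) F"
    if "((\<lambda>x. V b x - V a x) \<longlongrightarrow> 0) F" "((\<lambda>x. cmod (V a x)) \<longlongrightarrow> 1) F" for F
  proof (rule Lim_null_comparison)
    have "\<forall>\<^sub>F x in F. 0 < cmod (V a x)" by (rule order_tendstoD(1)[OF that(2)]) simp
    then show "\<forall>\<^sub>F x in F. norm (cmod (dir (V b x) - dir (V a x))) \<le> 2 * cmod (V b x - V a x) / cmod (V a x)"
      by eventually_elim (use dir_dist in auto)
    have "((\<lambda>x. 2 * cmod (V b x - V a x) / cmod (V a x)) \<longlongrightarrow> 2 * cmod 0 / 1) F" by (intro tendsto_intros that) simp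
    then show "((\<lambda>x. 2 * cmod (V b x - V a x) / cmod (V a x)) \<longlongrightarrow> 0) F" by simp
  qed
  have d1: "((\<lambda>R. cmod (dir (V b R) - dir (V a R))) \<longlongrightarrow> 0) at_top"
    by (rule dlim[OF diff_tendsto(1) A.mod_tendsto_one(1)[OF M]])
  have d2: "((\<lambda>R. cmod (dir (V b (-R)) - dir (V a (-R)))) \<longlongrightarrow> 0) at_top"
    using dlim[OF diff_tendsto(2) A.mod_tendsto_one(2)[OF M]] by (simp add: filterlim_at_bot_mirror)
  have "((\<lambda>R. \<bar>J b R - J a R\<bar> + (cmod (dir (V b R) - dir (V a R)) + cmod (dir (V b (-R)) - dir (V a (-R))))) \<longlongrightarrow> 0 + (0 + 0)) at_top"
    by (intro tendsto_intros Jlim d1 d2)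
  then have "\<forall>\<^sub>F R in at_top. \<bar>J b R - J a R\<bar> + (cmod (dir (V b R) - dir (V a R)) + cmod (dir (V b (-R)) - dir (V a (-R)))) < s"
    by (rule order_tendstoD(2)) (use s in simp)
  then show ?thesis using ph
  proof eventually_elim
    case (elim R)
    have "exp (\<i> * of_real (J b R)) + dir (V b R) * cnj (dir (V b (-R)))
      = (exp (\<i> * of_real (J a R)) + dir (V a R) * cnj (dir (V a (-R))))
        + ((exp (\<i> * of_real (J b R)) - exp (\<i> * of_real (J a R))) + (dir (V b R) * cnj (dir (V b (-R))) - dir (V a R) * cnj (dir (V a (-R)))))" by simp
    also have "cmod \<dots> \<le> S + (\<bar>J b R - J a R\<bar> + (cmod (dir (V b R) - dir (V a R)) + cmod (dir (V b (-R)) - dir (V a (-R)))))"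
      by (intro norm_triangle_mono exp_i_dist dir_prod_dist) (use elim(2) in \<open>simp add: J_def\<close>)
    also have "\<dots> \<le> S + s" using elim(1) by simp
    finally show ?case by (simp add: J_def)
  qed
qed

section \<open>Orbital stability\<close>

lemma AE_le_continuous:
  fixes f :: "real \<Rightarrow> real"
  assumes "continuous_on UNIV f" "open U" "AE x in lborel. x \<in> U \<longrightarrow> f x \<le> C" "x \<in> U"
  shows "f x \<le> C"
proof (rule ccontr)
  assume "\<not> f x \<le> C"
  moreover have "open (U \<inter> {y. C < f y})"
    by (intro open_Int assms(2) open_Collect_less assms(1) continuous_on_const)
  ultimately obtain e where e: "e > 0" "ball x e \<subseteq> U \<inter> {y. C < f y}"
    using assms(4) by (metis IntI mem_Collect_eq not_less open_contains_ball_eq)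
  have "AE y in lborel. y \<notin> {x-e<..<x+e}"
    using assms(3)
  proof eventually_elim
    case (elim y)
    show ?case
    proof
      assume "y \<in> {x-e<..<x+e}"
      then have "y \<in> ball x e" by (auto simp: dist_real_def)
      then show False using e(2) elim by auto
    qed
  qed
  then have "{x-e<..<x+e} \<in> null_sets lborel" by (subst AE_iff_null_sets) auto
  then have "emeasure lborel {x-e<..<x+e} = 0" by blast
  then show False using e(1) by simp
qed

lemma Linf_norm_on_le:
  assumes "0 \<le> C" "\<And>x. x \<in> {-A..A} \<Longrightarrow> norm (f x) \<le> C"
  shows "Linf_norm_on A f \<le> C"
  unfolding Linf_norm_on_def
  by (rule cInf_lower) (use assms in \<open>auto intro: bdd_belowI[of _ 0]\<close>)

lemma Linf_norm_on_upper:
  assumes f: "continuous_on UNIV f" and x: "x \<in> {-A<..<A}"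
  shows "norm (f x) \<le> Linf_norm_on A f"
  unfolding Linf_norm_on_def
proof (rule cInf_greatest)
  have "compact (f ` {-A..A})" by (intro compact_continuous_image continuous_on_subset[OF f]) auto
  then obtain K where K: "\<And>y. y \<in> f ` {-A..A} \<Longrightarrow> norm y \<le> K" using compact_imp_bounded bounded_iff by metis
  then have "\<bar>K\<bar> \<in> {C. 0 \<le> C \<and> (AE x in lborel. x \<in> {-A..A} \<longrightarrow> norm (f x) \<le> C)}" by force
  then show "{C. 0 \<le> C \<and> (AE x in lborel. x \<in> {-A..A} \<longrightarrow> norm (f x) \<le> C)} \<noteq> {}" by blast
next
  fix C assume "C \<in> {C. 0 \<le> C \<and> (AE x in lborel. x \<in> {-A..A} \<longrightarrow> norm (f x) \<le> C)}"
  then have ae: "AE x in lborel. x \<in> {-A..A} \<longrightarrow> norm (f x) \<le> C" by simp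
  show "norm (f x) \<le> C"
  proof (rule AE_le_continuous[where f="\<lambda>x. norm (f x)", OF _ _ _ x])
    show "continuous_on UNIV (\<lambda>x. norm (f x))" by (intro continuous_intros f)
    show "AE x in lborel. x \<in> {-A<..<A} \<longrightarrow> norm (f x) \<le> C" using ae by eventually_elim auto
  qed auto
qed

lemma Linf_norm_on_cong_AE:
  assumes "AE x in lborel. f x = g x" shows "Linf_norm_on A f = Linf_norm_on A g"
proof -
  have "(AE x in lborel. x \<in> {-A..A} \<longrightarrow> norm (f x) \<le> C) \<longleftrightarrow> (AE x in lborel. x \<in> {-A..A} \<longrightarrow> norm (g x) \<le> C)" for C
    by (rule eventually_cong[OF assms]) simp
  then show ?thesis by (simp add: Linf_norm_on_def)
qed

lemma L2norm_cong_AE: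
  fixes f g :: "real \<Rightarrow> 'a::{real_normed_vector,second_countable_topology}"
  assumes [measurable]: "f \<in> borel_measurable borel" "g \<in> borel_measurable borel" and ae: "AE x in lborel. f x = g x"
  shows "L2norm f = L2norm g"
proof -
  have "(LINT x|lborel. (norm (f x))^2) = (LINT x|lborel. (norm (g x))^2)"
    by (rule integral_cong_AE) (use ae in auto)
  then show ?thesis by (simp add: L2norm_def)
qed

lemma wderiv_of_prim:
  assumes p: "prim f g" and m: "h \<in> borel_measurable borel" and ae: "AE x in lborel. h x = f x"
  shows "AE x in lborel. wderiv h x = g x" "wderiv h \<in> borel_measurable borel"
proof -
  have ae': "AE x in lborel. f x = h x" using ae by eventually_elim simp
  have w: "weak_deriv h g"
    by (rule weak_deriv_cong_AE[OF prim_weak_deriv[OF p] m ae' prim_meas[OF p]]) simp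
  show "AE x in lborel. wderiv h x = g x" by (rule wderiv_eq(2)[OF w])
  show "wderiv h \<in> borel_measurable borel"
    using wderiv_eq(1)[OF w] loc_integrable_meas unfolding weak_deriv_def by blast
qed

text \<open>The distance sees only almost everywhere classes, so the chosen weak derivatives may be
  replaced by the densities of continuous representatives.\<close>

lemma dAX1_prim:
  assumes p: "prim f1 g1" "prim f2 g2" and m[measurable]: "w1 \<in> borel_measurable borel" "w2 \<in> borel_measurable borel"
    and ae: "AE x in lborel. w1 x = f1 x" "AE x in lborel. w2 x = f2 x"
  shows "dAX1 A w1 w2 = Linf_norm_on A (\<lambda>x. f1 x - f2 x) + L2norm (\<lambda>x. g1 x - g2 x) + L2norm (\<lambda>x. cmod (f1 x) - cmod (f2 x))"
proof -
  note w1 = wderiv_of_prim[OF p(1) m(1) ae(1)] and w2 = wderiv_of_prim[OF p(2) m(2) ae(2)]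
  note [measurable] = w1(2) w2(2) prim_meas[OF p(1)] prim_meas[OF p(2)] prim_meas'[OF p(1)] prim_meas'[OF p(2)]
  have "Linf_norm_on A (\<lambda>x. w1 x - w2 x) = Linf_norm_on A (\<lambda>x. f1 x - f2 x)"
    by (rule Linf_norm_on_cong_AE) (use ae in eventually_elim, simp)
  moreover have "L2norm (\<lambda>x. wderiv w1 x - wderiv w2 x) = L2norm (\<lambda>x. g1 x - g2 x)"
  proof (rule L2norm_cong_AE)
    show "AE x in lborel. wderiv w1 x - wderiv w2 x = g1 x - g2 x" using w1(1) w2(1) by eventually_elim simp
  qed measurable
  moreover have "L2norm (\<lambda>x. cmod (w1 x) - cmod (w2 x)) = L2norm (\<lambda>x. cmod (f1 x) - cmod (f2 x))"
  proof (rule L2norm_cong_AE)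
    show "AE x in lborel. cmod (w1 x) - cmod (w2 x) = cmod (f1 x) - cmod (f2 x)" using ae by eventually_elim simp
  qed measurable
  ultimately show ?thesis by (simp add: dAX1_def)
qed

text \<open>Representatives \<open>F0\<close> of the datum and \<open>F t\<close> of the increments
  are built separately, since only the increments are in \<open>H1\<close>. Both are bounded, so
  \<open>(cmod (V t x))^2 - (cmod (F0 x))^2\<close> is dominated by a multiple of
  \<open>F t x\<close>, which keeps \<open>V t\<close> in the energy space.\<close>

lemma gp_solution_flow:
  assumes X: "X1 v0" and S: "gp_solution v0 v"
  obtains V G where "gp_flow V G" "\<And>t. AE x in lborel. v t x = V t x" "\<And>t. v t \<in> borel_measurable borel"
proof -
  obtain g0 C where g0: "weak_deriv v0 g0" "L2 g0" and Lv0: "AE x in lborel. norm (v0 x) \<le> C" and mv0[measurable]: "v0 \<in> borel_measurable borel"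
    and et0: "L2 (\<lambda>x. 1 - (cmod (v0 x))^2)"
    using X unfolding X1_def Linfty_def by auto
  obtain F0 where F0: "prim F0 g0" "AE x in lborel. v0 x = F0 x" by (rule du_Bois_Reymond[OF g0(1)])
  have Hv: "L2 (\<lambda>x. v t x - v0 x)" for t using S by (simp add: gp_solution_def H1_def)
  have "\<exists>F h. prim F h \<and> L2 h \<and> (AE x in lborel. v t x - v0 x = F x)" for t
  proof -
    obtain h where h: "weak_deriv (\<lambda>x. v t x - v0 x) h" "L2 h" using S unfolding gp_solution_def H1_def by blast
    obtain F where "prim F h" "AE x in lborel. v t x - v0 x = F x" by (rule du_Bois_Reymond[OF h(1)])
    then show ?thesis using h(2) by blast
  qed
  then obtain F h where F: "\<And>t. prim (F t) (h t)" "\<And>t. L2 (h t)" "\<And>t. AE x in lborel. v t x - v0 x = F t x" by metis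
  define V where "V t x = F0 x + F t x" for t x
  define G where "G t x = g0 x + h t x" for t x
  have pV: "prim (V t) (G t)" for t unfolding V_def[abs_def] G_def[abs_def] by (rule prim_add[OF F0(1) F(1)])
  have L2G: "L2 (G t)" for t unfolding G_def[abs_def] by (rule L2_add(1)[OF g0(2) F(2)])
  have L2F: "L2 (F t)" for t by (rule L2_cong_AE(1)[OF Hv prim_meas'[OF F(1)] F(3)])
  have ae: "AE x in lborel. v t x = V t x" for t
    using F0(2) F(3)[of t] by eventually_elim (simp add: V_def algebra_simps)
  have mv[measurable]: "v t \<in> borel_measurable borel" for t
  proof -
    have "(\<lambda>x. (v t x - v0 x) + v0 x) \<in> borel_measurable borel" using L2_meas[OF Hv[of t]] mv0 by (rule borel_measurable_add)
    then show ?thesis by simp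
  qed
  note mV[measurable] = prim_meas'[OF pV] and mF0[measurable] = prim_meas'[OF F0(1)] and mF[measurable] = prim_meas'[OF F(1)]
  have F0b: "cmod (F0 x) \<le> C" for x
  proof (rule AE_le_continuous[where U=UNIV and f="\<lambda>x. cmod (F0 x)"])
    show "continuous_on UNIV (\<lambda>x. cmod (F0 x))" by (intro continuous_intros prim_cont[OF F0(1)])
    show "AE x in lborel. x \<in> UNIV \<longrightarrow> cmod (F0 x) \<le> C" using Lv0 F0(2) by eventually_elim simp
  qed auto
  define K where "K t = L2norm (h t) + L2norm (F t)" for t
  have Fb: "cmod (F t x) \<le> K t" for t x unfolding K_def by (rule prim_L2_sup[OF F(1) L2F F(2)])
  have C0: "0 \<le> C" using order_trans[OF norm_ge_zero F0b] .
  have L2d: "L2 (\<lambda>x. V s x - V t x)" for s t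
    using L2_diff(1)[OF L2F[of s] L2F[of t]] by (simp add: V_def)
  have L2e: "L2 (\<lambda>x. 1 - (cmod (V t x))^2)" for t
  proof -
    have e0: "L2 (\<lambda>x. 1 - (cmod (F0 x))^2)"
    proof (rule L2_cong_AE(1)[OF et0])
      show "AE x in lborel. 1 - (cmod (v0 x))^2 = 1 - (cmod (F0 x))^2" using F0(2) by eventually_elim simp
    qed measurable
    have "L2 (\<lambda>x. (cmod (V t x))^2 - (cmod (F0 x))^2)"
    proof (rule L2_bound[OF _ L2F[of t]])
      show "AE x in lborel. norm ((cmod (V t x))^2 - (cmod (F0 x))^2) \<le> (2 * C + K t) * norm (F t x)"
      proof (rule AE_I2)
        fix x
        have "(cmod (V t x))^2 - (cmod (F0 x))^2 = (cmod (V t x) + cmod (F0 x)) * (cmod (V t x) - cmod (F0 x))"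
          by (simp add: power2_eq_square algebra_simps)
        also have "\<bar>\<dots>\<bar> = (cmod (V t x) + cmod (F0 x)) * \<bar>cmod (V t x) - cmod (F0 x)\<bar>" by (simp add: abs_mult)
        also have "\<dots> \<le> (2 * C + K t) * cmod (F t x)"
        proof (intro mult_mono)
          have "cmod (V t x) \<le> cmod (F0 x) + cmod (F t x)" unfolding V_def by (rule norm_triangle_ineq)
          then show "cmod (V t x) + cmod (F0 x) \<le> 2 * C + K t" using F0b[of x] Fb[of t x] by linarith
          have "V t x - F0 x = F t x" by (simp add: V_def)
          then show "\<bar>cmod (V t x) - cmod (F0 x)\<bar> \<le> cmod (F t x)" using norm_triangle_ineq3[of "V t x" "F0 x"] by simp
          show "0 \<le> 2 * C + K t" using C0 by (simp add: K_def)
        qed auto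
        finally show "norm ((cmod (V t x))^2 - (cmod (F0 x))^2) \<le> (2 * C + K t) * norm (F t x)" by simp
      qed
    qed measurable
    from L2_diff(1)[OF e0 this] show ?thesis by simp
  qed
  have norms: "L2norm (\<lambda>x. V s x - V t x) \<le> H1norm (\<lambda>x. v s x - v t x)" "L2norm (\<lambda>x. G s x - G t x) \<le> H1norm (\<lambda>x. v s x - v t x)" for s t
  proof -
    have ad: "AE x in lborel. v s x - v t x = V s x - V t x" using ae[of s] ae[of t] by eventually_elim simp
    have 1: "L2norm (\<lambda>x. v s x - v t x) = L2norm (\<lambda>x. V s x - V t x)"
      by (rule L2norm_cong_AE[OF _ _ ad]) measurable
    have md: "(\<lambda>x. v s x - v t x) \<in> borel_measurable borel" by measurable
    note w = wderiv_of_prim[OF prim_diff[OF pV pV] md ad]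
    have 2: "L2norm (wderiv (\<lambda>x. v s x - v t x)) = L2norm (\<lambda>x. G s x - G t x)"
      by (rule L2norm_cong_AE[OF w(2) L2_meas[OF L2_diff(1)[OF L2G L2G]] w(1)])
    show "L2norm (\<lambda>x. V s x - V t x) \<le> H1norm (\<lambda>x. v s x - v t x)" "L2norm (\<lambda>x. G s x - G t x) \<le> H1norm (\<lambda>x. v s x - v t x)"
      unfolding H1norm_def 1 2 by (intro real_le_rsqrt; simp)+
  qed
  have Hc: "((\<lambda>s. H1norm (\<lambda>x. v s x - v t x)) \<longlongrightarrow> 0) (at t)" for t using S by (simp add: gp_solution_def)
  have cVG: "((\<lambda>s. L2norm (\<lambda>x. V s x - V t x)) \<longlongrightarrow> 0) (at t)" "((\<lambda>s. L2norm (\<lambda>x. G s x - G t x)) \<longlongrightarrow> 0) (at t)" for t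
    by (rule Lim_null_comparison[OF _ Hc]; use norms in simp)+
  have eq: "((\<lambda>s. LINT x|lborel. V s x * of_real (\<phi> x)) has_vector_derivative
      (\<i> * ((LINT x|lborel. V t x * of_real (deriv (deriv \<phi>) x)) + (LINT x|lborel. NL (V t x) * of_real (\<phi> x))))) (at t)"
    if \<phi>: "test_fun \<phi>" for \<phi> t
  proof -
    note [measurable] = test_fun_meas[OF \<phi>] test_fun_meas[OF test_fun_deriv[OF test_fun_deriv[OF \<phi>]]]
    obtain D where D: "((\<lambda>s. LINT x|lborel. v s x * of_real (\<phi> x)) has_vector_derivative D) (at t)"
      "\<i> * D + (LINT x|lborel. v t x * of_real (deriv (deriv \<phi>) x))
          = (LINT x|lborel. v t x * of_real ((cmod (v t x))\<^sup>2 - 1) * of_real (\<phi> x))"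
      using S \<phi> unfolding gp_solution_def by blast
    have i1: "(LINT x|lborel. v s x * of_real (\<phi> x)) = (LINT x|lborel. V s x * of_real (\<phi> x))" for s
      by (rule integral_cong_AE) (use ae[of s] in auto)
    have i2: "(LINT x|lborel. v t x * of_real (deriv (deriv \<phi>) x)) = (LINT x|lborel. V t x * of_real (deriv (deriv \<phi>) x))"
      by (rule integral_cong_AE) (use ae[of t] in auto)
    have "(LINT x|lborel. v t x * of_real ((cmod (v t x))\<^sup>2 - 1) * of_real (\<phi> x))
      = (LINT x|lborel. V t x * of_real ((cmod (V t x))\<^sup>2 - 1) * of_real (\<phi> x))"
      by (rule integral_cong_AE) (use ae[of t] in auto)
    also have "\<dots> = (LINT x|lborel. - (NL (V t x) * of_real (\<phi> x)))"
      by (rule Bochner_Integration.integral_cong) (simp_all add: NL_def algebra_simps)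
    also have "\<dots> = - (LINT x|lborel. NL (V t x) * of_real (\<phi> x))" by simp
    finally have "\<i> * D = - ((LINT x|lborel. V t x * of_real (deriv (deriv \<phi>) x)) + (LINT x|lborel. NL (V t x) * of_real (\<phi> x)))"
      using D(2) unfolding i2 by (simp add: algebra_simps add_eq_0_iff2)
    \<comment> \<open>Multiplying once more by \<open>\<i>\<close> solves for the time
      derivative.\<close>
    then have "\<i> * (\<i> * D) = \<i> * - ((LINT x|lborel. V t x * of_real (deriv (deriv \<phi>) x)) + (LINT x|lborel. NL (V t x) * of_real (\<phi> x)))"
      by (rule arg_cong)
    then have "D = \<i> * ((LINT x|lborel. V t x * of_real (deriv (deriv \<phi>) x)) + (LINT x|lborel. NL (V t x) * of_real (\<phi> x)))"
      by (simp only: mult.assoc[symmetric] i_squared mult_minus_right mult_minus_left mult_1_left minus_equation_iff neg_equal_iff_equal)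
    then show ?thesis using D(1) unfolding i1 by simp
  qed
  have "gp_flow V G"
  proof
    show "\<exists>M. \<forall>x. cmod (V t x) \<le> M" for t
    proof (intro exI allI)
      show "cmod (V t x) \<le> C + K t" for x unfolding V_def by (rule norm_triangle_le) (rule add_mono[OF F0b Fb])
    qed
  qed (rule pV L2G L2e L2d cVG eq | assumption)+
  then show thesis using ae mv by (rule that)
qed

lemma prim_phase_kink: "prim (\<lambda>x. \<sigma> * kink x) (\<lambda>x. \<sigma> * of_real (kd x))"
proof -
  have "prim kink (\<lambda>x. of_real (kd x))"
    using prim_linear[OF bounded_linear_of_real prim_kT] by (simp add: kink_def[abs_def] kT_def[abs_def])
  then show ?thesis by (rule prim_linear[OF bounded_linear_mult_right])
qed

lemma kink_kT: "kink x = of_real (kT x)" by (simp add: kink_def kT_def)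

lemma kd_norm_le: "L2norm kd \<le> 1"
proof -
  have "sqrt 2 \<le> 3/2" by (rule real_le_lsqrt) (auto simp: power2_eq_square)
  then have "(L2norm kd)^2 \<le> 1^2" unfolding kd_norm by simp
  then show ?thesis by (rule power2_le_imp_le) simp
qed

lemma kd_complex_L2: "L2 (\<lambda>x. \<sigma> * complex_of_real (kd (x - a)))" "L2norm (\<lambda>x. \<sigma> * complex_of_real (kd (x - a))) = cmod \<sigma> * L2norm kd"
proof -
  have k: "L2 (\<lambda>x. complex_of_real (kd (x - a)))"
    by (rule L2_bound[OF _ kd_shift_L2[of a], where K=1]) auto
  show "L2 (\<lambda>x. \<sigma> * complex_of_real (kd (x - a)))" by (rule L2_cmult(1)[OF k])
  have "L2norm (\<lambda>x. complex_of_real (kd (x - a))) = L2norm (\<lambda>x. kd (x - a))" by (simp add: L2norm_def)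
  also have "\<dots> = L2norm kd" using L2norm_shift[of kd "-a"] by simp
  finally show "L2norm (\<lambda>x. \<sigma> * complex_of_real (kd (x - a))) = cmod \<sigma> * L2norm kd" using L2_cmult(2)[OF k] by simp
qed

section \<open>Energy, phases and distance near the kink\<close>

context finite_energy begin

lemma L2_mod_diff: "L2 (\<lambda>x. cmod (u x) - \<bar>kT x\<bar>)"
proof -
  have u: "L2 (\<lambda>x. 1 - cmod (u x))"
  proof (rule L2_bound[OF _ Leta, where K=1])
    show "(\<lambda>x. 1 - cmod (u x)) \<in> borel_measurable borel" using prim_meas'[OF pu] by measurable
    show "AE x in lborel. norm (1 - cmod (u x)) \<le> 1 * norm (1 - (cmod (u x))^2)"
    proof (rule AE_I2)
      fix x
      have "1 - (cmod (u x))^2 = (1 + cmod (u x)) * (1 - cmod (u x))" by (simp add: power2_eq_square algebra_simps)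
      then have "\<bar>1 - (cmod (u x))^2\<bar> = (1 + cmod (u x)) * \<bar>1 - cmod (u x)\<bar>" by (simp add: abs_mult)
      then show "norm (1 - cmod (u x)) \<le> 1 * norm (1 - (cmod (u x))^2)" by (simp add: algebra_simps)
    qed
  qed
  have k: "L2 (\<lambda>x. 1 - \<bar>kT x\<bar>)"
  proof (rule L2_bound[OF _ kd_L2, where K="sqrt 2"])
    show "(\<lambda>x. 1 - \<bar>kT x\<bar>) \<in> borel_measurable borel" by (intro borel_measurable_continuous_onI continuous_intros kT_cont)
    show "AE x in lborel. norm (1 - \<bar>kT x\<bar>) \<le> sqrt 2 * norm (kd x)"
    proof (rule AE_I2)
      fix x
      have "\<bar>kT x\<bar> * \<bar>kT x\<bar> \<le> 1 * \<bar>kT x\<bar>" using kT_bounds(1)[of x] by (intro mult_right_mono) auto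
      then have "(kT x)^2 \<le> \<bar>kT x\<bar>" by (simp add: power2_eq_square)
      moreover have "sqrt 2 * kd x = 1 - (kT x)^2" by (simp add: kd_def)
      ultimately show "norm (1 - \<bar>kT x\<bar>) \<le> sqrt 2 * norm (kd x)" using kT_bounds(1)[of x] kd_bounds(1)[of x] by simp
    qed
  qed
  from L2_diff(1)[OF k u] show ?thesis by simp
qed

text \<open>The potential is quadratic in \<open>(cmod u)^2\<close>, so a sup bound on the modulus
  is needed before the \<open>L2\<close> distance of the moduli controls it;
  \<open>hoelder_L2_sup\<close> provides it and yields the factor 6. Expanding the squares gives
  \<open>15 * \<delta>\<close>, rounded up.\<close>

lemma near_kink_energy:
  assumes d: "L2norm (\<lambda>x. du x - of_real (kd x)) \<le> \<delta>" "L2norm (\<lambda>x. cmod (u x) - \<bar>kT x\<bar>) \<le> \<delta>" "\<delta> \<le> 1"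
  shows "energy u du \<le> 2 * sqrt 2 / 3 + 16 * \<delta>"
proof -
  define k where "k = L2norm kd"
  have k: "0 \<le> k" "k \<le> 1" "k^2 = 2 * sqrt 2 / 3" using kd_norm_le kd_norm by (auto simp: k_def)
  have \<delta>0: "0 \<le> \<delta>" using order_trans[OF L2norm_nonneg d(1)] .
  have Lk: "L2 (\<lambda>x. complex_of_real (kd x))" "L2norm (\<lambda>x. complex_of_real (kd x)) = k"
    using kd_complex_L2[of 1 0] by (auto simp: k_def)
  have n1: "L2norm du \<le> \<delta> + k"
    using L2_add(2)[OF L2_diff(1)[OF Ldu Lk(1)] Lk(1)] d(1) Lk(2) by simp
  have sup: "\<bar>cmod (u x) - \<bar>kT x\<bar>\<bar> \<le> (\<delta> + k + k) + \<delta>" for x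
  proof -
    have "norm (cmod (u x) - \<bar>kT x\<bar>) \<le> (\<delta> + k + k) + L2norm (\<lambda>x. cmod (u x) - \<bar>kT x\<bar>)"
    proof (rule hoelder_L2_sup[OF L2_mod_diff])
      fix x y
      have "norm (u x - u y) \<le> sqrt \<bar>x - y\<bar> * (\<delta> + k)"
        by (rule order_trans[OF prim_hoelder[OF pu Ldu] mult_left_mono[OF n1]]) simp
      moreover have "norm (kT x - kT y) \<le> sqrt \<bar>x - y\<bar> * k" using prim_hoelder[OF prim_kT kd_L2] by (simp add: k_def)
      moreover have "\<bar>(cmod (u x) - \<bar>kT x\<bar>) - (cmod (u y) - \<bar>kT y\<bar>)\<bar> \<le> norm (u x - u y) + norm (kT x - kT y)"
        using norm_triangle_ineq3[of "u x" "u y"] abs_triangle_ineq3[of "kT x" "kT y"] unfolding real_norm_def by linarith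
      ultimately show "norm ((cmod (u x) - \<bar>kT x\<bar>) - (cmod (u y) - \<bar>kT y\<bar>)) \<le> (\<delta> + k + k) * sqrt \<bar>x - y\<bar>"
        by (simp add: algebra_simps)
    qed (use \<delta>0 k in simp)
    then show ?thesis using d(2) by simp
  qed
  define w where "w x = sqrt 2 * kd x" for x
  have Lw: "L2 w" "L2norm w = sqrt 2 * k"
    using L2_cmult[OF kd_L2, of "sqrt 2"] by (auto simp: w_def[abs_def] k_def)
  have wk: "w x = 1 - (kT x)^2" for x by (simp add: w_def kd_def)
  have Le: "L2 (\<lambda>x. (1 - (cmod (u x))^2) - w x)" by (rule L2_diff(1)[OF Leta Lw(1)])
  have "L2norm (\<lambda>x. (1 - (cmod (u x))^2) - w x) \<le> 6 * L2norm (\<lambda>x. cmod (u x) - \<bar>kT x\<bar>)"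
  proof (rule L2norm_bound[OF L2_mod_diff], intro AE_I2)
    fix x
    have "(1 - (cmod (u x))^2) - w x = - ((cmod (u x) + \<bar>kT x\<bar>) * (cmod (u x) - \<bar>kT x\<bar>))"
      unfolding wk by (simp add: power2_eq_square algebra_simps)
    also have "\<bar>\<dots>\<bar> = (cmod (u x) + \<bar>kT x\<bar>) * \<bar>cmod (u x) - \<bar>kT x\<bar>\<bar>" by (simp only: abs_minus_cancel abs_mult) simp
    also have "\<dots> \<le> 6 * \<bar>cmod (u x) - \<bar>kT x\<bar>\<bar>"
      using sup[of x] kT_bounds(1)[of x] k d(3) by (intro mult_right_mono) auto
    finally show "norm ((1 - (cmod (u x))^2) - w x) \<le> 6 * norm (cmod (u x) - \<bar>kT x\<bar>)" by simp
  qed simp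
  then have n2: "L2norm (\<lambda>x. 1 - (cmod (u x))^2) \<le> 6 * \<delta> + sqrt 2 * k"
    using L2_add(2)[OF Le Lw(1)] d(2) Lw(2) by simp
  have "energy u du \<le> 1/2 * (\<delta> + k)^2 + 1/4 * (6 * \<delta> + sqrt 2 * k)^2"
    unfolding energy_def by (intro add_mono mult_left_mono power_mono n1 n2) auto
  also have "\<dots> = k^2 + (1 + 3 * sqrt 2) * (k * \<delta>) + 19/2 * (\<delta> * \<delta>)"
  proof -
    have s: "(sqrt 2)^2 = (2::real)" by simp
    have "(6 * \<delta> + sqrt 2 * k)^2 = 36 * (\<delta> * \<delta>) + 12 * sqrt 2 * (k * \<delta>) + 2 * k^2"
      unfolding power2_sum power_mult_distrib s by (simp add: power2_eq_square)
    moreover have "(\<delta> + k)^2 = \<delta> * \<delta> + 2 * (k * \<delta>) + k^2" by algebra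
    ultimately show ?thesis by (simp add: algebra_simps)
  qed
  also have "\<dots> \<le> k^2 + 11/2 * \<delta> + 19/2 * \<delta>"
  proof -
    have "sqrt 2 \<le> 3/2" by (rule real_le_lsqrt) (auto simp: power2_eq_square)
    moreover have "k * \<delta> \<le> 1 * \<delta>" "\<delta> * \<delta> \<le> 1 * \<delta>" using k d(3) \<delta>0 by (intro mult_right_mono; simp)+
    ultimately have "(1 + 3 * sqrt 2) * (k * \<delta>) \<le> 11/2 * \<delta>" using k \<delta>0 by (intro mult_mono) auto
    then show ?thesis using \<open>\<delta> * \<delta> \<le> 1 * \<delta>\<close> by simp
  qed
  finally show ?thesis using k(3) \<delta>0 by simp
qed

text \<open>\<open>du\<close> is close both to \<open>kd\<close> and to the two-phase profile, so
  these are close to each other. As \<open>\<bar>a\<bar> < 1\<close>, the intervals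
  \<open>{1..2}\<close> and \<open>{-2..-1}\<close> lie on opposite sides of \<open>a\<close> and
  test the two phases separately.\<close>

lemma near_kink_phases:
  assumes c: "0 < c" "\<And>x. 1 \<le> \<bar>x\<bar> \<Longrightarrow> \<bar>x\<bar> \<le> 2 \<Longrightarrow> c \<le> kd x"
    and \<sigma>: "cmod \<sigma>p = 1" "cmod \<sigma>m = 1" and a: "\<bar>a\<bar> \<le> \<omega>" "\<omega> < 1"
    and L: "L2 (\<lambda>x. du x - (if x \<ge> a then \<sigma>p else \<sigma>m) * of_real (kd (x - a)))"
      "L2norm (\<lambda>x. du x - (if x \<ge> a then \<sigma>p else \<sigma>m) * of_real (kd (x - a))) \<le> \<omega>"
    and d: "L2norm (\<lambda>x. du x - of_real (kd x)) \<le> \<omega>"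
  shows "cmod (\<sigma>p * cnj \<sigma>m - 1) \<le> 6 * \<omega> / c"
proof -
  define K where "K x = (du x - of_real (kd x)) - (du x - (if x \<ge> a then \<sigma>p else \<sigma>m) * of_real (kd (x - a)))" for x
  have Lk: "L2 (\<lambda>x. du x - of_real (kd x))" using L2_diff(1)[OF Ldu kd_complex_L2(1)[of 1 0]] by simp
  have LK: "L2 K" "L2norm K \<le> \<omega> + \<omega>"
    unfolding K_def[abs_def] using L2_diff[OF Lk L(1)] L(2) d by auto
  have "cmod (\<sigma>p - 1) * c \<le> L2norm K + \<bar>a\<bar>"
    by (rule unit_phase_close[OF c \<sigma>(1) _ _ LK(1), of 2 1]) (use a in \<open>auto simp: K_def\<close>)
  then have 1: "cmod (\<sigma>p - 1) \<le> 3 * \<omega> / c" using LK(2) a c(1) by (simp add: pos_le_divide_eq)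
  have "cmod (\<sigma>m - 1) * c \<le> L2norm K + \<bar>a\<bar>"
    by (rule unit_phase_close[OF c \<sigma>(2) _ _ LK(1), of "-1" "-2"]) (use a in \<open>auto simp: K_def\<close>)
  then have 2: "cmod (\<sigma>m - 1) \<le> 3 * \<omega> / c" using LK(2) a c(1) by (simp add: pos_le_divide_eq)
  have "cmod (\<sigma>p * cnj \<sigma>m - 1 * cnj 1) \<le> cmod (\<sigma>p - 1) + cmod (\<sigma>m - 1)" by (rule unit_prod_dist) (use \<sigma> in auto)
  also have "\<dots> \<le> 3 * \<omega> / c + 3 * \<omega> / c" by (rule add_mono[OF 1 2])
  finally show ?thesis by simp
qed

text \<open>Replacing the left phase by \<open>\<sigma>p\<close> costs at most
  \<open>\<kappa>\<close> in the derivative, as \<open>L2norm kd \<le> 1\<close>. On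
  \<open>{-A..A}\<close> the difference from the rotated kink is its value at the core plus an
  increment of at most \<open>sqrt A\<close> times the norm of its derivative.\<close>

lemma close_to_rotated_kink:
  assumes w: "w \<in> borel_measurable borel" "AE x in lborel. w x = u x" and A: "0 < A"
    and \<sigma>: "cmod \<sigma>p = 1" "cmod \<sigma>m = 1" "cmod (\<sigma>p * cnj \<sigma>m - 1) \<le> \<kappa>"
    and ua: "cmod (u a) \<le> \<omega>"
    and L: "L2 (\<lambda>x. du x - (if x \<ge> a then \<sigma>p else \<sigma>m) * of_real (kd (x - a)))"
      "L2norm (\<lambda>x. du x - (if x \<ge> a then \<sigma>p else \<sigma>m) * of_real (kd (x - a))) \<le> \<omega>"
    and m: "L2norm (\<lambda>x. cmod (u x) - \<bar>kT (x - a)\<bar>) \<le> \<omega>"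
  shows "dAX1 A (\<lambda>x. w (x + a)) (\<lambda>x. \<sigma>p * kink x) \<le> 2 * \<omega> + (1 + sqrt A) * (\<omega> + \<kappa>)"
proof -
  have jump: "cmod (\<sigma>m - \<sigma>p) \<le> \<kappa>"
  proof -
    have "\<sigma>m * cnj \<sigma>m = 1" using \<sigma>(2) complex_norm_square[of \<sigma>m] by simp
    then have "\<sigma>p - \<sigma>m = (\<sigma>p * cnj \<sigma>m - 1) * \<sigma>m" by (simp add: algebra_simps)
    then have "cmod (\<sigma>p - \<sigma>m) = cmod (\<sigma>p * cnj \<sigma>m - 1)" using \<sigma>(2) by (simp add: norm_mult)
    then show ?thesis using \<sigma>(3) by (simp add: norm_minus_commute)
  qed
  have \<kappa>0: "0 \<le> \<kappa>" using order_trans[OF norm_ge_zero jump] .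
  have \<omega>0: "0 \<le> \<omega>" using order_trans[OF norm_ge_zero ua] .
  note Lk = kd_complex_L2[of \<sigma>p a]
  have Ld: "L2 (\<lambda>x. du x - \<sigma>p * of_real (kd (x - a)))" by (rule L2_diff(1)[OF Ldu Lk(1)])
  have Lj: "L2 (\<lambda>x. (du x - \<sigma>p * of_real (kd (x - a))) - (du x - (if x \<ge> a then \<sigma>p else \<sigma>m) * of_real (kd (x - a))))"
    by (rule L2_diff(1)[OF Ld L(1)])
  have "L2norm (\<lambda>x. (du x - \<sigma>p * of_real (kd (x - a))) - (du x - (if x \<ge> a then \<sigma>p else \<sigma>m) * of_real (kd (x - a)))) \<le> \<kappa> * L2norm (\<lambda>x. kd (x - a))"
  proof (rule L2norm_bound[OF kd_shift_L2 _ \<kappa>0], intro AE_I2)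
    fix x
    have e: "(du x - \<sigma>p * of_real (kd (x - a))) - (du x - (if x \<ge> a then \<sigma>p else \<sigma>m) * of_real (kd (x - a)))
      = (if x \<ge> a then 0 else \<sigma>m - \<sigma>p) * of_real (kd (x - a))" by (simp add: algebra_simps)
    show "norm ((du x - \<sigma>p * of_real (kd (x - a))) - (du x - (if x \<ge> a then \<sigma>p else \<sigma>m) * of_real (kd (x - a)))) \<le> \<kappa> * norm (kd (x - a))"
      unfolding e norm_mult norm_of_real real_norm_def using jump \<kappa>0 by (intro mult_right_mono) auto
  qed
  also have "\<dots> \<le> \<kappa>" using L2norm_shift[of kd "-a"] kd_norm_le \<kappa>0 mult_left_mono[of "L2norm kd" 1 \<kappa>] by simp
  finally have nd: "L2norm (\<lambda>x. du x - \<sigma>p * of_real (kd (x - a))) \<le> \<omega> + \<kappa>"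
    using L2_add(2)[OF L(1) Lj] L(2) by simp
  have ps: "prim (\<lambda>x. u (x + a)) (\<lambda>x. du (x + a))" by (rule prim_shift[OF pu])
  have nds: "L2norm (\<lambda>x. du (x + a) - \<sigma>p * of_real (kd x)) \<le> \<omega> + \<kappa>"
    using nd L2norm_shift[of "\<lambda>x. du x - \<sigma>p * of_real (kd (x - a))" a] by simp
  have Lds: "L2 (\<lambda>x. du (x + a) - \<sigma>p * of_real (kd x))" using L2_shift[OF Ld, of a] by simp
  have ms: "L2norm (\<lambda>x. cmod (u (x + a)) - cmod (\<sigma>p * kink x)) \<le> \<omega>"
    using m L2norm_shift[of "\<lambda>x. cmod (u x) - \<bar>kT (x - a)\<bar>" a] \<sigma>(1) by (simp add: norm_mult kink_kT)
  note pd = prim_diff[OF ps prim_phase_kink[of \<sigma>p]]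
  have sup: "Linf_norm_on A (\<lambda>x. u (x + a) - \<sigma>p * kink x) \<le> \<omega> + sqrt A * (\<omega> + \<kappa>)"
  proof (rule Linf_norm_on_le)
    fix x assume x: "x \<in> {-A..A}"
    have "norm ((u (x + a) - \<sigma>p * kink x) - (u (0 + a) - \<sigma>p * kink 0)) \<le> sqrt \<bar>x - 0\<bar> * L2norm (\<lambda>x. du (x + a) - \<sigma>p * of_real (kd x))"
      by (rule prim_hoelder[OF pd Lds])
    also have "\<dots> \<le> sqrt A * (\<omega> + \<kappa>)" using x nds A by (intro mult_mono) auto
    finally have "norm ((u (x + a) - \<sigma>p * kink x) - u a) \<le> sqrt A * (\<omega> + \<kappa>)" by (simp add: kink_kT)
    then show "norm (u (x + a) - \<sigma>p * kink x) \<le> \<omega> + sqrt A * (\<omega> + \<kappa>)"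
      using norm_triangle_sub[of "u (x + a) - \<sigma>p * kink x" "u a"] ua by linarith
  qed (use \<omega>0 \<kappa>0 A in simp)
  have mu[measurable]: "u \<in> borel_measurable borel" by (rule prim_meas'[OF pu])
  note w(1)[measurable]
  have "AE x in lborel. w (a + 1 * x) = u (a + 1 * x)"
    by (rule AE_borel_affine[OF _ _ w(2)]) (simp, measurable)
  then have aes: "AE x in lborel. w (x + a) = u (x + a)" by (simp add: add.commute)
  have "dAX1 A (\<lambda>x. w (x + a)) (\<lambda>x. \<sigma>p * kink x)
     = Linf_norm_on A (\<lambda>x. u (x + a) - \<sigma>p * kink x) + L2norm (\<lambda>x. du (x + a) - \<sigma>p * of_real (kd x)) + L2norm (\<lambda>x. cmod (u (x + a)) - cmod (\<sigma>p * kink x))"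
    by (rule dAX1_prim[OF ps prim_phase_kink _ prim_meas'[OF prim_phase_kink] aes]) auto
  then show ?thesis using sup nds ms by (simp add: algebra_simps)
qed

end

theorem theorem2:
  shows "\<forall>\<epsilon>>0. \<forall>A>0. \<exists>\<delta>>0. \<forall>v0 v.
           X1 v0 \<and> dAX1 A v0 kink \<le> \<delta> \<and> gp_solution v0 v \<longrightarrow>
           (\<forall>t. \<exists>a \<theta>. dAX1 A (\<lambda>x. v t (x + a)) (\<lambda>x. exp (\<i> * of_real \<theta>) * kink x) < \<epsilon>)"
proof (intro allI impI)
  fix \<epsilon> A :: real assume \<epsilon>: "0 < \<epsilon>" and A: "0 < A"
  \<comment> \<open>The bound reached at the end is
    \<open>2 * \<omega>1 + (1 + sqrt A) * (\<omega>1 + 2 * \<omega>1)\<close>, with a phase jump of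
    at most \<open>2 * \<omega>1\<close>; the extra factor 2 makes the inequality strict.\<close>
  define \<omega>1 where "\<omega>1 = \<epsilon> / (2 * (5 + 3 * sqrt A))"
  have sA: "0 < 5 + 3 * sqrt A" using A by (intro add_pos_pos) auto
  have \<omega>1: "0 < \<omega>1" unfolding \<omega>1_def using \<epsilon> sA by (intro divide_pos_pos) auto
  have "\<omega>1 * (5 + 3 * sqrt A) = \<epsilon> / 2" using sA by (simp add: \<omega>1_def field_simps)
  then have \<omega>1\<epsilon>: "\<omega>1 * (5 + 3 * sqrt A) < \<epsilon>" using \<epsilon> by simp
  obtain \<delta>1 where \<delta>1: "0 < \<delta>1" "\<delta>1 \<le> \<omega>1" "\<delta>1 \<le> 1/96" and corner1: "\<And>u du x0. finite_energy u du \<Longrightarrow> energy u du \<le> 2 * sqrt 2 / 3 + \<delta>1 \<Longrightarrow> cmod (u x0) \<le> \<delta>1 \<Longrightarrow>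
      corner_close u du x0 \<omega>1"
    by (rule corner_uniform[OF \<omega>1]) blast
  \<comment> \<open>\<open>\<delta>1\<close> will be the lower bound \<open>\<mu>\<close> in
    \<open>nonvanishing_energy\<close>, which asks for an angle of at most
    \<open>\<mu> / 6\<close>.\<close>
  define \<tau> where "\<tau> = \<delta>1 / 6"
  have \<tau>: "0 < \<tau>" "\<tau> \<le> \<delta>1 / 6" "\<tau> \<le> 1/2" using \<delta>1 by (auto simp: \<tau>_def)
  \<comment> \<open>One tolerance for two uses of the conserved phase: \<open>2 * sin \<tau>\<close>
    to force a small value, \<open>\<omega>1\<close> to match the two phases.\<close>
  define S where "S = min \<omega>1 (2 * sin \<tau>)"
  have S: "0 < S" "S \<le> \<omega>1" "S \<le> 2 * sin \<tau>"
    using \<omega>1 sin_gt_zero[of \<tau>] \<tau> pi_gt3 by (auto simp: S_def)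
  obtain c where c: "0 < c" "\<And>x. 1 \<le> \<bar>x\<bar> \<Longrightarrow> \<bar>x\<bar> \<le> 2 \<Longrightarrow> c \<le> kd x" by (rule kd_unit_lower) blast
  \<comment> \<open>Half of \<open>S\<close> bounds the deviation for the datum, of which
    \<open>6 * \<omega>0 / c\<close> is due to its phase jump; the other half is left for the
    transport in time.\<close>
  define \<omega>0 where "\<omega>0 = min (1/2) (S / (2 * (1 + 6 / c)))"
  have \<omega>0: "0 < \<omega>0" "\<omega>0 < 1" using S(1) c(1) by (auto simp: \<omega>0_def add_pos_pos)
  have "\<omega>0 * (1 + 6 / c) \<le> S / (2 * (1 + 6 / c)) * (1 + 6 / c)"
    using c(1) by (intro mult_right_mono) (auto simp: \<omega>0_def)
  also have "\<dots> = S / 2"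
  proof -
    have "1 + 6 / c > 0" using c(1) by (simp add: add_pos_pos)
    then show ?thesis by (simp add: field_simps)
  qed
  finally have \<omega>0S: "\<omega>0 + 6 * \<omega>0 / c \<le> S / 2" by (simp add: algebra_simps)
  obtain \<delta>0 where \<delta>0: "0 < \<delta>0" "\<delta>0 \<le> \<omega>0" "\<delta>0 \<le> 1/96" and corner0: "\<And>u du x0. finite_energy u du \<Longrightarrow> energy u du \<le> 2 * sqrt 2 / 3 + \<delta>0 \<Longrightarrow> cmod (u x0) \<le> \<delta>0 \<Longrightarrow>
      corner_close u du x0 \<omega>0"
    by (rule corner_uniform[OF \<omega>0(1)]) blast
  \<comment> \<open>By \<open>near_kink_energy\<close> the energy excess is at most
    \<open>16 * \<delta>\<close>. It must stay below the excess
    \<open>sqrt 2 / 6 * \<delta>1^2\<close> of a nonvanishing map, and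
    \<open>\<delta>1^2 / 8\<close> is less than \<open>\<delta>1^2 / 6\<close>.\<close>
  define \<delta> where "\<delta> = min \<delta>0 (min \<delta>1 (\<delta>1^2 / 8)) / 16"
  have \<delta>: "0 < \<delta>" "16 * \<delta> \<le> \<delta>0" "16 * \<delta> \<le> \<delta>1" "16 * \<delta> \<le> \<delta>1^2 / 8"
    using \<delta>0 \<delta>1 by (auto simp: \<delta>_def)
  have sq2: "sqrt 2 \<le> 143/100" "1 \<le> sqrt (2::real)" by (rule real_le_lsqrt) (auto simp: power2_eq_square)
  show "\<exists>\<delta>>0. \<forall>v0 v. X1 v0 \<and> dAX1 A v0 kink \<le> \<delta> \<and> gp_solution v0 v \<longrightarrow>
           (\<forall>t. \<exists>a \<theta>. dAX1 A (\<lambda>x. v t (x + a)) (\<lambda>x. exp (\<i> * of_real \<theta>) * kink x) < \<epsilon>)"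
  proof (rule exI[of _ \<delta>], intro conjI \<delta>(1) allI impI)
    fix v0 v t
    assume "X1 v0 \<and> dAX1 A v0 kink \<le> \<delta> \<and> gp_solution v0 v"
    then have X: "X1 v0" and d: "dAX1 A v0 kink \<le> \<delta>" and sol: "gp_solution v0 v" by auto
    obtain V G where flow: "gp_flow V G" and ae: "\<And>t. AE x in lborel. v t x = V t x" and mv: "\<And>t. v t \<in> borel_measurable borel"
      by (rule gp_solution_flow[OF X sol]) blast
    interpret gp_flow V G by fact
    have fe: "finite_energy (V s) (G s)" for s by standard (rule prim_V L2_G L2_eta)+
    interpret I: finite_energy "V 0" "G 0" by (rule fe)
    interpret F: finite_energy "V t" "G t" by (rule fe)
    have v00: "v 0 = v0" using sol by (simp add: gp_solution_def)
    have pk: "prim kink (\<lambda>x. of_real (kd x))" using prim_phase_kink[of 1] by simp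
    have d': "Linf_norm_on A (\<lambda>x. V 0 x - kink x) + L2norm (\<lambda>x. G 0 x - of_real (kd x)) + L2norm (\<lambda>x. cmod (V 0 x) - \<bar>kT x\<bar>) \<le> \<delta>"
      using d dAX1_prim[OF prim_V[of 0] pk mv[of 0] prim_meas'[OF pk] ae[of 0], of A] by (simp add: v00 kink_kT)
    have cd: "continuous_on UNIV (\<lambda>x. V 0 x - kink x)" by (intro continuous_intros cont_V prim_cont[OF pk])
    have init: "cmod (V 0 0) \<le> \<delta>" "L2norm (\<lambda>x. G 0 x - of_real (kd x)) \<le> \<delta>" "L2norm (\<lambda>x. cmod (V 0 x) - \<bar>kT x\<bar>) \<le> \<delta>"
    proof -
      \<comment> \<open>The kink vanishes at 0, which is interior to the interval of the sup norm,
        so the datum is almost zero there.\<close>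
      have "cmod (V 0 0) \<le> Linf_norm_on A (\<lambda>x. V 0 x - kink x)"
        using Linf_norm_on_upper[OF cd, of 0 A] A by (simp add: kink_kT)
      note n = this L2norm_nonneg[of "\<lambda>x. G 0 x - of_real (kd x)"] L2norm_nonneg[of "\<lambda>x. cmod (V 0 x) - \<bar>kT x\<bar>"]
        norm_ge_zero[of "V 0 0"]
      show "cmod (V 0 0) \<le> \<delta>" "L2norm (\<lambda>x. G 0 x - of_real (kd x)) \<le> \<delta>" "L2norm (\<lambda>x. cmod (V 0 x) - \<bar>kT x\<bar>) \<le> \<delta>"
        using d' n by linarith+
    qed
    have E0: "energy (V 0) (G 0) \<le> 2 * sqrt 2 / 3 + 16 * \<delta>"
      by (rule I.near_kink_energy[OF init(2,3)]) (use \<delta> \<delta>1 in linarith)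
    have Et: "energy (V t) (G t) \<le> 2 * sqrt 2 / 3 + 16 * \<delta>" by (rule order_trans[OF energy_le E0])
    obtain a0 \<sigma>p0 \<sigma>m0 where p0: "cmod \<sigma>p0 = 1" "cmod \<sigma>m0 = 1" "\<bar>a0 - 0\<bar> \<le> \<omega>0"
      "L2 (\<lambda>x. G 0 x - (if x \<ge> a0 then \<sigma>p0 else \<sigma>m0) * of_real (kd (x - a0)))"
      "L2norm (\<lambda>x. G 0 x - (if x \<ge> a0 then \<sigma>p0 else \<sigma>m0) * of_real (kd (x - a0))) \<le> \<omega>0"
      "\<forall>\<^sub>F R in at_top. cmod (exp (\<i> * of_real (LINT x:{-R..R}|lborel. Im (cnj (V 0 x) * G 0 x))) * \<sigma>p0 * cnj \<sigma>m0
          + dir (V 0 R) * cnj (dir (V 0 (-R)))) \<le> \<omega>0"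
    proof -
      have "energy (V 0) (G 0) \<le> 2 * sqrt 2 / 3 + \<delta>0" "cmod (V 0 0) \<le> \<delta>0" using E0 init(1) \<delta> by linarith+
      from corner0[OF fe this] show thesis using that unfolding corner_close_def by blast
    qed
    have jump0: "cmod (\<sigma>p0 * cnj \<sigma>m0 - 1) \<le> 6 * \<omega>0 / c"
    proof (rule I.near_kink_phases[OF c(1) _ p0(1,2) _ \<omega>0(2) p0(4,5)])
      show "\<bar>a0\<bar> \<le> \<omega>0" using p0(3) by simp
      show "L2norm (\<lambda>x. G 0 x - of_real (kd x)) \<le> \<omega>0" using init(2) \<delta> \<delta>0 by linarith
    qed (rule c(2))
    have "\<forall>\<^sub>F R in at_top. cmod (exp (\<i> * of_real (LINT x:{-R..R}|lborel. Im (cnj (V 0 x) * G 0 x)))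
          + dir (V 0 R) * cnj (dir (V 0 (-R)))) \<le> S / 2"
      using p0(6)
    proof eventually_elim
      case (elim R)
      let ?e = "exp (\<i> * of_real (LINT x:{-R..R}|lborel. Im (cnj (V 0 x) * G 0 x)))"
      have n: "cmod ?e = 1" by simp
      have "?e + dir (V 0 R) * cnj (dir (V 0 (-R))) = (?e * \<sigma>p0 * cnj \<sigma>m0 + dir (V 0 R) * cnj (dir (V 0 (-R)))) - ?e * (\<sigma>p0 * cnj \<sigma>m0 - 1)"
        by (simp add: algebra_simps)
      also have "cmod \<dots> \<le> \<omega>0 + 6 * \<omega>0 / c"
        by (rule order_trans[OF norm_triangle_ineq4 add_mono[OF elim]]) (use jump0 n in \<open>simp add: norm_mult\<close>)
      finally show ?case using \<omega>0S by linarith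
    qed
    from phase_transport[OF this, of "S/2" t] S(1)
    have pt: "\<forall>\<^sub>F R in at_top. cmod (exp (\<i> * of_real (LINT x:{-R..R}|lborel. Im (cnj (V t x) * G t x)))
          + dir (V t R) * cnj (dir (V t (-R)))) \<le> S" by simp
    have "\<exists>x0. cmod (V t x0) \<le> \<delta>1"
    proof (rule ccontr)
      assume "\<not> (\<exists>x0. cmod (V t x0) \<le> \<delta>1)"
      then have nz: "\<And>x. \<delta>1 < cmod (V t x)" by (auto simp: not_le)
      have ph: "\<forall>\<^sub>F R in at_top. cmod (exp (\<i> * of_real (LINT x:{-R..R}|lborel. Im (cnj (V t x) * G t x)))
          + dir (V t R) * cnj (dir (V t (-R)))) \<le> 2 * sin \<tau>"
        using pt by eventually_elim (use S(3) in linarith)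
      have "energy (V t) (G t) \<le> 1" using Et \<delta> \<delta>1 sq2 by linarith
      then have "2 * sqrt 2 / 3 + sqrt 2 / 6 * \<delta>1^2 \<le> energy (V t) (G t)"
        by (rule F.nonvanishing_energy[OF _ \<delta>1(1) nz \<tau> ph])
      moreover have "1 / 6 * \<delta>1^2 \<le> sqrt 2 / 6 * \<delta>1^2" using sq2 by (intro mult_right_mono) auto
      moreover have "0 < \<delta>1^2" using \<delta>1 by simp
      ultimately show False using Et \<delta>(4) by linarith
    qed
    then obtain x0 where x0: "cmod (V t x0) \<le> \<delta>1" by blast
    obtain a \<sigma>p \<sigma>m where p: "cmod \<sigma>p = 1" "cmod \<sigma>m = 1" "cmod (V t a) \<le> \<omega>1"
      "L2 (\<lambda>x. G t x - (if x \<ge> a then \<sigma>p else \<sigma>m) * of_real (kd (x - a)))"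
      "L2norm (\<lambda>x. G t x - (if x \<ge> a then \<sigma>p else \<sigma>m) * of_real (kd (x - a))) \<le> \<omega>1"
      "L2norm (\<lambda>x. cmod (V t x) - \<bar>kT (x - a)\<bar>) \<le> \<omega>1"
      "\<forall>\<^sub>F R in at_top. cmod (exp (\<i> * of_real (LINT x:{-R..R}|lborel. Im (cnj (V t x) * G t x))) * \<sigma>p * cnj \<sigma>m
          + dir (V t R) * cnj (dir (V t (-R)))) \<le> \<omega>1"
    proof -
      have "energy (V t) (G t) \<le> 2 * sqrt 2 / 3 + \<delta>1" using Et \<delta> by linarith
      from corner1[OF fe this x0] show thesis using that unfolding corner_close_def by blast
    qed
    \<comment> \<open>Both asymptotic relations are taken at one \<open>R\<close>, so that the
      unknown directions at \<open>R\<close> and \<open>-R\<close> cancel in their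
      difference.\<close>
    obtain R where R: "cmod (exp (\<i> * of_real (LINT x:{-R..R}|lborel. Im (cnj (V t x) * G t x))) * \<sigma>p * cnj \<sigma>m
          + dir (V t R) * cnj (dir (V t (-R)))) \<le> \<omega>1"
        "cmod (exp (\<i> * of_real (LINT x:{-R..R}|lborel. Im (cnj (V t x) * G t x))) + dir (V t R) * cnj (dir (V t (-R)))) \<le> S"
      using eventually_happens'[OF trivial_limit_at_top_linorder eventually_conj[OF p(7) pt]] by blast
    have jump: "cmod (\<sigma>p * cnj \<sigma>m - 1) \<le> 2 * \<omega>1"
    proof -
      let ?e = "exp (\<i> * of_real (LINT x:{-R..R}|lborel. Im (cnj (V t x) * G t x)))" and ?D = "dir (V t R) * cnj (dir (V t (-R)))"
      have "cmod (\<sigma>p * cnj \<sigma>m - 1) = cmod (?e * (\<sigma>p * cnj \<sigma>m - 1))" by (simp add: norm_mult)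
      also have "?e * (\<sigma>p * cnj \<sigma>m - 1) = (?e * \<sigma>p * cnj \<sigma>m + ?D) - (?e + ?D)" by (simp add: algebra_simps)
      also have "cmod \<dots> \<le> \<omega>1 + S" by (rule order_trans[OF norm_triangle_ineq4 add_mono[OF R]])
      finally show ?thesis using S(2) by linarith
    qed
    obtain \<theta> where \<theta>: "\<sigma>p = exp (\<i> * of_real \<theta>)" using p(1) complex_norm_eq_1_exp[of \<sigma>p] by metis
    have "dAX1 A (\<lambda>x. v t (x + a)) (\<lambda>x. \<sigma>p * kink x) \<le> 2 * \<omega>1 + (1 + sqrt A) * (\<omega>1 + 2 * \<omega>1)"
      by (rule F.close_to_rotated_kink[OF mv ae A p(1,2) jump p(3-6)])
    also have "\<dots> = \<omega>1 * (5 + 3 * sqrt A)" by (simp add: algebra_simps)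
    finally show "\<exists>a \<theta>. dAX1 A (\<lambda>x. v t (x + a)) (\<lambda>x. exp (\<i> * of_real \<theta>) * kink x) < \<epsilon>"
      using \<omega>1\<epsilon> unfolding \<theta> by (intro exI[of _ a] exI[of _ \<theta>]) linarith
  qed
qed

end
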